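(* Let $R$ be a graded-commutative noetherian ring and $\mathsf T$ a compactly generated $R$-linear triangulated category with arbitrary coproducts. When $\dim\operatorname{Spec}R$ is finite, the local-global principle holds for $\mathsf T$.
   Context: Graded-commutative: $R$ is $\mathbb Z$-graded with $rs=(-1)^{|r||s|}sr$ for homogeneous $r,s$. $\operatorname{Spec}R$ is the set of homogeneous prime ideals; $\mathcal V(\mathfrak a)=\{\mathfrak p\in\operatorname{Spec}R\mid\mathfrak p\supseteq\mathfrak a\}$ for a homogeneous ideal $\mathfrak a$. The dimension of a subset $\mathcal U\subseteq\operatorname{Spec}R$ is the supremum of integers $n$ such that there is a chain $\mathfrak p_0\subsetneq\mathfrak p_1\subsetneq\cdots\subsetneq\mathfrak p_n$ in $\mathcal U$. $R$-modules are graded and $M_{\mathfrak p}$ is homogeneous localization. A subset $\mathcal V\subseteq\operatorname{Spec}R$ is specialization closed if $\mathfrak p\in\mathcal V$, $\mathfrak p\subseteq\mathfrak q$ imply $\mathfrak q\in\mathcal V$. $\mathsf T$ has suspension $\Sigma$. A localizing subcategory is a full triangulated subcategory closed under coproducts; $\operatorname{Loc}_{\mathsf T}(\mathsf C)$ is the smallest one containing $\mathsf C$. An object $C$ is compact if $\operatorname{Hom}_{\mathsf T}(C,-)$ commutes with coproducts; $\mathsf T^c$ is the full subcategory of compact objects. $\mathsf T$ is compactly generated if $\mathsf T=\operatorname{Loc}_{\mathsf T}(\mathsf G)$ for a set $\mathsf G$ of compact objects. $\mathsf T$ is $R$-linear if there is given a homomorphism of graded rings $R\to Z^*(\mathsf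 T)$ to the graded center ($Z^n(\mathsf T)$ consists of natural transformations $\eta\colon\mathrm{Id}\to\Sigma^n$ with $\eta\Sigma=(-1)^n\Sigma\eta$); then $\operatorname{Hom}^*_{\mathsf T}(X,Y)=\bigoplus_i\operatorname{Hom}_{\mathsf T}(X,\Sigma^iY)$ is a graded $R$-module. For specialization closed $\mathcal V$, let $\mathsf T_{\mathcal V}=\{X\in\mathsf T\mid\operatorname{Hom}^*_{\mathsf T}(C,X)_{\mathfrak p}=0\text{ for all }C\in\mathsf T^c,\ \mathfrak p\in\operatorname{Spec}R\setminus\mathcal V\}$. This is a localizing subcategory and there is a localization functor $L_{\mathcal V}\colon\mathsf T\to\mathsf T$ with $\operatorname{Ker}L_{\mathcal V}=\mathsf T_{\mathcal V}$, giving functorial exact triangles $\varGamma_{\mathcal V}X\to X\to L_{\mathcal V}X\to$ with $\varGamma_{\mathcal V}X\in\mathsf T_{\mathcal V}$ and $\operatorname{Hom}_{\mathsf T}(\mathsf T_{\mathcal V},L_{\mathcal V}X)=0$. For $\mathfrak p\in\operatorname{Spec}R$ put $\mathcal Z(\mathfrak p)=\{\mathfrak q\in\operatorname{Spec}R\mid\mathfrak q\not\subseteq\mathfrak p\}$, $X_{\mathfrak p}=L_{\mathcal Z(\mathfrak p)}X$, $\varGamma_{\mathfrak p}X=\varGamma_{\mathcal V(\mathfrak p)}(X_{\mathfrak p})$. The local-global principle holds for $\mathsf T$ if $\operatorname{Loc}_{\mathsf T}(X)=\operatorname{Loc}_{\mathsf T}(\{\varGamma_{\mathfrak p}X\mid\mathfrak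 p\in\operatorname{Spec}R\})$ for every object $X$ of $\mathsf T$. *)

theory Defs
  imports "HOL-Algebra.Free_Abelian_Groups" "HOL-Algebra.Ring_Divisibility" "HOL-Library.Extended_Nat"
begin

unbundle cardinal_syntax

section \<open>Smallness\<close>

text \<open>
  Triangulated categories with arbitrary coproducts have a proper class of objects. The distinction
  between sets and classes is made relative to a universe: a set \<open>U\<close> whose cardinality
  is inaccessible. ``Small'' means of cardinality less than that of \<open>U\<close>, and small families are
  indexed by small subsets of \<open>U\<close>, which up to bijection is no restriction on the index set.
\<close>

definition small :: "'u set \<Rightarrow> 'a set \<Rightarrow> bool"
  where "small U A \<longleftrightarrow> |A| <o |U|"

definition universe :: "'u set \<Rightarrow> bool"
  where "universe U \<longleftrightarrow>
    natLeq <o |U| \<and> regularCard |U| \<and> (\<forall>A \<subseteq> U. small U A \<longrightarrow> small U (Pow A))"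


section \<open>Graded-commutative rings\<close>

locale graded_ring = ring R
  for R :: "('r, 'b) ring_scheme" (structure) and gr :: "int \<Rightarrow> 'r set" +
  assumes gr_subgroup: "additive_subgroup (gr n) R"
    and gr_one: "\<one> \<in> gr 0"
    and gr_mult: "\<lbrakk>r \<in> gr m; s \<in> gr n\<rbrakk> \<Longrightarrow> r \<otimes> s \<in> gr (m + n)"
    and gr_decomp: "r \<in> carrier R \<Longrightarrow>
      \<exists>!c. (\<forall>n. c n \<in> gr n) \<and> finite {n. c n \<noteq> \<zero>} \<and> r = (\<Oplus>n \<in> {n. c n \<noteq> \<zero>}. c n)"

locale graded_commutative_ring = graded_ring +
  assumes gr_commute: "\<lbrakk>r \<in> gr m; s \<in> gr n\<rbrakk> \<Longrightarrow>
    r \<otimes> s = (if even (m * n) then s \<otimes> r else \<ominus> (s \<otimes> r))"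

definition homogeneous_ideal :: "('r, 'b) ring_scheme \<Rightarrow> (int \<Rightarrow> 'r set) \<Rightarrow> 'r set \<Rightarrow> bool"
  where "homogeneous_ideal R gr I \<longleftrightarrow> ideal I R \<and>
    (\<forall>r \<in> I. \<exists>c. (\<forall>n. c n \<in> gr n \<inter> I) \<and> finite {n. c n \<noteq> \<zero>\<^bsub>R\<^esub>} \<and>
      r = finsum R c {n. c n \<noteq> \<zero>\<^bsub>R\<^esub>})"

definition Spec :: "('r, 'b) ring_scheme \<Rightarrow> (int \<Rightarrow> 'r set) \<Rightarrow> 'r set set"
  where "Spec R gr = {P. homogeneous_ideal R gr P \<and> P \<noteq> carrier R \<and>
    (\<forall>m n. \<forall>a \<in> gr m. \<forall>b \<in> gr n. a \<otimes>\<^bsub>R\<^esub> b \<in> P \<longrightarrow> a \<in> P \<or> b \<in> P)}"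

definition closed_set :: "('r, 'b) ring_scheme \<Rightarrow> (int \<Rightarrow> 'r set) \<Rightarrow> 'r set \<Rightarrow> 'r set set"
  where "closed_set R gr I = {P \<in> Spec R gr. I \<subseteq> P}"

definition not_below :: "('r, 'b) ring_scheme \<Rightarrow> (int \<Rightarrow> 'r set) \<Rightarrow> 'r set \<Rightarrow> 'r set set"
  where "not_below R gr P = {Q \<in> Spec R gr. \<not> Q \<subseteq> P}"

definition specialization_closed ::
    "('r, 'b) ring_scheme \<Rightarrow> (int \<Rightarrow> 'r set) \<Rightarrow> 'r set set \<Rightarrow> bool"
  where "specialization_closed R gr V \<longleftrightarrow>
    V \<subseteq> Spec R gr \<and> (\<forall>P \<in> V. \<forall>Q \<in> Spec R gr. P \<subseteq> Q \<longrightarrow> Q \<in> V)"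

lemma specialization_closed_closed_set: "specialization_closed R gr (closed_set R gr I)"
  unfolding specialization_closed_def closed_set_def by blast

lemma specialization_closed_not_below: "specialization_closed R gr (not_below R gr P)"
  unfolding specialization_closed_def not_below_def by blast

text \<open>In \<^typ>\<open>enat\<close> the empty set has dimension 0 instead of \<open>-\<infinity>\<close>; only finiteness matters here.\<close>

definition dimension :: "'r set set \<Rightarrow> enat"
  where "dimension V = Sup {enat n | n. \<exists>c :: nat \<Rightarrow> 'r set.
    (\<forall>i \<le> n. c i \<in> V) \<and> (\<forall>i < n. c i \<subset> c (Suc i))}"


section \<open>Homogeneous localization of graded modules\<close>

text \<open>
  A graded module is given by its homogeneous components. The action of \<open>r\<close> of degree \<open>k\<close> on \<open>m\<close>
  of degree \<open>n\<close> is \<open>gact M k r n m\<close>, of degree \<open>n + k\<close>; the degrees are arguments because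
  components of different degree need not be disjoint.
  The components are additive groups, rendered as multiplicatively written \<^typ>\<open>'m monoid\<close>s.
\<close>

record ('r, 'm) gmod =
  gpart :: "int \<Rightarrow> 'm monoid"
  gact :: "int \<Rightarrow> 'r \<Rightarrow> int \<Rightarrow> 'm \<Rightarrow> 'm"

text \<open>
  Elements of degree \<open>n\<close> of the localization at \<open>P\<close> are fractions \<open>m / s\<close> with \<open>s \<notin> P\<close>
  homogeneous of degree \<open>k\<close> and \<open>m\<close> of degree \<open>n + k\<close>, coded as \<open>(k, s, m)\<close>.
  Two fractions \<open>m / s\<close>, \<open>m' / s'\<close> agree if \<open>u s' m = u s m'\<close> for some homogeneous \<open>u \<notin> P\<close>. No
  signs are needed: if some \<open>t \<notin> P\<close> has odd degree then \<open>2 t\<^sup>2 = 0\<close>, so \<open>2\<close> becomes zero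
  after localization.
\<close>

definition fractions ::
    "(int \<Rightarrow> 'r set) \<Rightarrow> 'r set \<Rightarrow> ('r, 'm) gmod \<Rightarrow> int \<Rightarrow> (int \<times> 'r \<times> 'm) set"
  where "fractions gr P M n =
    {(k, s, m). s \<in> gr k \<and> s \<notin> P \<and> m \<in> carrier (gpart M (n + k))}"

definition fraction_rel ::
    "(int \<Rightarrow> 'r set) \<Rightarrow> 'r set \<Rightarrow> ('r, 'm) gmod \<Rightarrow> int \<Rightarrow> (int \<times> 'r \<times> 'm) rel"
  where "fraction_rel gr P M n =
    {((k, s, m), (k', s', m')).
       (k, s, m) \<in> fractions gr P M n \<and> (k', s', m') \<in> fractions gr P M n \<and>
       (\<exists>j. \<exists>u \<in> gr j - P.
          gact M j u (n + k + k') (gact M k' s' (n + k) m) =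
          gact M j u (n + k' + k) (gact M k s (n + k') m'))}"

definition localization ::
    "(int \<Rightarrow> 'r set) \<Rightarrow> 'r set \<Rightarrow> ('r, 'm) gmod \<Rightarrow> int \<Rightarrow> (int \<times> 'r \<times> 'm) set set"
  where "localization gr P M n = fractions gr P M n // fraction_rel gr P M n"

text \<open>The localization is zero if in every degree its only element is the class of \<open>0 / 1\<close>.\<close>

definition localization_zero ::
    "('r, 'b) ring_scheme \<Rightarrow> (int \<Rightarrow> 'r set) \<Rightarrow> 'r set \<Rightarrow> ('r, 'm) gmod \<Rightarrow> bool"
  where "localization_zero R gr P M \<longleftrightarrow> (\<forall>n. localization gr P M n =
    {fraction_rel gr P M n `` {(0, \<one>\<^bsub>R\<^esub>, \<one>\<^bsub>gpart M n\<^esub>)}})"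


section \<open>Additive categories\<close>

text \<open>
  \<open>Hom T X Y\<close> is the additive group of morphisms, rendered as a multiplicatively written
  \<^const>\<open>comm_group\<close>: \<open>\<one>\<close> is the zero morphism, \<open>\<otimes>\<close> is addition and \<open>inv\<close> is negation.
  Hom sets are disjoint, so composition, \<open>Cmp T g f\<close> for \<open>g\<close> after \<open>f\<close>, need not
  mention objects.
\<close>

record ('o, 'm) precat =
  Ob :: "'o set"
  Hom :: "'o \<Rightarrow> 'o \<Rightarrow> 'm monoid"
  Idt :: "'o \<Rightarrow> 'm"
  Cmp :: "'m \<Rightarrow> 'm \<Rightarrow> 'm"

definition Arr :: "('o, 'm, 'z) precat_scheme \<Rightarrow> 'm set"
  where "Arr T = (\<Union>X \<in> Ob T. \<Union>Y \<in> Ob T. carrier (Hom T X Y))"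

definition isos :: "('o, 'm, 'z) precat_scheme \<Rightarrow> 'o \<Rightarrow> 'o \<Rightarrow> 'm set"
  where "isos T X Y = {f \<in> carrier (Hom T X Y).
    \<exists>g \<in> carrier (Hom T Y X). Cmp T g f = Idt T X \<and> Cmp T f g = Idt T Y}"

definition is_zero :: "('o, 'm, 'z) precat_scheme \<Rightarrow> 'o \<Rightarrow> bool"
  where "is_zero T Z \<longleftrightarrow> Z \<in> Ob T \<and>
    (\<forall>X \<in> Ob T. carrier (Hom T X Z) = {\<one>\<^bsub>Hom T X Z\<^esub>} \<and> carrier (Hom T Z X) = {\<one>\<^bsub>Hom T Z X\<^esub>})"

definition is_coproduct ::
    "('o, 'm, 'z) precat_scheme \<Rightarrow> 'i set \<Rightarrow> ('i \<Rightarrow> 'o) \<Rightarrow> 'o \<Rightarrow> ('i \<Rightarrow> 'm) \<Rightarrow> bool"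
  where "is_coproduct T I X S \<iota> \<longleftrightarrow>
    X \<in> I \<rightarrow> Ob T \<and> S \<in> Ob T \<and> (\<forall>i \<in> I. \<iota> i \<in> carrier (Hom T (X i) S)) \<and>
    (\<forall>Y \<in> Ob T. \<forall>f. (\<forall>i \<in> I. f i \<in> carrier (Hom T (X i) Y)) \<longrightarrow>
      (\<exists>!g. g \<in> carrier (Hom T S Y) \<and> (\<forall>i \<in> I. Cmp T g (\<iota> i) = f i)))"

locale additive_category =
  fixes T :: "('o, 'm, 'z) precat_scheme"
  assumes Hom_disjoint:
      "\<lbrakk>X \<in> Ob T; Y \<in> Ob T; X' \<in> Ob T; Y' \<in> Ob T;
        f \<in> carrier (Hom T X Y); f \<in> carrier (Hom T X' Y')\<rbrakk> \<Longrightarrow> X = X' \<and> Y = Y'"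
    and Hom_group: "\<lbrakk>X \<in> Ob T; Y \<in> Ob T\<rbrakk> \<Longrightarrow> comm_group (Hom T X Y)"
    and Idt_Hom: "X \<in> Ob T \<Longrightarrow> Idt T X \<in> carrier (Hom T X X)"
    and Cmp_hom_right:
      "\<lbrakk>X \<in> Ob T; Y \<in> Ob T; Z \<in> Ob T; g \<in> carrier (Hom T Y Z)\<rbrakk> \<Longrightarrow>
        (\<lambda>f. Cmp T g f) \<in> hom (Hom T X Y) (Hom T X Z)"
    and Cmp_hom_left:
      "\<lbrakk>X \<in> Ob T; Y \<in> Ob T; Z \<in> Ob T; f \<in> carrier (Hom T X Y)\<rbrakk> \<Longrightarrow>
        (\<lambda>g. Cmp T g f) \<in> hom (Hom T Y Z) (Hom T X Z)"
    and Cmp_assoc: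
      "\<lbrakk>W \<in> Ob T; X \<in> Ob T; Y \<in> Ob T; Z \<in> Ob T; f \<in> carrier (Hom T W X);
        g \<in> carrier (Hom T X Y); h \<in> carrier (Hom T Y Z)\<rbrakk> \<Longrightarrow>
        Cmp T h (Cmp T g f) = Cmp T (Cmp T h g) f"
    and Idt_left: "\<lbrakk>X \<in> Ob T; Y \<in> Ob T; f \<in> carrier (Hom T X Y)\<rbrakk> \<Longrightarrow> Cmp T (Idt T Y) f = f"
    and Idt_right: "\<lbrakk>X \<in> Ob T; Y \<in> Ob T; f \<in> carrier (Hom T X Y)\<rbrakk> \<Longrightarrow> Cmp T f (Idt T X) = f"
    and has_zero: "\<exists>Z. is_zero T Z"
    and has_sums: "\<lbrakk>X \<in> Ob T; Y \<in> Ob T\<rbrakk> \<Longrightarrow>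
      \<exists>S \<iota>. is_coproduct T (UNIV :: bool set) (\<lambda>b. if b then X else Y) S \<iota>"

text \<open>An endofunctor is given by its actions \<open>F\<close> on objects and \<open>Fm\<close> on morphisms.\<close>

definition endofunctor :: "('o, 'm, 'z) precat_scheme \<Rightarrow> ('o \<Rightarrow> 'o) \<Rightarrow> ('m \<Rightarrow> 'm) \<Rightarrow> bool"
  where "endofunctor T F Fm \<longleftrightarrow>
    F \<in> Ob T \<rightarrow> Ob T \<and>
    (\<forall>X \<in> Ob T. \<forall>Y \<in> Ob T. Fm \<in> carrier (Hom T X Y) \<rightarrow> carrier (Hom T (F X) (F Y))) \<and>
    (\<forall>X \<in> Ob T. Fm (Idt T X) = Idt T (F X)) \<and>
    (\<forall>X \<in> Ob T. \<forall>Y \<in> Ob T. \<forall>Z \<in> Ob T. \<forall>f \<in> carrier (Hom T X Y). \<forall>g \<in> carrier (Hom T Y Z).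
      Fm (Cmp T g f) = Cmp T (Fm g) (Fm f))"

definition additive_functor :: "('o, 'm, 'z) precat_scheme \<Rightarrow> ('o \<Rightarrow> 'o) \<Rightarrow> ('m \<Rightarrow> 'm) \<Rightarrow> bool"
  where "additive_functor T F Fm \<longleftrightarrow> endofunctor T F Fm \<and>
    (\<forall>X \<in> Ob T. \<forall>Y \<in> Ob T. Fm \<in> hom (Hom T X Y) (Hom T (F X) (F Y)))"

definition nat_transf :: "('o, 'm, 'z) precat_scheme \<Rightarrow>
    ('o \<Rightarrow> 'o) \<Rightarrow> ('m \<Rightarrow> 'm) \<Rightarrow> ('o \<Rightarrow> 'o) \<Rightarrow> ('m \<Rightarrow> 'm) \<Rightarrow> ('o \<Rightarrow> 'm) \<Rightarrow> bool"
  where "nat_transf T F Fm G Gm \<alpha> \<longleftrightarrow>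
    (\<forall>X \<in> Ob T. \<alpha> X \<in> carrier (Hom T (F X) (G X))) \<and>
    (\<forall>X \<in> Ob T. \<forall>Y \<in> Ob T. \<forall>f \<in> carrier (Hom T X Y).
      Cmp T (\<alpha> Y) (Fm f) = Cmp T (Gm f) (\<alpha> X))"


section \<open>Triangulated categories\<close>

text \<open>
  \<open>Tri T X Y Z\<close> is the set of all \<open>(f, g, h)\<close> such that \<open>X \<rightarrow>\<^bsub>f\<^esub> Y \<rightarrow>\<^bsub>g\<^esub> Z \<rightarrow>\<^bsub>h\<^esub> \<Sigma>X\<close> is an exact
  triangle. The suspension is an automorphism, so that all \<open>\<Sigma>\<^sup>n\<close> with \<open>n\<close> an integer are defined
  and \<open>\<Sigma>\<^sup>n\<Sigma> = \<Sigma>\<Sigma>\<^sup>n\<close> holds on the nose, as the sign rule for the graded center requires.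
\<close>

record ('o, 'm) tricat = "('o, 'm) precat" +
  Susp :: "'o \<Rightarrow> 'o"
  SuspM :: "'m \<Rightarrow> 'm"
  Tri :: "'o \<Rightarrow> 'o \<Rightarrow> 'o \<Rightarrow> ('m \<times> 'm \<times> 'm) set"

locale triangulated_category = additive_category T
  for T :: "('o, 'm, 'z) tricat_scheme" +
  assumes Susp_functor: "additive_functor T (Susp T) (SuspM T)"
    and Susp_bij: "bij_betw (Susp T) (Ob T) (Ob T)"
    and SuspM_bij: "\<lbrakk>X \<in> Ob T; Y \<in> Ob T\<rbrakk> \<Longrightarrow>
      bij_betw (SuspM T) (carrier (Hom T X Y)) (carrier (Hom T (Susp T X) (Susp T Y)))"
    and Tri_Hom: "\<lbrakk>X \<in> Ob T; Y \<in> Ob T; Z \<in> Ob T\<rbrakk> \<Longrightarrow>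
      Tri T X Y Z \<subseteq> carrier (Hom T X Y) \<times> carrier (Hom T Y Z) \<times> carrier (Hom T Z (Susp T X))"
    and Tri_iso:
      "\<lbrakk>X \<in> Ob T; Y \<in> Ob T; Z \<in> Ob T; X' \<in> Ob T; Y' \<in> Ob T; Z' \<in> Ob T; (f, g, h) \<in> Tri T X Y Z;
        f' \<in> carrier (Hom T X' Y'); g' \<in> carrier (Hom T Y' Z'); h' \<in> carrier (Hom T Z' (Susp T X'));
        a \<in> isos T X X'; b \<in> isos T Y Y'; c \<in> isos T Z Z';
        Cmp T b f = Cmp T f' a; Cmp T c g = Cmp T g' b; Cmp T (SuspM T a) h = Cmp T h' c\<rbrakk> \<Longrightarrow>
        (f', g', h') \<in> Tri T X' Y' Z'"
    and Tri_Idt: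
      "\<lbrakk>X \<in> Ob T; is_zero T Z\<rbrakk> \<Longrightarrow>
        (Idt T X, \<one>\<^bsub>Hom T X Z\<^esub>, \<one>\<^bsub>Hom T Z (Susp T X)\<^esub>) \<in> Tri T X X Z"
    and Tri_exists:
      "\<lbrakk>X \<in> Ob T; Y \<in> Ob T; f \<in> carrier (Hom T X Y)\<rbrakk> \<Longrightarrow> \<exists>Z \<in> Ob T. \<exists>g h. (f, g, h) \<in> Tri T X Y Z"
    and Tri_rotate:
      "\<lbrakk>X \<in> Ob T; Y \<in> Ob T; Z \<in> Ob T; f \<in> carrier (Hom T X Y); g \<in> carrier (Hom T Y Z);
        h \<in> carrier (Hom T Z (Susp T X))\<rbrakk> \<Longrightarrow>
        (f, g, h) \<in> Tri T X Y Z \<longleftrightarrow>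
        (g, h, inv\<^bsub>Hom T (Susp T X) (Susp T Y)\<^esub> (SuspM T f)) \<in> Tri T Y Z (Susp T X)"
    and Tri_morphism:
      "\<lbrakk>X \<in> Ob T; Y \<in> Ob T; Z \<in> Ob T; X' \<in> Ob T; Y' \<in> Ob T; Z' \<in> Ob T;
        (f, g, h) \<in> Tri T X Y Z; (f', g', h') \<in> Tri T X' Y' Z';
        a \<in> carrier (Hom T X X'); b \<in> carrier (Hom T Y Y'); Cmp T b f = Cmp T f' a\<rbrakk> \<Longrightarrow>
        \<exists>c \<in> carrier (Hom T Z Z'). Cmp T c g = Cmp T g' b \<and> Cmp T (SuspM T a) h = Cmp T h' c"
    and Tri_octahedron:
      "\<lbrakk>X \<in> Ob T; Y \<in> Ob T; Z \<in> Ob T; X' \<in> Ob T; Y' \<in> Ob T; Z' \<in> Ob T;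
        (f, f1, f2) \<in> Tri T X Y Z'; (g, g1, g2) \<in> Tri T Y Z X'; (Cmp T g f, h1, h2) \<in> Tri T X Z Y'\<rbrakk> \<Longrightarrow>
        \<exists>u v. (u, v, Cmp T (SuspM T f1) g2) \<in> Tri T Z' Y' X' \<and>
          Cmp T u f1 = Cmp T h1 g \<and> Cmp T h2 u = f2 \<and>
          Cmp T v h1 = g1 \<and> Cmp T g2 v = Cmp T (SuspM T f) h2"

definition susp :: "('o, 'm, 'z) tricat_scheme \<Rightarrow> int \<Rightarrow> 'o \<Rightarrow> 'o"
  where "susp T n = (if 0 \<le> n then Susp T ^^ nat n
    else inv_into (Ob T) (Susp T) ^^ nat (- n))"

definition suspM :: "('o, 'm, 'z) tricat_scheme \<Rightarrow> int \<Rightarrow> 'm \<Rightarrow> 'm"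
  where "suspM T n = (if 0 \<le> n then SuspM T ^^ nat n
    else inv_into (Arr T) (SuspM T) ^^ nat (- n))"

text \<open>An exact functor \<open>F\<close> comes with an isomorphism \<open>\<theta> : F\<Sigma> \<cong> \<Sigma>F\<close> and preserves exact triangles.\<close>

definition exact_functor :: "('o, 'm, 'z) tricat_scheme \<Rightarrow> ('o \<Rightarrow> 'o) \<Rightarrow> ('m \<Rightarrow> 'm) \<Rightarrow> bool"
  where "exact_functor T F Fm \<longleftrightarrow> additive_functor T F Fm \<and>
    (\<exists>\<theta>. (\<forall>X \<in> Ob T. \<theta> X \<in> isos T (F (Susp T X)) (Susp T (F X))) \<and>
      nat_transf T (F \<circ> Susp T) (Fm \<circ> SuspM T) (Susp T \<circ> F) (SuspM T \<circ> Fm) \<theta> \<and>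
      (\<forall>X \<in> Ob T. \<forall>Y \<in> Ob T. \<forall>Z \<in> Ob T. \<forall>(f, g, h) \<in> Tri T X Y Z.
        (Fm f, Fm g, Cmp T (\<theta> X) (Fm h)) \<in> Tri T (F X) (F Y) (F Z)))"

definition locally_small :: "'u set \<Rightarrow> ('o, 'm, 'z) precat_scheme \<Rightarrow> bool"
  where "locally_small U T \<longleftrightarrow> (\<forall>X \<in> Ob T. \<forall>Y \<in> Ob T. small U (carrier (Hom T X Y)))"

definition has_coproducts :: "'u set \<Rightarrow> ('o, 'm, 'z) precat_scheme \<Rightarrow> bool"
  where "has_coproducts U T \<longleftrightarrow>
    (\<forall>I \<subseteq> U. small U I \<longrightarrow> (\<forall>X \<in> I \<rightarrow> Ob T. \<exists>S \<iota>. is_coproduct T I X S \<iota>))"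

text \<open>
  Full subcategories are identified with their sets of objects. Triangulated subcategories are
  closed under isomorphisms.
\<close>

definition localizing :: "'u set \<Rightarrow> ('o, 'm, 'z) tricat_scheme \<Rightarrow> 'o set \<Rightarrow> bool"
  where "localizing U T L \<longleftrightarrow> L \<subseteq> Ob T \<and>
    (\<forall>Z. is_zero T Z \<longrightarrow> Z \<in> L) \<and>
    (\<forall>X \<in> L. \<forall>Y \<in> Ob T. isos T X Y \<noteq> {} \<longrightarrow> Y \<in> L) \<and>
    (\<forall>X \<in> Ob T. X \<in> L \<longleftrightarrow> Susp T X \<in> L) \<and>
    (\<forall>X \<in> Ob T. \<forall>Y \<in> Ob T. \<forall>Z \<in> Ob T. Tri T X Y Z \<noteq> {} \<longrightarrow>
      (X \<in> L \<and> Y \<in> L \<longrightarrow> Z \<in> L) \<and> (Y \<in> L \<and> Z \<in> L \<longrightarrow> X \<in> L) \<and> (X \<in> L \<and> Z \<in> L \<longrightarrow> Y \<in> L)) \<and>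
    (\<forall>I \<subseteq> U. small U I \<longrightarrow> (\<forall>X \<in> I \<rightarrow> L. \<forall>S \<iota>. is_coproduct T I X S \<iota> \<longrightarrow> S \<in> L))"

definition Loc :: "'u set \<Rightarrow> ('o, 'm, 'z) tricat_scheme \<Rightarrow> 'o set \<Rightarrow> 'o set"
  where "Loc U T C = \<Inter> {L. localizing U T L \<and> C \<subseteq> L}"

text \<open>\<open>C\<close> is compact if the canonical map \<open>\<Oplus>\<^bsub>i\<^esub> Hom(C, X\<^sub>i) \<rightarrow> Hom(C, \<Coprod>\<^bsub>i\<^esub> X\<^sub>i)\<close> is always bijective.\<close>

definition compact_object :: "'u set \<Rightarrow> ('o, 'm, 'z) precat_scheme \<Rightarrow> 'o \<Rightarrow> bool"
  where "compact_object U T C \<longleftrightarrow> C \<in> Ob T \<and>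
    (\<forall>I \<subseteq> U. small U I \<longrightarrow> (\<forall>X \<in> I \<rightarrow> Ob T. \<forall>S \<iota>. is_coproduct T I X S \<iota> \<longrightarrow>
      (\<lambda>f. gfinprod (Hom T C S) (\<lambda>i. Cmp T (\<iota> i) (f i)) I)
        \<in> iso (sum_group I (\<lambda>i. Hom T C (X i))) (Hom T C S)))"

definition compactly_generated :: "'u set \<Rightarrow> ('o, 'm, 'z) tricat_scheme \<Rightarrow> bool"
  where "compactly_generated U T \<longleftrightarrow>
    (\<exists>G. small U G \<and> (\<forall>C \<in> G. compact_object U T C) \<and> Loc U T G = Ob T)"


section \<open>The graded center and linear triangulated categories\<close>

text \<open>Elements of the center are functions that are \<^const>\<open>undefined\<close> outside the set of objects.\<close>

definition center :: "('o, 'm, 'z) tricat_scheme \<Rightarrow> int \<Rightarrow> ('o \<Rightarrow> 'm) set"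
  where "center T n = {\<eta> \<in> extensional (Ob T).
    nat_transf T (\<lambda>X. X) (\<lambda>f. f) (susp T n) (suspM T n) \<eta> \<and>
    (\<forall>X \<in> Ob T. \<eta> (Susp T X) =
      (if even n then SuspM T (\<eta> X)
       else inv\<^bsub>Hom T (Susp T X) (Susp T (susp T n X))\<^esub> (SuspM T (\<eta> X))))}"

definition center_add ::
    "('o, 'm, 'z) tricat_scheme \<Rightarrow> int \<Rightarrow> ('o \<Rightarrow> 'm) \<Rightarrow> ('o \<Rightarrow> 'm) \<Rightarrow> ('o \<Rightarrow> 'm)"
  where "center_add T n \<eta> \<zeta> = (\<lambda>X \<in> Ob T. \<eta> X \<otimes>\<^bsub>Hom T X (susp T n X)\<^esub> \<zeta> X)"

text \<open>The product of \<open>\<eta>\<close> with \<open>\<zeta>\<close> of degree \<open>n\<close> is \<open>Id \<rightarrow>\<^bsub>\<zeta>\<^esub> \<Sigma>\<^sup>n \<rightarrow>\<^bsub>\<eta>\<Sigma>\<^sup>n\<^esub> \<Sigma>\<^bsup>m+n\<^esup>\<close>.\<close>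

definition center_mult ::
    "('o, 'm, 'z) tricat_scheme \<Rightarrow> int \<Rightarrow> ('o \<Rightarrow> 'm) \<Rightarrow> ('o \<Rightarrow> 'm) \<Rightarrow> ('o \<Rightarrow> 'm)"
  where "center_mult T n \<eta> \<zeta> = (\<lambda>X \<in> Ob T. Cmp T (\<eta> (susp T n X)) (\<zeta> X))"

definition center_one :: "('o, 'm, 'z) tricat_scheme \<Rightarrow> ('o \<Rightarrow> 'm)"
  where "center_one T = (\<lambda>X \<in> Ob T. Idt T X)"

text \<open>\<open>\<phi> n\<close> is the degree \<open>n\<close> component of the homomorphism of graded rings from \<open>R\<close> to the center.\<close>

definition linear_structure :: "('r, 'b) ring_scheme \<Rightarrow> (int \<Rightarrow> 'r set) \<Rightarrow>
    ('o, 'm, 'z) tricat_scheme \<Rightarrow> (int \<Rightarrow> 'r \<Rightarrow> 'o \<Rightarrow> 'm) \<Rightarrow> bool"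
  where "linear_structure R gr T \<phi> \<longleftrightarrow>
    (\<forall>n. \<phi> n \<in> gr n \<rightarrow> center T n) \<and>
    (\<forall>n. \<forall>r \<in> gr n. \<forall>s \<in> gr n. \<phi> n (r \<oplus>\<^bsub>R\<^esub> s) = center_add T n (\<phi> n r) (\<phi> n s)) \<and>
    (\<forall>m n. \<forall>r \<in> gr m. \<forall>s \<in> gr n. \<phi> (m + n) (r \<otimes>\<^bsub>R\<^esub> s) = center_mult T n (\<phi> m r) (\<phi> n s)) \<and>
    \<phi> 0 \<one>\<^bsub>R\<^esub> = center_one T"

definition hom_star ::
    "('o, 'm, 'z) tricat_scheme \<Rightarrow> (int \<Rightarrow> 'r \<Rightarrow> 'o \<Rightarrow> 'm) \<Rightarrow> 'o \<Rightarrow> 'o \<Rightarrow> ('r, 'm) gmod"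
  where "hom_star T \<phi> X Y =
    \<lparr>gpart = (\<lambda>n. Hom T X (susp T n Y)),
     gact = (\<lambda>k r n f. Cmp T (\<phi> k r (susp T n Y)) f)\<rparr>"


section \<open>Local cohomology and the local-global principle\<close>

definition torsion :: "'u set \<Rightarrow> ('r, 'b) ring_scheme \<Rightarrow> (int \<Rightarrow> 'r set) \<Rightarrow>
    ('o, 'm, 'z) tricat_scheme \<Rightarrow> (int \<Rightarrow> 'r \<Rightarrow> 'o \<Rightarrow> 'm) \<Rightarrow> 'r set set \<Rightarrow> 'o set"
  where "torsion U R gr T \<phi> V = {X \<in> Ob T.
    \<forall>C. compact_object U T C \<longrightarrow>
      (\<forall>P \<in> Spec R gr - V. localization_zero R gr P (hom_star T \<phi> C X))}"

definition localization_functor ::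
    "('o, 'm, 'z) tricat_scheme \<Rightarrow> ('o \<Rightarrow> 'o) \<Rightarrow> ('m \<Rightarrow> 'm) \<Rightarrow> ('o \<Rightarrow> 'm) \<Rightarrow> bool"
  where "localization_functor T L Lm \<eta> \<longleftrightarrow> exact_functor T L Lm \<and>
    nat_transf T (\<lambda>X. X) (\<lambda>f. f) L Lm \<eta> \<and>
    (\<forall>X \<in> Ob T. Lm (\<eta> X) = \<eta> (L X) \<and> Lm (\<eta> X) \<in> isos T (L X) (L (L X)))"

text \<open>
  A localization functor \<open>L\<close> with kernel \<open>S\<close>, together with functorial exact triangles
  \<open>\<Gamma>X \<rightarrow> X \<rightarrow> LX \<rightarrow> \<Sigma>\<Gamma>X\<close> such that \<open>\<Gamma>X\<close> lies in \<open>S\<close> and \<open>Hom(S, LX) = 0\<close>.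
\<close>

record ('o, 'm) loc_data =
  LO :: "'o \<Rightarrow> 'o"
  LM :: "'m \<Rightarrow> 'm"
  GO :: "'o \<Rightarrow> 'o"
  GM :: "'m \<Rightarrow> 'm"
  from_G :: "'o \<Rightarrow> 'm"
  to_L :: "'o \<Rightarrow> 'm"
  connect :: "'o \<Rightarrow> 'm"

definition is_localization ::
    "('o, 'm, 'z) tricat_scheme \<Rightarrow> 'o set \<Rightarrow> ('o, 'm) loc_data \<Rightarrow> bool"
  where "is_localization T S D \<longleftrightarrow>
    localization_functor T (LO D) (LM D) (to_L D) \<and>
    {X \<in> Ob T. is_zero T (LO D X)} = S \<and>
    endofunctor T (GO D) (GM D) \<and>
    nat_transf T (GO D) (GM D) (\<lambda>X. X) (\<lambda>f. f) (from_G D) \<and>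
    nat_transf T (LO D) (LM D) (Susp T \<circ> GO D) (SuspM T \<circ> GM D) (connect D) \<and>
    (\<forall>X \<in> Ob T.
      (from_G D X, to_L D X, connect D X) \<in> Tri T (GO D X) X (LO D X) \<and>
      GO D X \<in> S \<and>
      (\<forall>Y \<in> S. carrier (Hom T Y (LO D X)) = {\<one>\<^bsub>Hom T Y (LO D X)\<^esub>}))"

text \<open>
  The localization at \<open>V\<close> is determined up to isomorphism by \<^const>\<open>is_localization\<close>. A choice is
  made once and for all; no assumption about its existence enters the definitions.
\<close>

definition loc_at :: "'u set \<Rightarrow> ('r, 'b) ring_scheme \<Rightarrow> (int \<Rightarrow> 'r set) \<Rightarrow>
    ('o, 'm, 'z) tricat_scheme \<Rightarrow> (int \<Rightarrow> 'r \<Rightarrow> 'o \<Rightarrow> 'm) \<Rightarrow> 'r set set \<Rightarrow> ('o, 'm) loc_data"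
  where "loc_at U R gr T \<phi> V = (SOME D. is_localization T (torsion U R gr T \<phi> V) D)"

definition Gamma_prime :: "'u set \<Rightarrow> ('r, 'b) ring_scheme \<Rightarrow> (int \<Rightarrow> 'r set) \<Rightarrow>
    ('o, 'm, 'z) tricat_scheme \<Rightarrow> (int \<Rightarrow> 'r \<Rightarrow> 'o \<Rightarrow> 'm) \<Rightarrow> 'r set \<Rightarrow> 'o \<Rightarrow> 'o"
  where "Gamma_prime U R gr T \<phi> P X =
    GO (loc_at U R gr T \<phi> (closed_set R gr P)) (LO (loc_at U R gr T \<phi> (not_below R gr P)) X)"

definition local_global_principle :: "'u set \<Rightarrow> ('r, 'b) ring_scheme \<Rightarrow> (int \<Rightarrow> 'r set) \<Rightarrow>
    ('o, 'm, 'z) tricat_scheme \<Rightarrow> (int \<Rightarrow> 'r \<Rightarrow> 'o \<Rightarrow> 'm) \<Rightarrow> bool"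
  where "local_global_principle U R gr T \<phi> \<longleftrightarrow>
    (\<forall>X \<in> Ob T. Loc U T {X} = Loc U T {Gamma_prime U R gr T \<phi> P X | P. P \<in> Spec R gr})"

end

theory Submission
  imports Defs
begin

text \<open>
  A set of central operators of even degree is inverted on \<open>X\<close> by a countable homotopy colimit, each step
  of which divides out the fibres of all the operators. The steps use only \<open>X\<close>, so localization triangles
  \<open>\<Gamma>X \<rightarrow> X \<rightarrow> LX\<close> with all terms in \<open>Loc X\<close> exist for the closed sets \<open>V(P)\<close> and for \<open>Z(P)\<close>, and
  \<open>\<Gamma>\<^sub>P X\<close> lies in \<open>Loc X\<close>.

  For the converse, let \<open>I(Y)\<close> be the intersection of the primes in the support of \<open>Y\<close>. If some \<open>Y\<close> in \<open>Loc X\<close>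
  is not in \<open>Loc {\<Gamma>\<^sub>P X}\<close>, choose one with \<open>I(Y)\<close> maximal. Inverting an element outside \<open>I(Y)\<close>
  shows that \<open>I(Y)\<close> is a prime \<open>P\<close>. The fibre of \<open>Y \<rightarrow> Y\<^sub>P\<close> is built from objects with larger ideal,
  and \<open>Y\<^sub>P = \<Gamma>\<^sub>P Y\<close> is built from \<open>\<Gamma>\<^sub>P X\<close>, because \<open>\<Gamma>\<^sub>P\<close> is exact and preserves coproducts.
\<close>

text \<open>A representability argument would give localization triangles without placing their
  terms in \<open>Loc U T {X}\<close>, and that membership is needed throughout. A telescope does
  place them there, and it can be computed because maps from a compact object see only finite
  stages.

  The ideal \<open>I(Y)\<close> is useful because a homogeneous \<open>r\<close> lies in it exactly
  when every map from a compact object to \<open>Y\<close> is killed by a power of \<open>r\<close>.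
  This is membership of \<open>Y\<close> in a localizing subcategory, so \<open>I\<close> can only
  grow inside \<open>Loc U T {Y}\<close>. Maximality is then the ascending chain condition of
  \<open>R\<close>; finite generation of \<open>P\<close> makes the objects supported on
  \<open>V(P)\<close> a finite intersection of torsion classes of single elements.

  Torsion for a set of operators allows a different operator for each map, which says little about
  \<open>I\<close>. The fibre of \<open>Y \<rightarrow> Y_P\<close> is therefore tracked through
  objects on which the square of one operator vanishes: the corresponding ring element lies in the
  ideal of such an object. Operators are kept in even degree, where the signs of the graded center
  disappear.\<close>

section \<open>Additive and triangulated categories\<close>

context additive_category
begin

abbreviation cmp (infixr "\<cdot>" 75) where "g \<cdot> f \<equiv> Cmp T g f"
abbreviation zr where "zr X Y \<equiv> \<one>\<^bsub>Hom T X Y\<^esub>"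

text \<open>Carrying the object memberships along with the arrow lets typing facts be chained by
  \<open>OF\<close> without separate side conditions on objects.\<close>

definition ar where "ar f X Y \<longleftrightarrow> X \<in> Ob T \<and> Y \<in> Ob T \<and> f \<in> carrier (Hom T X Y)"
text \<open>The difference \<open>x - y\<close>; Hom groups are written multiplicatively.\<close>

definition mi where "mi X Y x y = x \<otimes>\<^bsub>Hom T X Y\<^esub> inv\<^bsub>Hom T X Y\<^esub> y"

lemma ar_Ob: "ar f X Y \<Longrightarrow> X \<in> Ob T" "ar f X Y \<Longrightarrow> Y \<in> Ob T"
  by (auto simp: ar_def)

lemma ar_carrier: "ar f X Y \<Longrightarrow> f \<in> carrier (Hom T X Y)"
  by (auto simp: ar_def)

lemma arI: "\<lbrakk>X \<in> Ob T; Y \<in> Ob T; f \<in> carrier (Hom T X Y)\<rbrakk> \<Longrightarrow> ar f X Y"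
  by (auto simp: ar_def)

lemma ar_unique: "\<lbrakk>ar f X Y; ar f X' Y'\<rbrakk> \<Longrightarrow> X = X' \<and> Y = Y'"
  unfolding ar_def using Hom_disjoint by blast

lemma ar_group: "\<lbrakk>X \<in> Ob T; Y \<in> Ob T\<rbrakk> \<Longrightarrow> group (Hom T X Y)"
  using Hom_group comm_group.axioms(2) by blast

lemma ar_Idt: "X \<in> Ob T \<Longrightarrow> ar (Idt T X) X X"
  by (simp add: Idt_Hom ar_def)

lemma ar_zr: "\<lbrakk>X \<in> Ob T; Y \<in> Ob T\<rbrakk> \<Longrightarrow> ar (zr X Y) X Y"
  using ar_group by (simp add: ar_def group.is_monoid monoid.one_closed)

lemma ar_cmp: "\<lbrakk>ar g Y Z; ar f X Y\<rbrakk> \<Longrightarrow> ar (g \<cdot> f) X Z"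
  using Cmp_hom_right[of X Y Z g] by (auto simp: ar_def hom_def)

lemma ar_pl: "\<lbrakk>ar f X Y; ar g X Y\<rbrakk> \<Longrightarrow> ar (f \<otimes>\<^bsub>Hom T X Y\<^esub> g) X Y"
  using ar_group by (simp add: ar_def group.is_monoid monoid.m_closed)

lemma ar_neg: "ar f X Y \<Longrightarrow> ar (inv\<^bsub>Hom T X Y\<^esub> f) X Y"
  using ar_group by (simp add: ar_def)

lemma ar_mi: "\<lbrakk>ar f X Y; ar g X Y\<rbrakk> \<Longrightarrow> ar (mi X Y f g) X Y"
  by (simp add: mi_def ar_pl ar_neg)

lemma cmp_assoc: "\<lbrakk>ar h Y Z; ar g X Y; ar f W X\<rbrakk> \<Longrightarrow> (h \<cdot> g) \<cdot> f = h \<cdot> (g \<cdot> f)"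
  using Cmp_assoc[of W X Y Z f g h] by (auto simp: ar_def)

lemma id_cmp: "ar f X Y \<Longrightarrow> Idt T Y \<cdot> f = f"
  using Idt_left by (auto simp: ar_def)

lemma cmp_id: "ar f X Y \<Longrightarrow> f \<cdot> Idt T X = f"
  using Idt_right by (auto simp: ar_def)

lemma right_hom: "\<lbrakk>ar g Y Z; X \<in> Ob T\<rbrakk> \<Longrightarrow> group_hom (Hom T X Y) (Hom T X Z) (\<lambda>f. g \<cdot> f)"
  using Cmp_hom_right[of X Y Z g] ar_group[of X Y] ar_group[of X Z]
  by (auto simp: ar_def group_hom_def group_hom_axioms_def)

lemma left_hom: "\<lbrakk>ar f X Y; Z \<in> Ob T\<rbrakk> \<Longrightarrow> group_hom (Hom T Y Z) (Hom T X Z) (\<lambda>g. g \<cdot> f)"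
  using Cmp_hom_left[of X Y Z f] ar_group[of X Z] ar_group[of Y Z]
  by (auto simp: ar_def group_hom_def group_hom_axioms_def)

lemma cmp_zr: "\<lbrakk>ar g Y Z; X \<in> Ob T\<rbrakk> \<Longrightarrow> g \<cdot> zr X Y = zr X Z"
  using group_hom.hom_one[OF right_hom] by blast

lemma zr_cmp: "\<lbrakk>ar f X Y; Z \<in> Ob T\<rbrakk> \<Longrightarrow> zr Y Z \<cdot> f = zr X Z"
  using group_hom.hom_one[OF left_hom] by blast

lemma cmp_pl: "\<lbrakk>ar g Y Z; ar x X Y; ar y X Y\<rbrakk> \<Longrightarrow>
    g \<cdot> (x \<otimes>\<^bsub>Hom T X Y\<^esub> y) = (g \<cdot> x) \<otimes>\<^bsub>Hom T X Z\<^esub> (g \<cdot> y)"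
  using group_hom.hom_mult[OF right_hom, of g Y Z X x y] by (auto simp: ar_def)

lemma pl_cmp: "\<lbrakk>ar f X Y; ar x Y Z; ar y Y Z\<rbrakk> \<Longrightarrow>
    (x \<otimes>\<^bsub>Hom T Y Z\<^esub> y) \<cdot> f = (x \<cdot> f) \<otimes>\<^bsub>Hom T X Z\<^esub> (y \<cdot> f)"
  using group_hom.hom_mult[OF left_hom, of f X Y Z x y] by (auto simp: ar_def)

lemma cmp_neg: "\<lbrakk>ar g Y Z; ar x X Y\<rbrakk> \<Longrightarrow> g \<cdot> (inv\<^bsub>Hom T X Y\<^esub> x) = inv\<^bsub>Hom T X Z\<^esub> (g \<cdot> x)"
  using group_hom.hom_inv[OF right_hom, of g Y Z X x] by (auto simp: ar_def)

lemma neg_cmp: "\<lbrakk>ar f X Y; ar x Y Z\<rbrakk> \<Longrightarrow> (inv\<^bsub>Hom T Y Z\<^esub> x) \<cdot> f = inv\<^bsub>Hom T X Z\<^esub> (x \<cdot> f)"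
  using group_hom.hom_inv[OF left_hom, of f X Y Z x] by (auto simp: ar_def)

lemma cmp_mi: "\<lbrakk>ar g Y Z; ar x X Y; ar y X Y\<rbrakk> \<Longrightarrow> g \<cdot> mi X Y x y = mi X Z (g \<cdot> x) (g \<cdot> y)"
  by (simp add: mi_def cmp_pl cmp_neg ar_neg)

lemma mi_cmp: "\<lbrakk>ar f X Y; ar x Y Z; ar y Y Z\<rbrakk> \<Longrightarrow> mi Y Z x y \<cdot> f = mi X Z (x \<cdot> f) (y \<cdot> f)"
  by (simp add: mi_def pl_cmp neg_cmp ar_neg)

lemma mi_eq_zr_iff: "\<lbrakk>ar x X Y; ar y X Y\<rbrakk> \<Longrightarrow> mi X Y x y = zr X Y \<longleftrightarrow> x = y"
proof -
  assume x: "ar x X Y" and y: "ar y X Y"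
  then interpret group "Hom T X Y" using ar_group ar_Ob by blast
  show ?thesis using x y inv_solve_right'[of "\<one>\<^bsub>Hom T X Y\<^esub>" x y] unfolding mi_def ar_def by auto
qed

lemma mi_zr: "ar x X Y \<Longrightarrow> mi X Y x (zr X Y) = x"
  unfolding mi_def ar_def using ar_group[of X Y] by (simp add: group.is_monoid monoid.inv_one monoid.r_one)

lemma mi_self: "ar x X Y \<Longrightarrow> mi X Y x x = zr X Y"
  by (simp add: mi_eq_zr_iff)

lemma pl_mi: "\<lbrakk>ar x X Y; ar y X Y\<rbrakk> \<Longrightarrow> mi X Y x y \<otimes>\<^bsub>Hom T X Y\<^esub> y = x"
proof -
  assume x: "ar x X Y" and y: "ar y X Y"
  then interpret group "Hom T X Y" using ar_group ar_Ob by blast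
  show ?thesis using x y unfolding mi_def ar_def by (simp add: m_assoc)
qed

lemma neg_zr: "\<lbrakk>X \<in> Ob T; Y \<in> Ob T\<rbrakk> \<Longrightarrow> inv\<^bsub>Hom T X Y\<^esub> (zr X Y) = zr X Y"
  using ar_group[of X Y] by (simp add: group.is_monoid monoid.inv_one)

lemma neg_neg: "ar x X Y \<Longrightarrow> inv\<^bsub>Hom T X Y\<^esub> (inv\<^bsub>Hom T X Y\<^esub> x) = x"
  using ar_group[of X Y] by (simp add: ar_def)

lemma neg_eq_zr: "\<lbrakk>ar x X Y; inv\<^bsub>Hom T X Y\<^esub> x = zr X Y\<rbrakk> \<Longrightarrow> x = zr X Y"
  using neg_neg[of x X Y] neg_zr[of X Y] by (auto simp: ar_def)

section \<open>Isomorphisms and zero objects\<close>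

lemma isosI: "\<lbrakk>ar f X Y; ar g Y X; g \<cdot> f = Idt T X; f \<cdot> g = Idt T Y\<rbrakk> \<Longrightarrow> f \<in> isos T X Y"
  by (auto simp: isos_def ar_def)

lemma isosE:
  assumes "f \<in> isos T X Y" "X \<in> Ob T" "Y \<in> Ob T"
  obtains g where "ar f X Y" "ar g Y X" "g \<cdot> f = Idt T X" "f \<cdot> g = Idt T Y"
  using assms by (auto simp: isos_def ar_def)

lemma isos_Idt: "X \<in> Ob T \<Longrightarrow> Idt T X \<in> isos T X X"
  using isosI[of "Idt T X" X X "Idt T X"] ar_Idt id_cmp by blast

lemma is_zero_Ob: "is_zero T Z \<Longrightarrow> Z \<in> Ob T"
  by (simp add: is_zero_def)

lemma ar_zero_cod: "\<lbrakk>is_zero T Z; ar f X Z\<rbrakk> \<Longrightarrow> f = zr X Z"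
  by (auto simp: is_zero_def ar_def)

lemma ar_zero_dom: "\<lbrakk>is_zero T Z; ar f Z X\<rbrakk> \<Longrightarrow> f = zr Z X"
  by (auto simp: is_zero_def ar_def)

lemma is_zeroI:
  assumes "Z \<in> Ob T" "Idt T Z = zr Z Z"
  shows "is_zero T Z"
proof -
  have "f = zr X Z" if "ar f X Z" for f X
    using id_cmp[OF that] zr_cmp[OF that assms(1)] assms(2) by simp
  moreover have "f = zr Z X" if "ar f Z X" for f X
    using cmp_id[OF that] cmp_zr[OF that assms(1)] assms(2) by simp
  ultimately show ?thesis
    unfolding is_zero_def using assms(1) ar_zr[unfolded ar_def] by (auto simp: ar_def)
qed

lemma is_zero_iso:
  assumes "is_zero T Z" "isos T Z W \<noteq> {}" "W \<in> Ob T"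
  shows "is_zero T W"
proof -
  obtain f g where "ar f Z W" "ar g W Z" "f \<cdot> g = Idt T W"
    using assms isosE is_zero_Ob by (metis ex_in_conv)
  then have "Idt T W = zr W W"
    using ar_zero_dom[OF assms(1)] zr_cmp[of _ W Z W] assms(3) by metis
  then show ?thesis using is_zeroI assms by blast
qed

section \<open>Coproducts in an additive category\<close>

lemma coprod_Ob: "is_coproduct T I X S \<iota> \<Longrightarrow> S \<in> Ob T"
  by (auto simp: is_coproduct_def)

lemma coprod_ar: "\<lbrakk>is_coproduct T I X S \<iota>; i \<in> I\<rbrakk> \<Longrightarrow> ar (\<iota> i) (X i) S"
  by (auto simp: is_coproduct_def ar_def)

lemma coprod_Ob': "\<lbrakk>is_coproduct T I X S \<iota>; i \<in> I\<rbrakk> \<Longrightarrow> X i \<in> Ob T"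
  by (auto simp: is_coproduct_def)

lemma coprod_desc:
  assumes "is_coproduct T I X S \<iota>" "Y \<in> Ob T" "\<And>i. i \<in> I \<Longrightarrow> ar (f i) (X i) Y"
  obtains g where "ar g S Y" "\<And>i. i \<in> I \<Longrightarrow> g \<cdot> \<iota> i = f i"
proof -
  have "\<forall>i\<in>I. f i \<in> carrier (Hom T (X i) Y)" using assms(3) by (auto simp: ar_def)
  then obtain g where "g \<in> carrier (Hom T S Y)" "\<forall>i \<in> I. g \<cdot> \<iota> i = f i"
    using assms(1,2) unfolding is_coproduct_def
    by (elim conjE) (drule (1) bspec, drule spec, drule (1) mp, blast)
  then show ?thesis using that assms coprod_Ob arI by blast
qed

lemma coprod_eq:
  assumes "is_coproduct T I X S \<iota>" "ar g S Y" "ar h S Y" "\<And>i. i \<in> I \<Longrightarrow> g \<cdot> \<iota> i = h \<cdot> \<iota> i"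
  shows "g = h"
proof -
  define f where "f i = h \<cdot> \<iota> i" for i
  have Y: "Y \<in> Ob T" using ar_Ob[OF assms(2)] by blast
  have f: "\<forall>i\<in>I. f i \<in> carrier (Hom T (X i) Y)"
    unfolding f_def using ar_carrier[OF ar_cmp[OF assms(3) coprod_ar[OF assms(1)]]] by simp
  have "\<forall>f. (\<forall>i \<in> I. f i \<in> carrier (Hom T (X i) Y)) \<longrightarrow>
      (\<exists>!g. g \<in> carrier (Hom T S Y) \<and> (\<forall>i \<in> I. Cmp T g (\<iota> i) = f i))"
    using assms(1) Y by (simp add: is_coproduct_def)
  from mp[OF spec[OF this, of f] f]
  have E: "\<exists>!g. g \<in> carrier (Hom T S Y) \<and> (\<forall>i \<in> I. g \<cdot> \<iota> i = f i)" .
  have "g \<in> carrier (Hom T S Y) \<and> (\<forall>i \<in> I. g \<cdot> \<iota> i = f i)"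
    using assms(4) ar_carrier[OF assms(2)] unfolding f_def by simp
  moreover have "h \<in> carrier (Hom T S Y) \<and> (\<forall>i \<in> I. h \<cdot> \<iota> i = f i)"
    using ar_carrier[OF assms(3)] unfolding f_def by simp
  ultimately show ?thesis using the1_equality[OF E, of g] the1_equality[OF E, of h] by simp
qed

text \<open>Uniqueness need only be checked for the zero family, since two maps that induce the same
  family differ by one that induces zero.\<close>

lemma coproductI:
  assumes "\<And>i. i \<in> I \<Longrightarrow> ar (\<iota> i) (X i) S" "S \<in> Ob T"
    and ex: "\<And>Y f. \<lbrakk>Y \<in> Ob T; \<And>i. i \<in> I \<Longrightarrow> ar (f i) (X i) Y\<rbrakk> \<Longrightarrow> \<exists>g. ar g S Y \<and> (\<forall>i\<in>I. g \<cdot> \<iota> i = f i)"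
    and un: "\<And>Y g. \<lbrakk>ar g S Y; \<And>i. i \<in> I \<Longrightarrow> g \<cdot> \<iota> i = zr (X i) Y\<rbrakk> \<Longrightarrow> g = zr S Y"
  shows "is_coproduct T I X S \<iota>"
  unfolding is_coproduct_def
proof (intro conjI ballI allI impI)
  show "X \<in> I \<rightarrow> Ob T" using ar_Ob(1)[OF assms(1)] by blast
  show "S \<in> Ob T" by fact
  show "\<iota> i \<in> carrier (Hom T (X i) S)" if "i \<in> I" for i using that assms(1) ar_carrier by blast
  fix Y f assume Y: "Y \<in> Ob T" and "\<forall>i\<in>I. f i \<in> carrier (Hom T (X i) Y)"
  then have f: "\<And>i. i \<in> I \<Longrightarrow> ar (f i) (X i) Y" using ar_Ob(1)[OF assms(1)] by (simp add: ar_def)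
  obtain g where g: "ar g S Y" "\<forall>i\<in>I. g \<cdot> \<iota> i = f i" using ex[OF Y f] by blast
  show "\<exists>!g. g \<in> carrier (Hom T S Y) \<and> (\<forall>i\<in>I. g \<cdot> \<iota> i = f i)"
  proof (rule ex1I)
    show "g \<in> carrier (Hom T S Y) \<and> (\<forall>i\<in>I. g \<cdot> \<iota> i = f i)" using g ar_carrier by blast
    fix k assume "k \<in> carrier (Hom T S Y) \<and> (\<forall>i\<in>I. k \<cdot> \<iota> i = f i)"
    then have k: "ar k S Y" "\<forall>i\<in>I. k \<cdot> \<iota> i = f i" using assms Y arI by blast+
    have "mi S Y k g = zr S Y"
    proof (rule un)
      show "ar (mi S Y k g) S Y" using k g ar_mi by blast
      fix i assume "i \<in> I"
      then show "mi S Y k g \<cdot> \<iota> i = zr (X i) Y"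
        using k g assms(1)[of i] f[of i] by (simp add: mi_cmp mi_self)
    qed
    then show "k = g" using k g mi_eq_zr_iff by blast
  qed
qed

lemma coprod_proj:
  assumes "is_coproduct T I X S \<iota>" "i \<in> I"
  obtains p where "ar p S (X i)" "p \<cdot> \<iota> i = Idt T (X i)" "\<And>j. \<lbrakk>j \<in> I; j \<noteq> i\<rbrakk> \<Longrightarrow> p \<cdot> \<iota> j = zr (X j) (X i)"
proof -
  have X: "\<And>j. j \<in> I \<Longrightarrow> X j \<in> Ob T" using coprod_Ob'[OF assms(1)] .
  define f where "f j = (if j = i then Idt T (X i) else zr (X j) (X i))" for j
  have f: "ar (f j) (X j) (X i)" if "j \<in> I" for j
    using ar_Idt[OF X[OF assms(2)]] ar_zr[OF X[OF that] X[OF assms(2)]] by (simp add: f_def)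
  obtain g where "ar g S (X i)" "\<And>i. i \<in> I \<Longrightarrow> g \<cdot> \<iota> i = f i"
    by (rule coprod_desc[OF assms(1) X[OF assms(2)], of f]) (use f in auto)
  then show ?thesis using that[of g] assms(2) by (simp add: f_def)
qed

lemma coprod_cong: "\<lbrakk>is_coproduct T I X S \<iota>; \<And>i. i \<in> I \<Longrightarrow> X i = X' i; \<And>i. i \<in> I \<Longrightarrow> \<iota> i = \<iota>' i\<rbrakk>
    \<Longrightarrow> is_coproduct T I X' S \<iota>'"
  unfolding is_coproduct_def by (simp add: Pi_iff cong: ball_cong)

lemma coprod_reindex:
  assumes "is_coproduct T (e ` I) X S \<iota>" "inj_on e I"
  shows "is_coproduct T I (X \<circ> e) S (\<iota> \<circ> e)"
proof (rule coproductI)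
  show "ar ((\<iota> \<circ> e) i) ((X \<circ> e) i) S" if "i \<in> I" for i using that coprod_ar[OF assms(1)] by simp
  show "S \<in> Ob T" using assms coprod_Ob by blast
  fix Y f assume Y: "Y \<in> Ob T" and f: "\<And>i. i \<in> I \<Longrightarrow> ar (f i) ((X \<circ> e) i) Y"
  define f' where "f' j = f (inv_into I e j)" for j
  have "ar (f' j) (X j) Y" if "j \<in> e ` I" for j
    using that f[of "inv_into I e j"] by (simp add: f'_def inv_into_into f_inv_into_f)
  then obtain g where g: "ar g S Y" "\<And>j. j \<in> e ` I \<Longrightarrow> g \<cdot> \<iota> j = f' j"
    by (rule coprod_desc[OF assms(1) Y]) auto
  then have "\<forall>i\<in>I. g \<cdot> (\<iota> \<circ> e) i = f i" using assms(2) by (simp add: f'_def)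
  then show "\<exists>g. ar g S Y \<and> (\<forall>i\<in>I. g \<cdot> (\<iota> \<circ> e) i = f i)" using g by blast
next
  fix Y g assume g: "ar g S Y" "\<And>i. i \<in> I \<Longrightarrow> g \<cdot> (\<iota> \<circ> e) i = zr ((X \<circ> e) i) Y"
  then have "ar (zr S Y) S Y" using ar_zr[OF ar_Ob] by blast
  moreover have "zr S Y \<cdot> \<iota> j = zr (X j) Y" if "j \<in> e ` I" for j
    using zr_cmp[OF coprod_ar[OF assms(1) that] ar_Ob(2)[OF g(1)]] .
  moreover have "g \<cdot> \<iota> j = zr (X j) Y" if "j \<in> e ` I" for j
    using that g(2) by auto
  ultimately show "g = zr S Y" using coprod_eq[OF assms(1) g(1)] by metis
qed

end

section \<open>Exact triangles and their long exact sequences\<close>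

context triangulated_category
begin

definition tri where "tri f g h X Y Z \<longleftrightarrow> X \<in> Ob T \<and> Y \<in> Ob T \<and> Z \<in> Ob T \<and> (f, g, h) \<in> Tri T X Y Z"

lemma tri_Ob: "tri f g h X Y Z \<Longrightarrow> X \<in> Ob T" "tri f g h X Y Z \<Longrightarrow> Y \<in> Ob T" "tri f g h X Y Z \<Longrightarrow> Z \<in> Ob T"
  by (auto simp: tri_def)

lemma Susp_Ob: "X \<in> Ob T \<Longrightarrow> Susp T X \<in> Ob T"
  using Susp_bij bij_betwE by blast

lemma tri_ar:
  assumes "tri f g h X Y Z"
  shows "ar f X Y" "ar g Y Z" "ar h Z (Susp T X)"
  using assms Tri_Hom[of X Y Z] Susp_Ob[of X] by (auto simp: tri_def ar_def)

lemma SuspM_ar: "ar f X Y \<Longrightarrow> ar (SuspM T f) (Susp T X) (Susp T Y)"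
  using SuspM_bij[of X Y] bij_betwE Susp_Ob unfolding ar_def by blast

lemma SuspM_cmp: "\<lbrakk>ar g Y Z; ar f X Y\<rbrakk> \<Longrightarrow> SuspM T (g \<cdot> f) = SuspM T g \<cdot> SuspM T f"
  using Susp_functor unfolding additive_functor_def endofunctor_def ar_def by blast

lemma SuspM_Idt: "X \<in> Ob T \<Longrightarrow> SuspM T (Idt T X) = Idt T (Susp T X)"
  using Susp_functor unfolding additive_functor_def endofunctor_def by blast

lemma SuspM_hom: "\<lbrakk>X \<in> Ob T; Y \<in> Ob T\<rbrakk> \<Longrightarrow> group_hom (Hom T X Y) (Hom T (Susp T X) (Susp T Y)) (SuspM T)"
  using Susp_functor ar_group Susp_Ob
  unfolding additive_functor_def group_hom_def group_hom_axioms_def by blast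

lemma SuspM_zr: "\<lbrakk>X \<in> Ob T; Y \<in> Ob T\<rbrakk> \<Longrightarrow> SuspM T (zr X Y) = zr (Susp T X) (Susp T Y)"
  using group_hom.hom_one[OF SuspM_hom] by blast

lemma SuspM_pl: "\<lbrakk>ar f X Y; ar g X Y\<rbrakk> \<Longrightarrow>
    SuspM T (f \<otimes>\<^bsub>Hom T X Y\<^esub> g) = SuspM T f \<otimes>\<^bsub>Hom T (Susp T X) (Susp T Y)\<^esub> SuspM T g"
  using group_hom.hom_mult[OF SuspM_hom, of X Y f g] by (auto simp: ar_def)

lemma SuspM_eq: "\<lbrakk>SuspM T f = SuspM T g; ar f X Y; ar g X Y\<rbrakk> \<Longrightarrow> f = g"
  using SuspM_bij[of X Y] unfolding ar_def bij_betw_def inj_on_def by blast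

lemma SuspM_full:
  assumes "ar k (Susp T X) (Susp T Y)" "X \<in> Ob T" "Y \<in> Ob T"
  obtains f where "ar f X Y" "SuspM T f = k"
proof -
  have "k \<in> SuspM T ` carrier (Hom T X Y)"
    using SuspM_bij[of X Y] assms unfolding ar_def bij_betw_def by blast
  then show ?thesis using that assms arI by blast
qed

lemma Susp_surj:
  assumes "Z \<in> Ob T" obtains Z' where "Z' \<in> Ob T" "Susp T Z' = Z"
proof -
  have "Z \<in> Susp T ` Ob T" using Susp_bij assms by (simp add: bij_betw_def)
  then show ?thesis using that by blast
qed

lemma tri_rot:
  assumes "tri f g h X Y Z"
  shows "tri g h (inv\<^bsub>Hom T (Susp T X) (Susp T Y)\<^esub> (SuspM T f)) Y Z (Susp T X)"
  using Tri_rotate[of X Y Z f g h] assms tri_ar[OF assms] Susp_Ob by (auto simp: tri_def ar_def)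

lemma tri_unrot:
  assumes "tri g h (inv\<^bsub>Hom T (Susp T X) (Susp T Y)\<^esub> (SuspM T f)) Y Z (Susp T X)" "ar f X Y"
  shows "tri f g h X Y Z"
  using Tri_rotate[of X Y Z f g h] assms tri_ar[OF assms(1)] by (auto simp: tri_def ar_def)

lemma tri_mor:
  assumes "tri f g h X Y Z" "tri f' g' h' X' Y' Z'" "ar a X X'" "ar b Y Y'" "b \<cdot> f = f' \<cdot> a"
  obtains c where "ar c Z Z'" "c \<cdot> g = g' \<cdot> b" "SuspM T a \<cdot> h = h' \<cdot> c"
  using Tri_morphism[of X Y Z X' Y' Z' f g h f' g' h' a b] assms that
  by (auto simp: tri_def ar_def)

lemma tri_cone:
  assumes "ar f X Y" obtains g h Z where "tri f g h X Y Z"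
  using Tri_exists[of X Y f] assms that by (auto simp: tri_def ar_def)

lemma tri_fibre:
  assumes "ar g Y Z" obtains f h X where "tri f g h X Y Z"
proof -
  obtain h k W where t: "tri g h k Y Z W" using tri_cone[OF assms] by blast
  obtain X where X: "X \<in> Ob T" "Susp T X = W" using Susp_surj tri_Ob t by metis
  have k: "ar k (Susp T X) (Susp T Y)" using tri_ar t X by blast
  \<comment> \<open>The sign of the rotation axiom is put into \<open>f\<close>, so that negating
    \<open>SuspM T f\<close> gives back \<open>k\<close>.\<close>
  obtain f where f: "ar f X Y" "SuspM T f = inv\<^bsub>Hom T (Susp T X) (Susp T Y)\<^esub> k"
    using SuspM_full[OF ar_neg[OF k]] X tri_Ob t by metis
  then have "inv\<^bsub>Hom T (Susp T X) (Susp T Y)\<^esub> (SuspM T f) = k" using neg_neg k by metis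
  then show ?thesis using tri_unrot[of g h X Y f Z] t X f that by auto
qed

lemma tri_Idt: "\<lbrakk>X \<in> Ob T; is_zero T Z\<rbrakk> \<Longrightarrow> tri (Idt T X) (zr X Z) (zr Z (Susp T X)) X X Z"
  using Tri_Idt is_zero_Ob by (simp add: tri_def)

lemma is_zero_Susp: "is_zero T Z \<Longrightarrow> is_zero T (Susp T Z)"
proof (rule is_zeroI)
  assume Z: "is_zero T Z"
  show "Susp T Z \<in> Ob T" using Z is_zero_Ob Susp_Ob by blast
  show "Idt T (Susp T Z) = zr (Susp T Z) (Susp T Z)"
    using SuspM_Idt[of Z] SuspM_zr[of Z Z] Z is_zero_Ob ar_zero_dom ar_Idt by metis
qed

lemma tri_zero_Idt:
  assumes W: "W \<in> Ob T" and z: "is_zero T Z"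
  shows "tri (zr Z W) (Idt T W) (zr W (Susp T Z)) Z W W"
proof -
  have Z: "Z \<in> Ob T" using z is_zero_Ob by blast
  have "tri (Idt T W) (zr W (Susp T Z)) (zr (Susp T Z) (Susp T W)) W W (Susp T Z)"
    using tri_Idt is_zero_Susp z W by blast
  moreover have "inv\<^bsub>Hom T (Susp T Z) (Susp T W)\<^esub> (SuspM T (zr Z W)) = zr (Susp T Z) (Susp T W)"
    using SuspM_zr neg_zr Susp_Ob Z W by metis
  ultimately show ?thesis using tri_unrot[of "Idt T W" "zr W (Susp T Z)" Z W "zr Z W" W] ar_zr Z W by auto
qed

text \<open>Compare the trivial triangle on the identity of \<open>X\<close> with the given one
  through the identity and \<open>f\<close>: the fill-in factors \<open>g \<cdot> f\<close> through
  a zero object.\<close>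

lemma tri_comp:
  assumes t: "tri f g h X Y Z"
  shows "g \<cdot> f = zr X Z"
proof -
  obtain O' where z: "is_zero T O'" using has_zero by blast
  have O: "X \<in> Ob T" "Y \<in> Ob T" "Z \<in> Ob T" using tri_Ob t by blast+
  have i: "tri (Idt T X) (zr X O') (zr O' (Susp T X)) X X O'" using tri_Idt z O by blast
  obtain c where c: "ar c O' Z" "c \<cdot> zr X O' = g \<cdot> f"
    using tri_mor[OF i t ar_Idt[OF O(1)] tri_ar(1)[OF t]] by auto
  then show ?thesis using cmp_zr[OF c(1) O(1)] by metis
qed

lemma tri_comp2: "tri f g h X Y Z \<Longrightarrow> h \<cdot> g = zr Y (Susp T X)"
  using tri_comp[OF tri_rot] .

lemma tri_comp3:
  assumes t: "tri f g h X Y Z"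
  shows "SuspM T f \<cdot> h = zr Z (Susp T Y)"
proof -
  have s: "ar (SuspM T f) (Susp T X) (Susp T Y)" using SuspM_ar tri_ar t by blast
  have "inv\<^bsub>Hom T (Susp T X) (Susp T Y)\<^esub> (SuspM T f) \<cdot> h = zr Z (Susp T Y)"
    using tri_comp2[OF tri_rot[OF t]] .
  then show ?thesis using neg_cmp[OF tri_ar(3)[OF t] s] neg_eq_zr ar_cmp[OF s tri_ar(3)[OF t]] by metis
qed

lemma tri_weak_coker:
  assumes t: "tri f g h X Y Z" and x: "ar x Y W" "x \<cdot> f = zr X W"
  obtains y where "ar y Z W" "x = y \<cdot> g"
proof -
  obtain O' where z: "is_zero T O'" using has_zero by blast
  have O: "X \<in> Ob T" "Y \<in> Ob T" "Z \<in> Ob T" "W \<in> Ob T" "O' \<in> Ob T"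
    using tri_Ob[OF t] ar_Ob[OF x(1)] is_zero_Ob[OF z] by blast+
  have i: "tri (zr O' W) (Idt T W) (zr W (Susp T O')) O' W W" using tri_zero_Idt z O by blast
  have "x \<cdot> f = zr O' W \<cdot> zr X O'" using x zr_cmp ar_zr O by metis
  then obtain c where c: "ar c Z W" "c \<cdot> g = Idt T W \<cdot> x"
    using tri_mor[OF t i ar_zr x(1)] O by metis
  then show ?thesis using that id_cmp x by metis
qed

lemma tri_weak_coker2:
  assumes t: "tri f g h X Y Z" and x: "ar x Z W" "x \<cdot> g = zr Y W"
  obtains y where "ar y (Susp T X) W" "x = y \<cdot> h"
  using tri_weak_coker[OF tri_rot[OF t] x] .

lemma tri_weak_coker3:
  assumes t: "tri f g h X Y Z" and x: "ar x (Susp T X) W" "x \<cdot> h = zr Z W"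
  obtains y where "ar y (Susp T Y) W" "x = y \<cdot> SuspM T f"
proof -
  have s: "ar (SuspM T f) (Susp T X) (Susp T Y)" using SuspM_ar tri_ar t by blast
  obtain y where y: "ar y (Susp T Y) W" "x = y \<cdot> inv\<^bsub>Hom T (Susp T X) (Susp T Y)\<^esub> (SuspM T f)"
    using tri_weak_coker2[OF tri_rot[OF t] x] .
  then have "x = inv\<^bsub>Hom T (Susp T Y) W\<^esub> y \<cdot> SuspM T f"
    using cmp_neg neg_cmp s by metis
  then show ?thesis using that ar_neg y by blast
qed

text \<open>The morphism axiom supplies only a third map. Both triangles are rotated once, so that
  the fill-in goes from \<open>Susp T W\<close> to \<open>Susp T X\<close>; it is brought back
  because \<open>SuspM\<close> is full, and the signs on both sides cancel.\<close>

lemma tri_weak_ker: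
  assumes t: "tri f g h X Y Z" and x: "ar x W Y" "g \<cdot> x = zr W Z"
  obtains y where "ar y W X" "x = f \<cdot> y"
proof -
  obtain O' where z: "is_zero T O'" using has_zero by blast
  have O: "X \<in> Ob T" "Y \<in> Ob T" "Z \<in> Ob T" "W \<in> Ob T" "O' \<in> Ob T"
    using tri_Ob[OF t] ar_Ob[OF x(1)] is_zero_Ob[OF z] by blast+
  have i: "tri (Idt T W) (zr W O') (zr O' (Susp T W)) W W O'" using tri_Idt z O by blast
  have "zr O' Z \<cdot> zr W O' = g \<cdot> x" using x zr_cmp ar_zr O by metis
  then obtain c where c: "ar c (Susp T W) (Susp T X)"
     "SuspM T x \<cdot> inv\<^bsub>Hom T (Susp T W) (Susp T W)\<^esub> (SuspM T (Idt T W)) =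
      inv\<^bsub>Hom T (Susp T X) (Susp T Y)\<^esub> (SuspM T f) \<cdot> c"
    using tri_mor[OF tri_rot[OF i] tri_rot[OF t] x(1) ar_zr[OF O(5,3)]] by blast
  obtain y where y: "ar y W X" "SuspM T y = c" using SuspM_full c O by metis
  have sx: "ar (SuspM T x) (Susp T W) (Susp T Y)" using SuspM_ar x by blast
  have sf: "ar (SuspM T f) (Susp T X) (Susp T Y)" using SuspM_ar tri_ar t by blast
  have "SuspM T x \<cdot> inv\<^bsub>Hom T (Susp T W) (Susp T W)\<^esub> (SuspM T (Idt T W))
     = inv\<^bsub>Hom T (Susp T W) (Susp T Y)\<^esub> (SuspM T x)"
    using cmp_neg[OF sx ar_Idt] cmp_id[OF sx] SuspM_Idt O Susp_Ob by metis
  moreover have "inv\<^bsub>Hom T (Susp T X) (Susp T Y)\<^esub> (SuspM T f) \<cdot> c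
     = inv\<^bsub>Hom T (Susp T W) (Susp T Y)\<^esub> (SuspM T f \<cdot> c)"
    using neg_cmp[OF c(1) sf] .
  ultimately have "SuspM T x = SuspM T f \<cdot> c"
    using c(2) neg_neg[OF sx] neg_neg[OF ar_cmp[OF sf c(1)]] by metis
  then have "SuspM T x = SuspM T (f \<cdot> y)" using y SuspM_cmp tri_ar(1)[OF t] by metis
  then have "x = f \<cdot> y" using SuspM_eq x y ar_cmp tri_ar(1)[OF t] by metis
  then show ?thesis using that y by blast
qed

lemma tri_weak_ker2:
  assumes t: "tri f g h X Y Z" and x: "ar x W Z" "h \<cdot> x = zr W (Susp T X)"
  obtains y where "ar y W Y" "x = g \<cdot> y"
  using tri_weak_ker[OF tri_rot[OF t] x] .

lemma tri_weak_ker3: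
  assumes t: "tri f g h X Y Z" and x: "ar x W (Susp T X)" "SuspM T f \<cdot> x = zr W (Susp T Y)"
  obtains y where "ar y W Z" "x = h \<cdot> y"
proof -
  have s: "ar (SuspM T f) (Susp T X) (Susp T Y)" using SuspM_ar tri_ar t by blast
  have "inv\<^bsub>Hom T (Susp T X) (Susp T Y)\<^esub> (SuspM T f) \<cdot> x = zr W (Susp T Y)"
    using neg_cmp[OF x(1) s] x(2) neg_zr[OF ar_Ob(1)[OF x(1)] ar_Ob(2)[OF s]] by simp
  then show ?thesis using tri_weak_ker2[OF tri_rot[OF t] x(1)] that by blast
qed

text \<open>One step back in the long exact sequence: what \<open>f\<close> kills comes from maps
  \<open>Susp T W \<rightarrow> Z\<close>.\<close>

lemma tri_mono:
  assumes t: "tri f g h X Y Z" and x: "ar x W X" "f \<cdot> x = zr W Y"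
    and z: "\<And>y. ar y (Susp T W) Z \<Longrightarrow> y = zr (Susp T W) Z"
  shows "x = zr W X"
proof -
  have O: "W \<in> Ob T" "X \<in> Ob T" "Y \<in> Ob T" using ar_Ob[OF x(1)] tri_Ob[OF t] by blast+
  have f: "ar f X Y" using t tri_ar by blast
  have "SuspM T f \<cdot> SuspM T x = zr (Susp T W) (Susp T Y)"
    using SuspM_cmp[OF f x(1)] x(2) SuspM_zr O by metis
  then obtain y where y: "ar y (Susp T W) Z" "SuspM T x = h \<cdot> y"
    using tri_weak_ker3[OF t SuspM_ar[OF x(1)]] by blast
  then have "SuspM T x = SuspM T (zr W X)"
    using z cmp_zr[OF tri_ar(3)[OF t] Susp_Ob[OF O(1)]] SuspM_zr[of W X] O by metis
  then show ?thesis using SuspM_eq x(1) ar_zr O by blast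
qed

lemma tri_mono_eq:
  assumes t: "tri f g h X Y Z" and x: "ar x W X" "ar x' W X" "f \<cdot> x = f \<cdot> x'"
    and z: "\<And>y. ar y (Susp T W) Z \<Longrightarrow> y = zr (Susp T W) Z"
  shows "x = x'"
proof -
  have f: "ar f X Y" using t tri_ar by blast
  have "f \<cdot> mi W X x x' = zr W Y" using cmp_mi[OF f x(1,2)] x(3) mi_self ar_cmp[OF f x(1)] by metis
  then have "mi W X x x' = zr W X" using tri_mono[OF t ar_mi[OF x(1,2)] _ z] by blast
  then show ?thesis using mi_eq_zr_iff x by blast
qed

lemma tri_epi_eq:
  assumes t: "tri f g h X Y Z" and x: "ar x Z W" "ar x' Z W" "x \<cdot> g = x' \<cdot> g"
    and z: "\<And>y. ar y (Susp T X) W \<Longrightarrow> y = zr (Susp T X) W"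
  shows "x = x'"
proof -
  have g: "ar g Y Z" and h: "ar h Z (Susp T X)" using t tri_ar by blast+
  have W: "W \<in> Ob T" using ar_Ob[OF x(1)] by blast
  have "mi Z W x x' \<cdot> g = zr Y W" using mi_cmp[OF g x(1,2)] x(3) mi_self ar_cmp[OF x(1) g] by metis
  then obtain y where "ar y (Susp T X) W" "mi Z W x x' = y \<cdot> h"
    using tri_weak_coker2[OF t ar_mi[OF x(1,2)]] by blast
  then have "mi Z W x x' = zr Z W" using z zr_cmp[OF h W] by metis
  then show ?thesis using mi_eq_zr_iff x by blast
qed

text \<open>With a zero cone the identity of \<open>Y\<close> lifts through \<open>f\<close>, and
  \<open>f\<close> can be cancelled by \<open>tri_mono_eq\<close>, so this right inverse is
  two-sided.\<close>

lemma tri_iso_if_zero: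
  assumes t: "tri f g h X Y Z" and z: "is_zero T Z"
  shows "f \<in> isos T X Y"
proof -
  have f: "ar f X Y" and g: "ar g Y Z" using t tri_ar by blast+
  have O: "X \<in> Ob T" "Y \<in> Ob T" using ar_Ob[OF f] by blast+
  have "g \<cdot> Idt T Y = zr Y Z" using ar_zero_cod[OF z ar_cmp[OF g ar_Idt[OF O(2)]]] .
  then obtain s where s: "ar s Y X" "Idt T Y = f \<cdot> s"
    using tri_weak_ker[OF t ar_Idt[OF O(2)]] by blast
  have "f \<cdot> (s \<cdot> f) = f \<cdot> Idt T X" using cmp_assoc[OF f s(1) f] s id_cmp[OF f] cmp_id[OF f] by metis
  then have "s \<cdot> f = Idt T X"
    using tri_mono_eq[OF t ar_cmp[OF s(1) f] ar_Idt[OF O(1)]] ar_zero_cod[OF z] by blast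
  then show ?thesis using isosI f s by metis
qed

lemma tri_iso_if_zero':
  assumes "tri f g h X Y Z" "is_zero T X"
  shows "g \<in> isos T Y Z"
  using tri_iso_if_zero[OF tri_rot[OF assms(1)]] is_zero_Susp assms by blast

text \<open>An invertible \<open>f\<close> forces both \<open>g\<close> and \<open>h\<close> to
  vanish, and the identity of \<open>Z\<close> then factors through \<open>h\<close>.\<close>

lemma tri_zero_if_iso:
  assumes t: "tri f g h X Y Z" and i: "f \<in> isos T X Y"
  shows "is_zero T Z"
proof -
  have f: "ar f X Y" and g: "ar g Y Z" and h: "ar h Z (Susp T X)" using t tri_ar by blast+
  have O: "X \<in> Ob T" "Y \<in> Ob T" "Z \<in> Ob T" using t tri_Ob by blast+
  obtain k where k: "ar k Y X" "k \<cdot> f = Idt T X" "f \<cdot> k = Idt T Y" using isosE i O by metis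
  have "g = zr Y Z"
    by (metis tri_comp[OF t] cmp_assoc[OF g f k(1)] k cmp_id[OF g] zr_cmp O)
  then have "Idt T Z \<cdot> g = zr Y Z" using id_cmp g by metis
  then obtain y where y: "ar y (Susp T X) Z" "Idt T Z = y \<cdot> h"
    using tri_weak_coker2[OF t ar_Idt[OF O(3)]] by blast
  have "SuspM T f \<cdot> h = zr Z (Susp T Y)" using tri_comp3 t by blast
  then have "SuspM T k \<cdot> (SuspM T f \<cdot> h) = zr Z (Susp T X)" using cmp_zr[OF SuspM_ar[OF k(1)]] O by metis
  then have "h = zr Z (Susp T X)"
    using cmp_assoc[OF SuspM_ar[OF k(1)] SuspM_ar[OF f] h] SuspM_cmp[OF k(1) f] k(2) SuspM_Idt[OF O(1)]
      id_cmp[OF h] by simp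
  then show ?thesis using is_zeroI y O cmp_zr[OF y(1)] by metis
qed

lemma octahedron:
  assumes "tri f f1 f2 X Y Z'" "tri g g1 g2 Y Z X'" "tri (g \<cdot> f) h1 h2 X Z Y'"
  obtains u v where "tri u v (SuspM T f1 \<cdot> g2) Z' Y' X'" "u \<cdot> f1 = h1 \<cdot> g" "h2 \<cdot> u = f2"
    "v \<cdot> h1 = g1" "g2 \<cdot> v = SuspM T f \<cdot> h2"
  using Tri_octahedron[of X Y Z X' Y' Z' f f1 f2 g g1 g2 h1 h2] assms that
  by (auto simp: tri_def)

text \<open>
  The fill-in of a morphism of triangles can be chosen compatibly with the cones of the three
  vertical maps: factor the diagonal \<open>X \<rightarrow> Y'\<close> both ways and compose the two maps of the octahedra.
\<close>

lemma tri_3x3: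
  assumes t: "tri f g h X Y Z" and t': "tri f' g' h' X' Y' Z'"
    and a: "tri a a1 a2 X X' A" and b: "tri b b1 b2 Y Y' B" and sq: "b \<cdot> f = f' \<cdot> a"
  obtains c c1 c2 C p q r where "c \<cdot> g = g' \<cdot> b" "SuspM T a \<cdot> h = h' \<cdot> c"
    "tri c c1 c2 Z Z' C" "tri p q r B C (Susp T A)"
proof -
  obtain e1 e2 E where e: "tri (b \<cdot> f) e1 e2 X Y' E"
    using tri_cone[OF ar_cmp[OF tri_ar(1)[OF b] tri_ar(1)[OF t]]] .
  obtain u v w where u: "tri u v w Z E B" "u \<cdot> g = e1 \<cdot> b" "e2 \<cdot> u = h"
    using octahedron[OF t b e] by metis
  obtain u' v' w' where v: "tri u' v' w' A E Z'" "v' \<cdot> e1 = g'" "h' \<cdot> v' = SuspM T a \<cdot> e2"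
    using octahedron[OF a t' e[unfolded sq]] by metis
  define c where "c = v' \<cdot> u"
  have ar: "ar u Z E" "ar v' E Z'" "ar g Y Z" "ar e1 Y' E" "ar b Y Y'" "ar h' Z' (Susp T X')"
    "ar (SuspM T a) (Susp T X) (Susp T X')" "ar e2 E (Susp T X)"
    using tri_ar[OF u(1)] tri_ar[OF v(1)] tri_ar[OF t] tri_ar[OF t'] tri_ar[OF e] tri_ar[OF b]
      SuspM_ar[OF tri_ar(1)[OF a]] by blast+
  obtain c1 c2 C where c: "tri c c1 c2 Z Z' C"
    using tri_cone[of c Z Z'] ar ar_cmp unfolding c_def by metis
  have rv: "tri v' w' (inv\<^bsub>Hom T (Susp T A) (Susp T E)\<^esub> (SuspM T u')) E Z' (Susp T A)"
    using tri_rot[OF v(1)] .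
  obtain p q r where pq: "tri p q r B C (Susp T A)"
    using octahedron[OF u(1) rv c[unfolded c_def]] by metis
  have "c \<cdot> g = g' \<cdot> b"
    using cmp_assoc[OF ar(2,1,3)] cmp_assoc[OF ar(2,4,5)] u(2) v(2) by (simp add: c_def)
  moreover have "SuspM T a \<cdot> h = h' \<cdot> c"
    using cmp_assoc[OF ar(6,2,1)] cmp_assoc[OF ar(7,8,1)] u(3) v(3) by (simp add: c_def)
  ultimately show ?thesis using that c pq by blast
qed

end

section \<open>Small sets\<close>

lemma small_image: "small U A \<Longrightarrow> small U (f ` A)"
  unfolding small_def using card_of_image ordLeq_ordLess_trans by blast

lemma small_inj_on: "\<lbrakk>inj_on f A; small U (f ` A)\<rbrakk> \<Longrightarrow> small U A"
  unfolding small_def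
  by (meson card_of_ordLeq order_refl ordLeq_ordLess_trans)

lemma small_nat: "universe U \<Longrightarrow> small U (UNIV :: nat set)"
  unfolding universe_def small_def using card_of_nat ordIso_ordLess_trans by blast

text \<open>Coproducts and compactness are quantified over index sets inside \<open>U\<close>; this
  moves a small index set of any type there.\<close>

lemma small_embed:
  assumes "small U A" obtains e where "inj_on e A" "e ` A \<subseteq> U" "small U (e ` A)"
proof -
  have "|A| \<le>o |U|" using assms ordLess_imp_ordLeq unfolding small_def by blast
  then obtain e where "inj_on e A" "e ` A \<subseteq> U" using card_of_ordLeq[of A U] by blast
  then show ?thesis using that small_image assms by blast
qed

context triangulated_category
begin

section \<open>Integer powers of the suspension\<close>

lemma Susp_inj: "\<lbrakk>Susp T X = Susp T Y; X \<in> Ob T; Y \<in> Ob T\<rbrakk> \<Longrightarrow> X = Y"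
  using Susp_bij unfolding bij_betw_def inj_on_def by blast

lemma susp_0: "susp T 0 X = X" and suspM_0: "suspM T 0 f = f"
  by (simp_all add: susp_def suspM_def)

lemma unSusp: "X \<in> Ob T \<Longrightarrow> inv_into (Ob T) (Susp T) X \<in> Ob T"
   "X \<in> Ob T \<Longrightarrow> Susp T (inv_into (Ob T) (Susp T) X) = X"
  using Susp_bij unfolding bij_betw_def by (metis inv_into_into, metis f_inv_into_f)

lemma unSusp_pow: "X \<in> Ob T \<Longrightarrow> (inv_into (Ob T) (Susp T) ^^ n) X \<in> Ob T"
  by (induction n) (auto simp: unSusp)

lemma Susp_pow: "X \<in> Ob T \<Longrightarrow> (Susp T ^^ n) X \<in> Ob T"
  by (induction n) (auto simp: Susp_Ob)

lemma susp_Ob: "X \<in> Ob T \<Longrightarrow> susp T n X \<in> Ob T"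
  by (simp add: susp_def unSusp_pow Susp_pow)

lemma susp_Suc: "X \<in> Ob T \<Longrightarrow> susp T (n + 1) X = Susp T (susp T n X)"
proof (cases "n \<ge> 0")
  case True
  then show ?thesis by (simp add: susp_def nat_add_distrib)
next
  case False
  assume X: "X \<in> Ob T"
  have *: "nat (- n) = Suc (nat (- n - 1))" using False by simp
  show ?thesis
  \<comment> \<open>For \<open>n = -1\<close> the left side falls into the nonnegative branch of
    \<open>susp_def\<close>, so this value is separate.\<close>
  proof (cases "n = -1")
    case True
    then show ?thesis using unSusp X by (simp add: susp_def)
  next
    case F: False
    have "nat (- (n + 1)) = nat (- n - 1)" by simp
    then show ?thesis using False F unSusp(2)[OF unSusp_pow[OF X]] unfolding susp_def * by simp
  qed
qed

lemma Arr_iff: "f \<in> Arr T \<longleftrightarrow> (\<exists>X Y. ar f X Y)"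
  by (auto simp: Arr_def ar_def)

text \<open>\<open>suspM\<close> inverts \<open>SuspM\<close> on \<open>Arr T\<close>, so
  bijectivity is needed on all arrows at once. Disjointness of Hom sets shows that arrows with equal
  suspensions have the same source and target.\<close>

lemma SuspM_Arr_bij: "bij_betw (SuspM T) (Arr T) (Arr T)"
  unfolding bij_betw_def
proof
  show "inj_on (SuspM T) (Arr T)"
  proof (rule inj_onI)
    fix f g assume "f \<in> Arr T" "g \<in> Arr T" and eq: "SuspM T f = SuspM T g"
    then obtain X Y X' Y' where fg: "ar f X Y" "ar g X' Y'" using Arr_iff by metis
    then have "Susp T X = Susp T X' \<and> Susp T Y = Susp T Y'"
      using ar_unique[OF SuspM_ar[OF fg(1)]] SuspM_ar[OF fg(2)] eq by simp
    then have "X = X'" "Y = Y'" using Susp_inj ar_Ob[OF fg(1)] ar_Ob[OF fg(2)] by blast+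
    then show "f = g" using fg SuspM_eq eq by blast
  qed
  show "SuspM T ` Arr T = Arr T"
  proof
    show "SuspM T ` Arr T \<subseteq> Arr T" using SuspM_ar Arr_iff by blast
    show "Arr T \<subseteq> SuspM T ` Arr T"
    proof
      fix k assume "k \<in> Arr T"
      then obtain X Y where k: "ar k X Y" using Arr_iff by blast
      obtain X' where X': "X' \<in> Ob T" "Susp T X' = X" using Susp_surj[OF ar_Ob(1)[OF k]] .
      obtain Y' where Y': "Y' \<in> Ob T" "Susp T Y' = Y" using Susp_surj[OF ar_Ob(2)[OF k]] .
      obtain f where "ar f X' Y'" "SuspM T f = k" using SuspM_full[of k X' Y'] k X' Y' by blast
      then show "k \<in> SuspM T ` Arr T" using Arr_iff by blast
    qed
  qed
qed

lemma unSuspM: "f \<in> Arr T \<Longrightarrow> inv_into (Arr T) (SuspM T) f \<in> Arr T"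
   "f \<in> Arr T \<Longrightarrow> SuspM T (inv_into (Arr T) (SuspM T) f) = f"
  using SuspM_Arr_bij unfolding bij_betw_def by (metis inv_into_into, metis f_inv_into_f)

lemma SuspM_Arr: "f \<in> Arr T \<Longrightarrow> SuspM T f \<in> Arr T"
  using SuspM_Arr_bij bij_betwE by blast

lemma unSuspM_pow: "X \<in> Arr T \<Longrightarrow> (inv_into (Arr T) (SuspM T) ^^ n) X \<in> Arr T"
  by (induction n) (auto simp: unSuspM)

lemma SuspM_pow: "X \<in> Arr T \<Longrightarrow> (SuspM T ^^ n) X \<in> Arr T"
  by (induction n) (auto simp: SuspM_Arr)

lemma suspM_Arr: "X \<in> Arr T \<Longrightarrow> suspM T n X \<in> Arr T"
  by (simp add: suspM_def unSuspM_pow SuspM_pow)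

lemma suspM_Suc: "X \<in> Arr T \<Longrightarrow> suspM T (n + 1) X = SuspM T (suspM T n X)"
proof (cases "n \<ge> 0")
  case True
  then show ?thesis by (simp add: suspM_def nat_add_distrib)
next
  case False
  assume X: "X \<in> Arr T"
  have *: "nat (- n) = Suc (nat (- n - 1))" using False by simp
  show ?thesis
  proof (cases "n = -1")
    case True
    then show ?thesis using unSuspM X by (simp add: suspM_def)
  next
    case F: False
    have "nat (- (n + 1)) = nat (- n - 1)" by simp
    then show ?thesis using False F unSuspM(2)[OF unSuspM_pow[OF X]] unfolding suspM_def * by simp
  qed
qed

lemma susp_pred: "X \<in> Ob T \<Longrightarrow> Susp T (susp T (n - 1) X) = susp T n X"
  using susp_Suc[of X "n - 1"] by simp

lemma suspM_pred: "f \<in> Arr T \<Longrightarrow> SuspM T (suspM T (n - 1) f) = suspM T n f"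
  using suspM_Suc[of f "n - 1"] by simp

text \<open>This and the following integer inductions treat the downward step by applying the
  suspension once on both sides and cancelling it, as it is injective.\<close>

lemma susp_add: "X \<in> Ob T \<Longrightarrow> susp T (m + n) X = susp T m (susp T n X)"
proof (induction m rule: int_induct[where k = 0])
  case base then show ?case by (simp add: susp_0)
next
  case (step1 m)
  then show ?case using susp_Suc[of X "m + n"] susp_Suc[OF susp_Ob[of X n], of m] by (simp add: ac_simps)
next
  case (step2 m)
  have "Susp T (susp T (m - 1 + n) X) = Susp T (susp T (m - 1) (susp T n X))"
    using step2 susp_pred[OF step2(3), of "m + n"] susp_pred[OF susp_Ob[OF step2(3)]]
    by (simp add: algebra_simps)
  then show ?case using Susp_inj susp_Ob step2(3) by blast
qed

lemma SuspM_inj: "\<lbrakk>SuspM T f = SuspM T g; f \<in> Arr T; g \<in> Arr T\<rbrakk> \<Longrightarrow> f = g"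
  using SuspM_Arr_bij unfolding bij_betw_def inj_on_def by blast

lemma suspM_add: "f \<in> Arr T \<Longrightarrow> suspM T (m + n) f = suspM T m (suspM T n f)"
proof (induction m rule: int_induct[where k = 0])
  case base then show ?case by (simp add: suspM_0)
next
  case (step1 m)
  then show ?case using suspM_Suc[of f "m + n"] suspM_Suc[OF suspM_Arr[of f n], of m] by (simp add: ac_simps)
next
  case (step2 m)
  have "SuspM T (suspM T (m - 1 + n) f) = SuspM T (suspM T (m - 1) (suspM T n f))"
    using step2 suspM_pred[OF step2(3), of "m + n"] suspM_pred[OF suspM_Arr[OF step2(3)]]
    by (simp add: algebra_simps)
  then show ?case using SuspM_inj suspM_Arr step2(3) by blast
qed

lemma ar_Arr: "ar f X Y \<Longrightarrow> f \<in> Arr T"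
  using Arr_iff by blast

lemma SuspM_ar_rev:
  assumes "ar (SuspM T f) (Susp T X) (Susp T Y)" "f \<in> Arr T" "X \<in> Ob T" "Y \<in> Ob T"
  shows "ar f X Y"
proof -
  obtain k where "ar k X Y" "SuspM T k = SuspM T f" using SuspM_full assms by metis
  then show ?thesis using SuspM_inj assms ar_Arr by metis
qed

lemma suspM_ar: "ar f X Y \<Longrightarrow> ar (suspM T n f) (susp T n X) (susp T n Y)"
proof (induction n rule: int_induct[where k = 0])
  case base then show ?case by (simp add: susp_0 suspM_0)
next
  case (step1 n)
  then show ?case
    using SuspM_ar suspM_Suc[OF ar_Arr[OF step1(3)]] susp_Suc[OF ar_Ob(1)[OF step1(3)]]
      susp_Suc[OF ar_Ob(2)[OF step1(3)]] by metis
next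
  case (step2 n)
  have "ar (SuspM T (suspM T (n - 1) f)) (Susp T (susp T (n - 1) X)) (Susp T (susp T (n - 1) Y))"
    using step2 suspM_pred[OF ar_Arr] susp_pred ar_Ob[OF step2(3)] by metis
  then show ?case using SuspM_ar_rev suspM_Arr[OF ar_Arr[OF step2(3)]] susp_Ob ar_Ob[OF step2(3)] by blast
qed

lemma suspM_cmp: "\<lbrakk>ar g Y Z; ar f X Y\<rbrakk> \<Longrightarrow> suspM T n (g \<cdot> f) = suspM T n g \<cdot> suspM T n f"
proof (induction n rule: int_induct[where k = 0])
  case base then show ?case by (simp add: suspM_0)
next
  case (step1 n)
  have a: "g \<in> Arr T" "f \<in> Arr T" "g \<cdot> f \<in> Arr T"
    using ar_Arr[OF step1(3)] ar_Arr[OF step1(4)] ar_Arr[OF ar_cmp[OF step1(3,4)]] by auto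
  then show ?case
    using step1 SuspM_cmp[OF suspM_ar[OF step1(3)] suspM_ar[OF step1(4)]] by (simp add: suspM_Suc)
next
  case (step2 n)
  have a: "g \<in> Arr T" "f \<in> Arr T" "g \<cdot> f \<in> Arr T"
    using ar_Arr[OF step2(3)] ar_Arr[OF step2(4)] ar_Arr[OF ar_cmp[OF step2(3,4)]] by auto
  have "SuspM T (suspM T (n - 1) (g \<cdot> f)) = SuspM T (suspM T (n - 1) g \<cdot> suspM T (n - 1) f)"
    using step2 a SuspM_cmp[OF suspM_ar[OF step2(3)] suspM_ar[OF step2(4)]] by (simp add: suspM_pred)
  then show ?case
    using SuspM_inj suspM_Arr[OF a(3)] ar_Arr[OF ar_cmp[OF suspM_ar[OF step2(3)] suspM_ar[OF step2(4)]]] by blast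
qed

lemma suspM_zr:
  assumes X: "X \<in> Ob T" and Y: "Y \<in> Ob T"
  shows "suspM T n (zr X Y) = zr (susp T n X) (susp T n Y)"
proof (induction n rule: int_induct[where k = 0])
  case base then show ?case by (simp add: suspM_0 susp_0)
next
  case (step1 n)
  then show ?case using suspM_Suc[OF ar_Arr[OF ar_zr[OF assms]]] SuspM_zr susp_Suc susp_Ob assms by simp
next
  case (step2 n)
  have "SuspM T (suspM T (n - 1) (zr X Y)) = SuspM T (zr (susp T (n - 1) X) (susp T (n - 1) Y))"
    using step2 suspM_pred[OF ar_Arr[OF ar_zr[OF assms]]] SuspM_zr susp_pred susp_Ob assms by simp
  then show ?case
    using SuspM_inj suspM_Arr[OF ar_Arr[OF ar_zr[OF assms]]] ar_Arr[OF ar_zr[OF susp_Ob[OF X] susp_Ob[OF Y]]]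
    by blast
qed

lemma susp_neg: "X \<in> Ob T \<Longrightarrow> susp T (- n) (susp T n X) = X" "X \<in> Ob T \<Longrightarrow> susp T n (susp T (- n) X) = X"
  using susp_add[of X "- n" n] susp_add[of X n "- n"] by (simp_all add: susp_0)

lemma suspM_neg: "f \<in> Arr T \<Longrightarrow> suspM T (- n) (suspM T n f) = f" "f \<in> Arr T \<Longrightarrow> suspM T n (suspM T (- n) f) = f"
  using suspM_add[of f "- n" n] suspM_add[of f n "- n"] by (simp_all add: suspM_0)

lemma suspM_eq: "\<lbrakk>suspM T n f = suspM T n g; f \<in> Arr T; g \<in> Arr T\<rbrakk> \<Longrightarrow> f = g"
  using suspM_neg(1) by metis

lemma suspM_Idt: "X \<in> Ob T \<Longrightarrow> suspM T n (Idt T X) = Idt T (susp T n X)"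
proof (induction n rule: int_induct[where k = 0])
  case base then show ?case by (simp add: susp_0 suspM_0)
next
  case (step1 n)
  then show ?case using suspM_Suc[OF ar_Arr[OF ar_Idt]] SuspM_Idt susp_Suc susp_Ob by simp
next
  case (step2 n)
  have "SuspM T (suspM T (n - 1) (Idt T X)) = SuspM T (Idt T (susp T (n - 1) X))"
    using step2 suspM_pred[OF ar_Arr[OF ar_Idt]] SuspM_Idt susp_pred susp_Ob by simp
  then show ?case
    using SuspM_inj suspM_Arr[OF ar_Arr[OF ar_Idt]] ar_Arr[OF ar_Idt[OF susp_Ob]] step2(3) by blast
qed

lemma suspM_pl:
  assumes f: "ar f X Y" and g: "ar g X Y"
  shows "suspM T n (f \<otimes>\<^bsub>Hom T X Y\<^esub> g) = suspM T n f \<otimes>\<^bsub>Hom T (susp T n X) (susp T n Y)\<^esub> suspM T n g"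
proof (induction n rule: int_induct[where k = 0])
  case base then show ?case by (simp add: susp_0 suspM_0)
next
  case (step1 n)
  have a: "f \<in> Arr T" "g \<in> Arr T" "f \<otimes>\<^bsub>Hom T X Y\<^esub> g \<in> Arr T"
    using ar_Arr[OF f] ar_Arr[OF g] ar_Arr[OF ar_pl[OF f g]] by auto
  then show ?case
    using step1 SuspM_pl[OF suspM_ar[OF f] suspM_ar[OF g]] susp_Suc ar_Ob[OF f] by (simp add: suspM_Suc)
next
  case (step2 n)
  have a: "f \<in> Arr T" "g \<in> Arr T" "f \<otimes>\<^bsub>Hom T X Y\<^esub> g \<in> Arr T"
    using ar_Arr[OF f] ar_Arr[OF g] ar_Arr[OF ar_pl[OF f g]] by auto
  have "SuspM T (suspM T (n - 1) (f \<otimes>\<^bsub>Hom T X Y\<^esub> g))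
      = SuspM T (suspM T (n - 1) f \<otimes>\<^bsub>Hom T (susp T (n - 1) X) (susp T (n - 1) Y)\<^esub> suspM T (n - 1) g)"
    using step2 a SuspM_pl[OF suspM_ar[OF f, of "n - 1"] suspM_ar[OF g, of "n - 1"]] susp_pred ar_Ob[OF f]
    by (simp add: suspM_pred)
  then show ?case
    using SuspM_inj suspM_Arr[OF a(3)] ar_Arr[OF ar_pl[OF suspM_ar[OF f] suspM_ar[OF g]]] by blast
qed

lemma suspM_full:
  assumes "ar k (susp T n X) (susp T n Y)" "X \<in> Ob T" "Y \<in> Ob T"
  obtains f where "ar f X Y" "suspM T n f = k"
proof -
  have "ar (suspM T (- n) k) X Y" using suspM_ar[OF assms(1), of "- n"] susp_neg assms by simp
  then show ?thesis using that suspM_neg(2)[OF ar_Arr[OF assms(1)], of n] by blast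
qed

section \<open>Coproducts of suspensions and of triangles\<close>

lemma coprod_susp:
  assumes "is_coproduct T I X S \<iota>"
  shows "is_coproduct T I (\<lambda>i. susp T n (X i)) (susp T n S) (\<lambda>i. suspM T n (\<iota> i))"
proof (rule coproductI)
  show "ar (suspM T n (\<iota> i)) (susp T n (X i)) (susp T n S)" if "i \<in> I" for i
    using that suspM_ar coprod_ar[OF assms] by blast
  show S: "susp T n S \<in> Ob T" using coprod_Ob[OF assms] susp_Ob by blast
  fix Y f assume Y: "Y \<in> Ob T" and f: "\<And>i. i \<in> I \<Longrightarrow> ar (f i) (susp T n (X i)) Y"
  define Y' where "Y' = susp T (- n) Y"
  have Y': "Y' \<in> Ob T" "susp T n Y' = Y" using Y susp_Ob susp_neg by (auto simp: Y'_def)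
  have "\<exists>k. ar k (X i) Y' \<and> suspM T n k = f i" if "i \<in> I" for i
    using suspM_full[of "f i" n "X i" Y'] f[OF that] Y' coprod_Ob'[OF assms that] by metis
  then obtain k where k: "\<And>i. i \<in> I \<Longrightarrow> ar (k i) (X i) Y'" "\<And>i. i \<in> I \<Longrightarrow> suspM T n (k i) = f i" by metis
  obtain g where g: "ar g S Y'" "\<And>i. i \<in> I \<Longrightarrow> g \<cdot> \<iota> i = k i"
    using coprod_desc[OF assms Y'(1), of k] k by metis
  have "suspM T n g \<cdot> suspM T n (\<iota> i) = f i" if "i \<in> I" for i
    using suspM_cmp[OF g(1) coprod_ar[OF assms that], of n] g(2) k(2) that by simp
  then show "\<exists>g. ar g (susp T n S) Y \<and> (\<forall>i\<in>I. g \<cdot> suspM T n (\<iota> i) = f i)"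
    using suspM_ar[OF g(1), of n] Y' by metis
next
  fix Y g assume g: "ar g (susp T n S) Y" "\<And>i. i \<in> I \<Longrightarrow> g \<cdot> suspM T n (\<iota> i) = zr (susp T n (X i)) Y"
  have S: "S \<in> Ob T" using coprod_Ob[OF assms] .
  define Y' where "Y' = susp T (- n) Y"
  have Y': "Y' \<in> Ob T" "susp T n Y' = Y" using ar_Ob[OF g(1)] susp_Ob susp_neg by (auto simp: Y'_def)
  obtain k where k: "ar k S Y'" "suspM T n k = g" using suspM_full[of g n S Y'] g Y' S by metis
  have "k \<cdot> \<iota> i = zr S Y' \<cdot> \<iota> i" if i: "i \<in> I" for i
  proof -
    have \<iota>: "ar (\<iota> i) (X i) S" and X: "X i \<in> Ob T" using coprod_ar[OF assms i] coprod_Ob'[OF assms i] by auto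
    have "suspM T n (k \<cdot> \<iota> i) = suspM T n (zr (X i) Y')"
      using suspM_cmp[OF k(1) \<iota>] k(2) g(2)[OF i] suspM_zr[OF X Y'(1)] Y'(2) by simp
    then have "k \<cdot> \<iota> i = zr (X i) Y'"
      using suspM_eq ar_Arr[OF ar_cmp[OF k(1) \<iota>]] ar_Arr[OF ar_zr[OF X Y'(1)]] by blast
    then show ?thesis using zr_cmp[OF \<iota> Y'(1)] by simp
  qed
  then have "k = zr S Y'" using coprod_eq[OF assms k(1) ar_zr[OF S Y'(1)]] by blast
  then show "g = zr (susp T n S) Y" using suspM_zr[OF S Y'(1), of n] k Y' by simp
qed

lemma susp_1: "X \<in> Ob T \<Longrightarrow> susp T 1 X = Susp T X"
  using susp_Suc[of X 0] by (simp add: susp_0)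

lemma suspM_1: "f \<in> Arr T \<Longrightarrow> suspM T 1 f = SuspM T f"
  using suspM_Suc[of f 0] by (simp add: suspM_0)

lemma coprod_Susp:
  assumes "is_coproduct T I X S \<iota>"
  shows "is_coproduct T I (\<lambda>i. Susp T (X i)) (Susp T S) (\<lambda>i. SuspM T (\<iota> i))"
  using coprod_cong[OF coprod_susp[OF assms, of 1]] susp_1 suspM_1[OF ar_Arr[OF coprod_ar[OF assms]]]
    coprod_Ob[OF assms] coprod_Ob'[OF assms] by simp

text \<open>The cone of the coproduct map is shown to be a coproduct of the \<open>Z i\<close>. Its
  universal property is chased along the long exact sequences of maps into \<open>N\<close>, as in
  the five lemma; families indexed by \<open>I\<close> are assembled by the coproducts of the
  \<open>X i\<close>, the \<open>Y i\<close> and their suspensions.\<close>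

lemma coprod_tri:
  assumes t: "\<And>i. i \<in> I \<Longrightarrow> tri (f i) (g i) (h i) (X i) (Y i) (Z i)"
    and X: "is_coproduct T I X SX \<iota>" and Y: "is_coproduct T I Y SY \<kappa>"
  obtains f' g' h' SZ \<mu> where "tri f' g' h' SX SY SZ" "is_coproduct T I Z SZ \<mu>"
    "\<And>i. i \<in> I \<Longrightarrow> f' \<cdot> \<iota> i = \<kappa> i \<cdot> f i" "\<And>i. i \<in> I \<Longrightarrow> g' \<cdot> \<kappa> i = \<mu> i \<cdot> g i"
proof -
  have \<iota>: "\<And>i. i \<in> I \<Longrightarrow> ar (\<iota> i) (X i) SX" and \<kappa>: "\<And>i. i \<in> I \<Longrightarrow> ar (\<kappa> i) (Y i) SY"
    using coprod_ar[OF X] coprod_ar[OF Y] by simp_all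
  have fi: "\<And>i. i \<in> I \<Longrightarrow> ar (f i) (X i) (Y i)" and gi: "\<And>i. i \<in> I \<Longrightarrow> ar (g i) (Y i) (Z i)"
   and hi: "\<And>i. i \<in> I \<Longrightarrow> ar (h i) (Z i) (Susp T (X i))"
    using tri_ar t by blast+
  have OY: "SY \<in> Ob T" and OX: "SX \<in> Ob T" using coprod_Ob X Y by blast+
  obtain f' where f': "ar f' SX SY" "\<And>i. i \<in> I \<Longrightarrow> f' \<cdot> \<iota> i = \<kappa> i \<cdot> f i"
    using coprod_desc[OF X OY, of "\<lambda>i. \<kappa> i \<cdot> f i"] ar_cmp[OF \<kappa> fi] by metis
  obtain g' h' SZ where T': "tri f' g' h' SX SY SZ" using tri_cone[OF f'(1)] .
  have g': "ar g' SY SZ" and h': "ar h' SZ (Susp T SX)" and OZ: "SZ \<in> Ob T"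
    using tri_ar[OF T'] tri_Ob[OF T'] by blast+
  have "\<exists>c. ar c (Z i) SZ \<and> c \<cdot> g i = g' \<cdot> \<kappa> i \<and> SuspM T (\<iota> i) \<cdot> h i = h' \<cdot> c" if "i \<in> I" for i
    using tri_mor[OF t[OF that] T' \<iota>[OF that] \<kappa>[OF that]] f'(2)[OF that] by metis
  then obtain \<mu> where \<mu>: "\<And>i. i \<in> I \<Longrightarrow> ar (\<mu> i) (Z i) SZ"
      and \<mu>g: "\<And>i. i \<in> I \<Longrightarrow> \<mu> i \<cdot> g i = g' \<cdot> \<kappa> i"
      and \<mu>h: "\<And>i. i \<in> I \<Longrightarrow> h' \<cdot> \<mu> i = SuspM T (\<iota> i) \<cdot> h i"
    by metis
  have SX: "is_coproduct T I (\<lambda>i. Susp T (X i)) (Susp T SX) (\<lambda>i. SuspM T (\<iota> i))"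
    and SY: "is_coproduct T I (\<lambda>i. Susp T (Y i)) (Susp T SY) (\<lambda>i. SuspM T (\<kappa> i))"
    using coprod_Susp X Y by blast+
  have "is_coproduct T I Z SZ \<mu>"
  proof (rule coproductI)
    fix N q assume N: "N \<in> Ob T" and q: "\<And>i. i \<in> I \<Longrightarrow> ar (q i) (Z i) N"
    obtain q' where q': "ar q' SY N" "\<And>i. i \<in> I \<Longrightarrow> q' \<cdot> \<kappa> i = q i \<cdot> g i"
      using coprod_desc[OF Y N, of "\<lambda>i. q i \<cdot> g i"] ar_cmp[OF q gi] by metis
    have "(q' \<cdot> f') \<cdot> \<iota> i = zr SX N \<cdot> \<iota> i" if i: "i \<in> I" for i
    proof -
      have "(q' \<cdot> f') \<cdot> \<iota> i = q' \<cdot> (\<kappa> i \<cdot> f i)" using cmp_assoc[OF q'(1) f'(1) \<iota>[OF i]] f'(2)[OF i] by simp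
      also have "\<dots> = q i \<cdot> (g i \<cdot> f i)"
        using cmp_assoc[OF q'(1) \<kappa>[OF i] fi[OF i]] q'(2)[OF i] cmp_assoc[OF q[OF i] gi[OF i] fi[OF i]] by simp
      also have "\<dots> = zr (X i) N" using tri_comp[OF t[OF i]] cmp_zr[OF q[OF i]] tri_Ob t[OF i] by metis
      finally show ?thesis using zr_cmp[OF \<iota>[OF i] N] by simp
    qed
    then have "q' \<cdot> f' = zr SX N" using coprod_eq[OF X ar_cmp[OF q'(1) f'(1)] ar_zr[OF OX N]] by blast
    then obtain r where r: "ar r SZ N" "q' = r \<cdot> g'" using tri_weak_coker[OF T' q'(1)] by metis
    \<comment> \<open>\<open>r\<close> agrees with the required maps only after composing with
      \<open>g i\<close>. The error therefore factors through \<open>h i\<close>, and the factors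
      assemble to a map out of \<open>Susp T SX\<close> that corrects \<open>r\<close>.\<close>
    define e where "e i = mi (Z i) N (q i) (r \<cdot> \<mu> i)" for i
    have "\<exists>w. ar w (Susp T (X i)) N \<and> e i = w \<cdot> h i" if i: "i \<in> I" for i
    proof -
      have rm: "ar (r \<cdot> \<mu> i) (Z i) N" using ar_cmp r \<mu> i by blast
      have e: "ar (e i) (Z i) N" unfolding e_def using ar_mi[OF q[OF i] rm] .
      have "(r \<cdot> \<mu> i) \<cdot> g i = q i \<cdot> g i"
        using cmp_assoc[OF r(1) \<mu>[OF i] gi[OF i]] \<mu>g[OF i] cmp_assoc[OF r(1) g' \<kappa>[OF i]] r(2) q'(2)[OF i] by simp
      then have "e i \<cdot> g i = zr (Y i) N"
        unfolding e_def using mi_cmp[OF gi[OF i] q[OF i] rm] mi_self ar_cmp[OF q[OF i] gi[OF i]] by metis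
      then show ?thesis using tri_weak_coker2[OF t[OF i] e] by metis
    qed
    then obtain w where w: "\<And>i. i \<in> I \<Longrightarrow> ar (w i) (Susp T (X i)) N" "\<And>i. i \<in> I \<Longrightarrow> e i = w i \<cdot> h i" by metis
    obtain w' where w': "ar w' (Susp T SX) N" "\<And>i. i \<in> I \<Longrightarrow> w' \<cdot> SuspM T (\<iota> i) = w i"
      using coprod_desc[OF SX N, of w] w by metis
    define Q where "Q = (w' \<cdot> h') \<otimes>\<^bsub>Hom T SZ N\<^esub> r"
    have wh: "ar (w' \<cdot> h') SZ N" using ar_cmp w' h' by blast
    have "ar Q SZ N" unfolding Q_def using ar_pl[OF wh r(1)] .
    moreover have "Q \<cdot> \<mu> i = q i" if i: "i \<in> I" for i
    proof -
      have "(w' \<cdot> h') \<cdot> \<mu> i = e i"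
        using cmp_assoc[OF w'(1) h' \<mu>[OF i]] \<mu>h[OF i] cmp_assoc[OF w'(1) SuspM_ar[OF \<iota>[OF i]] hi[OF i]]
          w'(2)[OF i] w(2)[OF i] by simp
      then have "Q \<cdot> \<mu> i = e i \<otimes>\<^bsub>Hom T (Z i) N\<^esub> (r \<cdot> \<mu> i)"
        unfolding Q_def using pl_cmp[OF \<mu>[OF i] wh r(1)] by simp
      then show ?thesis unfolding e_def using pl_mi[OF q[OF i] ar_cmp[OF r(1) \<mu>[OF i]]] by simp
    qed
    ultimately show "\<exists>g. ar g SZ N \<and> (\<forall>i\<in>I. g \<cdot> \<mu> i = q i)" by blast
  next
    fix N q assume q: "ar q SZ N" and z: "\<And>i. i \<in> I \<Longrightarrow> q \<cdot> \<mu> i = zr (Z i) N"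
    have N: "N \<in> Ob T" using ar_Ob[OF q] by blast
    have "(q \<cdot> g') \<cdot> \<kappa> i = zr SY N \<cdot> \<kappa> i" if i: "i \<in> I" for i
      using cmp_assoc[OF q g' \<kappa>[OF i]] \<mu>g[OF i] cmp_assoc[OF q \<mu>[OF i] gi[OF i]] z[OF i]
        zr_cmp[OF gi[OF i] N] zr_cmp[OF \<kappa>[OF i] N] by simp
    then have "q \<cdot> g' = zr SY N" using coprod_eq[OF Y ar_cmp[OF q g'] ar_zr[OF OY N]] by blast
    then obtain w where w: "ar w (Susp T SX) N" "q = w \<cdot> h'" using tri_weak_coker2[OF T' q] by metis
    \<comment> \<open>One step further: on each summand \<open>w\<close> factors through
      \<open>SuspM T (f i)\<close>, hence \<open>w\<close> factors through
      \<open>SuspM T f'\<close>, which is zero after \<open>h'\<close>.\<close>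
    have "\<exists>v. ar v (Susp T (Y i)) N \<and> w \<cdot> SuspM T (\<iota> i) = v \<cdot> SuspM T (f i)" if i: "i \<in> I" for i
    proof -
      have s: "ar (SuspM T (\<iota> i)) (Susp T (X i)) (Susp T SX)" using SuspM_ar \<iota> i by blast
      have "(w \<cdot> SuspM T (\<iota> i)) \<cdot> h i = zr (Z i) N"
        using cmp_assoc[OF w(1) s hi[OF i]] \<mu>h[OF i] cmp_assoc[OF w(1) h' \<mu>[OF i]] w(2) z[OF i] by simp
      then show ?thesis using tri_weak_coker3[OF t[OF i] ar_cmp[OF w(1) s]] by metis
    qed
    then obtain v where v: "\<And>i. i \<in> I \<Longrightarrow> ar (v i) (Susp T (Y i)) N"
      "\<And>i. i \<in> I \<Longrightarrow> w \<cdot> SuspM T (\<iota> i) = v i \<cdot> SuspM T (f i)" by metis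
    obtain v' where v': "ar v' (Susp T SY) N" "\<And>i. i \<in> I \<Longrightarrow> v' \<cdot> SuspM T (\<kappa> i) = v i"
      using coprod_desc[OF SY N, of v] v by metis
    have sf: "ar (SuspM T f') (Susp T SX) (Susp T SY)" using SuspM_ar f' by blast
    have "w \<cdot> SuspM T (\<iota> i) = (v' \<cdot> SuspM T f') \<cdot> SuspM T (\<iota> i)" if i: "i \<in> I" for i
    proof -
      have "(v' \<cdot> SuspM T f') \<cdot> SuspM T (\<iota> i) = v' \<cdot> SuspM T (f' \<cdot> \<iota> i)"
        using cmp_assoc[OF v'(1) sf SuspM_ar[OF \<iota>[OF i]]] SuspM_cmp[OF f'(1) \<iota>[OF i]] by simp
      also have "\<dots> = v' \<cdot> (SuspM T (\<kappa> i) \<cdot> SuspM T (f i))"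
        using f'(2)[OF i] SuspM_cmp[OF \<kappa>[OF i] fi[OF i]] by simp
      also have "\<dots> = v i \<cdot> SuspM T (f i)"
        using cmp_assoc[OF v'(1) SuspM_ar[OF \<kappa>[OF i]] SuspM_ar[OF fi[OF i]]] v'(2)[OF i] by simp
      finally show ?thesis using v(2)[OF i] by simp
    qed
    then have "w = v' \<cdot> SuspM T f'" using coprod_eq[OF SX w(1) ar_cmp[OF v'(1) sf]] by blast
    then have "q = v' \<cdot> (SuspM T f' \<cdot> h')" using w cmp_assoc[OF v'(1) sf h'] by simp
    then show "q = zr SZ N" using tri_comp3[OF T'] cmp_zr[OF v'(1) OZ] by simp
  qed (use \<mu> OZ in auto)
  then show ?thesis using that T' f' \<mu>g by metis
qed

text \<open>In even degree the sign in \<open>center\<close> disappears, so the operator commutes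
  with the suspension on the nose.\<close>

definition cen where "cen d \<rho> \<longleftrightarrow> even d \<and> \<rho> \<in> center T d"

lemma cen_ar: "\<lbrakk>cen d \<rho>; X \<in> Ob T\<rbrakk> \<Longrightarrow> ar (\<rho> X) X (susp T d X)"
  by (auto simp: cen_def center_def nat_transf_def ar_def susp_Ob)

lemma cen_nat: "\<lbrakk>cen d \<rho>; ar f X Y\<rbrakk> \<Longrightarrow> \<rho> Y \<cdot> f = suspM T d f \<cdot> \<rho> X"
  by (auto simp: cen_def center_def nat_transf_def ar_def)

lemma cen_Susp: "\<lbrakk>cen d \<rho>; X \<in> Ob T\<rbrakk> \<Longrightarrow> \<rho> (Susp T X) = SuspM T (\<rho> X)"
  by (auto simp: cen_def center_def)

lemma cen_susp: "\<lbrakk>cen d \<rho>; X \<in> Ob T\<rbrakk> \<Longrightarrow> \<rho> (susp T n X) = suspM T n (\<rho> X)"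
proof (induction n rule: int_induct[where k = 0])
  case base then show ?case by (simp add: susp_0 suspM_0)
next
  case (step1 n)
  then show ?case
    using suspM_Suc[OF ar_Arr[OF cen_ar[OF step1(3,4)]]] susp_Suc[OF step1(4)] cen_Susp[OF step1(3) susp_Ob[OF step1(4)]]
    by simp
next
  case (step2 n)
  have "SuspM T (suspM T (n - 1) (\<rho> X)) = SuspM T (\<rho> (susp T (n - 1) X))"
    using step2 suspM_pred[OF ar_Arr[OF cen_ar[OF step2(3,4)]]] susp_pred
      cen_Susp[OF step2(3) susp_Ob[OF step2(4), of "n - 1"]] by simp
  then show ?case
    using SuspM_inj suspM_Arr[OF ar_Arr[OF cen_ar[OF step2(3,4)]]] ar_Arr[OF cen_ar[OF step2(3) susp_Ob[OF step2(4)]]]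
    by metis
qed

end

section \<open>Localizing subcategories and compact objects\<close>

locale cg_category = triangulated_category T for T :: "('o, 'm, 'z) tricat_scheme" +
  fixes U :: "'u set"
  assumes univ: "universe U" and coprods: "has_coproducts U T" and cgen: "compactly_generated U T"
begin

lemma coprod_exists:
  assumes "small U I" "\<And>i. i \<in> I \<Longrightarrow> X i \<in> Ob T"
  obtains S \<iota> where "is_coproduct T I X S \<iota>"
proof -
  obtain e where e: "inj_on e I" "e ` I \<subseteq> U" "small U (e ` I)" using small_embed[OF assms(1)] .
  define X' where "X' = X \<circ> inv_into I e"
  have "X' \<in> e ` I \<rightarrow> Ob T" using assms(2) by (auto simp: X'_def e(1))
  then obtain S \<iota> where S: "is_coproduct T (e ` I) X' S \<iota>"
    using coprods e unfolding has_coproducts_def by meson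
  have "is_coproduct T I X S (\<iota> \<circ> e)"
    by (rule coprod_cong[OF coprod_reindex[OF S e(1)]]) (simp_all add: X'_def e(1))
  then show ?thesis using that by blast
qed

lemma coprod_embed:
  assumes "small U I" "is_coproduct T I X S \<iota>"
  obtains e where "inj_on e I" "e ` I \<subseteq> U" "small U (e ` I)"
    "is_coproduct T (e ` I) (X \<circ> inv_into I e) S (\<iota> \<circ> inv_into I e)"
proof -
  obtain e where e: "inj_on e I" "e ` I \<subseteq> U" "small U (e ` I)" using small_embed[OF assms(1)] .
  have "is_coproduct T (inv_into I e ` e ` I) X S \<iota>"
    using assms(2) inv_into_image_cancel[OF e(1), of I] by simp
  then have "is_coproduct T (e ` I) (X \<circ> inv_into I e) S (\<iota> \<circ> inv_into I e)"
    using coprod_reindex inj_on_inv_into by blast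
  then show ?thesis using that e by blast
qed

text \<open>Rotation turns closure under cones and suspension in both directions into the other two
  closure conditions for triangles. Closure under isomorphisms comes from the triangle of an
  isomorphism, whose cone is zero.\<close>

lemma localizingI:
  assumes "L \<subseteq> Ob T" and z: "\<And>Z. is_zero T Z \<Longrightarrow> Z \<in> L"
    and s: "\<And>X. X \<in> Ob T \<Longrightarrow> X \<in> L \<longleftrightarrow> Susp T X \<in> L"
    and c: "\<And>f g h X Y Z. \<lbrakk>tri f g h X Y Z; X \<in> L; Y \<in> L\<rbrakk> \<Longrightarrow> Z \<in> L"
    and p: "\<And>I X S \<iota>. \<lbrakk>I \<subseteq> U; small U I; is_coproduct T I X S \<iota>; \<And>i. i \<in> I \<Longrightarrow> X i \<in> L\<rbrakk> \<Longrightarrow> S \<in> L"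
  shows "localizing U T L"
  unfolding localizing_def
proof (intro conjI allI ballI impI)
  have c2: "X \<in> L" if t: "tri f g h X Y Z" and "Y \<in> L" "Z \<in> L" for f g h X Y Z
    using c[OF tri_rot[OF t]] that s tri_Ob[OF t] by blast
  have c3: "Y \<in> L" if t: "tri f g h X Y Z" and "X \<in> L" "Z \<in> L" for f g h X Y Z
    using c2[OF tri_rot[OF t]] that s tri_Ob[OF t] by blast
  {
    fix X Y Z assume "X \<in> Ob T" "Y \<in> Ob T" "Z \<in> Ob T" and "Tri T X Y Z \<noteq> {}"
    then obtain f g h where "tri f g h X Y Z" unfolding tri_def by (metis ex_in_conv prod_cases3)
    then show "X \<in> L \<and> Y \<in> L \<Longrightarrow> Z \<in> L" "Y \<in> L \<and> Z \<in> L \<Longrightarrow> X \<in> L" "X \<in> L \<and> Z \<in> L \<Longrightarrow> Y \<in> L"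
      using c c2 c3 by blast+
  }
  show "Y \<in> L" if XY: "X \<in> L" "Y \<in> Ob T" "isos T X Y \<noteq> {}" for X Y
  proof -
    obtain f where f: "f \<in> isos T X Y" using XY by blast
    have fa: "ar f X Y" using isosE[OF f] assms(1) XY(1,2) by blast
    obtain g h Z where t: "tri f g h X Y Z" using tri_cone[OF fa] .
    then show ?thesis using c3[OF t XY(1)] z tri_zero_if_iso[OF t f] by blast
  qed
  show "S \<in> L" if "I \<subseteq> U" "small U I" "X \<in> I \<rightarrow> L" "is_coproduct T I X S \<iota>" for I X S \<iota>
    using p[OF that(1,2,4)] that(3) by blast
qed (use assms(1) z s in auto)

lemma localizing_Ob: "localizing U T (Ob T)"
  by (rule localizingI) (auto simp: is_zero_Ob Susp_Ob tri_Ob coprod_Ob dest: tri_Ob)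

context
  fixes L assumes L: "localizing U T L"
begin

lemma loc_Ob: "X \<in> L \<Longrightarrow> X \<in> Ob T"
  using L unfolding localizing_def by (elim conjE) (erule subsetD)

lemma loc_zero: "is_zero T X \<Longrightarrow> X \<in> L"
  using L unfolding localizing_def by (elim conjE allE) (erule mp)

lemma loc_iso: "\<lbrakk>X \<in> L; Y \<in> Ob T; isos T X Y \<noteq> {}\<rbrakk> \<Longrightarrow> Y \<in> L"
  using L unfolding localizing_def by (elim conjE) simp

lemma loc_Susp: "X \<in> Ob T \<Longrightarrow> Susp T X \<in> L \<longleftrightarrow> X \<in> L"
  using L unfolding localizing_def by blast

lemma loc_tri:
  assumes t: "tri f g h X Y Z"
  shows "\<lbrakk>X \<in> L; Y \<in> L\<rbrakk> \<Longrightarrow> Z \<in> L" "\<lbrakk>Y \<in> L; Z \<in> L\<rbrakk> \<Longrightarrow> X \<in> L" "\<lbrakk>X \<in> L; Z \<in> L\<rbrakk> \<Longrightarrow> Y \<in> L"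
proof -
  have O: "X \<in> Ob T" "Y \<in> Ob T" "Z \<in> Ob T" "Tri T X Y Z \<noteq> {}" using t by (auto simp: tri_def)
  have "(X \<in> L \<and> Y \<in> L \<longrightarrow> Z \<in> L) \<and> (Y \<in> L \<and> Z \<in> L \<longrightarrow> X \<in> L) \<and> (X \<in> L \<and> Z \<in> L \<longrightarrow> Y \<in> L)"
    using L O unfolding localizing_def by blast
  then show "\<lbrakk>X \<in> L; Y \<in> L\<rbrakk> \<Longrightarrow> Z \<in> L" "\<lbrakk>Y \<in> L; Z \<in> L\<rbrakk> \<Longrightarrow> X \<in> L" "\<lbrakk>X \<in> L; Z \<in> L\<rbrakk> \<Longrightarrow> Y \<in> L"
    by blast+
qed

lemma loc_coprod:
  assumes "small U I" "is_coproduct T I X S \<iota>" "\<And>i. i \<in> I \<Longrightarrow> X i \<in> L"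
  shows "S \<in> L"
proof -
  obtain e where e: "inj_on e I" "e ` I \<subseteq> U" "small U (e ` I)"
    "is_coproduct T (e ` I) (X \<circ> inv_into I e) S (\<iota> \<circ> inv_into I e)"
    using coprod_embed[OF assms(1,2)] .
  have "X \<circ> inv_into I e \<in> e ` I \<rightarrow> L" using assms(3) e(1) by auto
  then show ?thesis using L e unfolding localizing_def by blast
qed

lemma loc_susp: "X \<in> Ob T \<Longrightarrow> susp T n X \<in> L \<longleftrightarrow> X \<in> L"
proof (induction n rule: int_induct[where k = 0])
  case base then show ?case by (simp add: susp_0)
next
  case (step1 n)
  then show ?case using loc_Susp[OF susp_Ob, of X n] susp_Suc[of X n] by simp
next
  case (step2 n)
  then show ?case using loc_Susp[OF susp_Ob, of X "n - 1"] susp_pred[of X n] by simp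
qed

end

section \<open>Generated localizing subcategories\<close>

lemma Loc_incl: "C \<subseteq> Loc U T C"
  by (auto simp: Loc_def)

lemma Loc_least: "\<lbrakk>localizing U T L; C \<subseteq> L\<rbrakk> \<Longrightarrow> Loc U T C \<subseteq> L"
  by (auto simp: Loc_def)

lemma Loc_localizing: "C \<subseteq> Ob T \<Longrightarrow> localizing U T (Loc U T C)"
proof (rule localizingI)
  assume C: "C \<subseteq> Ob T"
  show "Loc U T C \<subseteq> Ob T" unfolding Loc_def using localizing_Ob C by blast
  show "Z \<in> Loc U T C" if "is_zero T Z" for Z using that loc_zero by (auto simp: Loc_def)
  show "X \<in> Loc U T C \<longleftrightarrow> Susp T X \<in> Loc U T C" if "X \<in> Ob T" for X
    using that loc_Susp by (auto simp: Loc_def)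
  show "Z \<in> Loc U T C" if "tri f g h X Y Z" "X \<in> Loc U T C" "Y \<in> Loc U T C" for f g h X Y Z
    using that loc_tri(1) by (auto simp: Loc_def)
  show "S \<in> Loc U T C" if "I \<subseteq> U" "small U I" "is_coproduct T I X S \<iota>" and *: "\<And>i. i \<in> I \<Longrightarrow> X i \<in> Loc U T C"
    for I X S \<iota>
  proof -
    have "S \<in> L" if L: "localizing U T L" "C \<subseteq> L" for L
      using loc_coprod[OF L(1) \<open>small U I\<close> \<open>is_coproduct T I X S \<iota>\<close>] Loc_least[OF L] * by blast
    then show ?thesis by (auto simp: Loc_def)
  qed
qed

lemma Loc_subset: "\<lbrakk>D \<subseteq> Ob T; C \<subseteq> Loc U T D\<rbrakk> \<Longrightarrow> Loc U T C \<subseteq> Loc U T D"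
  using Loc_least Loc_localizing by blast

section \<open>Compact objects\<close>

lemma compact_Ob: "compact_object U T C \<Longrightarrow> C \<in> Ob T"
  by (simp add: compact_object_def)

text \<open>Surjectivity of the canonical map makes \<open>x\<close> a finite sum of maps through
  the inclusions. This induction principle is the form in which compactness is used from here
  on.\<close>

lemma compact_induct0:
  assumes C: "compact_object U T C" and I: "I \<subseteq> U" "small U I" and S: "is_coproduct T I X S \<iota>"
    and x: "ar x C S"
    and P0: "P (zr C S)" and Pp: "\<And>x y. \<lbrakk>ar x C S; ar y C S; P x; P y\<rbrakk> \<Longrightarrow> P (x \<otimes>\<^bsub>Hom T C S\<^esub> y)"
    and Pi: "\<And>i f. \<lbrakk>i \<in> I; ar f C (X i)\<rbrakk> \<Longrightarrow> P (\<iota> i \<cdot> f)"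
  shows "P x"
proof -
  have CO: "C \<in> Ob T" and SO: "S \<in> Ob T" using compact_Ob[OF C] coprod_Ob[OF S] by auto
  interpret G: comm_group "Hom T C S" using Hom_group CO SO by blast
  have XO: "X \<in> I \<rightarrow> Ob T" using coprod_Ob'[OF S] by blast
  have iso: "(\<lambda>f. gfinprod (Hom T C S) (\<lambda>i. \<iota> i \<cdot> f i) I) \<in> iso (sum_group I (\<lambda>i. Hom T C (X i))) (Hom T C S)"
    using C I XO S unfolding compact_object_def by blast
  have "x \<in> carrier (Hom T C S)" using x ar_carrier by blast
  then obtain f where f: "f \<in> carrier (sum_group I (\<lambda>i. Hom T C (X i)))"
     "x = gfinprod (Hom T C S) (\<lambda>i. \<iota> i \<cdot> f i) I"
    using iso by (auto simp: iso_def bij_betw_def)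
  have gr: "group (Hom T C (X i))" if "i \<in> I" for i using ar_group CO XO that by blast
  have car: "carrier (sum_group I (\<lambda>i. Hom T C (X i)))
      = {x \<in> \<Pi>\<^sub>E i\<in>I. carrier (Hom T C (X i)). finite {i \<in> I. x i \<noteq> zr C (X i)}}"
    by (rule carrier_sum_group) (rule gr)
  have fi: "ar (f i) C (X i)" if "i \<in> I" for i
    using f(1) that CO XO unfolding car ar_def by auto
  define F where "F = {i \<in> I. \<iota> i \<cdot> f i \<noteq> zr C S}"
  have car: "ar (\<iota> i \<cdot> f i) C S" if "i \<in> I" for i using ar_cmp[OF coprod_ar[OF S that] fi[OF that]] .
  have sub: "P (finprod (Hom T C S) (\<lambda>i. \<iota> i \<cdot> f i) E) \<and> ar (finprod (Hom T C S) (\<lambda>i. \<iota> i \<cdot> f i) E) C S"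
    if "finite E" "E \<subseteq> I" for E
    using that
  proof (induction E)
    case empty
    then show ?case using P0 ar_zr[OF CO SO] by simp
  next
    case (insert i E)
    have "finprod (Hom T C S) (\<lambda>i. \<iota> i \<cdot> f i) (insert i E)
        = (\<iota> i \<cdot> f i) \<otimes>\<^bsub>Hom T C S\<^esub> finprod (Hom T C S) (\<lambda>i. \<iota> i \<cdot> f i) E"
      by (rule G.finprod_insert) (use insert car ar_carrier in auto)
    then show ?case using insert Pp[OF car] Pi[OF _ fi] ar_pl[OF car] by auto
  qed
  show ?thesis
  proof (cases "finite F")
    case True
    then have "x = finprod (Hom T C S) (\<lambda>i. \<iota> i \<cdot> f i) F" using f(2) by (simp add: gfinprod_def F_def)
    then show ?thesis using sub[OF True] by (auto simp: F_def)
  next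
    \<comment> \<open>\<open>gfinprod\<close> returns the neutral element when the support is
      infinite.\<close>
    case False
    then have "x = zr C S" using f(2) by (simp add: gfinprod_def F_def)
    then show ?thesis using P0 by simp
  qed
qed

lemma compact_induct:
  assumes C: "compact_object U T C" and I: "small U I" and S: "is_coproduct T I X S \<iota>"
    and x: "ar x C S"
    and P0: "P (zr C S)" and Pp: "\<And>x y. \<lbrakk>ar x C S; ar y C S; P x; P y\<rbrakk> \<Longrightarrow> P (x \<otimes>\<^bsub>Hom T C S\<^esub> y)"
    and Pi: "\<And>i f. \<lbrakk>i \<in> I; ar f C (X i)\<rbrakk> \<Longrightarrow> P (\<iota> i \<cdot> f)"
  shows "P x"
proof -
  obtain e where e: "inj_on e I" "e ` I \<subseteq> U" "small U (e ` I)"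
    "is_coproduct T (e ` I) (X \<circ> inv_into I e) S (\<iota> \<circ> inv_into I e)"
    using coprod_embed[OF I S] .
  show ?thesis
    by (rule compact_induct0[OF C e(2-4) x, where P = P]) (use P0 Pp Pi e(1) in auto)
qed

text \<open>Injectivity of the canonical map is automatic, by the projections of a coproduct in an
  additive category. Surjectivity is the induction principle applied to membership in the image,
  which is a subgroup containing all maps through an inclusion.\<close>

lemma compactI:
  assumes CO: "C \<in> Ob T"
    and ind: "\<And>I X S \<iota> x P. \<lbrakk>I \<subseteq> U; small U I; is_coproduct T I X S \<iota>; ar x C S; P (zr C S);
      \<And>x y. \<lbrakk>ar x C S; ar y C S; P x; P y\<rbrakk> \<Longrightarrow> P (x \<otimes>\<^bsub>Hom T C S\<^esub> y);
      \<And>i f. \<lbrakk>i \<in> I; ar f C (X i)\<rbrakk> \<Longrightarrow> P (\<iota> i \<cdot> f)\<rbrakk> \<Longrightarrow> P x"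
  shows "compact_object U T C"
  unfolding compact_object_def
proof (intro conjI allI ballI impI)
  fix I X S \<iota>
  assume I: "I \<subseteq> U" "small U I" and XO: "X \<in> I \<rightarrow> Ob T" and S: "is_coproduct T I X S \<iota>"
  have SO: "S \<in> Ob T" using coprod_Ob[OF S] by auto
  interpret G: comm_group "Hom T C S" using Hom_group CO SO by blast
  have \<iota>: "ar (\<iota> i) (X i) S" if "i \<in> I" for i using coprod_ar[OF S that] .
  let ?H = "\<lambda>i. Hom T C (X i)"
  define M where "M f = gfinprod (Hom T C S) (\<lambda>i. \<iota> i \<cdot> f i) I" for f
  have gr: "group (?H i)" if "i \<in> I" for i using ar_group CO XO that by blast
  have car: "carrier (sum_group I ?H) = {x \<in> \<Pi>\<^sub>E i\<in>I. carrier (?H i). finite {i \<in> I. x i \<noteq> \<one>\<^bsub>?H i\<^esub>}}"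
    by (rule carrier_sum_group) (rule gr)
  have "\<And>i. i \<in> I \<Longrightarrow> (\<lambda>f. \<iota> i \<cdot> f) \<in> hom (?H i) (Hom T C S)"
    using group_hom.homh[OF right_hom[OF \<iota> CO]] by blast
  then have hom: "M \<in> hom (sum_group I ?H) (Hom T C S)"
    using G.hom_group_sum[of I "\<lambda>i f. \<iota> i \<cdot> f" ?H] gr unfolding M_def[abs_def] by blast
  interpret K: group "sum_group I ?H" by (rule sum_group) (rule gr)
  interpret hm: group_hom "sum_group I ?H" "Hom T C S" M
    using hom by unfold_locales
  have inj: "f = \<one>\<^bsub>sum_group I ?H\<^esub>" if f: "f \<in> carrier (sum_group I ?H)" and z: "M f = zr C S" for f
  proof -
    have fi: "ar (f i) C (X i)" if "i \<in> I" for i using f that CO XO unfolding car ar_def by auto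
    have fS: "ar (\<iota> i \<cdot> f i) C S" if "i \<in> I" for i using ar_cmp[OF \<iota>[OF that] fi[OF that]] .
    define F where "F = {i \<in> I. \<iota> i \<cdot> f i \<noteq> zr C S}"
    have "F \<subseteq> {i \<in> I. f i \<noteq> \<one>\<^bsub>?H i\<^esub>}" using cmp_zr[OF \<iota> CO] by (auto simp: F_def)
    then have "finite F" using f unfolding car by (auto intro: finite_subset)
    then have m: "M f = finprod (Hom T C S) (\<lambda>i. \<iota> i \<cdot> f i) F" by (simp add: M_def gfinprod_def F_def)
    have "f i = zr C (X i)" if i: "i \<in> I" for i
    proof -
      obtain p where p: "ar p S (X i)" "p \<cdot> \<iota> i = Idt T (X i)" "\<And>j. \<lbrakk>j \<in> I; j \<noteq> i\<rbrakk> \<Longrightarrow> p \<cdot> \<iota> j = zr (X j) (X i)"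
        using coprod_proj[OF S i] by blast
      have pi: "p \<cdot> (\<iota> i \<cdot> f i) = f i" using cmp_assoc[OF p(1) \<iota>[OF i] fi[OF i]] p(2) id_cmp[OF fi[OF i]] by simp
      have pj: "p \<cdot> (\<iota> j \<cdot> f j) = zr C (X i)" if "j \<in> I" "j \<noteq> i" for j
        using cmp_assoc[OF p(1) \<iota>[OF that(1)] fi[OF that(1)]] p(3)[OF that] zr_cmp[OF fi[OF that(1)], of "X i"] XO i
        by (simp add: Pi_iff)
      interpret Hi: group "?H i" using gr[OF i] .
      have "ar (finprod (Hom T C S) (\<lambda>i. \<iota> i \<cdot> f i) E) C S \<and>
         p \<cdot> finprod (Hom T C S) (\<lambda>i. \<iota> i \<cdot> f i) E = (if i \<in> E then f i else zr C (X i))"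
        if "finite E" "E \<subseteq> I" for E using that
      proof (induction E)
        case empty
        then show ?case using cmp_zr[OF p(1) CO] ar_zr[OF CO SO] by simp
      next
        case (insert j E)
        have e: "finprod (Hom T C S) (\<lambda>i. \<iota> i \<cdot> f i) (insert j E)
            = (\<iota> j \<cdot> f j) \<otimes>\<^bsub>Hom T C S\<^esub> finprod (Hom T C S) (\<lambda>i. \<iota> i \<cdot> f i) E"
          by (rule G.finprod_insert) (use insert fS ar_carrier in auto)
        have IH: "ar (finprod (Hom T C S) (\<lambda>i. \<iota> i \<cdot> f i) E) C S"
          "p \<cdot> finprod (Hom T C S) (\<lambda>i. \<iota> i \<cdot> f i) E = (if i \<in> E then f i else zr C (X i))"
          using insert by auto
        have "p \<cdot> finprod (Hom T C S) (\<lambda>i. \<iota> i \<cdot> f i) (insert j E) =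
           (p \<cdot> (\<iota> j \<cdot> f j)) \<otimes>\<^bsub>?H i\<^esub> (if i \<in> E then f i else zr C (X i))"
          unfolding e using cmp_pl[OF p(1) fS[of j] IH(1)] IH(2) insert by simp
        moreover have "ar (finprod (Hom T C S) (\<lambda>i. \<iota> i \<cdot> f i) (insert j E)) C S"
          unfolding e using ar_pl[OF fS[of j] IH(1)] insert by simp
        ultimately show ?case
          using pi pj[of j] insert ar_carrier[OF fi[OF i]] by (cases "j = i") auto
      qed
      from this[OF \<open>finite F\<close>] have "p \<cdot> M f = (if i \<in> F then f i else zr C (X i))"
        unfolding m by (simp add: F_def)
      then have "i \<in> F \<Longrightarrow> ?thesis" using z cmp_zr[OF p(1) CO] by simp
      moreover have "?thesis" if "i \<notin> F"
        using that i pi cmp_zr[OF p(1) CO] by (simp add: F_def)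
      ultimately show ?thesis by blast
    qed
    then show ?thesis using f unfolding one_sum_group car by (intro extensionalityI[of f I]) (auto simp: PiE_def)
  qed
  have inj: "inj_on M (carrier (sum_group I ?H))"
    unfolding hm.inj_iff_trivial_ker kernel_def using inj hm.hom_one K.one_closed by blast
  have surj: "x \<in> M ` carrier (sum_group I ?H)" if "ar x C S" for x
  proof (rule ind[OF I S that])
    show "zr C S \<in> M ` carrier (sum_group I ?H)" using imageI[OF K.one_closed, of M] hm.hom_one by simp
    show "x \<otimes>\<^bsub>Hom T C S\<^esub> y \<in> M ` carrier (sum_group I ?H)"
      if xy: "x \<in> M ` carrier (sum_group I ?H)" "y \<in> M ` carrier (sum_group I ?H)" for x y
    proof -
      obtain a b where "a \<in> carrier (sum_group I ?H)" "b \<in> carrier (sum_group I ?H)" "x = M a" "y = M b"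
        using xy by blast
      then show ?thesis using imageI[OF K.m_closed, of a b M] hm.hom_mult[of a b] by simp
    qed
    fix i f assume i: "i \<in> I" and f: "ar f C (X i)"
    \<comment> \<open>The family concentrated at \<open>i\<close>, a preimage of
      \<open>\<iota> i \<cdot> f\<close>.\<close>
    define k where "k = (\<lambda>j\<in>I. if j = i then f else \<one>\<^bsub>?H j\<^esub>)"
    have k: "k \<in> carrier (sum_group I ?H)"
      unfolding car using f ar_carrier group.is_monoid[OF gr] monoid.one_closed
      by (auto simp: k_def intro: finite_subset[of _ "{i}"])
    have "M k = \<iota> i \<cdot> f"
    proof (cases "\<iota> i \<cdot> f = zr C S")
      case True
      then have "{j \<in> I. \<iota> j \<cdot> k j \<noteq> zr C S} = {}" using cmp_zr[OF \<iota> CO] by (auto simp: k_def)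
      then show ?thesis unfolding M_def gfinprod_def using True by (simp only: G.finprod_empty if_cancel)
    next
      case False
      then have "{j \<in> I. \<iota> j \<cdot> k j \<noteq> zr C S} = {i}" using cmp_zr[OF \<iota> CO] i by (auto simp: k_def)
      then have "M k = finprod (Hom T C S) (\<lambda>j. \<iota> j \<cdot> k j) {i}"
        unfolding M_def gfinprod_def by (simp only: finite.intros if_True)
      also have "\<dots> = \<iota> i \<cdot> f"
        using G.finprod_insert[of "{}" i "\<lambda>j. \<iota> j \<cdot> k j"] i ar_carrier[OF ar_cmp[OF \<iota>[OF i] f]]
        by (simp add: k_def)
      finally show ?thesis .
    qed
    then show "\<iota> i \<cdot> f \<in> M ` carrier (sum_group I ?H)" using imageI[OF k, of M] by simp
  qed
  have "M \<in> iso (sum_group I ?H) (Hom T C S)"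
    unfolding iso_def bij_betw_def using hom inj surj arI[OF CO SO] hm.hom_closed by blast
  then show "(\<lambda>f. gfinprod (Hom T C S) (\<lambda>i. \<iota> i \<cdot> f i) I) \<in> iso (sum_group I ?H) (Hom T C S)"
    unfolding M_def[abs_def] .
qed (fact CO)

text \<open>The induction principle is transported along the suspension by reading the predicate
  through \<open>suspM T n\<close>; the isomorphism with the sum group never has to be
  transported.\<close>

lemma compact_susp:
  assumes C: "compact_object U T C"
  shows "compact_object U T (susp T n C)"
proof (rule compactI)
  have CO: "C \<in> Ob T" using compact_Ob[OF C] .
  show "susp T n C \<in> Ob T" using susp_Ob[OF CO] .
  fix I X S \<iota> x and P :: "'m \<Rightarrow> bool"
  assume I: "I \<subseteq> U" "small U I" and S: "is_coproduct T I X S \<iota>" and x: "ar x (susp T n C) S"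
   and P0: "P (zr (susp T n C) S)"
   and Pp: "\<And>x y. \<lbrakk>ar x (susp T n C) S; ar y (susp T n C) S; P x; P y\<rbrakk> \<Longrightarrow> P (x \<otimes>\<^bsub>Hom T (susp T n C) S\<^esub> y)"
   and Pi: "\<And>i f. \<lbrakk>i \<in> I; ar f (susp T n C) (X i)\<rbrakk> \<Longrightarrow> P (\<iota> i \<cdot> f)"
  have SO: "S \<in> Ob T" using coprod_Ob[OF S] .
  define S' where "S' = susp T (- n) S"
  have S': "S' \<in> Ob T" "susp T n S' = S" using SO susp_Ob susp_neg by (auto simp: S'_def)
  obtain x' where x': "ar x' C S'" "suspM T n x' = x" using suspM_full[of x n C S'] x S' CO by auto
  have "P (suspM T n x')"
  proof (rule compact_induct[OF C I(2) coprod_susp[OF S, of "- n", folded S'_def] x'(1), where P = "\<lambda>z. P (suspM T n z)"])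
    show "P (suspM T n (zr C S'))" using suspM_zr[OF CO S'(1)] P0 S' by simp
    show "P (suspM T n (x \<otimes>\<^bsub>Hom T C S'\<^esub> y))"
      if "ar x C S'" "ar y C S'" "P (suspM T n x)" "P (suspM T n y)" for x y
      using Pp[of "suspM T n x" "suspM T n y"] suspM_ar[OF that(1), of n] suspM_ar[OF that(2), of n] that
        suspM_pl[OF that(1,2), of n] S'(2) by simp
    fix i f assume i: "i \<in> I" and f: "ar f C (susp T (- n) (X i))"
    have \<iota>: "ar (\<iota> i) (X i) S" and X: "X i \<in> Ob T" using coprod_ar[OF S i] coprod_Ob'[OF S i] by auto
    have "ar (suspM T n f) (susp T n C) (X i)" using suspM_ar[OF f, of n] susp_neg(2)[OF X] by simp
    then have "P (\<iota> i \<cdot> suspM T n f)" using Pi i by blast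
    moreover have "suspM T n (suspM T (- n) (\<iota> i) \<cdot> f) = \<iota> i \<cdot> suspM T n f"
      using suspM_cmp[OF suspM_ar[OF \<iota>, of "- n"] f, of n] suspM_neg(2)[OF ar_Arr[OF \<iota>]] by simp
    ultimately show "P (suspM T n (suspM T (- n) (\<iota> i) \<cdot> f))" by simp
  qed
  then show "P x" using x' by simp
qed

end

section \<open>Homotopy colimits\<close>

context cg_category
begin

text \<open>For localizing \<open>M\<close> these are the maps that become invertible in the
  quotient by \<open>M\<close>.\<close>

definition cone_in where "cone_in M f X Y \<longleftrightarrow> (\<exists>a b K. tri f a b X Y K \<and> K \<in> M)"

lemma cone_in_ar: "cone_in M f X Y \<Longrightarrow> ar f X Y"
  unfolding cone_in_def using tri_ar(1) by blast

text \<open>The \<open>3 x 3\<close> lemma for two identity maps: the comparison map of the cones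
  has itself a cone lying between two zero objects.\<close>

lemma cone_unique:
  assumes "tri f a b X Y K" "tri f a' b' X Y K'"
  shows "isos T K K' \<noteq> {}"
proof -
  obtain Z where Z: "is_zero T Z" using has_zero by blast
  have f: "ar f X Y" and O: "X \<in> Ob T" "Y \<in> Ob T" using tri_ar(1) tri_Ob assms(1) by blast+
  have "Idt T Y \<cdot> f = f \<cdot> Idt T X" using f id_cmp cmp_id by metis
  from tri_3x3[OF assms tri_Idt[OF O(1) Z] tri_Idt[OF O(2) Z] this]
  obtain c c1 c2 C p q r where c: "tri c c1 c2 K K' C" "tri p q r Z C (Susp T Z)" by metis
  have "is_zero T C"
    using loc_tri(3)[of "{Z. is_zero T Z}"] is_zero_iso tri_iso_if_zero[OF c(2)] is_zero_Susp[OF Z] Z tri_Ob[OF c(2)]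
    by (metis empty_iff)
  then show ?thesis using tri_iso_if_zero[OF c(1)] by blast
qed

lemma cone_in_tri: "\<lbrakk>localizing U T M; cone_in M f X Y; tri f a b X Y K\<rbrakk> \<Longrightarrow> K \<in> M"
  unfolding cone_in_def using cone_unique loc_iso tri_Ob(3) by metis

lemma cone_in_iso:
  assumes M: "localizing U T M" and f: "f \<in> isos T X Y" and O: "X \<in> Ob T" "Y \<in> Ob T"
  shows "cone_in M f X Y"
proof -
  have fa: "ar f X Y" using isosE[OF f O] by blast
  obtain a b K where t: "tri f a b X Y K" using tri_cone[OF fa] .
  then show ?thesis unfolding cone_in_def using loc_zero[OF M tri_zero_if_iso[OF t f]] by blast
qed

text \<open>The octahedron puts the cone of the composite between the other two cones.\<close>

lemma cone_in_cmp:
  assumes M: "localizing U T M" and f: "cone_in M f X Y" and g: "cone_in M g Y Z"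
  shows "cone_in M (g \<cdot> f) X Z"
proof -
  obtain a b K where t: "tri f a b X Y K" "K \<in> M" using f cone_in_def by blast
  obtain a' b' K' where t': "tri g a' b' Y Z K'" "K' \<in> M" using g cone_in_def by blast
  obtain h1 h2 N where n: "tri (g \<cdot> f) h1 h2 X Z N"
    using tri_cone[OF ar_cmp[OF cone_in_ar[OF g] cone_in_ar[OF f]]] .
  obtain u v w where "tri u v w K N K'" using octahedron[OF t(1) t'(1) n] by metis
  then have "N \<in> M" using loc_tri(3)[OF M] t t' by blast
  then show ?thesis using n cone_in_def by blast
qed

lemma cone_in_coprod:
  assumes M: "localizing U T M" and I: "small U I" and f: "\<And>i. i \<in> I \<Longrightarrow> cone_in M (f i) (X i) (Y i)"
    and X: "is_coproduct T I X SX \<iota>" and Y: "is_coproduct T I Y SY \<kappa>"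
  obtains f' where "cone_in M f' SX SY" "\<And>i. i \<in> I \<Longrightarrow> f' \<cdot> \<iota> i = \<kappa> i \<cdot> f i"
proof -
  obtain a b K where t: "\<And>i. i \<in> I \<Longrightarrow> tri (f i) (a i) (b i) (X i) (Y i) (K i)" "\<And>i. i \<in> I \<Longrightarrow> K i \<in> M"
    using f unfolding cone_in_def by metis
  obtain f' g' h' Z \<mu> where *: "tri f' g' h' SX SY Z" "is_coproduct T I K Z \<mu>"
    "\<And>i. i \<in> I \<Longrightarrow> f' \<cdot> \<iota> i = \<kappa> i \<cdot> f i"
    using coprod_tri[of I f a b X Y K, OF t(1) X Y] by metis
  have "Z \<in> M" using loc_coprod[OF M I *(2) t(2)] .
  then show ?thesis using that * cone_in_def by blast
qed

section \<open>Telescopes: cones of the identity minus the shift\<close>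

primrec seq_map :: "(nat \<Rightarrow> 'o) \<Rightarrow> (nat \<Rightarrow> 'm) \<Rightarrow> nat \<Rightarrow> nat \<Rightarrow> 'm" where
  "seq_map X j n 0 = Idt T (X n)"
| "seq_map X j n (Suc k) = j (n + k) \<cdot> seq_map X j n k"

context
  fixes X :: "nat \<Rightarrow> 'o" and j :: "nat \<Rightarrow> 'm"
  assumes j: "\<And>n. ar (j n) (X n) (X (Suc n))"
begin

abbreviation jj where "jj \<equiv> seq_map X j"

lemma seq_Ob: "X n \<in> Ob T" using ar_Ob(1)[OF j] .

lemma jj_ar: "ar (jj n k) (X n) (X (n + k))"
proof (induction k)
  case 0
  then show ?case using ar_Idt[OF seq_Ob] by simp
next
  case (Suc k)
  then show ?case using ar_cmp[OF j[of "n + k"] Suc] by simp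
qed

lemma jj_shift: "jj n (Suc k) = jj (Suc n) k \<cdot> j n"
proof (induction k)
  case 0
  then show ?case using cmp_id[OF j] id_cmp[OF j] by simp
next
  case (Suc k)
  have "jj n (Suc (Suc k)) = j (n + Suc k) \<cdot> (jj (Suc n) k \<cdot> j n)" using Suc by simp
  also have "\<dots> = (j (n + Suc k) \<cdot> jj (Suc n) k) \<cdot> j n"
    using cmp_assoc[OF _ jj_ar[of "Suc n" k] j[of n]] j[of "Suc n + k"] by simp
  finally show ?case by simp
qed

context
  fixes P \<iota> \<sigma> d
  assumes P: "is_coproduct T UNIV X P \<iota>"
    and \<sigma>: "ar \<sigma> P P" "\<And>n. \<sigma> \<cdot> \<iota> n = \<iota> (Suc n) \<cdot> j n"
    and d: "d = mi P P (Idt T P) \<sigma>"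
begin

lemma tel_\<iota>: "ar (\<iota> n) (X n) P" using coprod_ar[OF P] by simp

lemma tel_P: "P \<in> Ob T" using coprod_Ob[OF P] .

lemma tel_d: "ar d P P"
  unfolding d using ar_mi[OF ar_Idt[OF tel_P] \<sigma>(1)] .

lemma tel_d\<iota>: "d \<cdot> \<iota> n = mi (X n) P (\<iota> n) (\<iota> (Suc n) \<cdot> j n)"
  unfolding d using mi_cmp[OF tel_\<iota> ar_Idt[OF tel_P] \<sigma>(1)] id_cmp[OF tel_\<iota>] \<sigma>(2) by simp

text \<open>Take the transition maps to \<open>X m\<close> up to stage \<open>m\<close> and zero
  beyond. In \<open>q \<cdot> d\<close> everything cancels except at stage \<open>m\<close>, so the
  projection to \<open>X m\<close> factors through \<open>d\<close>.\<close>

lemma tel_proj: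
  obtains q where "ar q P (X m)" "\<And>k. k \<le> m \<Longrightarrow> q \<cdot> \<iota> k = jj k (m - k)"
    "ar (q \<cdot> d) P (X m)" "(q \<cdot> d) \<cdot> \<iota> m = Idt T (X m)" "\<And>k. k \<noteq> m \<Longrightarrow> (q \<cdot> d) \<cdot> \<iota> k = zr (X k) (X m)"
proof -
  define f where "f k = (if k \<le> m then jj k (m - k) else zr (X k) (X m))" for k
  have f: "ar (f k) (X k) (X m)" for k
    using jj_ar[of k "m - k"] ar_zr[OF seq_Ob seq_Ob] by (auto simp: f_def)
  obtain q where q: "ar q P (X m)" "\<And>k. q \<cdot> \<iota> k = f k"
    using coprod_desc[OF P seq_Ob[of m], of f] f by auto
  have qd: "ar (q \<cdot> d) P (X m)" using ar_cmp[OF q(1) tel_d] .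
  have e: "(q \<cdot> d) \<cdot> \<iota> k = mi (X k) (X m) (f k) (f (Suc k) \<cdot> j k)" for k
    using cmp_assoc[OF q(1) tel_d tel_\<iota>[of k]] tel_d\<iota>[of k] q(2)
      cmp_mi[OF q(1) tel_\<iota>[of k] ar_cmp[OF tel_\<iota>[of "Suc k"] j[of k]]]
      cmp_assoc[OF q(1) tel_\<iota>[of "Suc k"] j[of k]] by simp
  have fs: "f k = f (Suc k) \<cdot> j k" if "k < m" for k
  proof -
    have "m - k = Suc (m - Suc k)" using that by simp
    then show ?thesis using that jj_shift[of k "m - Suc k"] by (simp add: f_def)
  qed
  have "(q \<cdot> d) \<cdot> \<iota> k = zr (X k) (X m)" if "k \<noteq> m" for k
  proof (cases "k < m")
    case True
    then show ?thesis using e[of k] fs mi_self[OF f[of k]] by simp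
  next
    case False
    then have "f k = zr (X k) (X m)" "f (Suc k) \<cdot> j k = zr (X k) (X m)"
      using that zr_cmp[OF j seq_Ob] by (simp_all add: f_def)
    then show ?thesis using e[of k] mi_self[OF ar_zr[OF seq_Ob seq_Ob]] by simp
  qed
  moreover have "(q \<cdot> d) \<cdot> \<iota> m = Idt T (X m)"
    using e[of m] zr_cmp[OF j seq_Ob, of m m] mi_zr[OF ar_Idt[OF seq_Ob[of m]]] by (simp add: f_def)
  ultimately show ?thesis using that[OF q(1) _ qd] q(2) by (simp add: f_def)
qed

text \<open>A map from a compact object meets only finitely many summands. Stated through maps
  \<open>q\<close> that vanish on an initial segment, this property is closed under addition and
  fits the induction principle.\<close>

lemma tel_trunc:
  assumes C: "compact_object U T C" and y: "ar y C P"
  obtains m where "\<And>k q. \<lbrakk>m \<le> k; ar q P Y; \<And>i. i < k \<Longrightarrow> q \<cdot> \<iota> i = zr (X i) Y\<rbrakk> \<Longrightarrow> q \<cdot> y = zr C Y"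
proof -
  have CO: "C \<in> Ob T" using compact_Ob[OF C] .
  let ?Q = "\<lambda>y. \<exists>m. \<forall>k q. m \<le> k \<longrightarrow> ar q P Y \<longrightarrow> (\<forall>i<k. q \<cdot> \<iota> i = zr (X i) Y) \<longrightarrow> q \<cdot> y = zr C Y"
  have "?Q y"
  proof (rule compact_induct[OF C small_nat[OF univ] P y, where P = ?Q])
    show "?Q (zr C P)" using cmp_zr[OF _ CO] by blast
    fix x y assume xy: "ar x C P" "ar y C P" "?Q x" "?Q y"
    then obtain m n where
      m: "\<And>k q. \<lbrakk>m \<le> k; ar q P Y; \<forall>i<k. q \<cdot> \<iota> i = zr (X i) Y\<rbrakk> \<Longrightarrow> q \<cdot> x = zr C Y" and
      n: "\<And>k q. \<lbrakk>n \<le> k; ar q P Y; \<forall>i<k. q \<cdot> \<iota> i = zr (X i) Y\<rbrakk> \<Longrightarrow> q \<cdot> y = zr C Y"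
      by metis
    have "q \<cdot> (x \<otimes>\<^bsub>Hom T C P\<^esub> y) = zr C Y"
      if k: "max m n \<le> k" and q: "ar q P Y" "\<forall>i<k. q \<cdot> \<iota> i = zr (X i) Y" for k q
    proof -
      have "q \<cdot> x = zr C Y" "q \<cdot> y = zr C Y" using m[of k q] n[of k q] k q by auto
      then have "q \<cdot> (x \<otimes>\<^bsub>Hom T C P\<^esub> y) = zr C Y \<otimes>\<^bsub>Hom T C Y\<^esub> zr C Y"
        using cmp_pl[OF q(1) xy(1,2)] by simp
      then show ?thesis
        using group.is_monoid[OF ar_group[OF CO ar_Ob(2)[OF q(1)]]] by (simp add: monoid.l_one monoid.one_closed)
    qed
    then show "?Q (x \<otimes>\<^bsub>Hom T C P\<^esub> y)" by blast
  next
    fix i f assume f: "ar f C (X i)"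
    have "q \<cdot> (\<iota> i \<cdot> f) = zr C Y"
      if k: "Suc i \<le> k" and q: "ar q P Y" "\<forall>i<k. q \<cdot> \<iota> i = zr (X i) Y" for k q
      using cmp_assoc[OF q(1) tel_\<iota> f] q(2) k zr_cmp[OF f ar_Ob(2)[OF q(1)]] by simp
    then show "?Q (\<iota> i \<cdot> f)" by blast
  qed
  then show ?thesis using that by blast
qed

text \<open>Take \<open>N\<close> beyond \<open>n\<close> and beyond the summands met by
  \<open>y\<close>. The projection \<open>q \<cdot> d\<close> to \<open>X N\<close> kills
  \<open>y\<close>, while \<open>q\<close> sends \<open>d \<cdot> y = \<iota> n \<cdot> x\<close> to
  the image of \<open>x\<close> in \<open>X N\<close>.\<close>

lemma tel_inj:
  assumes C: "compact_object U T C" and x: "ar x C (X n)" and y: "ar y C P" and e: "\<iota> n \<cdot> x = d \<cdot> y"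
  shows "\<exists>k. jj n k \<cdot> x = zr C (X (n + k))"
proof -
  have CO: "C \<in> Ob T" using compact_Ob[OF C] .
  obtain m where m: "\<And>k q. \<lbrakk>m \<le> k; ar q P P; \<And>i. i < k \<Longrightarrow> q \<cdot> \<iota> i = zr (X i) P\<rbrakk> \<Longrightarrow> q \<cdot> y = zr C P"
    using tel_trunc[OF C y, of P] by metis
  define N where "N = max m n"
  obtain q where q: "ar q P (X N)" "\<And>k. k \<le> N \<Longrightarrow> q \<cdot> \<iota> k = jj k (N - k)"
    "ar (q \<cdot> d) P (X N)" "(q \<cdot> d) \<cdot> \<iota> N = Idt T (X N)" "\<And>k. k \<noteq> N \<Longrightarrow> (q \<cdot> d) \<cdot> \<iota> k = zr (X k) (X N)"
    using tel_proj[of N] by blast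
  \<comment> \<open>The bound \<open>m\<close> was fixed for maps into \<open>P\<close> before
    \<open>N\<close> was chosen, so the projection is followed by \<open>\<iota> N\<close>, which is
    cancelled afterwards.\<close>
  have i: "ar (\<iota> N \<cdot> (q \<cdot> d)) P P" using ar_cmp[OF tel_\<iota> q(3)] .
  have "(\<iota> N \<cdot> (q \<cdot> d)) \<cdot> \<iota> k = zr (X k) P" if "k < N" for k
    using cmp_assoc[OF tel_\<iota>[of N] q(3) tel_\<iota>[of k]] q(5)[of k] that cmp_zr[OF tel_\<iota>[of N] seq_Ob[of k]] by simp
  then have z: "(\<iota> N \<cdot> (q \<cdot> d)) \<cdot> y = zr C P" using m[of N] i by (simp add: N_def)
  have a: "ar ((q \<cdot> d) \<cdot> y) C (X N)" using ar_cmp[OF q(3) y] .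
  have "\<iota> N \<cdot> ((q \<cdot> d) \<cdot> y) = zr C P" using z cmp_assoc[OF tel_\<iota> q(3) y] by simp
  then have "(q \<cdot> d) \<cdot> (\<iota> N \<cdot> ((q \<cdot> d) \<cdot> y)) = zr C (X N)" using cmp_zr[OF q(3) CO] by simp
  then have "(q \<cdot> d) \<cdot> y = zr C (X N)"
    using cmp_assoc[OF q(3) tel_\<iota> a] q(4) id_cmp[OF a] by simp
  moreover have "(q \<cdot> d) \<cdot> y = jj n (N - n) \<cdot> x"
    using cmp_assoc[OF q(1) tel_d y] e cmp_assoc[OF q(1) tel_\<iota> x] q(2)[of n] by (simp add: N_def)
  moreover have "n + (N - n) = N" by (simp add: N_def)
  ultimately show ?thesis by metis
qed

text \<open>Every projection of \<open>y\<close> factors through \<open>d \<cdot> y\<close> by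
  \<open>tel_proj\<close>, hence vanishes; and by compactness \<open>y\<close> equals one of its
  truncations, which are built up one projection at a time.\<close>

lemma tel_mono:
  assumes C: "compact_object U T C" and y: "ar y C P" and e: "d \<cdot> y = zr C P"
  shows "y = zr C P"
proof -
  have CO: "C \<in> Ob T" using compact_Ob[OF C] .
  have proj: "p \<cdot> y = zr C (X m)"
    if p: "ar p P (X m)" "p \<cdot> \<iota> m = Idt T (X m)" "\<And>k. k \<noteq> m \<Longrightarrow> p \<cdot> \<iota> k = zr (X k) (X m)" for p m
  proof -
    obtain q where q: "ar q P (X m)" "ar (q \<cdot> d) P (X m)" "(q \<cdot> d) \<cdot> \<iota> m = Idt T (X m)"
        "\<And>k. k \<noteq> m \<Longrightarrow> (q \<cdot> d) \<cdot> \<iota> k = zr (X k) (X m)"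
      using tel_proj[of m] by metis
    have "p = q \<cdot> d" by (rule coprod_eq[OF P p(1) q(2)]) (metis p q)
    then show ?thesis using cmp_assoc[OF q(1) tel_d y] e cmp_zr[OF q(1) CO] by simp
  qed
  \<comment> \<open>\<open>t m\<close> will be the truncation to the first \<open>m\<close>
    summands; consecutive truncations differ by \<open>\<iota> m\<close> after the projection to
    \<open>X m\<close>.\<close>
  define tr where "tr m k = (if k < m then \<iota> k else zr (X k) P)" for m k :: nat
  have "\<exists>t. ar t P P \<and> (\<forall>k. t \<cdot> \<iota> k = tr m k)" for m
  proof -
    have "ar (tr m k) (X k) P" for k using tel_\<iota> ar_zr[OF seq_Ob tel_P] by (simp add: tr_def)
    then show ?thesis using coprod_desc[OF P tel_P, of "tr m"] by (metis UNIV_I)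
  qed
  then obtain t where t: "\<And>m. ar (t m) P P" "\<And>m k. t m \<cdot> \<iota> k = tr m k" by metis
  have ty: "t m \<cdot> y = zr C P" for m
  proof (induction m)
    case 0
    have "t 0 = zr P P"
      by (rule coprod_eq[OF P t(1) ar_zr[OF tel_P tel_P]]) (simp add: t tr_def zr_cmp[OF tel_\<iota> tel_P])
    then show ?case using zr_cmp[OF y tel_P] by simp
  next
    case (Suc m)
    obtain p where p: "ar p P (X m)" "p \<cdot> \<iota> m = Idt T (X m)" "\<And>k. k \<noteq> m \<Longrightarrow> p \<cdot> \<iota> k = zr (X k) (X m)"
      using coprod_proj[OF P, of m] by auto
    have ip: "ar (\<iota> m \<cdot> p) P P" using ar_cmp[OF tel_\<iota> p(1)] .
    have "mi P P (t (Suc m)) (t m) = \<iota> m \<cdot> p"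
    proof (rule coprod_eq[OF P ar_mi[OF t(1) t(1)] ip])
      fix k
      have l: "mi P P (t (Suc m)) (t m) \<cdot> \<iota> k = mi (X k) P (tr (Suc m) k) (tr m k)"
        using mi_cmp[OF tel_\<iota>[of k] t(1) t(1)] t(2) by simp
      have r: "(\<iota> m \<cdot> p) \<cdot> \<iota> k = \<iota> m \<cdot> (p \<cdot> \<iota> k)" using cmp_assoc[OF tel_\<iota> p(1) tel_\<iota>] .
      consider "k < m" | "k = m" | "k > m" by linarith
      then show "mi P P (t (Suc m)) (t m) \<cdot> \<iota> k = (\<iota> m \<cdot> p) \<cdot> \<iota> k"
      proof cases
        case 1
        then show ?thesis unfolding l r
          using p(3)[of k] cmp_zr[OF tel_\<iota>[of m] seq_Ob[of k]] mi_self[OF tel_\<iota>[of k]] by (simp add: tr_def)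
      next
        case 2
        then show ?thesis unfolding l r
          using p(2) cmp_id[OF tel_\<iota>[of m]] mi_zr[OF tel_\<iota>[of k]] by (simp add: tr_def)
      next
        case 3
        then show ?thesis unfolding l r
          using p(3)[of k] cmp_zr[OF tel_\<iota>[of m] seq_Ob[of k]] mi_self[OF ar_zr[OF seq_Ob[of k] tel_P]]
          by (simp add: tr_def)
      qed
    qed
    moreover have "(\<iota> m \<cdot> p) \<cdot> y = zr C P"
      using cmp_assoc[OF tel_\<iota> p(1) y] proj[OF p] cmp_zr[OF tel_\<iota> CO] by simp
    ultimately have "mi C P (t (Suc m) \<cdot> y) (t m \<cdot> y) = zr C P" using mi_cmp[OF y t(1) t(1)] by metis
    then show ?case using Suc mi_zr[OF ar_cmp[OF t(1) y]] by metis
  qed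
  obtain m where m: "\<And>k q. \<lbrakk>m \<le> k; ar q P P; \<And>i. i < k \<Longrightarrow> q \<cdot> \<iota> i = zr (X i) P\<rbrakk> \<Longrightarrow> q \<cdot> y = zr C P"
    using tel_trunc[OF C y, of P] by metis
  have "mi P P (Idt T P) (t m) \<cdot> y = zr C P"
  proof (rule m[OF order_refl ar_mi[OF ar_Idt[OF tel_P] t(1)]])
    show "mi P P (Idt T P) (t m) \<cdot> \<iota> i = zr (X i) P" if "i < m" for i
      using mi_cmp[OF tel_\<iota>[of i] ar_Idt[OF tel_P] t(1)] t(2) that id_cmp[OF tel_\<iota>] mi_self[OF tel_\<iota>]
      by (simp add: tr_def)
  qed
  then have "mi C P y (t m \<cdot> y) = zr C P" using mi_cmp[OF y ar_Idt[OF tel_P] t(1)] id_cmp[OF y] by simp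
  then show ?thesis using ty mi_zr[OF y] by simp
qed

context
  fixes g h H
  assumes H: "tri d g h P P H"
begin

lemma tel_g: "ar g P H" and tel_h: "ar h H (Susp T P)"
  using tri_ar[OF H] by blast+

lemma tel_in: "ar (g \<cdot> \<iota> n) (X n) H"
  using ar_cmp[OF tel_g tel_\<iota>] .

lemma tel_in_j: "(g \<cdot> \<iota> (Suc n)) \<cdot> j n = g \<cdot> \<iota> n"
proof -
  have a: "ar (\<iota> (Suc n) \<cdot> j n) (X n) P" using ar_cmp[OF tel_\<iota> j] .
  have "g \<cdot> (d \<cdot> \<iota> n) = zr (X n) H"
    using tri_comp[OF H] cmp_assoc[OF tel_g tel_d tel_\<iota>, of n] zr_cmp[OF tel_\<iota> tri_Ob(3)[OF H], of n] by simp
  then have "mi (X n) H (g \<cdot> \<iota> n) (g \<cdot> (\<iota> (Suc n) \<cdot> j n)) = zr (X n) H"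
    unfolding tel_d\<iota> using cmp_mi[OF tel_g tel_\<iota> a] by simp
  then have "g \<cdot> \<iota> n = g \<cdot> (\<iota> (Suc n) \<cdot> j n)"
    using mi_eq_zr_iff[OF tel_in ar_cmp[OF tel_g a]] by simp
  then show ?thesis using cmp_assoc[OF tel_g tel_\<iota> j] by simp
qed

lemma tel_in_jj: "(g \<cdot> \<iota> (n + k)) \<cdot> jj n k = g \<cdot> \<iota> n"
proof (induction k)
  case 0
  then show ?case using cmp_id[OF tel_in] by simp
next
  case (Suc k)
  have "(g \<cdot> \<iota> (n + Suc k)) \<cdot> jj n (Suc k) = ((g \<cdot> \<iota> (Suc (n + k))) \<cdot> j (n + k)) \<cdot> jj n k"
    using cmp_assoc[OF tel_in j jj_ar] by simp
  then show ?case using tel_in_j Suc by simp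
qed

text \<open>As \<open>d\<close> is injective on maps from compact objects,
  \<open>h \<cdot> x\<close> vanishes and \<open>x\<close> lifts to \<open>P\<close>. There it is a
  finite sum of maps through single stages, which can all be moved to a common later stage.\<close>

lemma tel_compact_surj:
  assumes C: "compact_object U T C" and x: "ar x C H"
  obtains n y where "ar y C (X n)" "x = (g \<cdot> \<iota> n) \<cdot> y"
proof -
  have CO: "C \<in> Ob T" using compact_Ob[OF C] .
  define C' where "C' = susp T (- 1) C"
  have C': "compact_object U T C'" "C' \<in> Ob T" "Susp T C' = C"
    using compact_susp[OF C] susp_Ob[OF CO] susp_neg(2)[OF CO, of 1] susp_1[OF susp_Ob[OF CO]] by (auto simp: C'_def)
  have hx: "ar (h \<cdot> x) C (Susp T P)" using ar_cmp[OF tel_h x] .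
  obtain y where y: "ar y C' P" "SuspM T y = h \<cdot> x" using SuspM_full[of "h \<cdot> x" C' P] hx C' tel_P by metis
  have "SuspM T (d \<cdot> y) = (SuspM T d \<cdot> h) \<cdot> x"
    using SuspM_cmp[OF tel_d y(1)] y(2) cmp_assoc[OF SuspM_ar[OF tel_d] tel_h x] by simp
  also have "\<dots> = SuspM T (zr C' P)"
    using tri_comp3[OF H] zr_cmp[OF x Susp_Ob[OF tel_P]] SuspM_zr[OF C'(2) tel_P] C'(3) by simp
  finally have "d \<cdot> y = zr C' P" using SuspM_eq ar_cmp[OF tel_d y(1)] ar_zr[OF C'(2) tel_P] by blast
  then have "y = zr C' P" using tel_mono[OF C'(1) y(1)] by blast
  then have "h \<cdot> x = zr C (Susp T P)" using y(2) SuspM_zr[OF C'(2) tel_P] C'(3) by simp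
  then obtain z where z: "ar z C P" "x = g \<cdot> z" using tri_weak_ker2[OF H x] by metis
  let ?Q = "\<lambda>z. \<exists>n y. ar y C (X n) \<and> g \<cdot> z = (g \<cdot> \<iota> n) \<cdot> y"
  have "?Q z"
  proof (rule compact_induct[OF C small_nat[OF univ] P z(1), where P = ?Q])
    show "?Q (zr C P)"
      using ar_zr[OF CO seq_Ob[of 0]] cmp_zr[OF tel_g CO] cmp_zr[OF tel_in CO, of 0] by metis
    fix x y assume xy: "ar x C P" "ar y C P" "?Q x" "?Q y"
    obtain n x' where x': "ar x' C (X n)" "g \<cdot> x = (g \<cdot> \<iota> n) \<cdot> x'" using xy by blast
    obtain m y' where y': "ar y' C (X m)" "g \<cdot> y = (g \<cdot> \<iota> m) \<cdot> y'" using xy by blast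
    define N where "N = max m n"
    have N: "n + (N - n) = N" "m + (N - m) = N" by (auto simp: N_def)
    have jn: "ar (jj n (N - n)) (X n) (X N)" "ar (jj m (N - m)) (X m) (X N)"
      using jj_ar[of n "N - n"] jj_ar[of m "N - m"] N by simp_all
    have "g \<cdot> x = (g \<cdot> \<iota> N) \<cdot> (jj n (N - n) \<cdot> x')" "g \<cdot> y = (g \<cdot> \<iota> N) \<cdot> (jj m (N - m) \<cdot> y')"
      using x' y' tel_in_jj[of n "N - n"] tel_in_jj[of m "N - m"] N
        cmp_assoc[OF tel_in jn(1) x'(1)] cmp_assoc[OF tel_in jn(2) y'(1)] by simp_all
    then have "g \<cdot> (x \<otimes>\<^bsub>Hom T C P\<^esub> y)
        = (g \<cdot> \<iota> N) \<cdot> ((jj n (N - n) \<cdot> x') \<otimes>\<^bsub>Hom T C (X N)\<^esub> (jj m (N - m) \<cdot> y'))"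
      using cmp_pl[OF tel_g xy(1,2)] cmp_pl[OF tel_in ar_cmp[OF jn(1) x'(1)] ar_cmp[OF jn(2) y'(1)]] by simp
    then show "?Q (x \<otimes>\<^bsub>Hom T C P\<^esub> y)"
      using ar_pl[OF ar_cmp[OF jn(1) x'(1)] ar_cmp[OF jn(2) y'(1)]] by blast
  next
    fix i f assume f: "ar f C (X i)"
    then show "?Q (\<iota> i \<cdot> f)" using cmp_assoc[OF tel_g tel_\<iota> f] by metis
  qed
  then show ?thesis using that z(2) by metis
qed

lemma tel_compact_inj:
  assumes C: "compact_object U T C" and x: "ar x C (X n)" and z: "(g \<cdot> \<iota> n) \<cdot> x = zr C H"
  obtains k where "jj n k \<cdot> x = zr C (X (n + k))"
proof -
  have i: "ar (\<iota> n \<cdot> x) C P" using ar_cmp[OF tel_\<iota> x] .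
  have "g \<cdot> (\<iota> n \<cdot> x) = zr C H" using z cmp_assoc[OF tel_g tel_\<iota> x] by simp
  then obtain y where "ar y C P" "\<iota> n \<cdot> x = d \<cdot> y" using tri_weak_ker[OF H i] by metis
  then show ?thesis using that tel_inj[OF C x] by blast
qed

lemma tel_loc:
  assumes L: "localizing U T L" and X: "\<And>n. X n \<in> L"
  shows "H \<in> L"
  using loc_tri(1)[OF L H] loc_coprod[OF L small_nat[OF univ] P] X by blast

end
end

end

text \<open>The telescope of a constant sequence is split exact: its differential has a retraction.\<close>

lemma tel_const:
  assumes P: "is_coproduct T (UNIV :: nat set) (\<lambda>_. Y) P \<iota>"
    and \<sigma>: "ar \<sigma> P P" "\<And>n. \<sigma> \<cdot> \<iota> n = \<iota> (Suc n)"
    and H: "tri (mi P P (Idt T P) \<sigma>) g h P P H"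
  shows "g \<cdot> \<iota> 0 \<in> isos T Y H"
proof -
  define d where "d = mi P P (Idt T P) \<sigma>"
  have YO: "Y \<in> Ob T" using coprod_Ob'[OF P] by simp
  have PO: "P \<in> Ob T" using coprod_Ob[OF P] .
  have HO: "H \<in> Ob T" using tri_Ob[OF H] by blast
  have \<iota>: "ar (\<iota> n) Y P" for n using coprod_ar[OF P] by simp
  have d: "ar d P P" unfolding d_def using ar_mi[OF ar_Idt[OF PO] \<sigma>(1)] .
  have d\<iota>: "d \<cdot> \<iota> n = mi Y P (\<iota> n) (\<iota> (Suc n))" for n
    unfolding d_def using mi_cmp[OF \<iota> ar_Idt[OF PO] \<sigma>(1)] id_cmp[OF \<iota>] \<sigma>(2) by simp
  note t = H[folded d_def]
  have g: "ar g P H" and h: "ar h H (Susp T P)" using tri_ar[OF t] by blast+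
  define \<kappa> where "\<kappa> = g \<cdot> \<iota> 0"
  have \<kappa>: "ar \<kappa> Y H" unfolding \<kappa>_def using ar_cmp[OF g \<iota>] .
  have g\<iota>: "g \<cdot> \<iota> n = \<kappa>" for n
  proof (induction n)
    case (Suc n)
    have "mi Y H (g \<cdot> \<iota> n) (g \<cdot> \<iota> (Suc n)) = (g \<cdot> d) \<cdot> \<iota> n"
      using cmp_assoc[OF g d \<iota>] d\<iota> cmp_mi[OF g \<iota> \<iota>] by simp
    also have "\<dots> = zr Y H" using tri_comp[OF t] zr_cmp[OF \<iota> HO] by simp
    finally have "g \<cdot> \<iota> n = g \<cdot> \<iota> (Suc n)" using mi_eq_zr_iff[OF ar_cmp[OF g \<iota>] ar_cmp[OF g \<iota>]] by blast
    then show ?case using Suc by simp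
  qed (simp add: \<kappa>_def)
  obtain s where s: "ar s P Y" "\<And>n. s \<cdot> \<iota> n = Idt T Y"
    using coprod_desc[OF P YO, of "\<lambda>_. Idt T Y"] ar_Idt[OF YO] by auto
  have "s \<cdot> d = zr P Y"
  proof (rule coprod_eq[OF P ar_cmp[OF s(1) d] ar_zr[OF PO YO]])
    fix n
    show "(s \<cdot> d) \<cdot> \<iota> n = zr P Y \<cdot> \<iota> n"
      using cmp_assoc[OF s(1) d \<iota>[of n]] d\<iota>[of n] cmp_mi[OF s(1) \<iota>[of n] \<iota>[of "Suc n"]] s(2)
        mi_self[OF ar_Idt[OF YO]] zr_cmp[OF \<iota>[of n] YO] by simp
  qed
  then obtain u where u: "ar u H Y" "s = u \<cdot> g" using tri_weak_coker[OF t s(1)] by metis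
  have u\<kappa>: "u \<cdot> \<kappa> = Idt T Y" unfolding \<kappa>_def using cmp_assoc[OF u(1) g \<iota>] u(2) s(2) by simp
  \<comment> \<open>\<open>r n\<close> is minus the sum of the first \<open>n\<close> inclusions,
    the solution of \<open>r n - r (Suc n) = \<iota> n\<close>; so the induced map is a retraction
    of \<open>d\<close>.\<close>
  define r where "r = rec_nat (zr Y P) (\<lambda>n x. mi Y P x (\<iota> n))"
  have r0: "r 0 = zr Y P" and rS: "\<And>n. r (Suc n) = mi Y P (r n) (\<iota> n)" by (simp_all add: r_def)
  have r: "ar (r n) Y P" for n
    by (induction n) (simp_all add: r0 rS ar_zr[OF YO PO] ar_mi \<iota>)
  obtain \<rho> where \<rho>: "ar \<rho> P P" "\<And>n. \<rho> \<cdot> \<iota> n = r n" using coprod_desc[OF P PO, of r] r by auto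
  have mm: "mi Y P x (mi Y P x y) = y" if "ar x Y P" "ar y Y P" for x y
  proof -
    interpret comm_group "Hom T Y P" using Hom_group YO PO .
    show ?thesis using that ar_carrier by (simp add: mi_def inv_mult m_assoc[symmetric])
  qed
  have \<rho>d: "\<rho> \<cdot> d = Idt T P"
  proof (rule coprod_eq[OF P ar_cmp[OF \<rho>(1) d] ar_Idt[OF PO]])
    fix n
    show "(\<rho> \<cdot> d) \<cdot> \<iota> n = Idt T P \<cdot> \<iota> n"
      using cmp_assoc[OF \<rho>(1) d \<iota>[of n]] d\<iota>[of n] cmp_mi[OF \<rho>(1) \<iota>[of n] \<iota>[of "Suc n"]] \<rho>(2)
        rS[of n] mm[OF r[of n] \<iota>[of n]] id_cmp[OF \<iota>[of n]] by simp
  qed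
  have "h = SuspM T (\<rho> \<cdot> d) \<cdot> h" using \<rho>d SuspM_Idt[OF PO] id_cmp[OF h] by simp
  also have "\<dots> = SuspM T \<rho> \<cdot> (SuspM T d \<cdot> h)"
    using SuspM_cmp[OF \<rho>(1) d] cmp_assoc[OF SuspM_ar[OF \<rho>(1)] SuspM_ar[OF d] h] by simp
  also have "\<dots> = zr H (Susp T P)" using tri_comp3[OF t] cmp_zr[OF SuspM_ar[OF \<rho>(1)] HO] by simp
  finally have h0: "h = zr H (Susp T P)" .
  have \<kappa>u: "ar (\<kappa> \<cdot> u) H H" using ar_cmp[OF \<kappa> u(1)] .
  have "(\<kappa> \<cdot> u) \<cdot> g = g"
  proof (rule coprod_eq[OF P ar_cmp[OF \<kappa>u g] g])
    fix n
    show "((\<kappa> \<cdot> u) \<cdot> g) \<cdot> \<iota> n = g \<cdot> \<iota> n"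
      using cmp_assoc[OF \<kappa> u(1) g] u(2) cmp_assoc[OF \<kappa> s(1) \<iota>[of n]] s(2) cmp_id[OF \<kappa>] g\<iota> by simp
  qed
  then have "mi H H (\<kappa> \<cdot> u) (Idt T H) \<cdot> g = zr P H"
    using mi_cmp[OF g \<kappa>u ar_Idt[OF HO]] id_cmp[OF g] mi_self[OF g] by simp
  then obtain w where w: "ar w (Susp T P) H" "mi H H (\<kappa> \<cdot> u) (Idt T H) = w \<cdot> h"
    using tri_weak_coker2[OF t ar_mi[OF \<kappa>u ar_Idt[OF HO]]] by metis
  then have "mi H H (\<kappa> \<cdot> u) (Idt T H) = zr H H" using h0 cmp_zr[OF w(1) HO] by simp
  then have "\<kappa> \<cdot> u = Idt T H" using mi_eq_zr_iff[OF \<kappa>u ar_Idt[OF HO]] by blast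
  then show ?thesis using isosI[OF \<kappa> u(1) u\<kappa>] \<kappa>_def by simp
qed

text \<open>The first five properties collect the facts on telescopes. For the last one, the
  constant sequence on \<open>X 0\<close>, whose homotopy colimit is again \<open>X 0\<close>, is
  mapped to the given sequence. The map between the coproducts has its cone in \<open>M\<close>, and
  the \<open>3 x 3\<close> lemma passes this on to the homotopy colimits.\<close>

lemma hocolim:
  fixes X :: "nat \<Rightarrow> 'o" and j :: "nat \<Rightarrow> 'm"
  assumes j: "\<And>n. ar (j n) (X n) (X (Suc n))"
  obtains i H where "\<And>n. ar (i n) (X n) H" "\<And>n. i (Suc n) \<cdot> j n = i n"
    "\<And>L. \<lbrakk>localizing U T L; \<And>n. X n \<in> L\<rbrakk> \<Longrightarrow> H \<in> L"
    "\<And>C x. \<lbrakk>compact_object U T C; ar x C H\<rbrakk> \<Longrightarrow> \<exists>n y. ar y C (X n) \<and> x = i n \<cdot> y"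
    "\<And>C x n. \<lbrakk>compact_object U T C; ar x C (X n); i n \<cdot> x = zr C H\<rbrakk> \<Longrightarrow> \<exists>k. seq_map X j n k \<cdot> x = zr C (X (n + k))"
    "\<And>M. \<lbrakk>localizing U T M; \<And>n. cone_in M (j n) (X n) (X (Suc n))\<rbrakk> \<Longrightarrow> cone_in M (i 0) (X 0) H"
proof -
  have XO: "X n \<in> Ob T" for n using ar_Ob(1)[OF j] .
  have jj: "ar (seq_map X j n k) (X n) (X (n + k))" for n k using jj_ar[where X = X and j = j, OF j] .
  obtain P \<iota> where P: "is_coproduct T (UNIV :: nat set) X P \<iota>"
    using coprod_exists[OF small_nat[OF univ], of X] XO by blast
  have PO: "P \<in> Ob T" using coprod_Ob[OF P] .
  have \<iota>: "ar (\<iota> n) (X n) P" for n using coprod_ar[OF P] by simp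
  obtain \<sigma> where \<sigma>: "ar \<sigma> P P" "\<And>n. \<sigma> \<cdot> \<iota> n = \<iota> (Suc n) \<cdot> j n"
    using coprod_desc[OF P PO, of "\<lambda>n. \<iota> (Suc n) \<cdot> j n"] ar_cmp[OF \<iota> j] by auto
  define d where "d = mi P P (Idt T P) \<sigma>"
  note tel = j P \<sigma> d_def
  have d: "ar d P P" using tel_d[where X = X and j = j, OF tel] .
  obtain g h H where H: "tri d g h P P H" using tri_cone[OF d] .
  have g: "ar g P H" using tri_ar[OF H] by blast
  have cone: "cone_in M (g \<cdot> \<iota> 0) (X 0) H"
    if M: "localizing U T M" and c: "\<And>n. cone_in M (j n) (X n) (X (Suc n))" for M
  proof -
    have cj: "cone_in M (seq_map X j n k) (X n) (X (n + k))" for n k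
    proof (induction k)
      case 0
      then show ?case using cone_in_iso[OF M isos_Idt XO XO, OF XO] by simp
    next
      case (Suc k)
      then show ?case using cone_in_cmp[OF M Suc c[of "n + k"]] by simp
    qed
    obtain Q \<kappa> where Q: "is_coproduct T (UNIV :: nat set) (\<lambda>_. X 0) Q \<kappa>"
      using coprod_exists[OF small_nat[OF univ], of "\<lambda>_. X 0"] XO by blast
    have QO: "Q \<in> Ob T" using coprod_Ob[OF Q] .
    have \<kappa>: "ar (\<kappa> n) (X 0) Q" for n using coprod_ar[OF Q] by simp
    obtain s where s: "ar s Q Q" "\<And>n. s \<cdot> \<kappa> n = \<kappa> (Suc n)"
      using coprod_desc[OF Q QO, of "\<lambda>n. \<kappa> (Suc n)"] \<kappa> by auto
    define e where "e = mi Q Q (Idt T Q) s"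
    have e: "ar e Q Q" unfolding e_def using ar_mi[OF ar_Idt[OF QO] s(1)] .
    obtain g' h' K where K: "tri e g' h' Q Q K" using tri_cone[OF e] .
    have g': "ar g' Q K" using tri_ar[OF K] by blast
    have iso: "g' \<cdot> \<kappa> 0 \<in> isos T (X 0) K" using tel_const[OF Q s K[unfolded e_def]] .
    have cj0: "cone_in M (seq_map X j 0 n) (X 0) (X n)" for n using cj[of 0 n] by simp
    \<comment> \<open>On the \<open>n\<close>-th summand this is the composite transition map from
      \<open>X 0\<close> to \<open>X n\<close>.\<close>
    obtain \<psi> where \<psi>: "cone_in M \<psi> Q P" "\<And>n. \<psi> \<cdot> \<kappa> n = \<iota> n \<cdot> seq_map X j 0 n"
      using cone_in_coprod[OF M small_nat[OF univ] cj0 Q P] by auto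
    have \<psi>a: "ar \<psi> Q P" using cone_in_ar[OF \<psi>(1)] .
    have jj0: "ar (seq_map X j 0 n) (X 0) (X n)" for n using jj[of 0 n] by simp
    have sq: "\<psi> \<cdot> e = d \<cdot> \<psi>"
    proof (rule coprod_eq[OF Q ar_cmp[OF \<psi>a e] ar_cmp[OF d \<psi>a]])
      fix n
      have "(\<psi> \<cdot> e) \<cdot> \<kappa> n = mi (X 0) P (\<psi> \<cdot> \<kappa> n) (\<psi> \<cdot> \<kappa> (Suc n))"
        unfolding e_def
        using cmp_assoc[OF \<psi>a ar_mi[OF ar_Idt[OF QO] s(1)] \<kappa>[of n]] mi_cmp[OF \<kappa>[of n] ar_Idt[OF QO] s(1)]
          id_cmp[OF \<kappa>[of n]] s(2) cmp_mi[OF \<psi>a \<kappa>[of n] \<kappa>[of "Suc n"]] by simp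
      also have "\<dots> = mi (X 0) P (\<iota> n \<cdot> seq_map X j 0 n) ((\<iota> (Suc n) \<cdot> j n) \<cdot> seq_map X j 0 n)"
        using \<psi>(2) cmp_assoc[OF \<iota>[of "Suc n"] j[of n] jj0[of n]] by simp
      also have "\<dots> = (d \<cdot> \<psi>) \<cdot> \<kappa> n"
        using cmp_assoc[OF d \<psi>a \<kappa>[of n]] \<psi>(2) cmp_assoc[OF d \<iota>[of n] jj0[of n]] tel_d\<iota>[where X = X and j = j, OF tel, of n]
          mi_cmp[OF jj0[of n] \<iota>[of n] ar_cmp[OF \<iota>[of "Suc n"] j[of n]]] by simp
      finally show "(\<psi> \<cdot> e) \<cdot> \<kappa> n = (d \<cdot> \<psi>) \<cdot> \<kappa> n" .
    qed
    obtain a b B where B: "tri \<psi> a b Q P B" "B \<in> M" using \<psi>(1) cone_in_def by blast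
    obtain c c1 c2 D p q r where c: "c \<cdot> g' = g \<cdot> \<psi>" "tri c c1 c2 K H D" "tri p q r B D (Susp T B)"
      using tri_3x3[OF K H B(1) B(1) sq] by metis
    have "D \<in> M" using loc_tri(3)[OF M c(3)] B(2) loc_Susp[OF M tri_Ob(3)[OF B(1)]] by blast
    then have "cone_in M c K H" using c(2) cone_in_def by blast
    moreover have "cone_in M (g' \<cdot> \<kappa> 0) (X 0) K" using cone_in_iso[OF M iso XO tri_Ob(3)[OF K]] .
    moreover have "c \<cdot> (g' \<cdot> \<kappa> 0) = g \<cdot> \<iota> 0"
      using cmp_assoc[OF tri_ar(1)[OF c(2)] g' \<kappa>[of 0]] c(1) cmp_assoc[OF g \<psi>a \<kappa>[of 0]] \<psi>(2)[of 0]
        cmp_id[OF \<iota>[of 0]] by simp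
    ultimately show ?thesis using cone_in_cmp[OF M] by metis
  qed
  show ?thesis
  proof (rule that[of "\<lambda>n. g \<cdot> \<iota> n" H])
    show "ar (g \<cdot> \<iota> n) (X n) H" for n using ar_cmp[OF g \<iota>] .
    show "(g \<cdot> \<iota> (Suc n)) \<cdot> j n = g \<cdot> \<iota> n" for n using tel_in_j[where X = X and j = j, OF tel H] .
    show "H \<in> L" if "localizing U T L" "\<And>n. X n \<in> L" for L using tel_loc[where X = X and j = j, OF tel H that] .
    show "\<exists>n y. ar y C (X n) \<and> x = (g \<cdot> \<iota> n) \<cdot> y" if "compact_object U T C" "ar x C H" for C x
      using tel_compact_surj[where X = X and j = j, OF tel H that] by metis
    show "\<exists>k. seq_map X j n k \<cdot> x = zr C (X (n + k))"
      if "compact_object U T C" "ar x C (X n)" "(g \<cdot> \<iota> n) \<cdot> x = zr C H" for C x n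
      using tel_compact_inj[where X = X and j = j, OF tel H that] by metis
  qed (use cone in blast)
qed

end

section \<open>Inverting central operators\<close>

context cg_category
begin

section \<open>Orthogonal complements\<close>

definition lorth where "lorth N = {Y \<in> Ob T. \<forall>Z \<in> N. \<forall>f. ar f Y Z \<longrightarrow> f = zr Y Z}"
definition rorth where "rorth S = {N \<in> Ob T. \<forall>Y \<in> S. \<forall>f. ar f Y N \<longrightarrow> f = zr Y N}"

lemma rorthD: "\<lbrakk>N \<in> rorth S; Y \<in> S; ar f Y N\<rbrakk> \<Longrightarrow> f = zr Y N"
  by (auto simp: rorth_def)

lemma rorth_Ob: "N \<in> rorth S \<Longrightarrow> N \<in> Ob T"
  by (auto simp: rorth_def)

lemma lorthD: "\<lbrakk>Y \<in> lorth N; Z \<in> N; ar f Y Z\<rbrakk> \<Longrightarrow> f = zr Y Z"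
  by (auto simp: lorth_def)

lemma lorth_localizing:
  assumes N: "N \<subseteq> Ob T" "\<And>Z. Z \<in> Ob T \<Longrightarrow> Susp T Z \<in> N \<longleftrightarrow> Z \<in> N"
  shows "localizing U T (lorth N)"
proof (rule localizingI)
  show "lorth N \<subseteq> Ob T" by (auto simp: lorth_def)
  show "Z \<in> lorth N" if "is_zero T Z" for Z
    using that is_zero_Ob ar_zero_dom by (auto simp: lorth_def)
  have up: "Susp T X \<in> lorth N" if X: "X \<in> lorth N" for X
    unfolding lorth_def
  proof (intro CollectI conjI ballI allI impI)
    have XO: "X \<in> Ob T" using X by (simp add: lorth_def)
    show "Susp T X \<in> Ob T" using Susp_Ob[OF XO] .
    fix Z f assume Z: "Z \<in> N" and f: "ar f (Susp T X) Z"
    obtain Z' where Z': "Z' \<in> Ob T" "Susp T Z' = Z" using Susp_surj[OF ar_Ob(2)[OF f]] .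
    obtain k where k: "ar k X Z'" "SuspM T k = f" using SuspM_full[of f X Z'] f Z' XO by blast
    have "k = zr X Z'" using lorthD[OF X _ k(1)] N(2)[OF Z'(1)] Z Z'(2) by simp
    then show "f = zr (Susp T X) Z" using k(2) SuspM_zr[OF XO Z'(1)] Z'(2) by simp
  qed
  show "X \<in> lorth N \<longleftrightarrow> Susp T X \<in> lorth N" if XO: "X \<in> Ob T" for X
  proof
    assume S: "Susp T X \<in> lorth N"
    show "X \<in> lorth N"
      unfolding lorth_def
    proof (intro CollectI conjI ballI allI impI XO)
      fix Z f assume Z: "Z \<in> N" and f: "ar f X Z"
      have ZO: "Z \<in> Ob T" using ar_Ob[OF f] by blast
      have "SuspM T f = SuspM T (zr X Z)"
        using lorthD[OF S _ SuspM_ar[OF f]] N(2)[OF ZO] Z SuspM_zr[OF XO ZO] by simp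
      then show "f = zr X Z" using SuspM_eq f ar_zr[OF XO ZO] by blast
    qed
  qed (rule up)
  show "Z \<in> lorth N" if t: "tri f g h X Y Z" and X: "X \<in> lorth N" and Y: "Y \<in> lorth N" for f g h X Y Z
    unfolding lorth_def
  proof (intro CollectI conjI ballI allI impI)
    show ZO: "Z \<in> Ob T" using tri_Ob[OF t] by blast
    fix W k assume W: "W \<in> N" and k: "ar k Z W"
    have g: "ar g Y Z" and h: "ar h Z (Susp T X)" using tri_ar[OF t] by blast+
    have "k \<cdot> g = zr Y W" using lorthD[OF Y W ar_cmp[OF k g]] .
    then obtain y where y: "ar y (Susp T X) W" "k = y \<cdot> h" using tri_weak_coker2[OF t k] by metis
    then show "k = zr Z W" using lorthD[OF up[OF X] W y(1)] zr_cmp[OF h ar_Ob(2)[OF k]] by simp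
  qed
  show "S \<in> lorth N" if S: "is_coproduct T I X S \<iota>" and X: "\<And>i. i \<in> I \<Longrightarrow> X i \<in> lorth N"
    for I and X :: "'u \<Rightarrow> 'o" and S \<iota>
    unfolding lorth_def
  proof (intro CollectI conjI ballI allI impI)
    show SO: "S \<in> Ob T" using coprod_Ob[OF S] .
    fix Z f assume Z: "Z \<in> N" and f: "ar f S Z"
    have ZO: "Z \<in> Ob T" using ar_Ob[OF f] by blast
    show "f = zr S Z"
    proof (rule coprod_eq[OF S f ar_zr[OF SO ZO]])
      fix i assume i: "i \<in> I"
      show "f \<cdot> \<iota> i = zr S Z \<cdot> \<iota> i"
        using lorthD[OF X[OF i] Z ar_cmp[OF f coprod_ar[OF S i]]] zr_cmp[OF coprod_ar[OF S i] ZO] by simp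
    qed
  qed
qed

lemma rorth_susp:
  assumes S: "localizing U T S" and N: "N \<in> rorth S"
  shows "susp T n N \<in> rorth S"
  unfolding rorth_def
proof (intro CollectI conjI ballI allI impI)
  have NO: "N \<in> Ob T" using rorth_Ob[OF N] .
  show "susp T n N \<in> Ob T" using susp_Ob[OF NO] .
  fix Y f assume Y: "Y \<in> S" and f: "ar f Y (susp T n N)"
  have YO: "Y \<in> Ob T" using ar_Ob[OF f] by blast
  have a: "ar (suspM T (- n) f) (susp T (- n) Y) N" using suspM_ar[OF f, of "- n"] susp_neg(1)[OF NO] by simp
  have "suspM T (- n) f = zr (susp T (- n) Y) N"
    using rorthD[OF N _ a] loc_susp[OF S YO] Y by blast
  then have "suspM T (- n) f = suspM T (- n) (zr Y (susp T n N))"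
    using suspM_zr[OF YO susp_Ob[OF NO], of "- n" n] susp_neg(1)[OF NO] by simp
  then show "f = zr Y (susp T n N)" using suspM_eq ar_Arr[OF f] ar_Arr[OF ar_zr[OF YO susp_Ob[OF NO]]] by blast
qed

lemma rorth_Susp_iff:
  assumes S: "localizing U T S" and NO: "N \<in> Ob T"
  shows "Susp T N \<in> rorth S \<longleftrightarrow> N \<in> rorth S"
  using rorth_susp[OF S, of N 1] rorth_susp[OF S, of "Susp T N" "- 1"] susp_1[OF NO] susp_neg(1)[OF NO, of 1]
  by metis

lemma rorth_mid:
  assumes t: "tri f g h X Y Z" and X: "X \<in> rorth S" and Z: "Z \<in> rorth S"
  shows "Y \<in> rorth S"
  unfolding rorth_def
proof (intro CollectI conjI ballI allI impI)
  show "Y \<in> Ob T" using tri_Ob[OF t] by blast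
  fix W k assume W: "W \<in> S" and k: "ar k W Y"
  have "g \<cdot> k = zr W Z" using rorthD[OF Z W ar_cmp[OF tri_ar(2)[OF t] k]] .
  then obtain y where y: "ar y W X" "k = f \<cdot> y" using tri_weak_ker[OF t k] by metis
  then show "k = zr W Y" using rorthD[OF X W y(1)] cmp_zr[OF tri_ar(1)[OF t] ar_Ob(1)[OF k]] by simp
qed

text \<open>A right orthogonal complement of a localizing subcategory is triangulated in any case;
  closure under coproducts is the extra condition that makes a localization smashing.\<close>

lemma rorth_localizing:
  assumes S: "localizing U T S"
    and p: "\<And>I X P \<iota>. \<lbrakk>small U I; is_coproduct T (I :: 'u set) X P \<iota>; \<And>i. i \<in> I \<Longrightarrow> X i \<in> rorth S\<rbrakk> \<Longrightarrow> P \<in> rorth S"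
  shows "localizing U T (rorth S)"
proof (rule localizingI)
  show "rorth S \<subseteq> Ob T" by (auto simp: rorth_def)
  show "Z \<in> rorth S" if "is_zero T Z" for Z
    using that is_zero_Ob ar_zero_cod by (auto simp: rorth_def)
  show "X \<in> rorth S \<longleftrightarrow> Susp T X \<in> rorth S" if "X \<in> Ob T" for X using rorth_Susp_iff[OF S that] by simp
  show "Z \<in> rorth S" if t: "tri f g h X Y Z" and X: "X \<in> rorth S" and Y: "Y \<in> rorth S" for f g h X Y Z
    using rorth_mid[OF tri_rot[OF t] Y] X rorth_Susp_iff[OF S tri_Ob(1)[OF t]] by blast
qed (rule p)

section \<open>Detection of zero objects and isomorphisms by compact objects\<close>

lemma compact_pred:
  assumes "compact_object U T C" obtains C' where "compact_object U T C'" "Susp T C' = C"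
  using that[of "susp T (- 1) C"] compact_susp[OF assms] compact_Ob[OF assms]
    susp_1[OF susp_Ob] susp_neg(2)[of C 1] by metis

lemma compact_Susp: "compact_object U T C \<Longrightarrow> compact_object U T (Susp T C)"
  using compact_susp[of C 1] susp_1 compact_Ob by metis

text \<open>The left orthogonal complement of all objects invisible to compact objects is localizing
  and contains the generators, so it is everything. An invisible object is thus orthogonal to
  itself.\<close>

lemma zero_if_compact:
  assumes YO: "Y \<in> Ob T" and z: "\<And>C x. \<lbrakk>compact_object U T C; ar x C Y\<rbrakk> \<Longrightarrow> x = zr C Y"
  shows "is_zero T Y"
proof -
  define N where "N = {Z \<in> Ob T. \<forall>C x. compact_object U T C \<longrightarrow> ar x C Z \<longrightarrow> x = zr C Z}"
  have "Susp T Z \<in> N \<longleftrightarrow> Z \<in> N" if ZO: "Z \<in> Ob T" for Z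
  proof
    assume Z: "Susp T Z \<in> N"
    show "Z \<in> N"
      unfolding N_def
    proof (intro CollectI conjI allI impI ZO)
      fix C x assume C: "compact_object U T C" and x: "ar x C Z"
      have "SuspM T x = SuspM T (zr C Z)"
        using Z compact_Susp[OF C] SuspM_ar[OF x] SuspM_zr[OF compact_Ob[OF C] ZO] by (simp add: N_def)
      then show "x = zr C Z" using SuspM_eq x ar_zr[OF compact_Ob[OF C] ZO] by blast
    qed
  next
    assume Z: "Z \<in> N"
    show "Susp T Z \<in> N"
      unfolding N_def
    proof (intro CollectI conjI allI impI Susp_Ob[OF ZO])
      fix C x assume C: "compact_object U T C" and x: "ar x C (Susp T Z)"
      obtain C' where C': "compact_object U T C'" "Susp T C' = C" using compact_pred[OF C] .
      obtain k where k: "ar k C' Z" "SuspM T k = x" using SuspM_full[of x C' Z] x C' ZO compact_Ob by blast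
      then have "k = zr C' Z" using Z C'(1) by (simp add: N_def)
      then show "x = zr C (Susp T Z)" using k(2) SuspM_zr[OF compact_Ob[OF C'(1)] ZO] C'(2) by simp
    qed
  qed
  then have l: "localizing U T (lorth N)" by (intro lorth_localizing) (auto simp: N_def)
  obtain G where G: "\<And>C. C \<in> G \<Longrightarrow> compact_object U T C" "Loc U T G = Ob T"
    using cgen unfolding compactly_generated_def by blast
  have "G \<subseteq> lorth N" using G(1) compact_Ob by (auto simp: lorth_def N_def)
  then have "Y \<in> lorth N" using Loc_least[OF l] G(2) YO by blast
  moreover have "Y \<in> N" using YO z by (auto simp: N_def)
  ultimately have "Idt T Y = zr Y Y" using lorthD ar_Idt[OF YO] by blast
  then show ?thesis using is_zeroI YO by blast
qed

text \<open>Injectivity at the desuspension of \<open>C\<close> lifts maps from \<open>C\<close> to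
  the cone back to \<open>Y\<close>, and surjectivity at \<open>C\<close> lifts them further to
  \<open>X\<close>; so no compact object sees the cone.\<close>

lemma iso_if_compact:
  assumes f: "ar f X Y"
    and inj: "\<And>C x. \<lbrakk>compact_object U T C; ar x C X; f \<cdot> x = zr C Y\<rbrakk> \<Longrightarrow> x = zr C X"
    and surj: "\<And>C y. \<lbrakk>compact_object U T C; ar y C Y\<rbrakk> \<Longrightarrow> \<exists>x. ar x C X \<and> y = f \<cdot> x"
  shows "f \<in> isos T X Y"
proof -
  obtain g h K where t: "tri f g h X Y K" using tri_cone[OF f] .
  have O: "X \<in> Ob T" "Y \<in> Ob T" "K \<in> Ob T" using tri_Ob[OF t] by auto
  have g: "ar g Y K" and h: "ar h K (Susp T X)" using tri_ar[OF t] by blast+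
  have "is_zero T K"
  proof (rule zero_if_compact[OF O(3)])
    fix C x assume C: "compact_object U T C" and x: "ar x C K"
    obtain C' where C': "compact_object U T C'" "Susp T C' = C" using compact_pred[OF C] .
    have CO: "C \<in> Ob T" "C' \<in> Ob T" using compact_Ob C C' by auto
    have hx: "ar (h \<cdot> x) C (Susp T X)" using ar_cmp[OF h x] .
    obtain k where k: "ar k C' X" "SuspM T k = h \<cdot> x" using SuspM_full[of "h \<cdot> x" C' X] hx C'(2) CO O by metis
    have "SuspM T (f \<cdot> k) = (SuspM T f \<cdot> h) \<cdot> x"
      using SuspM_cmp[OF f k(1)] k(2) cmp_assoc[OF SuspM_ar[OF f] h x] by simp
    also have "\<dots> = SuspM T (zr C' Y)"
      using tri_comp3[OF t] zr_cmp[OF x Susp_Ob[OF O(2)]] SuspM_zr[OF CO(2) O(2)] C'(2) by simp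
    finally have "f \<cdot> k = zr C' Y" using SuspM_eq ar_cmp[OF f k(1)] ar_zr[OF CO(2) O(2)] by blast
    then have "k = zr C' X" using inj[OF C'(1) k(1)] by blast
    then have "h \<cdot> x = zr C (Susp T X)" using k(2) SuspM_zr[OF CO(2) O(1)] C'(2) by simp
    then obtain y where y: "ar y C Y" "x = g \<cdot> y" using tri_weak_ker2[OF t x] by metis
    obtain z where z: "ar z C X" "y = f \<cdot> z" using surj[OF C y(1)] by blast
    then show "x = zr C K" using y(2) cmp_assoc[OF g f z(1)] tri_comp[OF t] zr_cmp[OF z(1) O(3)] by simp
  qed
  then show ?thesis using tri_iso_if_zero[OF t] by blast
qed

text \<open>The square appears because an operator need not vanish on its own fibre, but its square
  does. Each piece is tied to one operator, and is still an object of
  \<open>Loc U T {X}\<close>.\<close>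

definition pieces where
  "pieces A X = {F \<in> Loc U T {X}. \<exists>(d, \<rho>) \<in> A. \<rho> (susp T d F) \<cdot> \<rho> F = zr F (susp T d (susp T d F))}"

definition inv_set where
  "inv_set A = {N \<in> Ob T. \<forall>(d, \<rho>) \<in> A. \<rho> N \<in> isos T N (susp T d N)}"

text \<open>By naturality the operator on \<open>F\<close> followed by the shifted \<open>u\<close>
  is zero, so it comes from the connecting map \<open>w\<close>. Applying the operator again after
  \<open>w\<close> gives a suspension of \<open>w \<cdot> \<rho> X\<close>, which vanishes.\<close>

lemma fibre_square_zero:
  assumes c: "cen d \<rho>" and t: "tri u (\<rho> X) w F X (susp T d X)"
  shows "\<rho> (susp T d F) \<cdot> \<rho> F = zr F (susp T d (susp T d F))"
proof -
  have O: "X \<in> Ob T" "F \<in> Ob T" using tri_Ob[OF t] by auto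
  have \<rho>X: "ar (\<rho> X) X (susp T d X)" and \<rho>F: "ar (\<rho> F) F (susp T d F)" using cen_ar[OF c] O by auto
  have u: "ar u F X" and w: "ar w (susp T d X) (Susp T F)" using tri_ar[OF t] by auto
  \<comment> \<open>The operator on \<open>F\<close>, shifted so as to end in \<open>F\<close>,
    where the triangle can be used.\<close>
  define r where "r = suspM T (- d) (\<rho> F)"
  define F' where "F' = susp T (- d) F"
  have F'O: "F' \<in> Ob T" unfolding F'_def using susp_Ob[OF O(2)] .
  have r: "ar r F' F" unfolding r_def F'_def using suspM_ar[OF \<rho>F, of "- d"] susp_neg(1)[OF O(2)] by simp
  have "suspM T d u \<cdot> \<rho> F = zr F (susp T d X)" using cen_nat[OF c u] tri_comp[OF t] by simp
  then have "suspM T (- d) (suspM T d u \<cdot> \<rho> F) = zr F' X"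
    using suspM_zr[OF O(2) susp_Ob[OF O(1)], of "- d" d] susp_neg(1)[OF O(1)] by (simp add: F'_def)
  then have "u \<cdot> r = zr F' X"
    using suspM_cmp[OF suspM_ar[OF u] \<rho>F, of "- d"] suspM_neg(1)[OF ar_Arr[OF u]] by (simp add: r_def)
  then have "SuspM T u \<cdot> SuspM T r = zr (Susp T F') (Susp T X)"
    using SuspM_cmp[OF u r] SuspM_zr[OF F'O O(1)] by simp
  then obtain y where y: "ar y (Susp T F') (susp T d X)" "SuspM T r = w \<cdot> y"
    using tri_weak_ker3[OF t SuspM_ar[OF r]] by metis
  have \<rho>SF: "ar (\<rho> (Susp T F)) (Susp T F) (susp T d (Susp T F))" using cen_ar[OF c Susp_Ob[OF O(2)]] .
  have "SuspM T (\<rho> F \<cdot> r) = \<rho> (Susp T F) \<cdot> (w \<cdot> y)"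
    using SuspM_cmp[OF \<rho>F r] cen_Susp[OF c O(2)] y(2) by simp
  also have "\<dots> = (suspM T d w \<cdot> \<rho> (susp T d X)) \<cdot> y"
    using cmp_assoc[OF \<rho>SF w y(1)] cen_nat[OF c w] by simp
  also have "suspM T d w \<cdot> \<rho> (susp T d X) = suspM T d (w \<cdot> \<rho> X)"
    using cen_susp[OF c O(1)] suspM_cmp[OF w \<rho>X] by simp
  also have "\<dots> = zr (susp T d X) (susp T d (Susp T F))"
    using tri_comp2[OF t] suspM_zr[OF O(1) Susp_Ob[OF O(2)]] by simp
  also have "\<dots> \<cdot> y = zr (Susp T F') (susp T d (Susp T F))" using zr_cmp[OF y(1) susp_Ob[OF Susp_Ob[OF O(2)]]] .
  finally have e: "SuspM T (\<rho> F \<cdot> r) = zr (Susp T F') (susp T d (Susp T F))" .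
  have \<rho>r: "ar (\<rho> F \<cdot> r) F' (susp T d F)" using ar_cmp[OF \<rho>F r] .
  have "susp T d (Susp T F) = Susp T (susp T d F)"
    using ar_unique[OF \<rho>SF] SuspM_ar[OF \<rho>F] cen_Susp[OF c O(2)] by metis
  then have "SuspM T (\<rho> F \<cdot> r) = SuspM T (zr F' (susp T d F))" using e SuspM_zr[OF F'O susp_Ob[OF O(2)]] by simp
  then have "\<rho> F \<cdot> r = zr F' (susp T d F)" using SuspM_eq \<rho>r ar_zr[OF F'O susp_Ob[OF O(2)]] by blast
  then have "suspM T d (\<rho> F) \<cdot> suspM T d r = zr (susp T d F') (susp T d (susp T d F))"
    using suspM_cmp[OF \<rho>F r, of d] suspM_zr[OF F'O susp_Ob[OF O(2)], of d d] by simp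
  then show ?thesis
    using cen_susp[OF c O(2)] suspM_neg(2)[OF ar_Arr[OF \<rho>F]] susp_neg(2)[OF O(2)] by (simp add: r_def F'_def)
qed

context
  fixes A :: "(int \<times> ('o \<Rightarrow> 'm)) set"
  assumes A_cen: "\<And>d \<rho>. (d, \<rho>) \<in> A \<Longrightarrow> cen d \<rho>" and A_small: "small U A"
begin

lemma pieces_Ob: "X \<in> Ob T \<Longrightarrow> pieces A X \<subseteq> Ob T"
  unfolding pieces_def using loc_Ob[OF Loc_localizing[of "{X}"]] by blast

text \<open>
  Since each operator divides the transition map, elements killed by it die after one step and all
  elements become divisible by it.
\<close>

lemma localize_step:
  assumes XO: "X \<in> Ob T"
  shows "\<exists>X' j. ar j X X' \<and> X' \<in> Loc U T {X} \<and> cone_in (Loc U T (pieces A X)) j X X' \<and>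
    (\<forall>(d, \<rho>) \<in> A. \<exists>\<theta>. ar \<theta> (susp T d X) X' \<and> \<theta> \<cdot> \<rho> X = j)"
proof -
  have L: "localizing U T (Loc U T {X})" using Loc_localizing XO by blast
  have XL: "X \<in> Loc U T {X}" using Loc_incl by blast
  have P: "localizing U T (Loc U T (pieces A X))" using Loc_localizing pieces_Ob[OF XO] by blast
  have "\<exists>u w F. tri u (snd a X) w F X (susp T (fst a) X)" if "a \<in> A" for a
    using tri_fibre[OF cen_ar[OF A_cen XO]] that by (metis prod.collapse)
  then obtain u w F where t: "\<And>a. a \<in> A \<Longrightarrow> tri (u a) (snd a X) (w a) (F a) X (susp T (fst a) X)"
    by metis
  have Fp: "F a \<in> pieces A X" if "a \<in> A" for a
  proof -
    obtain d \<rho> where a: "a = (d, \<rho>)" by fastforce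
    have "susp T d X \<in> Loc U T {X}" using loc_susp[OF L XO] XL by blast
    then have "F a \<in> Loc U T {X}" using loc_tri(2)[OF L t[OF that]] XL a by simp
    moreover have "\<rho> (susp T d (F a)) \<cdot> \<rho> (F a) = zr (F a) (susp T d (susp T d (F a)))"
      using fibre_square_zero[OF A_cen[of d \<rho>]] t[OF that] that a by simp
    ultimately show ?thesis using that a by (auto simp: pieces_def)
  qed
  obtain W \<iota> where W: "is_coproduct T A F W \<iota>"
    using coprod_exists[OF A_small, of F] tri_Ob(1)[OF t] by blast
  obtain v where v: "ar v W X" "\<And>a. a \<in> A \<Longrightarrow> v \<cdot> \<iota> a = u a"
    using coprod_desc[OF W XO, of u] tri_ar(1)[OF t] by metis
  obtain j k X' where X': "tri v j k W X X'" using tri_cone[OF v(1)] .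
  have j: "ar j X X'" using tri_ar[OF X'] by blast
  have WP: "W \<in> Loc U T (pieces A X)"
    using loc_coprod[OF P A_small W] Fp Loc_incl by blast
  have "pieces A X \<subseteq> Loc U T {X}" by (auto simp: pieces_def)
  then have "W \<in> Loc U T {X}" using WP Loc_least[OF L] by blast
  then have "X' \<in> Loc U T {X}" using loc_tri(1)[OF L X'] XL by blast
  moreover have "cone_in (Loc U T (pieces A X)) j X X'"
    unfolding cone_in_def using tri_rot[OF X'] loc_Susp[OF P tri_Ob(1)[OF X']] WP by blast
  moreover have "\<exists>\<theta>. ar \<theta> (susp T d X) X' \<and> \<theta> \<cdot> \<rho> X = j" if a: "(d, \<rho>) \<in> A" for d \<rho>
  proof -
    have "j \<cdot> u (d, \<rho>) = (j \<cdot> v) \<cdot> \<iota> (d, \<rho>)" using cmp_assoc[OF j v(1) coprod_ar[OF W a]] v(2)[OF a] by simp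
    also have "\<dots> = zr (F (d, \<rho>)) X'" using tri_comp[OF X'] zr_cmp[OF coprod_ar[OF W a] tri_Ob(3)[OF X']] by simp
    finally show ?thesis using tri_weak_coker[OF t[OF a] j] by (metis fst_conv snd_conv)
  qed
  ultimately show ?thesis using j by blast
qed

text \<open>All stages of the sequence lie in \<open>Loc U T {X}\<close>, so their pieces are pieces
  of \<open>X\<close>; this controls the fibre of \<open>X \<rightarrow> H\<close> as well as
  \<open>H\<close>. Invertibility on \<open>H\<close> is tested on compact objects, whose maps come
  from finite stages and vanish at finite stages.\<close>

lemma localize:
  assumes XO: "X \<in> Ob T"
  obtains f g h G L where "tri f g h G X L" "L \<in> Loc U T {X}" "G \<in> Loc U T (pieces A X)"
    "L \<in> inv_set A"
proof -
  have LX: "localizing U T (Loc U T {X})" using Loc_localizing XO by blast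
  have P: "localizing U T (Loc U T (pieces A X))" using Loc_localizing pieces_Ob[OF XO] by blast
  \<comment> \<open>The successor is chosen for all objects at once, because the sequence is
    obtained by iterating it.\<close>
  have "\<exists>nx. \<forall>Y \<in> Ob T. \<exists>j. ar j Y (nx Y) \<and> nx Y \<in> Loc U T {Y} \<and> cone_in (Loc U T (pieces A Y)) j Y (nx Y) \<and>
    (\<forall>(d, \<rho>) \<in> A. \<exists>\<theta>. ar \<theta> (susp T d Y) (nx Y) \<and> \<theta> \<cdot> \<rho> Y = j)"
    by (rule bchoice) (use localize_step in blast)
  then obtain nx where "\<forall>Y \<in> Ob T. \<exists>j. ar j Y (nx Y) \<and> nx Y \<in> Loc U T {Y} \<and>
      cone_in (Loc U T (pieces A Y)) j Y (nx Y) \<and> (\<forall>(d, \<rho>) \<in> A. \<exists>\<theta>. ar \<theta> (susp T d Y) (nx Y) \<and> \<theta> \<cdot> \<rho> Y = j)"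
    by blast
  from bchoice[OF this] obtain jn where nx: "\<And>Y. Y \<in> Ob T \<Longrightarrow> ar (jn Y) Y (nx Y)"
      "\<And>Y. Y \<in> Ob T \<Longrightarrow> nx Y \<in> Loc U T {Y}"
      "\<And>Y. Y \<in> Ob T \<Longrightarrow> cone_in (Loc U T (pieces A Y)) (jn Y) Y (nx Y)"
      "\<And>Y d \<rho>. \<lbrakk>Y \<in> Ob T; (d, \<rho>) \<in> A\<rbrakk> \<Longrightarrow> \<exists>\<theta>. ar \<theta> (susp T d Y) (nx Y) \<and> \<theta> \<cdot> \<rho> Y = jn Y"
    by fastforce
  define Xn where "Xn n = (nx ^^ n) X" for n
  define j where "j n = jn (Xn n)" for n
  have XnL: "Xn n \<in> Loc U T {X}" for n
  proof (induction n)
    case 0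
    then show ?case using Loc_incl by (auto simp: Xn_def)
  next
    case (Suc n)
    then have "Xn n \<in> Ob T" using loc_Ob[OF LX] by blast
    then show ?case using nx(2)[of "Xn n"] Loc_least[OF LX, of "{Xn n}"] Suc by (auto simp: Xn_def)
  qed
  have XnO: "Xn n \<in> Ob T" for n using loc_Ob[OF LX XnL] .
  have j: "ar (j n) (Xn n) (Xn (Suc n))" for n using nx(1)[OF XnO[of n]] by (simp add: j_def Xn_def)
  have \<theta>: "\<exists>\<theta>. ar \<theta> (susp T d (Xn n)) (Xn (Suc n)) \<and> \<theta> \<cdot> \<rho> (Xn n) = j n" if "(d, \<rho>) \<in> A" for d \<rho> n
    using nx(4)[OF XnO[of n] that] by (simp add: j_def Xn_def)
  have "pieces A (Xn n) \<subseteq> pieces A X" for n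
    using Loc_subset[of "{X}" "{Xn n}"] XnL[of n] XO by (auto simp: pieces_def)
  then have "Loc U T (pieces A (Xn n)) \<subseteq> Loc U T (pieces A X)" for n
    by (intro Loc_least[OF P]) (use Loc_incl in blast)
  then have cj: "cone_in (Loc U T (pieces A X)) (j n) (Xn n) (Xn (Suc n))" for n
  proof -
    have "cone_in (Loc U T (pieces A (Xn n))) (j n) (Xn n) (Xn (Suc n))"
      using nx(3)[OF XnO[of n]] by (simp add: j_def Xn_def)
    then show ?thesis unfolding cone_in_def using \<open>Loc U T (pieces A (Xn n)) \<subseteq> Loc U T (pieces A X)\<close> by blast
  qed
  show ?thesis
  proof (rule hocolim[of j Xn, OF j])
    fix i H
    assume i: "\<And>n. ar (i n) (Xn n) H" and ij: "\<And>n. i (Suc n) \<cdot> j n = i n"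
      and HL: "\<And>L. \<lbrakk>localizing U T L; \<And>n. Xn n \<in> L\<rbrakk> \<Longrightarrow> H \<in> L"
      and surj: "\<And>C x. \<lbrakk>compact_object U T C; ar x C H\<rbrakk> \<Longrightarrow> \<exists>n y. ar y C (Xn n) \<and> x = i n \<cdot> y"
      and inj: "\<And>C x n. \<lbrakk>compact_object U T C; ar x C (Xn n); i n \<cdot> x = zr C H\<rbrakk> \<Longrightarrow>
          \<exists>k. seq_map Xn j n k \<cdot> x = zr C (Xn (n + k))"
      and cone: "\<And>M. \<lbrakk>localizing U T M; \<And>n. cone_in M (j n) (Xn n) (Xn (Suc n))\<rbrakk> \<Longrightarrow> cone_in M (i 0) (Xn 0) H"
    have HO: "H \<in> Ob T" using ar_Ob(2)[OF i] .
    have i0: "ar (i 0) X H" using i[of 0] by (simp add: Xn_def)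
    have jj: "ar (seq_map Xn j n k) (Xn n) (Xn (n + k))" for n k using jj_ar[of j Xn, OF j] .
    have ijj: "i (n + k) \<cdot> seq_map Xn j n k = i n" for n k
    proof (induction k)
      case 0
      then show ?case using cmp_id[OF i] by simp
    next
      case (Suc k)
      then show ?case using cmp_assoc[OF i[of "Suc (n + k)"] j[of "n + k"] jj[of n k]] ij[of "n + k"] by simp
    qed
    have inv: "\<rho> H \<in> isos T H (susp T d H)" if a: "(d, \<rho>) \<in> A" for d \<rho>
    proof (rule iso_if_compact)
      have c: "cen d \<rho>" using A_cen[OF a] .
      show \<rho>H: "ar (\<rho> H) H (susp T d H)" using cen_ar[OF c HO] .
      fix C x assume C: "compact_object U T C"
      have CO: "C \<in> Ob T" using compact_Ob[OF C] .
      define C' where "C' = susp T (- d) C"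
      have C': "compact_object U T C'" "C' \<in> Ob T" "susp T d C' = C"
        using compact_susp[OF C] susp_Ob[OF CO] susp_neg(2)[OF CO] by (auto simp: C'_def)
      {
        assume x: "ar x C H" and z: "\<rho> H \<cdot> x = zr C (susp T d H)"
        obtain n y where y: "ar y C (Xn n)" "x = i n \<cdot> y" using surj[OF C x] by blast
        have \<rho>X: "ar (\<rho> (Xn n)) (Xn n) (susp T d (Xn n))" using cen_ar[OF c XnO] .
        have ry: "ar (\<rho> (Xn n) \<cdot> y) C (susp T d (Xn n))" using ar_cmp[OF \<rho>X y(1)] .
        \<comment> \<open>Desuspended by \<open>d\<close>, the product of the operator with
          \<open>y\<close> ends in \<open>Xn n\<close> and starts in a compact object, as
          \<open>inj\<close> requires.\<close>
        define y' where "y' = suspM T (- d) (\<rho> (Xn n) \<cdot> y)"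
        have y': "ar y' C' (Xn n)" "suspM T d y' = \<rho> (Xn n) \<cdot> y"
          using suspM_ar[OF ry, of "- d"] susp_neg(1)[OF XnO] suspM_neg(2)[OF ar_Arr[OF ry]]
          by (simp_all add: y'_def C'_def)
        have "suspM T d (i n \<cdot> y') = suspM T d (i n) \<cdot> (\<rho> (Xn n) \<cdot> y)"
          using suspM_cmp[OF i y'(1)] y'(2) by simp
        also have "\<dots> = (\<rho> H \<cdot> i n) \<cdot> y"
          using cmp_assoc[OF suspM_ar[OF i] \<rho>X y(1)] cen_nat[OF c i] by simp
        also have "\<dots> = suspM T d (zr C' H)"
          using cmp_assoc[OF \<rho>H i y(1)] y(2) z suspM_zr[OF C'(2) HO] C'(3) by simp
        finally have "i n \<cdot> y' = zr C' H"
          using suspM_eq ar_Arr[OF ar_cmp[OF i y'(1)]] ar_Arr[OF ar_zr[OF C'(2) HO]] by blast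
        then obtain k where k: "seq_map Xn j n k \<cdot> y' = zr C' (Xn (n + k))" using inj[OF C'(1) y'(1)] by blast
        define m where "m = n + k"
        have e: "ar (seq_map Xn j n k) (Xn n) (Xn m)" using jj by (simp add: m_def)
        have \<rho>m: "ar (\<rho> (Xn m)) (Xn m) (susp T d (Xn m))" using cen_ar[OF c XnO] .
        have ey: "ar (seq_map Xn j n k \<cdot> y) C (Xn m)" using ar_cmp[OF e y(1)] .
        have "\<rho> (Xn m) \<cdot> (seq_map Xn j n k \<cdot> y) = suspM T d (seq_map Xn j n k) \<cdot> (\<rho> (Xn n) \<cdot> y)"
          using cmp_assoc[OF \<rho>m e y(1)] cen_nat[OF c e] cmp_assoc[OF suspM_ar[OF e] \<rho>X y(1)] by simp
        also have "\<dots> = zr C (susp T d (Xn m))"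
          using suspM_cmp[OF e y'(1), of d] y'(2) k suspM_zr[OF C'(2) XnO, of d m] C'(3) by (simp add: m_def)
        finally have 0: "\<rho> (Xn m) \<cdot> (seq_map Xn j n k \<cdot> y) = zr C (susp T d (Xn m))" .
        obtain \<theta>' where \<theta>': "ar \<theta>' (susp T d (Xn m)) (Xn (Suc m))" "\<theta>' \<cdot> \<rho> (Xn m) = j m"
          using \<theta>[OF a] by blast
        \<comment> \<open>The operator kills the image of \<open>y\<close> in \<open>Xn m\<close>,
          and the next transition map factors through the operator.\<close>
        have "j m \<cdot> (seq_map Xn j n k \<cdot> y) = zr C (Xn (Suc m))"
          using cmp_assoc[OF \<theta>'(1) \<rho>m ey] \<theta>'(2) 0 cmp_zr[OF \<theta>'(1) CO] by simp
        then have "i m \<cdot> (seq_map Xn j n k \<cdot> y) = zr C H"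
          using cmp_assoc[OF i[of "Suc m"] j[of m] ey] ij[of m] cmp_zr[OF i CO] by simp
        then show "x = zr C H"
          using y(2) ijj[of n k] cmp_assoc[OF i[of m] e y(1)] by (simp add: m_def)
      next
        assume x: "ar x C (susp T d H)"
        define x' where "x' = suspM T (- d) x"
        have x': "ar x' C' H" "suspM T d x' = x"
          using suspM_ar[OF x, of "- d"] susp_neg(1)[OF HO] suspM_neg(2)[OF ar_Arr[OF x]]
          by (simp_all add: x'_def C'_def)
        obtain n y where y: "ar y C' (Xn n)" "x' = i n \<cdot> y" using surj[OF C'(1) x'(1)] by blast
        have \<rho>X: "ar (\<rho> (Xn n)) (Xn n) (susp T d (Xn n))" using cen_ar[OF c XnO] .
        obtain \<theta>' where \<theta>': "ar \<theta>' (susp T d (Xn n)) (Xn (Suc n))" "\<theta>' \<cdot> \<rho> (Xn n) = j n"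
          using \<theta>[OF a] by blast
        define f where "f = i (Suc n) \<cdot> \<theta>'"
        have f: "ar f (susp T d (Xn n)) H" unfolding f_def using ar_cmp[OF i \<theta>'(1)] .
        have f\<rho>: "f \<cdot> \<rho> (Xn n) = i n" unfolding f_def using cmp_assoc[OF i \<theta>'(1) \<rho>X] \<theta>'(2) ij by simp
        define H' where "H' = susp T (- d) H"
        have H'O: "H' \<in> Ob T" "susp T d H' = H" using susp_Ob[OF HO] susp_neg(2)[OF HO] by (auto simp: H'_def)
        define f' where "f' = suspM T (- d) f"
        have f': "ar f' (Xn n) H'" "suspM T d f' = f"
          using suspM_ar[OF f, of "- d"] susp_neg(1)[OF XnO] suspM_neg(2)[OF ar_Arr[OF f]]
          by (simp_all add: f'_def H'_def)
        have \<rho>H': "ar (\<rho> H') H' H" using cen_ar[OF c H'O(1)] H'O(2) by simp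
        have fy: "ar (f' \<cdot> y) C' H'" using ar_cmp[OF f'(1) y(1)] .
        \<comment> \<open>So far \<open>i n\<close> factors with the operator on the source side;
          naturality moves the operator to the target side, where it exhibits \<open>x\<close> as a
          multiple.\<close>
        have "i n = \<rho> H' \<cdot> f'" using f\<rho> cen_nat[OF c f'(1)] f'(2) by simp
        then have "x' = \<rho> H' \<cdot> (f' \<cdot> y)" using y(2) cmp_assoc[OF \<rho>H' f'(1) y(1)] by simp
        then have "x = \<rho> H \<cdot> suspM T d (f' \<cdot> y)"
          using x'(2) suspM_cmp[OF \<rho>H' fy, of d] cen_susp[OF c H'O(1), of d] H'O(2) by simp
        moreover have "ar (suspM T d (f' \<cdot> y)) C H" using suspM_ar[OF fy, of d] C'(3) H'O(2) by simp
        ultimately show "\<exists>z. ar z C H \<and> x = \<rho> H \<cdot> z" by blast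
      }
    qed
    obtain f h G where t: "tri f (i 0) h G X H" using tri_fibre[OF i0] .
    have "cone_in (Loc U T (pieces A X)) (i 0) X H" using cone[OF P cj] by (simp add: Xn_def)
    then have "Susp T G \<in> Loc U T (pieces A X)" using cone_in_tri[OF P _ tri_rot[OF t]] by blast
    then have "G \<in> Loc U T (pieces A X)" using loc_Susp[OF P tri_Ob(1)[OF t]] by blast
    moreover have "H \<in> inv_set A" using HO inv by (auto simp: inv_set_def)
    ultimately show thesis using that[OF t HL[OF LX XnL]] by blast
  qed
qed

end

end

section \<open>Torsion for a multiplicatively closed set of central operators\<close>

context cg_category
begin

definition mult_central :: "(int \<times> ('o \<Rightarrow> 'm)) set \<Rightarrow> bool" where
  "mult_central A \<longleftrightarrow> A \<noteq> {} \<and> small U A \<and> (\<forall>(d, \<rho>) \<in> A. cen d \<rho>) \<and>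
    (\<forall>(d, \<rho>) \<in> A. \<forall>(e, \<tau>) \<in> A. (e + d, center_mult T d \<tau> \<rho>) \<in> A)"

definition tors where
  "tors A = {Y \<in> Ob T. \<forall>C x. compact_object U T C \<longrightarrow> ar x C Y \<longrightarrow> (\<exists>(d, \<rho>) \<in> A. \<rho> Y \<cdot> x = zr C (susp T d Y))}"

lemma mult_centralI:
  assumes "A \<noteq> {}" "small U A" "\<And>d \<rho>. (d, \<rho>) \<in> A \<Longrightarrow> cen d \<rho>"
    and "\<And>d \<rho> e \<tau>. \<lbrakk>(d, \<rho>) \<in> A; (e, \<tau>) \<in> A\<rbrakk> \<Longrightarrow> (e + d, center_mult T d \<tau> \<rho>) \<in> A"
  shows "mult_central A"
  using assms unfolding mult_central_def by blast

lemma tors_Ob: "Y \<in> tors A \<Longrightarrow> Y \<in> Ob T"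
  by (simp add: tors_def)

lemma torsD:
  assumes "Y \<in> tors A" "compact_object U T C" "ar x C Y"
  obtains d \<rho> where "(d, \<rho>) \<in> A" "\<rho> Y \<cdot> x = zr C (susp T d Y)"
  using assms unfolding tors_def by blast

lemma torsI:
  assumes "Y \<in> Ob T"
    and "\<And>C x. \<lbrakk>compact_object U T C; ar x C Y\<rbrakk> \<Longrightarrow> \<exists>d \<rho>. (d, \<rho>) \<in> A \<and> \<rho> Y \<cdot> x = zr C (susp T d Y)"
  shows "Y \<in> tors A"
  using assms unfolding tors_def by blast

lemma center_mult_ap: "X \<in> Ob T \<Longrightarrow> center_mult T d \<tau> \<rho> X = \<tau> (susp T d X) \<cdot> \<rho> X"
  by (simp add: center_mult_def)

text \<open>By naturality the product may be evaluated with either factor first, so it kills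
  whatever one of the factors kills.\<close>

lemma central_kill:
  assumes c: "cen d \<rho>" "cen e \<tau>" and x: "ar x C Y"
    and z: "\<rho> Y \<cdot> x = zr C (susp T d Y) \<or> \<tau> Y \<cdot> x = zr C (susp T e Y)"
  shows "center_mult T d \<tau> \<rho> Y \<cdot> x = zr C (susp T (e + d) Y)"
proof -
  have O: "C \<in> Ob T" "Y \<in> Ob T" using ar_Ob[OF x] by auto
  have \<rho>: "ar (\<rho> Y) Y (susp T d Y)" and \<tau>: "ar (\<tau> Y) Y (susp T e Y)" using cen_ar c O by auto
  have \<tau>\<rho>: "ar (\<tau> (susp T d Y)) (susp T d Y) (susp T (e + d) Y)"
    using cen_ar[OF c(2) susp_Ob[OF O(2)], of d] susp_add[OF O(2)] by simp
  have s\<rho>: "ar (suspM T e (\<rho> Y)) (susp T e Y) (susp T (e + d) Y)"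
    using suspM_ar[OF \<rho>, of e] susp_add[OF O(2)] by simp
  have "center_mult T d \<tau> \<rho> Y \<cdot> x = \<tau> (susp T d Y) \<cdot> (\<rho> Y \<cdot> x)"
    using center_mult_ap[OF O(2)] cmp_assoc[OF \<tau>\<rho> \<rho> x] by simp
  moreover have "center_mult T d \<tau> \<rho> Y \<cdot> x = suspM T e (\<rho> Y) \<cdot> (\<tau> Y \<cdot> x)"
    using center_mult_ap[OF O(2)] cen_nat[OF c(2) \<rho>] cmp_assoc[OF s\<rho> \<tau> x] by simp
  ultimately show ?thesis using z cmp_zr[OF \<tau>\<rho> O(1)] cmp_zr[OF s\<rho> O(1)] by auto
qed

text \<open>Closure of the complement under coproducts makes localization preserve coproducts. The
  clause on \<open>Loc U T {X}\<close> is what later puts \<open>Gamma_prime\<close> into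
  \<open>Loc U T {X}\<close>.\<close>

definition smashing where
  "smashing S \<longleftrightarrow> localizing U T S \<and> localizing U T (rorth S) \<and>
    (\<forall>X \<in> Ob T. \<exists>f g h G L. tri f g h G X L \<and> G \<in> S \<and> G \<in> Loc U T {X} \<and> L \<in> rorth S)"

context
  fixes A :: "(int \<times> ('o \<Rightarrow> 'm)) set"
  assumes A: "mult_central A"
begin

lemma A_cen: "(d, \<rho>) \<in> A \<Longrightarrow> cen d \<rho>"
  using A unfolding mult_central_def by blast

lemma A_small: "small U A"
  using A unfolding mult_central_def by blast

lemma A_mult: "\<lbrakk>(d, \<rho>) \<in> A; (e, \<tau>) \<in> A\<rbrakk> \<Longrightarrow> (e + d, center_mult T d \<tau> \<rho>) \<in> A"
  using A unfolding mult_central_def by blast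

lemma A_ex: obtains d \<rho> where "(d, \<rho>) \<in> A"
  using A unfolding mult_central_def by auto

text \<open>Closure of \<open>A\<close> under products serves triangles and coproducts. For a
  triangle, one operator makes \<open>x\<close> lift to the middle term and another kills the lift.
  For a coproduct, a product of operators kills the sum of finitely many components.\<close>

lemma tors_localizing: "localizing U T (tors A)"
proof (rule localizingI)
  show "tors A \<subseteq> Ob T" using tors_Ob by blast
  show "Z \<in> tors A" if Z: "is_zero T Z" for Z
  proof (rule torsI[OF is_zero_Ob[OF Z]])
    fix C x assume C: "compact_object U T C" and x: "ar x C Z"
    obtain d \<rho> where a: "(d, \<rho>) \<in> A" using A_ex .
    have "\<rho> Z \<cdot> x = zr C (susp T d Z)"
      using ar_zero_cod[OF Z x] cmp_zr[OF cen_ar[OF A_cen[OF a] is_zero_Ob[OF Z]] compact_Ob[OF C]] by simp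
    then show "\<exists>d \<rho>. (d, \<rho>) \<in> A \<and> \<rho> Z \<cdot> x = zr C (susp T d Z)" using a by blast
  qed
  have \<rho>S: "\<rho> (Susp T Y) \<cdot> SuspM T k = zr (Susp T C) (susp T d (Susp T Y)) \<longleftrightarrow> \<rho> Y \<cdot> k = zr C (susp T d Y)"
    if a: "(d, \<rho>) \<in> A" and k: "ar k C Y" for d \<rho> k C Y
  proof -
    have O: "C \<in> Ob T" "Y \<in> Ob T" using ar_Ob[OF k] by auto
    have c: "cen d \<rho>" using A_cen[OF a] .
    have \<rho>Y: "ar (\<rho> Y) Y (susp T d Y)" using cen_ar[OF c O(2)] .
    have e: "susp T d (Susp T Y) = Susp T (susp T d Y)"
      using ar_unique[OF cen_ar[OF c Susp_Ob[OF O(2)]]] SuspM_ar[OF \<rho>Y] cen_Susp[OF c O(2)] by metis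
    have "\<rho> (Susp T Y) \<cdot> SuspM T k = SuspM T (\<rho> Y \<cdot> k)" using cen_Susp[OF c O(2)] SuspM_cmp[OF \<rho>Y k] by simp
    moreover have "zr (Susp T C) (susp T d (Susp T Y)) = SuspM T (zr C (susp T d Y))"
      using SuspM_zr[OF O(1) susp_Ob[OF O(2)]] e by simp
    ultimately show ?thesis using SuspM_eq[OF _ ar_cmp[OF \<rho>Y k] ar_zr[OF O(1) susp_Ob[OF O(2)]]] by auto
  qed
  have up: "Susp T Y \<in> tors A" if Y: "Y \<in> tors A" for Y
  proof (rule torsI[OF Susp_Ob[OF tors_Ob[OF Y]]])
    fix C x assume C: "compact_object U T C" and x: "ar x C (Susp T Y)"
    obtain C' where C': "compact_object U T C'" "Susp T C' = C" using compact_pred[OF C] .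
    obtain k where k: "ar k C' Y" "SuspM T k = x"
      using SuspM_full[of x C' Y] x C' compact_Ob tors_Ob[OF Y] by blast
    obtain d \<rho> where "(d, \<rho>) \<in> A" "\<rho> Y \<cdot> k = zr C' (susp T d Y)" using torsD[OF Y C'(1) k(1)] .
    then show "\<exists>d \<rho>. (d, \<rho>) \<in> A \<and> \<rho> (Susp T Y) \<cdot> x = zr C (susp T d (Susp T Y))"
      using \<rho>S[OF _ k(1)] k(2) C'(2) by metis
  qed
  show "Y \<in> tors A \<longleftrightarrow> Susp T Y \<in> tors A" if YO: "Y \<in> Ob T" for Y
  proof
    assume S: "Susp T Y \<in> tors A"
    show "Y \<in> tors A"
    proof (rule torsI[OF YO])
      fix C x assume C: "compact_object U T C" and x: "ar x C Y"
      obtain d \<rho> where "(d, \<rho>) \<in> A" "\<rho> (Susp T Y) \<cdot> SuspM T x = zr (Susp T C) (susp T d (Susp T Y))"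
        using torsD[OF S compact_Susp[OF C] SuspM_ar[OF x]] .
      then show "\<exists>d \<rho>. (d, \<rho>) \<in> A \<and> \<rho> Y \<cdot> x = zr C (susp T d Y)" using \<rho>S[OF _ x] by blast
    qed
  qed (rule up)
  show "Z \<in> tors A" if t: "tri f g h X Y Z" and X: "X \<in> tors A" and Y: "Y \<in> tors A" for f g h X Y Z
  proof (rule torsI[OF tri_Ob(3)[OF t]])
    fix C x assume C: "compact_object U T C" and x: "ar x C Z"
    have O: "X \<in> Ob T" "Y \<in> Ob T" "Z \<in> Ob T" "C \<in> Ob T" using tri_Ob[OF t] compact_Ob[OF C] by auto
    have g: "ar g Y Z" and h: "ar h Z (Susp T X)" using tri_ar[OF t] by auto
    obtain d \<rho> where a: "(d, \<rho>) \<in> A" "\<rho> (Susp T X) \<cdot> (h \<cdot> x) = zr C (susp T d (Susp T X))"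
      using torsD[OF up[OF X] C ar_cmp[OF h x]] .
    have c: "cen d \<rho>" using A_cen[OF a(1)] .
    have \<rho>Z: "ar (\<rho> Z) Z (susp T d Z)" using cen_ar[OF c O(3)] .
    \<comment> \<open>The operator shifts degree, so the product with \<open>x\<close> is
      desuspended in order to be a map into \<open>Z\<close>, from which it can be lifted.\<close>
    define C' where "C' = susp T (- d) C"
    have C': "compact_object U T C'" "C' \<in> Ob T" "susp T d C' = C"
      using compact_susp[OF C] susp_Ob[OF O(4)] susp_neg(2)[OF O(4)] by (auto simp: C'_def)
    have \<rho>x: "ar (\<rho> Z \<cdot> x) C (susp T d Z)" using ar_cmp[OF \<rho>Z x] .
    obtain x' where x': "ar x' C' Z" "suspM T d x' = \<rho> Z \<cdot> x"
      using suspM_full[of "\<rho> Z \<cdot> x" d C' Z] \<rho>x C' O by metis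
    have "suspM T d (h \<cdot> x') = suspM T d h \<cdot> (\<rho> Z \<cdot> x)" using suspM_cmp[OF h x'(1)] x'(2) by simp
    also have "\<dots> = \<rho> (Susp T X) \<cdot> (h \<cdot> x)"
      using cmp_assoc[OF suspM_ar[OF h] \<rho>Z x] cen_nat[OF c h] cmp_assoc[OF cen_ar[OF c Susp_Ob[OF O(1)]] h x] by simp
    also have "\<dots> = suspM T d (zr C' (Susp T X))" using a(2) suspM_zr[OF C'(2) Susp_Ob[OF O(1)]] C'(3) by simp
    finally have "h \<cdot> x' = zr C' (Susp T X)"
      using suspM_eq ar_Arr[OF ar_cmp[OF h x'(1)]] ar_Arr[OF ar_zr[OF C'(2) Susp_Ob[OF O(1)]]] by blast
    then obtain y where y: "ar y C' Y" "x' = g \<cdot> y" using tri_weak_ker2[OF t x'(1)] by metis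
    obtain e \<tau> where b: "(e, \<tau>) \<in> A" "\<tau> Y \<cdot> y = zr C' (susp T e Y)" using torsD[OF Y C'(1) y(1)] .
    have c': "cen e \<tau>" using A_cen[OF b(1)] .
    have \<tau>: "ar (\<tau> Y) Y (susp T e Y)" "ar (\<tau> Z) Z (susp T e Z)" using cen_ar[OF c'] O by auto
    have "\<tau> Z \<cdot> x' = suspM T e g \<cdot> (\<tau> Y \<cdot> y)"
      using y(2) cmp_assoc[OF \<tau>(2) g y(1)] cen_nat[OF c' g] cmp_assoc[OF suspM_ar[OF g] \<tau>(1) y(1)] by simp
    then have z: "\<tau> Z \<cdot> x' = zr C' (susp T e Z)" using b(2) cmp_zr[OF suspM_ar[OF g] C'(2)] by simp
    have "\<tau> (susp T d Z) \<cdot> (\<rho> Z \<cdot> x) = suspM T d (\<tau> Z \<cdot> x')"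
      using cen_susp[OF c' O(3), of d] suspM_cmp[OF \<tau>(2) x'(1)] x'(2) by simp
    also have "\<dots> = zr C (susp T d (susp T e Z))" using z suspM_zr[OF C'(2) susp_Ob[OF O(3)]] C'(3) by simp
    also have "\<dots> = zr C (susp T (e + d) Z)" using susp_add[OF O(3), of d e] by (simp add: add.commute)
    finally have "center_mult T d \<tau> \<rho> Z \<cdot> x = zr C (susp T (e + d) Z)"
      using center_mult_ap[OF O(3)] cmp_assoc[OF cen_ar[OF c' susp_Ob[OF O(3)]] \<rho>Z x] by simp
    then show "\<exists>d \<rho>. (d, \<rho>) \<in> A \<and> \<rho> Z \<cdot> x = zr C (susp T d Z)" using A_mult[OF a(1) b(1)] by blast
  qed
  show "S \<in> tors A" if I: "small U I" and S: "is_coproduct T I X S \<iota>" and X: "\<And>i. i \<in> I \<Longrightarrow> X i \<in> tors A"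
    for I and X :: "'u \<Rightarrow> 'o" and S \<iota>
  proof (rule torsI[OF coprod_Ob[OF S]])
    have SO: "S \<in> Ob T" using coprod_Ob[OF S] .
    fix C x assume C: "compact_object U T C" and x: "ar x C S"
    have CO: "C \<in> Ob T" using compact_Ob[OF C] .
    let ?Q = "\<lambda>x. \<exists>d \<rho>. (d, \<rho>) \<in> A \<and> \<rho> S \<cdot> x = zr C (susp T d S)"
    show "?Q x"
    proof (rule compact_induct[OF C I S x, where P = ?Q])
      obtain d \<rho> where a: "(d, \<rho>) \<in> A" using A_ex .
      then show "?Q (zr C S)" using cmp_zr[OF cen_ar[OF A_cen[OF a] SO] CO] by blast
    next
      fix x y assume xy: "ar x C S" "ar y C S" "?Q x" "?Q y"
      then obtain d \<rho> e \<tau> where a: "(d, \<rho>) \<in> A" "\<rho> S \<cdot> x = zr C (susp T d S)"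
        "(e, \<tau>) \<in> A" "\<tau> S \<cdot> y = zr C (susp T e S)" by blast
      let ?m = "center_mult T d \<tau> \<rho> S"
      have m: "ar ?m S (susp T (e + d) S)" using cen_ar[OF A_cen[OF A_mult[OF a(1,3)]] SO] .
      have "?m \<cdot> x = zr C (susp T (e + d) S)" "?m \<cdot> y = zr C (susp T (e + d) S)"
        using central_kill[OF A_cen[OF a(1)] A_cen[OF a(3)]] xy(1,2) a(2,4) by blast+
      then have "?m \<cdot> (x \<otimes>\<^bsub>Hom T C S\<^esub> y) = zr C (susp T (e + d) S)"
        using cmp_pl[OF m xy(1,2)] group.is_monoid[OF ar_group[OF CO susp_Ob[OF SO]]]
        by (simp add: monoid.l_one monoid.one_closed)
      then show "?Q (x \<otimes>\<^bsub>Hom T C S\<^esub> y)" using A_mult[OF a(1,3)] by blast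
    next
      fix i f assume i: "i \<in> I" and f: "ar f C (X i)"
      obtain d \<rho> where a: "(d, \<rho>) \<in> A" "\<rho> (X i) \<cdot> f = zr C (susp T d (X i))" using torsD[OF X[OF i] C f] .
      have c: "cen d \<rho>" using A_cen[OF a(1)] .
      have \<iota>: "ar (\<iota> i) (X i) S" using coprod_ar[OF S i] .
      have "\<rho> S \<cdot> (\<iota> i \<cdot> f) = suspM T d (\<iota> i) \<cdot> (\<rho> (X i) \<cdot> f)"
        using cmp_assoc[OF cen_ar[OF c SO] \<iota> f] cen_nat[OF c \<iota>]
          cmp_assoc[OF suspM_ar[OF \<iota>] cen_ar[OF c ar_Ob(1)[OF \<iota>]] f] by simp
      then have "\<rho> S \<cdot> (\<iota> i \<cdot> f) = zr C (susp T d S)" using a(2) cmp_zr[OF suspM_ar[OF \<iota>] CO] by simp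
      then show "?Q (\<iota> i \<cdot> f)" using a(1) by blast
    qed
  qed
qed

lemma pieces_tors: "X \<in> Ob T \<Longrightarrow> pieces A X \<subseteq> tors A"
proof
  fix F assume XO: "X \<in> Ob T" and F: "F \<in> pieces A X"
  have FO: "F \<in> Ob T" using pieces_Ob[OF A_cen A_small XO] F by blast
  obtain d \<rho> where a: "(d, \<rho>) \<in> A" "\<rho> (susp T d F) \<cdot> \<rho> F = zr F (susp T d (susp T d F))"
    using F unfolding pieces_def by blast
  show "F \<in> tors A"
  proof (rule torsI[OF FO])
    fix C x assume C: "compact_object U T C" and x: "ar x C F"
    have "center_mult T d \<rho> \<rho> F \<cdot> x = zr C (susp T (d + d) F)"
      unfolding center_mult_ap[OF FO] a(2) susp_add[OF FO] by (rule zr_cmp[OF x susp_Ob[OF susp_Ob[OF FO]]])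
    then show "\<exists>d \<rho>. (d, \<rho>) \<in> A \<and> \<rho> F \<cdot> x = zr C (susp T d F)" using A_mult[OF a(1) a(1)] by blast
  qed
qed

lemma inv_mono:
  assumes c: "(d, \<rho>) \<in> A" and N: "N \<in> inv_set A" and k: "ar k Y N" and z: "\<rho> N \<cdot> k = zr Y (susp T d N)"
  shows "k = zr Y N"
proof -
  have NO: "N \<in> Ob T" using ar_Ob[OF k] by blast
  have i: "\<rho> N \<in> isos T N (susp T d N)" using N c by (auto simp: inv_set_def)
  obtain s where s: "ar (\<rho> N) N (susp T d N)" "ar s (susp T d N) N" "s \<cdot> \<rho> N = Idt T N"
    using isosE[OF i NO susp_Ob[OF NO]] by blast
  then have "k = s \<cdot> (\<rho> N \<cdot> k)" using cmp_assoc[OF s(2,1) k] id_cmp[OF k] by simp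
  then show ?thesis using z cmp_zr[OF s(2) ar_Ob(1)[OF k]] by simp
qed

lemma inv_susp:
  assumes N: "N \<in> inv_set A" shows "susp T n N \<in> inv_set A"
proof -
  have NO: "N \<in> Ob T" using N by (simp add: inv_set_def)
  have "\<rho> (susp T n N) \<in> isos T (susp T n N) (susp T d (susp T n N))" if a: "(d, \<rho>) \<in> A" for d \<rho>
  proof -
    have i: "\<rho> N \<in> isos T N (susp T d N)" using N a by (auto simp: inv_set_def)
    obtain s where s: "ar (\<rho> N) N (susp T d N)" "ar s (susp T d N) N" "s \<cdot> \<rho> N = Idt T N" "\<rho> N \<cdot> s = Idt T (susp T d N)"
      using isosE[OF i NO susp_Ob[OF NO]] by blast
    have e: "susp T n (susp T d N) = susp T d (susp T n N)"
      using susp_add[OF NO, of n d] susp_add[OF NO, of d n] by (simp add: add.commute)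
    have "suspM T n (\<rho> N) \<in> isos T (susp T n N) (susp T n (susp T d N))"
      using isosI[OF suspM_ar[OF s(1)] suspM_ar[OF s(2)]] suspM_cmp[OF s(2,1)] suspM_cmp[OF s(1,2)]
        s(3,4) suspM_Idt NO susp_Ob[OF NO] by metis
    then show ?thesis using cen_susp[OF A_cen[OF a] NO, of n] e by simp
  qed
  then show ?thesis using susp_Ob[OF NO] by (auto simp: inv_set_def)
qed

text \<open>An object of \<open>tors A\<close> need not be killed by a single operator, so a map
  from it to \<open>N\<close> cannot be cancelled directly. Localizing \<open>s\<close> itself gives
  a term that is both torsion and has all operators invertible, hence is zero. So \<open>s\<close>
  is built from pieces, and a map from a piece to \<open>N\<close> is killed by the square of one
  invertible operator.\<close>

lemma inv_set_orth:
  assumes N: "N \<in> inv_set A"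
  shows "N \<in> rorth (tors A)"
proof -
  have NO: "N \<in> Ob T" using N by (simp add: inv_set_def)
  have "Susp T Z \<in> inv_set A \<longleftrightarrow> Z \<in> inv_set A" if "Z \<in> Ob T" for Z
    using inv_susp[of Z 1] inv_susp[of "Susp T Z" "- 1"] susp_1[OF that] susp_neg(1)[OF that, of 1] by metis
  then have l: "localizing U T (lorth (inv_set A))" by (intro lorth_localizing) (auto simp: inv_set_def)
  have p: "pieces A X \<subseteq> lorth (inv_set A)" if XO: "X \<in> Ob T" for X
  proof
    fix F assume F: "F \<in> pieces A X"
    have FO: "F \<in> Ob T" using pieces_Ob[OF A_cen A_small XO] F by blast
    obtain d \<rho> where a: "(d, \<rho>) \<in> A" "\<rho> (susp T d F) \<cdot> \<rho> F = zr F (susp T d (susp T d F))"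
      using F unfolding pieces_def by blast
    have c: "cen d \<rho>" using A_cen[OF a(1)] .
    show "F \<in> lorth (inv_set A)"
      unfolding lorth_def
    proof (intro CollectI conjI ballI allI impI FO)
      fix M k assume M: "M \<in> inv_set A" and k: "ar k F M"
      have MO: "M \<in> Ob T" using ar_Ob[OF k] by blast
      have \<rho>F: "ar (\<rho> F) F (susp T d F)" and \<rho>M: "ar (\<rho> M) M (susp T d M)" using cen_ar[OF c] FO MO by auto
      have sk: "ar (suspM T d k) (susp T d F) (susp T d M)" using suspM_ar[OF k] .
      have \<rho>k: "ar (\<rho> M \<cdot> k) F (susp T d M)" using ar_cmp[OF \<rho>M k] .
      have "\<rho> (susp T d M) \<cdot> (\<rho> M \<cdot> k) = \<rho> (susp T d M) \<cdot> (suspM T d k \<cdot> \<rho> F)" using cen_nat[OF c k] by simp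
      also have "\<dots> = suspM T d (suspM T d k) \<cdot> (\<rho> (susp T d F) \<cdot> \<rho> F)"
        using cmp_assoc[OF cen_ar[OF c susp_Ob[OF MO]] sk \<rho>F] cen_nat[OF c sk]
          cmp_assoc[OF suspM_ar[OF sk] cen_ar[OF c susp_Ob[OF FO]] \<rho>F] by simp
      also have "\<dots> = zr F (susp T d (susp T d M))" using a(2) cmp_zr[OF suspM_ar[OF sk] FO] by simp
      finally have "\<rho> M \<cdot> k = zr F (susp T d M)" using inv_mono[OF a(1) inv_susp[OF M] \<rho>k] by blast
      then show "k = zr F M" using inv_mono[OF a(1) M k] by blast
    qed
  qed
  show ?thesis
    unfolding rorth_def
  proof (intro CollectI conjI ballI allI impI NO)
    fix s f assume s: "s \<in> tors A" and f: "ar f s N"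
    have sO: "s \<in> Ob T" using tors_Ob[OF s] .
    obtain u v w G L where t: "tri u v w G s L" "L \<in> Loc U T {s}" "G \<in> Loc U T (pieces A s)"
      and Li: "L \<in> inv_set A"
      using localize[OF A_cen A_small sO] .
    have LO: "L \<in> Ob T" using tri_Ob[OF t(1)] by blast
    have "Loc U T {s} \<subseteq> tors A" using Loc_least[OF tors_localizing] s by blast
    then have Lt: "L \<in> tors A" using t(2) by blast
    have "is_zero T L"
    proof (rule zero_if_compact[OF LO])
      fix C x assume "compact_object U T C" and x: "ar x C L"
      then obtain d \<rho> where "(d, \<rho>) \<in> A" "\<rho> L \<cdot> x = zr C (susp T d L)" using torsD[OF Lt] by blast
      then show "x = zr C L" using inv_mono[OF _ Li x] by blast
    qed
    then have "isos T G s \<noteq> {}" using tri_iso_if_zero[OF t(1)] by blast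
    moreover have "G \<in> lorth (inv_set A)" using Loc_least[OF l p[OF sO]] t(3) by blast
    ultimately have "s \<in> lorth (inv_set A)" using loc_iso[OF l _ sO] by blast
    then show "f = zr s N" using lorthD N f by blast
  qed
qed

text \<open>The fibre of \<open>\<rho> N\<close> is a piece of \<open>N\<close>, hence torsion.
  Orthogonality kills its map to \<open>N\<close> and the maps from its suspension to
  \<open>susp T d N\<close>, and then its identity.\<close>

lemma orth_inv_set:
  assumes N: "N \<in> rorth (tors A)"
  shows "N \<in> inv_set A"
proof -
  have NO: "N \<in> Ob T" using rorth_Ob[OF N] .
  have "\<rho> N \<in> isos T N (susp T d N)" if a: "(d, \<rho>) \<in> A" for d \<rho>
  proof -
    have c: "cen d \<rho>" using A_cen[OF a] .
    obtain u w F where t: "tri u (\<rho> N) w F N (susp T d N)" using tri_fibre[OF cen_ar[OF c NO]] .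
    have FO: "F \<in> Ob T" using tri_Ob[OF t] by blast
    have LN: "localizing U T (Loc U T {N})" using Loc_localizing NO by blast
    have NL: "N \<in> Loc U T {N}" using Loc_incl by blast
    have "F \<in> Loc U T {N}" using loc_tri(2)[OF LN t] NL loc_susp[OF LN NO] by blast
    then have "F \<in> pieces A N" using fibre_square_zero[OF c t] a by (auto simp: pieces_def)
    then have F: "F \<in> tors A" using pieces_tors[OF NO] by blast
    have u: "ar u F N" using tri_ar[OF t] by blast
    have "u \<cdot> Idt T F = zr F N" using rorthD[OF N F u] cmp_id[OF u] by simp
    then have "Idt T F = zr F F"
    proof (rule tri_mono[OF t ar_Idt[OF FO]])
      fix y assume "ar y (Susp T F) (susp T d N)"
      then show "y = zr (Susp T F) (susp T d N)"
        using rorthD[OF rorth_susp[OF tors_localizing N]] F loc_Susp[OF tors_localizing FO] by blast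
    qed
    then have "is_zero T F" using is_zeroI FO by blast
    then show ?thesis using tri_iso_if_zero'[OF t] by blast
  qed
  then show ?thesis using NO by (auto simp: inv_set_def)
qed

lemma inv_set_coprod:
  assumes S: "is_coproduct T I X S \<iota>" and X: "\<And>i. i \<in> I \<Longrightarrow> X i \<in> inv_set A"
  shows "S \<in> inv_set A"
proof -
  have SO: "S \<in> Ob T" using coprod_Ob[OF S] .
  have "\<rho> S \<in> isos T S (susp T d S)" if a: "(d, \<rho>) \<in> A" for d \<rho>
  proof -
    have c: "cen d \<rho>" using A_cen[OF a] .
    have \<iota>: "ar (\<iota> i) (X i) S" and XO: "X i \<in> Ob T" if "i \<in> I" for i
      using coprod_ar[OF S that] coprod_Ob'[OF S that] by auto
    have "\<exists>s. ar s (susp T d (X i)) (X i) \<and> s \<cdot> \<rho> (X i) = Idt T (X i) \<and> \<rho> (X i) \<cdot> s = Idt T (susp T d (X i))"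
      if i: "i \<in> I" for i
    proof -
      have "\<rho> (X i) \<in> isos T (X i) (susp T d (X i))" using X[OF i] a by (auto simp: inv_set_def)
      then show ?thesis using isosE[OF _ XO[OF i] susp_Ob[OF XO[OF i]]] by metis
    qed
    then obtain s where s: "\<And>i. i \<in> I \<Longrightarrow> ar (s i) (susp T d (X i)) (X i)"
      "\<And>i. i \<in> I \<Longrightarrow> s i \<cdot> \<rho> (X i) = Idt T (X i)" "\<And>i. i \<in> I \<Longrightarrow> \<rho> (X i) \<cdot> s i = Idt T (susp T d (X i))"
      by metis
    have S': "is_coproduct T I (\<lambda>i. susp T d (X i)) (susp T d S) (\<lambda>i. suspM T d (\<iota> i))" using coprod_susp[OF S] .
    obtain g where g: "ar g (susp T d S) S" "\<And>i. i \<in> I \<Longrightarrow> g \<cdot> suspM T d (\<iota> i) = \<iota> i \<cdot> s i"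
      using coprod_desc[OF S' SO, of "\<lambda>i. \<iota> i \<cdot> s i"] ar_cmp[OF \<iota> s(1)] by metis
    have \<rho>S: "ar (\<rho> S) S (susp T d S)" using cen_ar[OF c SO] .
    have "g \<cdot> \<rho> S = Idt T S"
    proof (rule coprod_eq[OF S ar_cmp[OF g(1) \<rho>S] ar_Idt[OF SO]])
      fix i assume i: "i \<in> I"
      have "(g \<cdot> \<rho> S) \<cdot> \<iota> i = (g \<cdot> suspM T d (\<iota> i)) \<cdot> \<rho> (X i)"
        using cmp_assoc[OF g(1) \<rho>S \<iota>[OF i]] cen_nat[OF c \<iota>[OF i]]
          cmp_assoc[OF g(1) suspM_ar[OF \<iota>[OF i]] cen_ar[OF c XO[OF i]]] by simp
      then show "(g \<cdot> \<rho> S) \<cdot> \<iota> i = Idt T S \<cdot> \<iota> i"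
        using g(2)[OF i] cmp_assoc[OF \<iota>[OF i] s(1)[OF i] cen_ar[OF c XO[OF i]]] s(2)[OF i]
          cmp_id[OF \<iota>[OF i]] id_cmp[OF \<iota>[OF i]] by simp
    qed
    moreover have "\<rho> S \<cdot> g = Idt T (susp T d S)"
    proof (rule coprod_eq[OF S' ar_cmp[OF \<rho>S g(1)] ar_Idt[OF susp_Ob[OF SO]]])
      fix i assume i: "i \<in> I"
      have s\<iota>: "ar (suspM T d (\<iota> i)) (susp T d (X i)) (susp T d S)" using suspM_ar[OF \<iota>[OF i]] .
      have "(\<rho> S \<cdot> g) \<cdot> suspM T d (\<iota> i) = (\<rho> S \<cdot> \<iota> i) \<cdot> s i"
        using cmp_assoc[OF \<rho>S g(1) s\<iota>] g(2)[OF i] cmp_assoc[OF \<rho>S \<iota>[OF i] s(1)[OF i]] by simp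
      also have "\<dots> = suspM T d (\<iota> i) \<cdot> (\<rho> (X i) \<cdot> s i)"
        using cen_nat[OF c \<iota>[OF i]] cmp_assoc[OF s\<iota> cen_ar[OF c XO[OF i]] s(1)[OF i]] by simp
      finally show "(\<rho> S \<cdot> g) \<cdot> suspM T d (\<iota> i) = Idt T (susp T d S) \<cdot> suspM T d (\<iota> i)"
        using s(3)[OF i] cmp_id[OF s\<iota>] id_cmp[OF s\<iota>] by simp
    qed
    ultimately show ?thesis using isosI[OF \<rho>S g(1)] by blast
  qed
  then show ?thesis using SO by (auto simp: inv_set_def)
qed

lemma tors_triangle:
  assumes XO: "X \<in> Ob T"
  obtains f g h G L where "tri f g h G X L" "G \<in> tors A" "L \<in> rorth (tors A)"
    "L \<in> Loc U T {X}" "G \<in> Loc U T (pieces A X)"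
proof -
  obtain u v w G L where t: "tri u v w G X L" "L \<in> Loc U T {X}" "G \<in> Loc U T (pieces A X)" "L \<in> inv_set A"
    using localize[OF A_cen A_small XO] .
  have "L \<in> rorth (tors A)" using inv_set_orth t(4) by blast
  moreover have "G \<in> tors A" using Loc_least[OF tors_localizing pieces_tors[OF XO]] t(3) by blast
  ultimately show ?thesis using that t by blast
qed

text \<open>The complement equals \<open>inv_set A\<close>, for which closure under coproducts is
  clear: inverses are assembled componentwise.\<close>

lemma smashing_tors: "smashing (tors A)"
  unfolding smashing_def
proof (intro conjI ballI tors_localizing)
  show "localizing U T (rorth (tors A))"
  proof (rule rorth_localizing[OF tors_localizing])
    fix I :: "'u set" and X P \<iota>
    assume "is_coproduct T I X P \<iota>" "\<And>i. i \<in> I \<Longrightarrow> X i \<in> rorth (tors A)"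
    then show "P \<in> rorth (tors A)" using inv_set_orth[OF inv_set_coprod] orth_inv_set by blast
  qed
  fix X assume XO: "X \<in> Ob T"
  obtain f g h G L where t: "tri f g h G X L" "G \<in> tors A" "L \<in> rorth (tors A)" "L \<in> Loc U T {X}"
    using tors_triangle[OF XO] by metis
  have LX: "localizing U T (Loc U T {X})" using Loc_localizing XO by blast
  have "X \<in> Loc U T {X}" using Loc_incl by blast
  then have "G \<in> Loc U T {X}" using loc_tri(2)[OF LX t(1)] t(4) by blast
  then show "\<exists>f g h G L. tri f g h G X L \<and> G \<in> tors A \<and> G \<in> Loc U T {X} \<and> L \<in> rorth (tors A)"
    using t by blast
qed

end

text \<open>Let \<open>X i\<close> lie in the complement of the intersection, with
  \<open>S'\<close>-torsion part \<open>G i\<close>. The \<open>S\<close>-torsion part of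
  \<open>G i\<close> lies in \<open>Loc U T {G i}\<close>, hence in both \<open>S\<close> and
  \<open>S'\<close>, and has only the zero map to \<open>X i\<close>; so \<open>G i\<close> lies in
  \<open>rorth S\<close>. Thus \<open>X i\<close> is an extension of an object of
  \<open>rorth S'\<close> by one of \<open>rorth S\<close>, and coproducts preserve such extensions.
  The triangle for the intersection takes the two torsion parts one after the other, joined by an
  octahedron.\<close>

lemma smashing_Int:
  assumes S: "smashing S" and S': "smashing S'"
  shows "smashing (S \<inter> S')"
proof -
  have l: "localizing U T S" "localizing U T S'" and r: "localizing U T (rorth S)" "localizing U T (rorth S')"
    using S S' by (auto simp: smashing_def)
  have lI: "localizing U T (S \<inter> S')"
  proof (rule localizingI)
    show "Y \<in> S \<inter> S'" if "is_coproduct T I X Y \<iota>" "small U I" "\<And>i. i \<in> I \<Longrightarrow> X i \<in> S \<inter> S'"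
      for I and X :: "'u \<Rightarrow> 'o" and Y \<iota>
      using loc_coprod[OF l(1) that(2,1)] loc_coprod[OF l(2) that(2,1)] that(3) by blast
    show "Z \<in> S \<inter> S'" if "tri f g h X Y Z" "X \<in> S \<inter> S'" "Y \<in> S \<inter> S'" for f g h X Y Z
      using loc_tri(1)[OF l(1) that(1)] loc_tri(1)[OF l(2) that(1)] that by blast
  qed (use loc_Ob[OF l(1)] loc_zero l loc_Susp[OF l(1)] loc_Susp[OF l(2)] in auto)
  have sub: "rorth S \<subseteq> rorth (S \<inter> S')" "rorth S' \<subseteq> rorth (S \<inter> S')" by (auto simp: rorth_def)
  have ex: "\<exists>f g h G L. tri f g h G X L \<and> G \<in> S \<and> G \<in> Loc U T {X} \<and> L \<in> rorth S"
    and ex': "\<exists>f g h G L. tri f g h G X L \<and> G \<in> S' \<and> G \<in> Loc U T {X} \<and> L \<in> rorth S'" if "X \<in> Ob T" for X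
    using S S' that by (auto simp: smashing_def)
  have LocS': "Y \<in> S'" if "Y \<in> Loc U T {X}" "X \<in> S'" for X Y
    using Loc_least[OF l(2), of "{X}"] that by blast
  show ?thesis
    unfolding smashing_def
  proof (intro conjI ballI lI)
    show "localizing U T (rorth (S \<inter> S'))"
    proof (rule rorth_localizing[OF lI])
      fix I :: "'u set" and X P \<iota>
      assume I: "small U I" and P: "is_coproduct T I X P \<iota>" and X: "\<And>i. i \<in> I \<Longrightarrow> X i \<in> rorth (S \<inter> S')"
      have "\<exists>f g h G L. tri f g h G (X i) L \<and> G \<in> S' \<and> G \<in> Loc U T {X i} \<and> L \<in> rorth S'" if "i \<in> I" for i
        using ex'[OF coprod_Ob'[OF P that]] .
      then obtain f g h G L where t: "\<And>i. i \<in> I \<Longrightarrow> tri (f i) (g i) (h i) (G i) (X i) (L i)"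
        "\<And>i. i \<in> I \<Longrightarrow> G i \<in> S'" "\<And>i. i \<in> I \<Longrightarrow> L i \<in> rorth S'" by metis
      have GS: "G i \<in> rorth S" if i: "i \<in> I" for i
      proof -
        have GO: "G i \<in> Ob T" using tri_Ob[OF t(1)[OF i]] by blast
        obtain u v w G1 L1 where t1: "tri u v w G1 (G i) L1" "G1 \<in> S" "G1 \<in> Loc U T {G i}" "L1 \<in> rorth S"
          using ex[OF GO] by blast
        have G1: "G1 \<in> S'" using LocS'[OF t1(3) t(2)[OF i]] .
        have G1O: "G1 \<in> Ob T" using tri_Ob[OF t1(1)] by blast
        have u: "ar u G1 (G i)" using tri_ar[OF t1(1)] by blast
        have "f i \<cdot> u = zr G1 (X i)"
          using rorthD[OF X[OF i] _ ar_cmp[OF tri_ar(1)[OF t(1)[OF i]] u]] t1(2) G1 by blast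
        then have u0: "u = zr G1 (G i)"
        proof (rule tri_mono[OF t(1)[OF i] u])
          show "y = zr (Susp T G1) (L i)" if "ar y (Susp T G1) (L i)" for y
            using rorthD[OF t(3)[OF i] _ that] loc_Susp[OF l(2) G1O] G1 by blast
        qed
        show ?thesis
          unfolding rorth_def
        proof (intro CollectI conjI ballI allI impI GO)
          fix s x assume s: "s \<in> S" and x: "ar x s (G i)"
          have "v \<cdot> x = zr s L1" using rorthD[OF t1(4) s ar_cmp[OF tri_ar(2)[OF t1(1)] x]] .
          then obtain y where "ar y s G1" "x = u \<cdot> y" using tri_weak_ker[OF t1(1) x] by metis
          then show "x = zr s (G i)" using u0 zr_cmp GO by metis
        qed
      qed
      have GO: "G i \<in> Ob T" if "i \<in> I" for i using tri_Ob[OF t(1)[OF that]] by blast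
      obtain Q \<kappa> where Q: "is_coproduct T I G Q \<kappa>" using coprod_exists[OF I, of G] GO by blast
      obtain f' g' h' Z \<mu> where Z: "tri f' g' h' Q P Z" "is_coproduct T I L Z \<mu>"
        using coprod_tri[of I f g h G X L, OF t(1) Q P] by metis
      have "Q \<in> rorth S" using loc_coprod[OF r(1) I Q GS] .
      moreover have "Z \<in> rorth S'" using loc_coprod[OF r(2) I Z(2) t(3)] .
      ultimately show "P \<in> rorth (S \<inter> S')" using rorth_mid[OF Z(1)] sub by blast
    qed
    fix X assume XO: "X \<in> Ob T"
    obtain f g h G L where t: "tri f g h G X L" "G \<in> S'" "G \<in> Loc U T {X}" "L \<in> rorth S'" using ex'[OF XO] by blast
    obtain u v w G1 L1 where t1: "tri u v w G1 G L1" "G1 \<in> S" "G1 \<in> Loc U T {G}" "L1 \<in> rorth S"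
      using ex tri_Ob(1)[OF t(1)] by metis
    obtain a b N where n: "tri (f \<cdot> u) a b G1 X N"
      using tri_cone[OF ar_cmp[OF tri_ar(1)[OF t(1)] tri_ar(1)[OF t1(1)]]] .
    obtain p q e where "tri p q e L1 N L" using octahedron[OF t1(1) t(1) n] by metis
    then have "N \<in> rorth (S \<inter> S')" using rorth_mid t(4) t1(4) sub by blast
    moreover have "G1 \<in> S'" using LocS'[OF t1(3) t(2)] .
    moreover have "G1 \<in> Loc U T {X}" using t1(3) t(3) Loc_subset[of "{X}" "{G}"] XO by blast
    ultimately show "\<exists>f g h G L. tri f g h G X L \<and> G \<in> S \<inter> S' \<and> G \<in> Loc U T {X} \<and> L \<in> rorth (S \<inter> S')"
      using n t1(2) by blast
  qed
qed

text \<open>The maps are forgotten: both ends are determined up to isomorphism by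
  \<open>locT_iso\<close>, and they are only tested for membership in subcategories closed under
  isomorphism.\<close>

definition locT where
  "locT S G X L \<longleftrightarrow> (\<exists>f g h. tri f g h G X L) \<and> G \<in> S \<and> L \<in> rorth S"

text \<open>Orthogonality makes the maps induced on both ends unique, so those induced by an
  isomorphism and by its inverse are inverse to each other.\<close>

lemma locT_iso:
  assumes S: "localizing U T S" and l: "locT S G X L" and l': "locT S G' X' L'" and i: "isos T X X' \<noteq> {}"
  shows "isos T G G' \<noteq> {} \<and> isos T L L' \<noteq> {}"
proof -
  obtain f g h where t: "tri f g h G X L" and G: "G \<in> S" and L: "L \<in> rorth S" using l by (auto simp: locT_def)
  obtain f' g' h' where t': "tri f' g' h' G' X' L'" and G': "G' \<in> S" and L': "L' \<in> rorth S" using l' by (auto simp: locT_def)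
  have O: "G \<in> Ob T" "X \<in> Ob T" "L \<in> Ob T" "G' \<in> Ob T" "X' \<in> Ob T" "L' \<in> Ob T" using tri_Ob[OF t] tri_Ob[OF t'] by auto
  obtain k m where k: "ar k X X'" "ar m X' X" "m \<cdot> k = Idt T X" "k \<cdot> m = Idt T X'"
    using i isosE[OF _ O(2,5)] by blast
  have f: "ar f G X" "ar g X L" and f': "ar f' G' X'" "ar g' X' L'" using tri_ar[OF t] tri_ar[OF t'] by auto
  have SG: "Susp T G \<in> S" "Susp T G' \<in> S" using G G' loc_Susp[OF S] O by auto
  have "g' \<cdot> (k \<cdot> f) = zr G L'" using rorthD[OF L' G ar_cmp[OF f'(2) ar_cmp[OF k(1) f(1)]]] .
  then obtain a where a: "ar a G G'" "k \<cdot> f = f' \<cdot> a" using tri_weak_ker[OF t' ar_cmp[OF k(1) f(1)]] by metis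
  have "g \<cdot> (m \<cdot> f') = zr G' L" using rorthD[OF L G' ar_cmp[OF f(2) ar_cmp[OF k(2) f'(1)]]] .
  then obtain b where b: "ar b G' G" "m \<cdot> f' = f \<cdot> b" using tri_weak_ker[OF t ar_cmp[OF k(2) f'(1)]] by metis
  have "f \<cdot> (b \<cdot> a) = f \<cdot> Idt T G"
    using cmp_assoc[OF f(1) b(1) a(1)] b(2) cmp_assoc[OF k(2) f'(1) a(1)] a(2) cmp_assoc[OF k(2,1) f(1)] k(3)
      id_cmp[OF f(1)] cmp_id[OF f(1)] by simp
  then have ba: "b \<cdot> a = Idt T G"
    using tri_mono_eq[OF t ar_cmp[OF b(1) a(1)] ar_Idt[OF O(1)]] rorthD[OF L SG(1)] by blast
  have "f' \<cdot> (a \<cdot> b) = f' \<cdot> Idt T G'"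
    using cmp_assoc[OF f'(1) a(1) b(1)] b(2) cmp_assoc[OF k(1) f(1) b(1)] a(2) cmp_assoc[OF k(1,2) f'(1)] k(4)
      id_cmp[OF f'(1)] cmp_id[OF f'(1)] by simp
  then have ab: "a \<cdot> b = Idt T G'"
    using tri_mono_eq[OF t' ar_cmp[OF a(1) b(1)] ar_Idt[OF O(4)]] rorthD[OF L' SG(2)] by blast
  have "(g' \<cdot> k) \<cdot> f = zr G L'" using rorthD[OF L' G ar_cmp[OF ar_cmp[OF f'(2) k(1)] f(1)]] .
  then obtain c where c: "ar c L L'" "g' \<cdot> k = c \<cdot> g" using tri_weak_coker[OF t ar_cmp[OF f'(2) k(1)]] by metis
  have "(g \<cdot> m) \<cdot> f' = zr G' L" using rorthD[OF L G' ar_cmp[OF ar_cmp[OF f(2) k(2)] f'(1)]] .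
  then obtain d where d: "ar d L' L" "g \<cdot> m = d \<cdot> g'" using tri_weak_coker[OF t' ar_cmp[OF f(2) k(2)]] by metis
  have "(d \<cdot> c) \<cdot> g = Idt T L \<cdot> g"
    using cmp_assoc[OF d(1) c(1) f(2)] c(2) cmp_assoc[OF d(1) f'(2) k(1)] d(2) cmp_assoc[OF f(2) k(2,1)] k(3)
      id_cmp[OF f(2)] cmp_id[OF f(2)] by simp
  then have dc: "d \<cdot> c = Idt T L"
    using tri_epi_eq[OF t ar_cmp[OF d(1) c(1)] ar_Idt[OF O(3)]] rorthD[OF L SG(1)] by blast
  have "(c \<cdot> d) \<cdot> g' = Idt T L' \<cdot> g'"
    using cmp_assoc[OF c(1) d(1) f'(2)] c(2) cmp_assoc[OF c(1) f(2) k(2)] d(2) cmp_assoc[OF f'(2) k(1,2)] k(4)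
      id_cmp[OF f'(2)] cmp_id[OF f'(2)] by simp
  then have cd: "c \<cdot> d = Idt T L'"
    using tri_epi_eq[OF t' ar_cmp[OF c(1) d(1)] ar_Idt[OF O(6)]] rorthD[OF L' SG(2)] by blast
  show ?thesis using isosI[OF a(1) b(1) ba ab] isosI[OF c(1) d(1) dc cd] by blast
qed

lemma locT_exists: "\<lbrakk>smashing S; X \<in> Ob T\<rbrakk> \<Longrightarrow> \<exists>G L. locT S G X L \<and> G \<in> Loc U T {X}"
  unfolding smashing_def locT_def by blast

lemma locT_Ob: "locT S G X L \<Longrightarrow> X \<in> Ob T \<and> G \<in> Ob T \<and> L \<in> Ob T"
  unfolding locT_def using tri_Ob by blast

text \<open>\<open>smashing\<close> provides one triangle inside \<open>Loc U T {X}\<close>; by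
  uniqueness the same holds for every other one, in particular for the one chosen by
  \<open>loc_at\<close>.\<close>

lemma locT_Loc:
  assumes S: "smashing S" and l: "locT S G X L"
  shows "G \<in> Loc U T {X} \<and> L \<in> Loc U T {X}"
proof -
  have O: "X \<in> Ob T" "G \<in> Ob T" "L \<in> Ob T" using locT_Ob[OF l] by auto
  obtain G' L' where l': "locT S G' X L'" "G' \<in> Loc U T {X}" using locT_exists[OF S O(1)] by blast
  have X: "localizing U T (Loc U T {X})" using Loc_localizing O by blast
  have "isos T X X \<noteq> {}" using isos_Idt O by blast
  then have "isos T G' G \<noteq> {}" using locT_iso[OF _ l'(1) l] S by (auto simp: smashing_def)
  then have G: "G \<in> Loc U T {X}" using loc_iso[OF X l'(2) O(2)] by blast
  obtain f g h where t: "tri f g h G X L" using l by (auto simp: locT_def)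
  have "X \<in> Loc U T {X}" using Loc_incl by blast
  then show ?thesis using G loc_tri(1)[OF X t] by blast
qed

lemma locT_Susp:
  assumes S: "localizing U T S" and l: "locT S G X L"
  shows "locT S (Susp T G) (Susp T X) (Susp T L)"
proof -
  obtain f g h where t: "tri f g h G X L" "G \<in> S" "L \<in> rorth S" using l by (auto simp: locT_def)
  have "\<exists>f g h. tri f g h (Susp T G) (Susp T X) (Susp T L)" using tri_rot[OF tri_rot[OF tri_rot[OF t(1)]]] by blast
  then show ?thesis
    unfolding locT_def using t loc_Susp[OF S tri_Ob(1)[OF t(1)]] rorth_Susp_iff[OF S tri_Ob(3)[OF t(1)]] by blast
qed

text \<open>
  The maps \<open>G \<rightarrow> X\<close> and \<open>G' \<rightarrow> Y\<close> have cones in the orthogonal complement of \<open>S\<close>, so by the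
  \<open>3 \<times> 3\<close> lemma the map on cones has, too.
\<close>

lemma locT_cone:
  assumes S: "smashing S" and t: "tri f g h X Y Z" and lX: "locT S G X L" and lY: "locT S G' Y L'"
  obtains W C a b c p q r where "locT S W Z C" "tri a b c G G' W" "tri p q r L' C (Susp T L)"
proof -
  have l: "localizing U T S" and r: "localizing U T (rorth S)" using S by (auto simp: smashing_def)
  obtain a a1 a2 where a: "tri a a1 a2 G X L" and G: "G \<in> S" and L: "L \<in> rorth S" using lX by (auto simp: locT_def)
  obtain b b1 b2 where b: "tri b b1 b2 G' Y L'" and G': "G' \<in> S" and L': "L' \<in> rorth S" using lY by (auto simp: locT_def)
  have f: "ar f X Y" using tri_ar[OF t] by blast
  have fa: "ar (f \<cdot> a) G Y" using ar_cmp[OF f tri_ar(1)[OF a]] .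
  have "b1 \<cdot> (f \<cdot> a) = zr G L'" using rorthD[OF L' G ar_cmp[OF tri_ar(2)[OF b] fa]] .
  then obtain e where e: "ar e G G'" "f \<cdot> a = b \<cdot> e" using tri_weak_ker[OF b fa] by metis
  obtain e1 e2 W where W: "tri e e1 e2 G G' W" using tri_cone[OF e(1)] .
  obtain c c1 c2 C p q s where c: "tri c c1 c2 W Z C" "tri p q s L' C (Susp T L)"
    using tri_3x3[OF W t a b e(2)[symmetric]] by metis
  have "W \<in> S" using loc_tri(1)[OF l W] G G' by blast
  moreover have "C \<in> rorth S" using loc_tri(3)[OF r c(2)] L' L loc_Susp[OF r tri_Ob(3)[OF a]] by blast
  ultimately have "locT S W Z C" using c(1) by (auto simp: locT_def)
  then show ?thesis using that W c(2) by blast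
qed

end

section \<open>Localization functors\<close>

context cg_category
begin

text \<open>These are the preimages of \<open>L\<close> under the torsion and the localization
  functor of \<open>S\<close>, described without choosing the functors. They are localizing because
  cones and coproducts of localization triangles again give localization triangles: both functors
  are exact and preserve coproducts.\<close>

lemma locT_preimages:
  assumes S: "smashing S" and L: "localizing U T L"
  shows "localizing U T {Y. \<exists>G K. locT S G Y K \<and> G \<in> L}" "localizing U T {Y. \<exists>G K. locT S G Y K \<and> K \<in> L}"
proof -
  have l: "localizing U T S" and r: "localizing U T (rorth S)" using S by (auto simp: smashing_def)
  have Z: "locT S Z Z Z" if "is_zero T Z" for Z
    unfolding locT_def
    using tri_Idt[OF is_zero_Ob[OF that] that] loc_zero[OF l that] loc_zero[OF r that] by blast
  have Sup: "(\<exists>G K. locT S G Y K \<and> G \<in> L) = (\<exists>G K. locT S G (Susp T Y) K \<and> G \<in> L)"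
     "(\<exists>G K. locT S G Y K \<and> K \<in> L) = (\<exists>G K. locT S G (Susp T Y) K \<and> K \<in> L)" if YO: "Y \<in> Ob T" for Y
  proof -
    obtain G K where t: "locT S G Y K" using locT_exists[OF S YO] by blast
    have t': "locT S (Susp T G) (Susp T Y) (Susp T K)" using locT_Susp[OF l t] .
    have O: "G \<in> Ob T" "K \<in> Ob T" "Susp T Y \<in> Ob T" using locT_Ob[OF t] Susp_Ob by auto
    have i: "isos T Y Y \<noteq> {}" "isos T (Susp T Y) (Susp T Y) \<noteq> {}" using isos_Idt YO O(3) by blast+
    have "G' \<in> L \<longleftrightarrow> G \<in> L" "K' \<in> L \<longleftrightarrow> K \<in> L" if "locT S G' Y K'" for G' K'
      using locT_iso[OF l that t i(1)] locT_iso[OF l t that i(1)] loc_iso[OF L] locT_Ob[OF that] O by blast+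
    moreover have "G' \<in> L \<longleftrightarrow> G \<in> L" "K' \<in> L \<longleftrightarrow> K \<in> L" if a: "locT S G' (Susp T Y) K'" for G' K'
      using locT_iso[OF l a t' i(2)] locT_iso[OF l t' a i(2)] loc_iso[OF L] locT_Ob[OF a] O loc_Susp[OF L]
        Susp_Ob by blast+
    ultimately show "(\<exists>G K. locT S G Y K \<and> G \<in> L) = (\<exists>G K. locT S G (Susp T Y) K \<and> G \<in> L)"
     "(\<exists>G K. locT S G Y K \<and> K \<in> L) = (\<exists>G K. locT S G (Susp T Y) K \<and> K \<in> L)"
      using t t' by blast+
  qed
  have C: "\<exists>G K. locT S G P K \<and> ((\<forall>i\<in>I. F i \<in> L) \<longrightarrow> G \<in> L) \<and> ((\<forall>i\<in>I. E i \<in> L) \<longrightarrow> K \<in> L)"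
    if I: "small U I" and P: "is_coproduct T I X P \<iota>" and t: "\<And>i. i \<in> I \<Longrightarrow> locT S (F i) (X i) (E i)"
    for I :: "'u set" and X P \<iota> F E
  proof -
    obtain f g h where fg: "\<And>i. i \<in> I \<Longrightarrow> tri (f i) (g i) (h i) (F i) (X i) (E i)"
      using t unfolding locT_def by metis
    have FE: "\<And>i. i \<in> I \<Longrightarrow> F i \<in> S" "\<And>i. i \<in> I \<Longrightarrow> E i \<in> rorth S" using t unfolding locT_def by blast+
    obtain Q \<kappa> where Q: "is_coproduct T I F Q \<kappa>" using coprod_exists[OF I, of F] tri_Ob(1)[OF fg] by blast
    obtain f' g' h' Z \<mu> where z: "tri f' g' h' Q P Z" "is_coproduct T I E Z \<mu>"
      using coprod_tri[of I f g h F X E, OF fg Q P] by metis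
    have "Q \<in> S" "Z \<in> rorth S" using loc_coprod[OF l I Q FE(1)] loc_coprod[OF r I z(2) FE(2)] by simp_all
    then have "locT S Q P Z" using z(1) by (auto simp: locT_def)
    then show ?thesis using loc_coprod[OF L I Q] loc_coprod[OF L I z(2)] by blast
  qed
  show "localizing U T {Y. \<exists>G K. locT S G Y K \<and> G \<in> L}"
  proof (rule localizingI)
    show "Z' \<in> {Y. \<exists>G K. locT S G Y K \<and> G \<in> L}"
      if t: "tri f g h X Y Z'" and XY: "X \<in> {Y. \<exists>G K. locT S G Y K \<and> G \<in> L}" "Y \<in> {Y. \<exists>G K. locT S G Y K \<and> G \<in> L}"
      for f g h X Y Z'
    proof -
      obtain G K G' K' where *: "locT S G X K" "G \<in> L" "locT S G' Y K'" "G' \<in> L" using XY by blast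
      obtain W C a b c where "locT S W Z' C" "tri a b c G G' W" using locT_cone[OF S t *(1,3)] by metis
      then show ?thesis using loc_tri(1)[OF L] * by blast
    qed
    fix I :: "'u set" and X P \<iota>
    assume I: "small U I" and P: "is_coproduct T I X P \<iota>"
      and X: "\<And>i. i \<in> I \<Longrightarrow> X i \<in> {Y. \<exists>G K. locT S G Y K \<and> G \<in> L}"
    have "\<forall>i\<in>I. \<exists>F E. locT S F (X i) E \<and> F \<in> L" using X by blast
    then obtain F E where "\<And>i. i \<in> I \<Longrightarrow> locT S (F i) (X i) (E i)" "\<And>i. i \<in> I \<Longrightarrow> F i \<in> L"
      by metis
    then show "P \<in> {Y. \<exists>G K. locT S G Y K \<and> G \<in> L}" using C[OF I P, of F E] by blast
  qed (use locT_Ob Z loc_zero[OF L] Sup(1) in blast)+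
  show "localizing U T {Y. \<exists>G K. locT S G Y K \<and> K \<in> L}"
  proof (rule localizingI)
    show "Z' \<in> {Y. \<exists>G K. locT S G Y K \<and> K \<in> L}"
      if t: "tri f g h X Y Z'" and XY: "X \<in> {Y. \<exists>G K. locT S G Y K \<and> K \<in> L}" "Y \<in> {Y. \<exists>G K. locT S G Y K \<and> K \<in> L}"
      for f g h X Y Z'
    proof -
      obtain G K G' K' where *: "locT S G X K" "K \<in> L" "locT S G' Y K'" "K' \<in> L" using XY by blast
      obtain W C p q u where "locT S W Z' C" "tri p q u K' C (Susp T K)" using locT_cone[OF S t *(1,3)] by metis
      then show ?thesis using loc_tri(3)[OF L] * loc_Susp[OF L] locT_Ob[OF *(1)] by blast
    qed
    fix I :: "'u set" and X P \<iota>
    assume I: "small U I" and P: "is_coproduct T I X P \<iota>"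
      and X: "\<And>i. i \<in> I \<Longrightarrow> X i \<in> {Y. \<exists>G K. locT S G Y K \<and> K \<in> L}"
    have "\<forall>i\<in>I. \<exists>F E. locT S F (X i) E \<and> E \<in> L" using X by blast
    then obtain F E where "\<And>i. i \<in> I \<Longrightarrow> locT S (F i) (X i) (E i)" "\<And>i. i \<in> I \<Longrightarrow> E i \<in> L"
      by metis
    then show "P \<in> {Y. \<exists>G K. locT S G Y K \<and> K \<in> L}" using C[OF I P, of F E] by blast
  qed (use locT_Ob Z loc_zero[OF L] Sup(2) in blast)+
qed

section \<open>Functors from a choice of localization triangles\<close>

context
  fixes S :: "'o set" and G L :: "'o \<Rightarrow> 'o" and f g h :: "'o \<Rightarrow> 'm"
  assumes S: "smashing S"
    and t: "\<And>X. X \<in> Ob T \<Longrightarrow> tri (f X) (g X) (h X) (G X) X (L X)"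
    and GS: "\<And>X. X \<in> Ob T \<Longrightarrow> G X \<in> S" and LS: "\<And>X. X \<in> Ob T \<Longrightarrow> L X \<in> rorth S"
begin

lemma S_loc: "localizing U T S" and S_rloc: "localizing U T (rorth S)"
  using S by (auto simp: smashing_def)

lemma GL_Ob: "X \<in> Ob T \<Longrightarrow> G X \<in> Ob T" "X \<in> Ob T \<Longrightarrow> L X \<in> Ob T"
  using tri_Ob[OF t] by auto

lemma fgh: "X \<in> Ob T \<Longrightarrow> ar (f X) (G X) X" "X \<in> Ob T \<Longrightarrow> ar (g X) X (L X)"
  "X \<in> Ob T \<Longrightarrow> ar (h X) (L X) (Susp T (G X))"
  using tri_ar[OF t] by auto

text \<open>This and the next three lemmas are the universal properties of the ends: maps from
  \<open>X\<close> to \<open>rorth S\<close> factor uniquely through \<open>g X\<close>, and maps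
  from \<open>S\<close> to \<open>X\<close> factor uniquely through \<open>f X\<close>.\<close>

lemma L_eq:
  assumes X: "X \<in> Ob T" and N: "N \<in> rorth S" and a: "ar a (L X) N" "ar b (L X) N" "a \<cdot> g X = b \<cdot> g X"
  shows "a = b"
  using tri_epi_eq[OF t[OF X] a] rorthD[OF N] GS[OF X] loc_Susp[OF S_loc GL_Ob(1)[OF X]] by blast

lemma L_ext:
  assumes X: "X \<in> Ob T" and N: "N \<in> rorth S" and y: "ar y X N"
  obtains m where "ar m (L X) N" "m \<cdot> g X = y"
proof -
  have "y \<cdot> f X = zr (G X) N" using rorthD[OF N GS[OF X] ar_cmp[OF y fgh(1)[OF X]]] .
  then show ?thesis using tri_weak_coker[OF t[OF X] y] that by metis
qed

lemma G_eq:
  assumes X: "X \<in> Ob T" and W: "W \<in> S" and a: "ar a W (G X)" "ar b W (G X)" "f X \<cdot> a = f X \<cdot> b"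
  shows "a = b"
  using tri_mono_eq[OF t[OF X] a] rorthD[OF LS[OF X]] W loc_Susp[OF S_loc] ar_Ob(1)[OF a(1)] by blast

lemma G_ext:
  assumes X: "X \<in> Ob T" and W: "W \<in> S" and y: "ar y W X"
  obtains m where "ar m W (G X)" "f X \<cdot> m = y"
proof -
  have "g X \<cdot> y = zr W (L X)" using rorthD[OF LS[OF X] W ar_cmp[OF fgh(2)[OF X] y]] .
  then show ?thesis using tri_weak_ker[OF t[OF X] y] that by metis
qed

text \<open>The source and target of \<open>k\<close> are determined by \<open>k\<close> because Hom sets are disjoint.\<close>

definition LMor where "LMor k = (THE m. \<exists>X Y. ar k X Y \<and> ar m (L X) (L Y) \<and> m \<cdot> g X = g Y \<cdot> k)"
definition GMor where "GMor k = (THE m. \<exists>X Y. ar k X Y \<and> ar m (G X) (G Y) \<and> f Y \<cdot> m = k \<cdot> f X)"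

lemma LMor:
  assumes k: "ar k X Y"
  shows "ar (LMor k) (L X) (L Y)" "LMor k \<cdot> g X = g Y \<cdot> k"
proof -
  have O: "X \<in> Ob T" "Y \<in> Ob T" using ar_Ob[OF k] by auto
  obtain m where m: "ar m (L X) (L Y)" "m \<cdot> g X = g Y \<cdot> k"
    using L_ext[OF O(1) LS[OF O(2)] ar_cmp[OF fgh(2)[OF O(2)] k]] .
  have "LMor k = m"
    unfolding LMor_def
  proof (rule the_equality)
    show "\<exists>X Y. ar k X Y \<and> ar m (L X) (L Y) \<and> m \<cdot> g X = g Y \<cdot> k" using k m by blast
    show "m' = m" if "\<exists>X Y. ar k X Y \<and> ar m' (L X) (L Y) \<and> m' \<cdot> g X = g Y \<cdot> k" for m'
      using that L_eq[OF O(1) LS[OF O(2)] _ m(1)] m(2) ar_unique[OF k] by metis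
  qed
  then show "ar (LMor k) (L X) (L Y)" "LMor k \<cdot> g X = g Y \<cdot> k" using m by auto
qed

lemma GMor:
  assumes k: "ar k X Y"
  shows "ar (GMor k) (G X) (G Y)" "f Y \<cdot> GMor k = k \<cdot> f X"
proof -
  have O: "X \<in> Ob T" "Y \<in> Ob T" using ar_Ob[OF k] by auto
  obtain m where m: "ar m (G X) (G Y)" "f Y \<cdot> m = k \<cdot> f X"
    using G_ext[OF O(2) GS[OF O(1)] ar_cmp[OF k fgh(1)[OF O(1)]]] .
  have "GMor k = m"
    unfolding GMor_def
  proof (rule the_equality)
    show "\<exists>X Y. ar k X Y \<and> ar m (G X) (G Y) \<and> f Y \<cdot> m = k \<cdot> f X" using k m by blast
    show "m' = m" if "\<exists>X Y. ar k X Y \<and> ar m' (G X) (G Y) \<and> f Y \<cdot> m' = k \<cdot> f X" for m'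
      using that G_eq[OF O(2) GS[OF O(1)] _ m(1)] m(2) ar_unique[OF k] by metis
  qed
  then show "ar (GMor k) (G X) (G Y)" "f Y \<cdot> GMor k = k \<cdot> f X" using m by auto
qed

lemma LMor_eq: "\<lbrakk>ar k X Y; ar m (L X) (L Y); m \<cdot> g X = g Y \<cdot> k\<rbrakk> \<Longrightarrow> LMor k = m"
  using L_eq[OF _ LS LMor(1)] LMor(2) ar_Ob by metis

lemma GMor_eq: "\<lbrakk>ar k X Y; ar m (G X) (G Y); f Y \<cdot> m = k \<cdot> f X\<rbrakk> \<Longrightarrow> GMor k = m"
  using G_eq[OF _ GS GMor(1)] GMor(2) ar_Ob by metis

lemma LMor_endofunctor: "endofunctor T L LMor"
  unfolding endofunctor_def
proof (intro conjI ballI)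
  show "L \<in> Ob T \<rightarrow> Ob T" using GL_Ob by blast
  show "LMor \<in> carrier (Hom T X Y) \<rightarrow> carrier (Hom T (L X) (L Y))" if "X \<in> Ob T" "Y \<in> Ob T" for X Y
    using LMor(1)[OF arI[OF that]] ar_carrier by blast
  show "LMor (Idt T X) = Idt T (L X)" if X: "X \<in> Ob T" for X
    using LMor_eq[OF ar_Idt[OF X] ar_Idt[OF GL_Ob(2)[OF X]]] id_cmp[OF fgh(2)[OF X]] cmp_id[OF fgh(2)[OF X]] by simp
  fix X Y Z a b assume O: "X \<in> Ob T" "Y \<in> Ob T" "Z \<in> Ob T"
    and "a \<in> carrier (Hom T X Y)" "b \<in> carrier (Hom T Y Z)"
  then have a: "ar a X Y" and b: "ar b Y Z" using arI by auto
  show "LMor (b \<cdot> a) = LMor b \<cdot> LMor a"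
    using LMor_eq[OF ar_cmp[OF b a] ar_cmp[OF LMor(1)[OF b] LMor(1)[OF a]]]
      cmp_assoc[OF LMor(1)[OF b] LMor(1)[OF a] fgh(2)[OF O(1)]] LMor(2)[OF a]
      cmp_assoc[OF LMor(1)[OF b] fgh(2)[OF O(2)] a] LMor(2)[OF b] cmp_assoc[OF fgh(2)[OF O(3)] b a] by simp
qed

lemma GMor_endofunctor: "endofunctor T G GMor"
  unfolding endofunctor_def
proof (intro conjI ballI)
  show "G \<in> Ob T \<rightarrow> Ob T" using GL_Ob by blast
  show "GMor \<in> carrier (Hom T X Y) \<rightarrow> carrier (Hom T (G X) (G Y))" if "X \<in> Ob T" "Y \<in> Ob T" for X Y
    using GMor(1)[OF arI[OF that]] ar_carrier by blast
  show "GMor (Idt T X) = Idt T (G X)" if X: "X \<in> Ob T" for X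
    using GMor_eq[OF ar_Idt[OF X] ar_Idt[OF GL_Ob(1)[OF X]]] id_cmp[OF fgh(1)[OF X]] cmp_id[OF fgh(1)[OF X]] by simp
  fix X Y Z a b assume O: "X \<in> Ob T" "Y \<in> Ob T" "Z \<in> Ob T"
    and "a \<in> carrier (Hom T X Y)" "b \<in> carrier (Hom T Y Z)"
  then have a: "ar a X Y" and b: "ar b Y Z" using arI by auto
  show "GMor (b \<cdot> a) = GMor b \<cdot> GMor a"
    using GMor_eq[OF ar_cmp[OF b a] ar_cmp[OF GMor(1)[OF b] GMor(1)[OF a]]]
      cmp_assoc[OF fgh(1)[OF O(3)] GMor(1)[OF b] GMor(1)[OF a]] GMor(2)[OF b]
      cmp_assoc[OF b fgh(1)[OF O(2)] GMor(1)[OF a]] GMor(2)[OF a] cmp_assoc[OF b a fgh(1)[OF O(1)]] by simp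
qed

lemma LMor_additive: "additive_functor T L LMor"
  unfolding additive_functor_def
proof (intro conjI ballI LMor_endofunctor)
  fix X Y assume O: "X \<in> Ob T" "Y \<in> Ob T"
  have "LMor (a \<otimes>\<^bsub>Hom T X Y\<^esub> b) = LMor a \<otimes>\<^bsub>Hom T (L X) (L Y)\<^esub> LMor b"
    if "a \<in> carrier (Hom T X Y)" "b \<in> carrier (Hom T X Y)" for a b
  proof -
    have a: "ar a X Y" and b: "ar b X Y" using arI that O by auto
    show ?thesis
      using LMor_eq[OF ar_pl[OF a b] ar_pl[OF LMor(1)[OF a] LMor(1)[OF b]]]
        pl_cmp[OF fgh(2)[OF O(1)] LMor(1)[OF a] LMor(1)[OF b]] LMor(2)[OF a] LMor(2)[OF b]
        cmp_pl[OF fgh(2)[OF O(2)] a b] by simp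
  qed
  moreover have "LMor a \<in> carrier (Hom T (L X) (L Y))" if "a \<in> carrier (Hom T X Y)" for a
    using LMor(1)[OF arI[OF O that]] ar_carrier by blast
  ultimately show "LMor \<in> hom (Hom T X Y) (Hom T (L X) (L Y))" by (simp add: hom_def)
qed

text \<open>\<open>L_eq\<close> one suspension higher; it reduces to \<open>L_eq\<close> because
  \<open>rorth S\<close> is closed under desuspension.\<close>

lemma SuspM_g_eq:
  assumes X: "X \<in> Ob T" and N: "N \<in> rorth S"
    and a: "ar a (Susp T (L X)) N" "ar b (Susp T (L X)) N" "a \<cdot> SuspM T (g X) = b \<cdot> SuspM T (g X)"
  shows "a = b"
proof -
  obtain N' where N': "N' \<in> Ob T" "Susp T N' = N" using Susp_surj[OF rorth_Ob[OF N]] .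
  have N'S: "N' \<in> rorth S" using rorth_Susp_iff[OF S_loc N'(1)] N N'(2) by simp
  obtain a' where a': "ar a' (L X) N'" "SuspM T a' = a" using SuspM_full[of a "L X" N'] a(1) N' GL_Ob(2)[OF X] by blast
  obtain b' where b': "ar b' (L X) N'" "SuspM T b' = b" using SuspM_full[of b "L X" N'] a(2) N' GL_Ob(2)[OF X] by blast
  note gX = fgh(2)[OF X]
  have "SuspM T (a' \<cdot> g X) = SuspM T (b' \<cdot> g X)"
    using SuspM_cmp[OF a'(1) gX] SuspM_cmp[OF b'(1) gX] a' b' a(3) by simp
  then have "a' \<cdot> g X = b' \<cdot> g X" using SuspM_eq ar_cmp[OF a'(1) gX] ar_cmp[OF b'(1) gX] by blast
  then have "a' = b'" using L_eq[OF X N'S a'(1) b'(1)] by blast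
  then show ?thesis using a' b' by simp
qed

text \<open>The cone \<open>W\<close> of \<open>LMor u\<close> lies in \<open>rorth S\<close>, and
  the \<open>3 x 3\<close> lemma gives a map from \<open>Z\<close> to \<open>W\<close> with cone in
  \<open>S\<close>. Hence \<open>W\<close> is a localization of \<open>Z\<close>, and the exact
  triangle on \<open>W\<close> is carried over to \<open>L Z\<close> by
  \<open>Tri_iso\<close>.\<close>

lemma LMor_exact: "exact_functor T L LMor"
proof -
  have "\<exists>\<theta>. ar \<theta> (L (Susp T X)) (Susp T (L X)) \<and> \<theta> \<cdot> g (Susp T X) = SuspM T (g X)" if X: "X \<in> Ob T" for X
    using L_ext[OF Susp_Ob[OF X] _ SuspM_ar[OF fgh(2)[OF X]]] rorth_Susp_iff[OF S_loc GL_Ob(2)[OF X]] LS[OF X] by metis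
  then obtain \<theta> where \<theta>: "\<And>X. X \<in> Ob T \<Longrightarrow> ar (\<theta> X) (L (Susp T X)) (Susp T (L X))"
    "\<And>X. X \<in> Ob T \<Longrightarrow> \<theta> X \<cdot> g (Susp T X) = SuspM T (g X)" by metis
  have SL: "Susp T (L X) \<in> rorth S" if X: "X \<in> Ob T" for X
    using rorth_Susp_iff[OF S_loc GL_Ob(2)[OF X]] LS[OF X] by blast
  have iso: "\<theta> X \<in> isos T (L (Susp T X)) (Susp T (L X))" if X: "X \<in> Ob T" for X
  proof -
    note SX = Susp_Ob[OF X]
    obtain N where N: "N \<in> Ob T" "Susp T N = L (Susp T X)" using Susp_surj[OF GL_Ob(2)[OF SX]] .
    have NS: "N \<in> rorth S" using rorth_Susp_iff[OF S_loc N(1)] LS[OF SX] N(2) by simp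
    have gS: "ar (g (Susp T X)) (Susp T X) (Susp T N)" using fgh(2)[OF SX] N(2) by simp
    obtain y where y: "ar y X N" "SuspM T y = g (Susp T X)" using SuspM_full[OF gS X N(1)] .
    obtain m where m: "ar m (L X) N" "m \<cdot> g X = y" using L_ext[OF X NS y(1)] .
    define p where "p = SuspM T m"
    have p: "ar p (Susp T (L X)) (L (Susp T X))" unfolding p_def using SuspM_ar[OF m(1)] N(2) by simp
    have pg: "p \<cdot> SuspM T (g X) = g (Susp T X)"
      unfolding p_def using SuspM_cmp[OF m(1) fgh(2)[OF X]] m(2) y(2) by simp
    have "p \<cdot> \<theta> X = Idt T (L (Susp T X))"
      by (rule L_eq[OF SX LS[OF SX] ar_cmp[OF p \<theta>(1)[OF X]] ar_Idt[OF GL_Ob(2)[OF SX]]])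
        (use cmp_assoc[OF p \<theta>(1)[OF X] fgh(2)[OF SX]] \<theta>(2)[OF X] pg id_cmp[OF fgh(2)[OF SX]] in simp)
    moreover have "\<theta> X \<cdot> p = Idt T (Susp T (L X))"
      by (rule SuspM_g_eq[OF X SL[OF X] ar_cmp[OF \<theta>(1)[OF X] p] ar_Idt[OF Susp_Ob[OF GL_Ob(2)[OF X]]]])
        (use cmp_assoc[OF \<theta>(1)[OF X] p SuspM_ar[OF fgh(2)[OF X]]] \<theta>(2)[OF X] pg id_cmp[OF SuspM_ar[OF fgh(2)[OF X]]] in simp)
    ultimately show ?thesis using isosI[OF \<theta>(1)[OF X] p] by blast
  qed
  have nat: "\<theta> Y \<cdot> LMor (SuspM T k) = SuspM T (LMor k) \<cdot> \<theta> X" if k: "ar k X Y" for k X Y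
  proof -
    have O: "X \<in> Ob T" "Y \<in> Ob T" using ar_Ob[OF k] by auto
    note SX = Susp_Ob[OF O(1)] and SY = Susp_Ob[OF O(2)] and Sk = SuspM_ar[OF k]
    note LSk = LMor[OF Sk] and Lk = LMor[OF k]
    show ?thesis
    proof (rule L_eq[OF SX SL[OF O(2)] ar_cmp[OF \<theta>(1)[OF O(2)] LSk(1)] ar_cmp[OF SuspM_ar[OF Lk(1)] \<theta>(1)[OF O(1)]]])
      have "(\<theta> Y \<cdot> LMor (SuspM T k)) \<cdot> g (Susp T X) = SuspM T (g Y) \<cdot> SuspM T k"
        using cmp_assoc[OF \<theta>(1)[OF O(2)] LSk(1) fgh(2)[OF SX]] LSk(2)
          cmp_assoc[OF \<theta>(1)[OF O(2)] fgh(2)[OF SY] Sk] \<theta>(2)[OF O(2)] by simp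
      also have "\<dots> = SuspM T (LMor k) \<cdot> SuspM T (g X)"
        using SuspM_cmp[OF fgh(2)[OF O(2)] k] SuspM_cmp[OF Lk(1) fgh(2)[OF O(1)]] Lk(2) by simp
      also have "\<dots> = (SuspM T (LMor k) \<cdot> \<theta> X) \<cdot> g (Susp T X)"
        using cmp_assoc[OF SuspM_ar[OF Lk(1)] \<theta>(1)[OF O(1)] fgh(2)[OF SX]] \<theta>(2)[OF O(1)] by simp
      finally show "(\<theta> Y \<cdot> LMor (SuspM T k)) \<cdot> g (Susp T X) = (SuspM T (LMor k) \<cdot> \<theta> X) \<cdot> g (Susp T X)" .
    qed
  qed
  have tri: "tri (LMor u) (LMor v) (\<theta> X \<cdot> LMor w) (L X) (L Y) (L Z)" if s: "tri u v w X Y Z" for u v w X Y Z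
  proof -
    have O: "X \<in> Ob T" "Y \<in> Ob T" "Z \<in> Ob T" using tri_Ob[OF s] by auto
    note SX = Susp_Ob[OF O(1)]
    have u: "ar u X Y" and v: "ar v Y Z" and w: "ar w Z (Susp T X)" using tri_ar[OF s] by auto
    note Lu = LMor[OF u] and Lv = LMor[OF v] and Lw = LMor[OF w]
    obtain a b W where W: "tri (LMor u) a b (L X) (L Y) W" using tri_cone[OF Lu(1)] .
    have WS: "W \<in> rorth S" using loc_tri(1)[OF S_rloc W LS LS] O by blast
    have a: "ar a (L Y) W" and b: "ar b W (Susp T (L X))" and WO: "W \<in> Ob T" using tri_ar[OF W] tri_Ob[OF W] by auto
    \<comment> \<open>The localization triangles are rotated so that the vertical maps are
      \<open>g X\<close> and \<open>g Y\<close>; their cones are suspensions of objects of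
      \<open>S\<close>.\<close>
    obtain c c1 c2 C p q r where c: "c \<cdot> v = a \<cdot> g Y" "SuspM T (g X) \<cdot> w = b \<cdot> c"
        "tri c c1 c2 Z W C" "tri p q r (Susp T (G Y)) C (Susp T (Susp T (G X)))"
      using tri_3x3[OF s W tri_rot[OF t[OF O(1)]] tri_rot[OF t[OF O(2)]] Lu(2)[symmetric]] by metis
    have SG: "Susp T (G X) \<in> S" if "X \<in> Ob T" for X using loc_Susp[OF S_loc GL_Ob(1)[OF that]] GS[OF that] by blast
    have "C \<in> S" using loc_tri(3)[OF S_loc c(4)] SG O loc_Susp[OF S_loc Susp_Ob[OF GL_Ob(1)[OF O(1)]]] by blast
    moreover obtain F k m where F: "tri k c m F Z W" using tri_fibre[OF tri_ar(1)[OF c(3)]] .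
    moreover have "isos T C (Susp T F) \<noteq> {}" using cone_unique[OF c(3) tri_rot[OF F]] .
    ultimately have "Susp T F \<in> S" using loc_iso[OF S_loc] Susp_Ob[OF tri_Ob(1)[OF F]] by blast
    then have FS: "F \<in> S" using loc_Susp[OF S_loc tri_Ob(1)[OF F]] by blast
    have ca: "ar c Z W" using tri_ar[OF c(3)] by blast
    note gZ = fgh(2)[OF O(3)]
    obtain e where e: "ar e (L Z) W" "e \<cdot> g Z = c" using L_ext[OF O(3) WS ca] .
    \<comment> \<open>The fibre \<open>F\<close> of \<open>c\<close> lies in \<open>S\<close>, so
      \<open>g Z\<close> extends along \<open>c\<close>; this is the map back from \<open>W\<close>
      to \<open>L Z\<close>.\<close>
    have "g Z \<cdot> k = zr F (L Z)" using rorthD[OF LS[OF O(3)] FS ar_cmp[OF gZ tri_ar(1)[OF F]]] .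
    then obtain e' where e': "ar e' W (L Z)" "g Z = e' \<cdot> c" using tri_weak_coker[OF F gZ] by metis
    have ee: "e' \<cdot> e = Idt T (L Z)"
      by (rule L_eq[OF O(3) LS[OF O(3)] ar_cmp[OF e'(1) e(1)] ar_Idt[OF GL_Ob(2)[OF O(3)]]])
        (use cmp_assoc[OF e'(1) e(1) gZ] e(2) e'(2) id_cmp[OF gZ] in simp)
    have "e \<cdot> e' = Idt T W"
    proof (rule tri_epi_eq[OF F ar_cmp[OF e(1) e'(1)] ar_Idt[OF WO]])
      show "(e \<cdot> e') \<cdot> c = Idt T W \<cdot> c" using cmp_assoc[OF e(1) e'(1) ca] e'(2) e(2) id_cmp[OF ca] by simp
      show "y = zr (Susp T F) W" if "ar y (Susp T F) W" for y
        using rorthD[OF WS \<open>Susp T F \<in> S\<close> that] .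
    qed
    then have ei: "e' \<in> isos T W (L Z)" using isosI[OF e'(1) e(1) _ ee] by blast
    have "e \<cdot> LMor v = a"
      by (rule L_eq[OF O(2) WS ar_cmp[OF e(1) Lv(1)] a])
        (use cmp_assoc[OF e(1) Lv(1) fgh(2)[OF O(2)]] Lv(2) cmp_assoc[OF e(1) gZ v] e(2) c(1) in simp)
    then have 1: "e' \<cdot> a = LMor v"
      using cmp_assoc[OF e'(1) e(1) Lv(1)] ee id_cmp[OF Lv(1)] by simp
    have \<theta>w: "ar (\<theta> X \<cdot> LMor w) (L Z) (Susp T (L X))" using ar_cmp[OF \<theta>(1)[OF O(1)] Lw(1)] .
    have "b \<cdot> e = \<theta> X \<cdot> LMor w"
    proof (rule L_eq[OF O(3) SL[OF O(1)] ar_cmp[OF b e(1)] \<theta>w])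
      show "(b \<cdot> e) \<cdot> g Z = (\<theta> X \<cdot> LMor w) \<cdot> g Z"
        using cmp_assoc[OF b e(1) gZ] e(2) c(2) cmp_assoc[OF \<theta>(1)[OF O(1)] Lw(1) gZ] Lw(2)
          cmp_assoc[OF \<theta>(1)[OF O(1)] fgh(2)[OF SX] w] \<theta>(2)[OF O(1)] by simp
    qed
    then have "(\<theta> X \<cdot> LMor w) \<cdot> e' = b"
      using cmp_assoc[OF b e(1) e'(1)] \<open>e \<cdot> e' = Idt T W\<close> cmp_id[OF b] by simp
    then have 2: "SuspM T (Idt T (L X)) \<cdot> b = (\<theta> X \<cdot> LMor w) \<cdot> e'"
      using SuspM_Idt[OF GL_Ob(2)[OF O(1)]] id_cmp[OF b] by simp
    have 3: "Idt T (L Y) \<cdot> LMor u = LMor u \<cdot> Idt T (L X)" using id_cmp[OF Lu(1)] cmp_id[OF Lu(1)] by simp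
    have 4: "e' \<cdot> a = LMor v \<cdot> Idt T (L Y)" using 1 cmp_id[OF Lv(1)] by simp
    have "(LMor u, LMor v, \<theta> X \<cdot> LMor w) \<in> Tri T (L X) (L Y) (L Z)"
      using Tri_iso[of "L X" "L Y" W "L X" "L Y" "L Z" "LMor u" a b "LMor u" "LMor v" "\<theta> X \<cdot> LMor w"
          "Idt T (L X)" "Idt T (L Y)" e'] GL_Ob(2) O WO W Lu(1) Lv(1) \<theta>w isos_Idt ei 2 3 4
      by (simp add: tri_def ar_def)
    then show ?thesis using GL_Ob(2) O by (simp add: tri_def)
  qed
  show ?thesis
    unfolding exact_functor_def
  proof (intro conjI LMor_additive exI[of _ \<theta>] ballI)
    show "\<theta> X \<in> isos T (L (Susp T X)) (Susp T (L X))" if "X \<in> Ob T" for X using iso[OF that] .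
    show "nat_transf T (L \<circ> Susp T) (LMor \<circ> SuspM T) (Susp T \<circ> L) (SuspM T \<circ> LMor) \<theta>"
      unfolding nat_transf_def using \<theta>(1) ar_carrier nat arI by simp
    show "case x of (u, v, w) \<Rightarrow> (LMor u, LMor v, \<theta> X \<cdot> LMor w) \<in> Tri T (L X) (L Y) (L Z)"
      if "X \<in> Ob T" "Y \<in> Ob T" "Z \<in> Ob T" "x \<in> Tri T X Y Z" for X Y Z x
      using tri[of _ _ _ X Y Z] that by (auto simp: tri_def)
  qed
qed

lemma g_L_iso:
  assumes X: "X \<in> Ob T"
  shows "g (L X) \<in> isos T (L X) (L (L X))"
proof -
  note LX = GL_Ob(2)[OF X]
  note GLX = GL_Ob(1)[OF LX]
  have "f (L X) \<cdot> Idt T (G (L X)) = f (L X) \<cdot> zr (G (L X)) (G (L X))"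
    using rorthD[OF LS[OF X] GS[OF LX] fgh(1)[OF LX]] cmp_id[OF fgh(1)[OF LX]] cmp_zr[OF fgh(1)[OF LX] GLX] by simp
  then have "Idt T (G (L X)) = zr (G (L X)) (G (L X))"
    using G_eq[OF LX GS[OF LX] ar_Idt[OF GLX] ar_zr[OF GLX GLX]] by blast
  then have "is_zero T (G (L X))" using is_zeroI GLX by blast
  then show ?thesis using tri_iso_if_zero'[OF t[OF LX]] by blast
qed

lemma is_localization_choice:
  "is_localization T S \<lparr>LO = L, LM = LMor, GO = G, GM = GMor, from_G = f, to_L = g, connect = h\<rparr>"
proof -
  have "nat_transf T (\<lambda>X. X) (\<lambda>f. f) L LMor g"
    unfolding nat_transf_def
  proof (intro conjI ballI)
    show "g X \<in> carrier (Hom T X (L X))" if "X \<in> Ob T" for X using fgh(2)[OF that] ar_carrier by blast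
    show "g Y \<cdot> k = LMor k \<cdot> g X" if "X \<in> Ob T" "Y \<in> Ob T" "k \<in> carrier (Hom T X Y)" for X Y k
      using LMor(2)[OF arI[OF that]] by simp
  qed
  moreover have "LMor (g X) = g (L X)" if X: "X \<in> Ob T" for X
    using LMor_eq[OF fgh(2)[OF X] fgh(2)[OF GL_Ob(2)[OF X]]] by simp
  ultimately have 1: "localization_functor T L LMor g"
    unfolding localization_functor_def using LMor_exact g_L_iso by simp
  have 2: "{X \<in> Ob T. is_zero T (L X)} = S"
  proof (intro equalityI subsetI)
    fix X assume "X \<in> {X \<in> Ob T. is_zero T (L X)}"
    then have X: "X \<in> Ob T" "is_zero T (L X)" by auto
    then show "X \<in> S" using loc_tri(3)[OF S_loc t[OF X(1)] GS[OF X(1)]] loc_zero[OF S_loc] by blast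
  next
    fix X assume XS: "X \<in> S"
    have X: "X \<in> Ob T" using loc_Ob[OF S_loc XS] .
    note LX = GL_Ob(2)[OF X]
    have "Idt T (L X) \<cdot> g X = zr (L X) (L X) \<cdot> g X"
      using rorthD[OF LS[OF X] XS fgh(2)[OF X]] id_cmp[OF fgh(2)[OF X]] zr_cmp[OF fgh(2)[OF X] LX] by simp
    then have "Idt T (L X) = zr (L X) (L X)" using L_eq[OF X LS[OF X] ar_Idt[OF LX] ar_zr[OF LX LX]] by blast
    then show "X \<in> {X \<in> Ob T. is_zero T (L X)}" using X is_zeroI LX by blast
  qed
  have 3: "nat_transf T G GMor (\<lambda>X. X) (\<lambda>f. f) f"
    unfolding nat_transf_def
  proof (intro conjI ballI)
    show "f X \<in> carrier (Hom T (G X) X)" if "X \<in> Ob T" for X using fgh(1)[OF that] ar_carrier by blast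
    show "f Y \<cdot> GMor k = k \<cdot> f X" if "X \<in> Ob T" "Y \<in> Ob T" "k \<in> carrier (Hom T X Y)" for X Y k
      using GMor(2)[OF arI[OF that]] by simp
  qed
  have 4: "nat_transf T L LMor (Susp T \<circ> G) (SuspM T \<circ> GMor) h"
    unfolding nat_transf_def
  proof (intro conjI ballI)
    show "h X \<in> carrier (Hom T (L X) ((Susp T \<circ> G) X))" if "X \<in> Ob T" for X
      using fgh(3)[OF that] ar_carrier by simp
    fix X Y k assume O: "X \<in> Ob T" "Y \<in> Ob T" and "k \<in> carrier (Hom T X Y)"
    then have k: "ar k X Y" using arI by blast
    \<comment> \<open>A fill-in is not unique in general, but its first square identifies it with
      \<open>LMor k\<close>; its second square is then naturality of the connecting maps.\<close>
    obtain c where c: "ar c (L X) (L Y)" "c \<cdot> g X = g Y \<cdot> k" "SuspM T (GMor k) \<cdot> h X = h Y \<cdot> c"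
      using tri_mor[OF t[OF O(1)] t[OF O(2)] GMor(1)[OF k] k GMor(2)[OF k, symmetric]] .
    then show "h Y \<cdot> LMor k = (SuspM T \<circ> GMor) k \<cdot> h X" using LMor_eq[OF k c(1,2)] by simp
  qed
  have 5: "carrier (Hom T Y (L X)) = {zr Y (L X)}" if X: "X \<in> Ob T" and Y: "Y \<in> S" for X Y
  proof -
    have YO: "Y \<in> Ob T" using loc_Ob[OF S_loc Y] .
    show ?thesis using rorthD[OF LS[OF X] Y] arI[OF YO GL_Ob(2)[OF X]] ar_zr[OF YO GL_Ob(2)[OF X]] ar_carrier by blast
  qed
  show ?thesis
    unfolding is_localization_def using 1 2 3 4 5 GMor_endofunctor t GS by (simp add: tri_def)
qed

end

text \<open>\<open>loc_at\<close> is a Hilbert choice, so nothing is known about it until one family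
  of functors and natural maps with all the required properties has been produced.\<close>

lemma is_localization_exists: "smashing S \<Longrightarrow> \<exists>D. is_localization T S D"
proof -
  assume S: "smashing S"
  have "\<exists>f g h G L. tri f g h G X L \<and> G \<in> S \<and> L \<in> rorth S" if "X \<in> Ob T" for X
    using S that unfolding smashing_def by blast
  then obtain f g h G L where "\<And>X. X \<in> Ob T \<Longrightarrow> tri (f X) (g X) (h X) (G X) X (L X)"
     "\<And>X. X \<in> Ob T \<Longrightarrow> G X \<in> S" "\<And>X. X \<in> Ob T \<Longrightarrow> L X \<in> rorth S" by metis
  from is_localization_choice[OF S this] show ?thesis by blast
qed

lemma is_localization_locT:
  assumes "is_localization T S D" "X \<in> Ob T"
  shows "locT S (GO D X) X (LO D X)"
proof -
  have O: "LO D X \<in> Ob T" "GO D X \<in> Ob T"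
    using assms unfolding is_localization_def localization_functor_def exact_functor_def additive_functor_def
      endofunctor_def by auto
  have "(from_G D X, to_L D X, connect D X) \<in> Tri T (GO D X) X (LO D X)" "GO D X \<in> S"
    "\<forall>Y \<in> S. carrier (Hom T Y (LO D X)) = {zr Y (LO D X)}"
    using assms unfolding is_localization_def by blast+
  then show ?thesis unfolding locT_def tri_def rorth_def using O assms(2) ar_carrier by blast
qed

end

section \<open>Homogeneous ideals\<close>

context graded_ring
begin

lemma gr_carrier: "r \<in> gr n \<Longrightarrow> r \<in> carrier R"
  using additive_subgroup.a_subset[OF gr_subgroup] by blast

lemma gr_zero: "\<zero> \<in> gr n"
  using additive_subgroup.zero_closed[OF gr_subgroup] .

lemma gr_add: "\<lbrakk>r \<in> gr n; s \<in> gr n\<rbrakk> \<Longrightarrow> r \<oplus> s \<in> gr n"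
  using additive_subgroup.a_closed[OF gr_subgroup] .

lemma gr_neg: "r \<in> gr n \<Longrightarrow> \<ominus> r \<in> gr n"
  using additive_subgroup.a_inv_closed[OF gr_subgroup] .

lemma gr_pow: "r \<in> gr d \<Longrightarrow> r [^] (k :: nat) \<in> gr (int k * d)"
proof (induction k)
  case 0
  then show ?case using gr_one by simp
next
  case (Suc k)
  then show ?case using gr_mult[of "r [^] k" "int k * d" r d] by (simp add: algebra_simps)
qed

definition hcomp :: "'r \<Rightarrow> int \<Rightarrow> 'r" where
  "hcomp r = (THE c. (\<forall>n. c n \<in> gr n) \<and> finite {n. c n \<noteq> \<zero>} \<and> r = (\<Oplus>n \<in> {n. c n \<noteq> \<zero>}. c n))"

lemma hcomp:
  assumes "r \<in> carrier R"
  shows "hcomp r n \<in> gr n" "finite {n. hcomp r n \<noteq> \<zero>}" "r = (\<Oplus>n \<in> {n. hcomp r n \<noteq> \<zero>}. hcomp r n)"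
  using theI'[OF gr_decomp[OF assms], folded hcomp_def] by auto

lemma hcomp_unique:
  assumes c: "\<And>n. c n \<in> gr n" and F: "finite F" "\<And>n. n \<notin> F \<Longrightarrow> c n = \<zero>" and r: "r = (\<Oplus>n \<in> F. c n)"
  shows "hcomp r = c"
proof -
  have cc: "c \<in> F \<rightarrow> carrier R" using gr_carrier c by blast
  have sub: "{n. c n \<noteq> \<zero>} \<subseteq> F" using F(2) by blast
  have "(\<Oplus>n \<in> {n. c n \<noteq> \<zero>}. c n) = (\<Oplus>n \<in> F. c n)"
    by (rule add.finprod_mono_neutral_cong_left[OF F(1) sub]) (use cc in auto)
  then have "(\<forall>n. c n \<in> gr n) \<and> finite {n. c n \<noteq> \<zero>} \<and> r = (\<Oplus>n \<in> {n. c n \<noteq> \<zero>}. c n)"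
    using c r finite_subset[OF sub F(1)] by simp
  moreover have "r \<in> carrier R" unfolding r using cc by (rule finsum_closed)
  ultimately show ?thesis unfolding hcomp_def using the1_equality[OF gr_decomp] by blast
qed

lemma hcomp_sum:
  assumes r: "r \<in> carrier R" and F: "finite F" "{n. hcomp r n \<noteq> \<zero>} \<subseteq> F"
  shows "r = (\<Oplus>n \<in> F. hcomp r n)"
proof -
  have "hcomp r \<in> F \<rightarrow> carrier R" using gr_carrier hcomp(1)[OF r] by blast
  then have "(\<Oplus>n \<in> {n. hcomp r n \<noteq> \<zero>}. hcomp r n) = (\<Oplus>n \<in> F. hcomp r n)"
    by (intro add.finprod_mono_neutral_cong_left[OF F]) auto
  then show ?thesis using hcomp(3)[OF r] by simp
qed

lemma hcomp_gr: "r \<in> gr m \<Longrightarrow> hcomp r = (\<lambda>n. if n = m then r else \<zero>)"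
  by (rule hcomp_unique[where F = "{m}"]) (use gr_carrier gr_zero in auto)

lemma hcomp_add:
  assumes r: "r \<in> carrier R" and s: "s \<in> carrier R"
  shows "hcomp (r \<oplus> s) n = hcomp r n \<oplus> hcomp s n"
proof -
  define F where "F = {n. hcomp r n \<noteq> \<zero>} \<union> {n. hcomp s n \<noteq> \<zero>}"
  have F: "finite F" using hcomp(2)[OF r] hcomp(2)[OF s] by (simp add: F_def)
  have "hcomp (r \<oplus> s) = (\<lambda>n. hcomp r n \<oplus> hcomp s n)"
  proof (rule hcomp_unique[where F = F])
    show "hcomp r n \<oplus> hcomp s n \<in> gr n" for n using gr_add hcomp(1) r s by blast
    have "r \<oplus> s = (\<Oplus>n\<in>F. hcomp r n) \<oplus> (\<Oplus>n\<in>F. hcomp s n)"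
      using hcomp_sum[OF r F] hcomp_sum[OF s F] by (simp add: F_def)
    also have "\<dots> = (\<Oplus>n\<in>F. hcomp r n \<oplus> hcomp s n)"
      by (rule finsum_addf[symmetric]) (use gr_carrier hcomp(1) r s in blast)+
    finally show "r \<oplus> s = (\<Oplus>n\<in>F. hcomp r n \<oplus> hcomp s n)" .
  qed (use F in \<open>auto simp: F_def\<close>)
  then show ?thesis by simp
qed

lemma hcomp_lmult:
  assumes t: "t \<in> gr m" and r: "r \<in> carrier R"
  shows "hcomp (t \<otimes> r) n = t \<otimes> hcomp r (n - m)"
proof -
  define F where "F = {n. hcomp r n \<noteq> \<zero>}"
  have F: "finite F" using hcomp(2)[OF r] by (simp add: F_def)
  have c: "hcomp r k \<in> carrier R" for k using gr_carrier hcomp(1)[OF r] by blast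
  have tc: "t \<in> carrier R" using t gr_carrier by blast
  have "hcomp (t \<otimes> r) = (\<lambda>n. t \<otimes> hcomp r (n - m))"
  proof (rule hcomp_unique[where F = "(\<lambda>k. k + m) ` F"])
    show "t \<otimes> hcomp r (n - m) \<in> gr n" for n using gr_mult[OF t hcomp(1)[OF r], of "n - m"] by simp
    show "t \<otimes> hcomp r (n - m) = \<zero>" if "n \<notin> (\<lambda>k. k + m) ` F" for n
    proof -
      have "n - m \<notin> F" using that by (metis diff_add_cancel image_eqI)
      then show ?thesis using tc by (simp add: F_def)
    qed
    have "t \<otimes> r = (\<Oplus>k\<in>F. t \<otimes> hcomp r k)"
      using hcomp_sum[OF r F] finsum_rdistr[OF F tc, of "hcomp r"] c by (simp add: F_def)
    also have "\<dots> = (\<Oplus>n\<in>(\<lambda>k. k + m) ` F. t \<otimes> hcomp r (n - m))"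
      by (subst finsum_reindex) (use tc c in auto)
    finally show "t \<otimes> r = (\<Oplus>n\<in>(\<lambda>k. k + m) ` F. t \<otimes> hcomp r (n - m))" .
  qed (use F in auto)
  then show ?thesis by simp
qed

lemma hcomp_rmult:
  assumes t: "t \<in> gr m" and r: "r \<in> carrier R"
  shows "hcomp (r \<otimes> t) n = hcomp r (n - m) \<otimes> t"
proof -
  define F where "F = {n. hcomp r n \<noteq> \<zero>}"
  have F: "finite F" using hcomp(2)[OF r] by (simp add: F_def)
  have c: "hcomp r k \<in> carrier R" for k using gr_carrier hcomp(1)[OF r] by blast
  have tc: "t \<in> carrier R" using t gr_carrier by blast
  have "hcomp (r \<otimes> t) = (\<lambda>n. hcomp r (n - m) \<otimes> t)"
  proof (rule hcomp_unique[where F = "(\<lambda>k. k + m) ` F"])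
    show "hcomp r (n - m) \<otimes> t \<in> gr n" for n using gr_mult[OF hcomp(1)[OF r] t, of "n - m"] by simp
    show "hcomp r (n - m) \<otimes> t = \<zero>" if "n \<notin> (\<lambda>k. k + m) ` F" for n
    proof -
      have "n - m \<notin> F" using that by (metis diff_add_cancel image_eqI)
      then show ?thesis using tc by (simp add: F_def)
    qed
    have "r \<otimes> t = (\<Oplus>k\<in>F. hcomp r k \<otimes> t)"
      using hcomp_sum[OF r F] finsum_ldistr[OF F tc, of "hcomp r"] c by (simp add: F_def)
    also have "\<dots> = (\<Oplus>n\<in>(\<lambda>k. k + m) ` F. hcomp r (n - m) \<otimes> t)"
      by (subst finsum_reindex) (use tc c in auto)
    finally show "r \<otimes> t = (\<Oplus>n\<in>(\<lambda>k. k + m) ` F. hcomp r (n - m) \<otimes> t)" .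
  qed (use F in auto)
  then show ?thesis by simp
qed

lemma hom_induct:
  assumes r: "r \<in> carrier R" and z: "P \<zero>" and h: "\<And>n. P (hcomp r n)"
    and a: "\<And>x y. \<lbrakk>x \<in> carrier R; y \<in> carrier R; P x; P y\<rbrakk> \<Longrightarrow> P (x \<oplus> y)"
  shows "P r"
proof -
  have c: "hcomp r n \<in> carrier R" for n using gr_carrier hcomp(1)[OF r] by blast
  have "P (\<Oplus>n \<in> F. hcomp r n)" if "finite F" for F
    using that
  proof (induction F)
    case empty
    then show ?case using z by simp
  next
    case (insert n F)
    have "(\<Oplus>k \<in> insert n F. hcomp r k) = hcomp r n \<oplus> (\<Oplus>k \<in> F. hcomp r k)"
      by (rule finsum_insert) (use insert c in auto)
    moreover have "(\<Oplus>k \<in> F. hcomp r k) \<in> carrier R" using c by (intro finsum_closed) auto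
    ultimately show ?case using a[OF c _ h] insert.IH by simp
  qed
  then show ?thesis using hcomp(2,3)[OF r] by metis
qed

lemma homogeneous_ideal_hcomp:
  assumes I: "homogeneous_ideal R gr I" and r: "r \<in> I"
  shows "hcomp r n \<in> I"
proof -
  obtain c where c: "\<And>n. c n \<in> gr n \<inter> I" "finite {n. c n \<noteq> \<zero>}" "r = finsum R c {n. c n \<noteq> \<zero>}"
    using I r unfolding homogeneous_ideal_def by blast
  have "hcomp r = c" by (rule hcomp_unique[where F = "{n. c n \<noteq> \<zero>}"]) (use c in auto)
  then show ?thesis using c(1) by blast
qed

lemma ideal_mem_hcomp:
  assumes I: "ideal I R" and r: "r \<in> carrier R" and h: "\<And>n. hcomp r n \<in> I"
  shows "r \<in> I"
  using hom_induct[OF r, of "\<lambda>x. x \<in> I"] h additive_subgroup.zero_closed[OF ideal.axioms(1)[OF I]]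
    additive_subgroup.a_closed[OF ideal.axioms(1)[OF I]] by blast

definition hideal :: "(int \<Rightarrow> 'r set) \<Rightarrow> 'r set" where
  "hideal N = {r \<in> carrier R. \<forall>n. hcomp r n \<in> N n}"

text \<open>Closure is asked for homogeneous multipliers; a general multiplier is treated through
  its components, and negation is multiplication by \<open>\<ominus> \<one>\<close>.\<close>

lemma
  assumes N: "\<And>n. N n \<subseteq> gr n" and z: "\<And>n. \<zero> \<in> N n"
    and a: "\<And>n x y. \<lbrakk>x \<in> N n; y \<in> N n\<rbrakk> \<Longrightarrow> x \<oplus> y \<in> N n"
    and l: "\<And>m n t x. \<lbrakk>t \<in> gr m; x \<in> N n\<rbrakk> \<Longrightarrow> t \<otimes> x \<in> N (m + n)"
    and r: "\<And>m n t x. \<lbrakk>t \<in> gr m; x \<in> N n\<rbrakk> \<Longrightarrow> x \<otimes> t \<in> N (m + n)"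
  shows hideal: "homogeneous_ideal R gr (hideal N)" and hideal_gr: "\<And>n. hideal N \<inter> gr n = N n"
proof -
  show J: "hideal N \<inter> gr n = N n" for n
  proof
    show "hideal N \<inter> gr n \<subseteq> N n"
    proof
      fix x assume x: "x \<in> hideal N \<inter> gr n"
      then have "hcomp x n \<in> N n" by (simp add: hideal_def)
      then show "x \<in> N n" using hcomp_gr[of x n] x by simp
    qed
    show "N n \<subseteq> hideal N \<inter> gr n"
    proof
      fix x assume x: "x \<in> N n"
      then have g: "x \<in> gr n" using N by blast
      then show "x \<in> hideal N \<inter> gr n" using x z gr_carrier by (auto simp: hideal_def hcomp_gr[OF g])
    qed
  qed
  have add: "x \<oplus> y \<in> hideal N" if "x \<in> hideal N" "y \<in> hideal N" for x y
    using that hcomp_add a by (auto simp: hideal_def)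
  have zero: "\<zero> \<in> hideal N" using J[of 0] z by blast
  have lm: "x \<otimes> y \<in> hideal N" if y: "y \<in> hideal N" and x: "x \<in> carrier R" for x y
  proof -
    have yc: "y \<in> carrier R" using y by (simp add: hideal_def)
    have hom: "t \<otimes> y \<in> hideal N" if t: "t \<in> gr m" for t m
    proof -
      have "t \<otimes> hcomp y (n - m) \<in> N n" for n
        using l[OF t, of "hcomp y (n - m)" "n - m"] y by (simp add: hideal_def)
      then show ?thesis using hcomp_lmult[OF t yc] gr_carrier[OF t] yc by (simp add: hideal_def)
    qed
    have "hcomp x n \<otimes> y \<in> hideal N" for n using hom hcomp(1)[OF x] by blast
    then show ?thesis
      by (intro hom_induct[OF x, where P = "\<lambda>x. x \<otimes> y \<in> hideal N"])
        (use zero add yc in \<open>auto simp: l_distr\<close>)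
  qed
  have rm: "y \<otimes> x \<in> hideal N" if y: "y \<in> hideal N" and x: "x \<in> carrier R" for x y
  proof -
    have yc: "y \<in> carrier R" using y by (simp add: hideal_def)
    have hom: "y \<otimes> t \<in> hideal N" if t: "t \<in> gr m" for t m
    proof -
      have "hcomp y (n - m) \<otimes> t \<in> N n" for n
        using r[OF t, of "hcomp y (n - m)" "n - m"] y by (simp add: hideal_def)
      then show ?thesis using hcomp_rmult[OF t yc] gr_carrier[OF t] yc by (simp add: hideal_def)
    qed
    have "y \<otimes> hcomp x n \<in> hideal N" for n using hom hcomp(1)[OF x] by blast
    then show ?thesis
      by (intro hom_induct[OF x, where P = "\<lambda>x. y \<otimes> x \<in> hideal N"])
        (use zero add yc in \<open>auto simp: r_distr\<close>)
  qed
  have neg: "\<ominus> x \<in> hideal N" if x: "x \<in> hideal N" for x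
  proof -
    have "(\<ominus> \<one>) \<otimes> x \<in> hideal N" using lm[OF x] by simp
    then show ?thesis using x by (simp add: hideal_def l_minus)
  qed
  have "subgroup (hideal N) (add_monoid R)"
  proof (rule add.subgroupI)
    show "hideal N \<subseteq> carrier R" by (auto simp: hideal_def)
    show "hideal N \<noteq> {}" using zero by blast
  qed (use neg add in \<open>auto simp: a_inv_def\<close>)
  from idealI[OF ring_axioms this lm rm] have I: "ideal (hideal N) R" by simp
  show "homogeneous_ideal R gr (hideal N)"
    unfolding homogeneous_ideal_def
  proof (intro conjI I ballI)
    fix x assume x: "x \<in> hideal N"
    then have xc: "x \<in> carrier R" by (simp add: hideal_def)
    have "hcomp x n \<in> gr n \<inter> hideal N" for n using x J[of n] N by (auto simp: hideal_def)
    then show "\<exists>c. (\<forall>n. c n \<in> gr n \<inter> hideal N) \<and> finite {n. c n \<noteq> \<zero>} \<and> x = finsum R c {n. c n \<noteq> \<zero>}"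
      using hcomp(2,3)[OF xc] by blast
  qed
qed

section \<open>Homogeneous primes\<close>

lemma Spec_ideal: "P \<in> Spec R gr \<Longrightarrow> ideal P R"
  by (simp add: Spec_def homogeneous_ideal_def)

lemma Spec_one: "P \<in> Spec R gr \<Longrightarrow> \<one> \<notin> P"
  using ideal.one_imp_carrier[OF Spec_ideal[of P]] unfolding Spec_def by blast

lemma Spec_zero: "P \<in> Spec R gr \<Longrightarrow> \<zero> \<in> P"
  using additive_subgroup.zero_closed[OF ideal.axioms(1)[OF Spec_ideal]] .

lemma Spec_mult: "\<lbrakk>P \<in> Spec R gr; a \<in> gr m; b \<in> gr n\<rbrakk> \<Longrightarrow> a \<otimes> b \<in> P \<longleftrightarrow> a \<in> P \<or> b \<in> P"
proof -
  assume P: "P \<in> Spec R gr" and a: "a \<in> gr m" and b: "b \<in> gr n"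
  have "a \<otimes> b \<in> P \<Longrightarrow> a \<in> P \<or> b \<in> P" using P a b unfolding Spec_def by blast
  then show ?thesis
    using ideal.I_l_closed[OF Spec_ideal[OF P] _ gr_carrier[OF a]] ideal.I_r_closed[OF Spec_ideal[OF P] _ gr_carrier[OF b]]
    by blast
qed

lemma Spec_pow: "\<lbrakk>P \<in> Spec R gr; a \<in> gr m; a [^] (k :: nat) \<in> P\<rbrakk> \<Longrightarrow> a \<in> P"
proof (induction k)
  case 0
  then show ?case using Spec_one by simp
next
  case (Suc k)
  then show ?case using Spec_mult[OF Suc(2) gr_pow[OF Suc(3), of k] Suc(3)] by auto
qed

end

context graded_commutative_ring
begin

lemma even_commute: "\<lbrakk>a \<in> gr m; b \<in> gr n; even (m * n)\<rbrakk> \<Longrightarrow> a \<otimes> b = b \<otimes> a"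
  using gr_commute by simp

text \<open>Graded commutativity costs at most a sign, which an ideal absorbs.\<close>

lemma hom_swap:
  assumes P: "ideal P R" and a: "a \<in> gr m" "b \<in> gr n" and ab: "a \<otimes> b \<in> P"
  shows "b \<otimes> a \<in> P"
proof -
  have "b \<otimes> a = a \<otimes> b \<or> b \<otimes> a = \<ominus> (a \<otimes> b)" using gr_commute[OF a(2,1)] by auto
  then show ?thesis using ab additive_subgroup.a_inv_closed[OF ideal.axioms(1)[OF P]] by auto
qed

text \<open>Colon ideals enlarge \<open>P\<close> and thereby exploit maximality. They are two-sided
  because homogeneous elements can be moved past \<open>c\<close> up to sign.\<close>

lemma
  assumes P: "homogeneous_ideal R gr P" and c: "c \<in> gr e"
  defines "Q \<equiv> hideal (\<lambda>n. {s \<in> gr n. s \<otimes> c \<in> P})"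
  shows colon: "homogeneous_ideal R gr Q" and colon_mem: "\<And>s n. s \<in> gr n \<Longrightarrow> s \<in> Q \<longleftrightarrow> s \<otimes> c \<in> P"
    and colon_sub: "P \<subseteq> Q"
proof -
  let ?N = "\<lambda>n. {s \<in> gr n. s \<otimes> c \<in> P}"
  have I: "ideal P R" using P by (simp add: homogeneous_ideal_def)
  interpret P: ideal P R using I .
  have cc: "c \<in> carrier R" using c gr_carrier by blast
  have 3: "x \<oplus> y \<in> ?N n" if "x \<in> ?N n" "y \<in> ?N n" for x y n
    using that gr_add P.a_closed[of "x \<otimes> c" "y \<otimes> c"] l_distr[OF gr_carrier gr_carrier cc] by auto
  have 4: "t \<otimes> x \<in> ?N (m + n)" if "t \<in> gr m" "x \<in> ?N n" for t x m n
    using that gr_mult P.I_l_closed[of "x \<otimes> c" t] gr_carrier m_assoc[OF gr_carrier gr_carrier cc] by auto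
  have 5: "x \<otimes> t \<in> ?N (m + n)" if t: "t \<in> gr m" and x: "x \<in> ?N n" for t x m n
  proof -
    have xg: "x \<in> gr n" "x \<otimes> c \<in> P" using x by auto
    have "c \<otimes> x \<in> P" using hom_swap[OF I xg(1) c xg(2)] .
    then have "c \<otimes> (x \<otimes> t) \<in> P"
      using P.I_r_closed[of "c \<otimes> x" t] m_assoc[OF cc gr_carrier[OF xg(1)] gr_carrier[OF t]] gr_carrier[OF t] by simp
    then have "(x \<otimes> t) \<otimes> c \<in> P" using hom_swap[OF I c gr_mult[OF xg(1) t]] by blast
    then show ?thesis using gr_mult[OF xg(1) t] by (simp add: add.commute)
  qed
  have 2: "\<zero> \<in> ?N n" for n using gr_zero cc P.zero_closed by simp
  have 1: "?N n \<subseteq> gr n" for n by blast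
  show "homogeneous_ideal R gr Q" unfolding Q_def by (rule hideal[OF 1 2 3 4 5])
  have g: "Q \<inter> gr n = ?N n" for n unfolding Q_def by (rule hideal_gr[OF 1 2 3 4 5])
  show m: "s \<in> Q \<longleftrightarrow> s \<otimes> c \<in> P" if "s \<in> gr n" for s n using g[of n] that by blast
  show "P \<subseteq> Q"
  proof
    fix x assume x: "x \<in> P"
    have xc: "x \<in> carrier R" using P.a_subset x by blast
    have "hcomp x n \<otimes> c \<in> P" for n using P.I_r_closed[OF homogeneous_ideal_hcomp[OF P x] cc] .
    then show "x \<in> Q" using hcomp(1)[OF xc] xc by (simp add: Q_def hideal_def)
  qed
qed

end

text \<open>By the ascending chain condition the union of a chain of ideals is a member of the
  chain. So the set \<open>\<A>\<close> may be arbitrary, as it is for the ideals attached to a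
  class of objects.\<close>

lemma (in noetherian_ring) maximal_ideal_exists:
  assumes "\<A> \<noteq> {}" "\<And>I. I \<in> \<A> \<Longrightarrow> ideal I R"
  obtains M where "M \<in> \<A>" "\<And>I. \<lbrakk>I \<in> \<A>; M \<subseteq> I\<rbrakk> \<Longrightarrow> I = M"
proof -
  have "\<exists>M\<in>\<A>. \<forall>X\<in>\<A>. M \<subseteq> X \<longrightarrow> X = M"
  proof (rule subset_Zorn_nonempty[OF assms(1)])
    fix C assume C: "C \<noteq> {}" "subset.chain \<A> C"
    then have "subset.chain {I. ideal I R} C" using assms(2) unfolding pred_on.chain_def by (auto dest: subsetD)
    then have "\<Union>C \<in> C" using ideal_chain_is_trivial C(1) by blast
    then show "\<Union>C \<in> \<A>" using C(2) unfolding pred_on.chain_def by blast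
  qed
  then show ?thesis using that by blast
qed

locale noetherian_graded_commutative_ring = graded_commutative_ring + noetherian_ring
begin

text \<open>Prime ideals arise as the homogeneous ideals that are maximal among those avoiding the powers of \<open>r\<close>.\<close>

lemma Spec_avoiding_powers:
  assumes N: "homogeneous_ideal R gr N" and r: "r \<in> gr d" and av: "\<And>k :: nat. r [^] k \<notin> N"
  obtains P where "P \<in> Spec R gr" "N \<subseteq> P" "r \<notin> P"
proof -
  define \<A> where "\<A> = {I. homogeneous_ideal R gr I \<and> N \<subseteq> I \<and> (\<forall>k :: nat. r [^] k \<notin> I)}"
  have rc: "r \<in> carrier R" using r gr_carrier by blast
  have "N \<in> \<A>" using N av by (auto simp: \<A>_def)
  then have ne: "\<A> \<noteq> {}" by blast
  have "ideal I R" if "I \<in> \<A>" for I using that by (simp add: \<A>_def homogeneous_ideal_def)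
  then obtain P where P: "P \<in> \<A>" "\<And>I. \<lbrakk>I \<in> \<A>; P \<subseteq> I\<rbrakk> \<Longrightarrow> I = P"
    using maximal_ideal_exists[OF ne] by metis
  have hP: "homogeneous_ideal R gr P" and IP: "ideal P R" and NP: "N \<subseteq> P" and rP: "\<And>k :: nat. r [^] k \<notin> P"
    using P(1) by (auto simp: \<A>_def homogeneous_ideal_def)
  \<comment> \<open>The colon ideal of \<open>P\<close> by \<open>c\<close> contains
    \<open>P\<close> and \<open>a\<close>, so by maximality it contains a power of \<open>r\<close>.
    This is used twice: with \<open>c = b\<close> and witness \<open>a\<close>, then with
    \<open>c\<close> a power of \<open>r\<close> and witness \<open>b\<close>.\<close>
  have key: "\<exists>k :: nat. r [^] k \<otimes> c \<in> P" if c: "c \<in> gr e" and a: "a \<in> gr m" "a \<otimes> c \<in> P" "a \<notin> P" for a c e m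
  proof (rule ccontr)
    define Q where "Q = hideal (\<lambda>n. {s \<in> gr n. s \<otimes> c \<in> P})"
    assume "\<nexists>k :: nat. r [^] k \<otimes> c \<in> P"
    then have "\<forall>k :: nat. r [^] k \<notin> Q" using colon_mem[OF hP c gr_pow[OF r]] by (simp add: Q_def)
    then have "Q \<in> \<A>" using colon[OF hP c] colon_sub[OF hP c] NP by (auto simp: \<A>_def Q_def)
    then have "Q = P" using P(2) colon_sub[OF hP c] by (auto simp: Q_def)
    moreover have "a \<in> Q" using colon_mem[OF hP c a(1)] a(2) by (simp add: Q_def)
    ultimately show False using a(3) by blast
  qed
  have "a \<in> P \<or> b \<in> P" if a: "a \<in> gr m" and b: "b \<in> gr n" and ab: "a \<otimes> b \<in> P" for a b m n
  proof (rule ccontr)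
    assume n: "\<not> (a \<in> P \<or> b \<in> P)"
    obtain k :: nat where k: "r [^] k \<otimes> b \<in> P" using key[OF b a ab] n by blast
    have "b \<otimes> r [^] k \<in> P" using hom_swap[OF IP gr_pow[OF r] b k] .
    then obtain l :: nat where "r [^] l \<otimes> r [^] k \<in> P" using key[OF gr_pow[OF r] b] n by blast
    then have "r [^] (l + k) \<in> P" using nat_pow_mult[OF rc] by simp
    then show False using rP by blast
  qed
  moreover have "P \<noteq> carrier R" using rP[of 0] by auto
  ultimately have "P \<in> Spec R gr" using hP by (auto simp: Spec_def)
  moreover have "r \<notin> P" using rP[of 1] rc by simp
  ultimately show ?thesis using that NP by blast
qed

lemma homogeneous_generators:
  assumes P: "homogeneous_ideal R gr P"
  obtains F where "finite F" "F \<noteq> {}" "\<And>d r. (d, r) \<in> F \<Longrightarrow> r \<in> gr d \<and> r \<in> P"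
    "\<And>Q. \<lbrakk>ideal Q R; \<And>d r. (d, r) \<in> F \<Longrightarrow> r \<in> Q\<rbrakk> \<Longrightarrow> P \<subseteq> Q"
proof -
  have I: "ideal P R" using P by (simp add: homogeneous_ideal_def)
  obtain A where A: "A \<subseteq> carrier R" "finite A" "P = Idl A" using finetely_gen[OF I] by blast
  \<comment> \<open>The pair \<open>(0, \<zero>)\<close> keeps \<open>F\<close> nonempty, so that
    intersections over \<open>F\<close> contain only objects of \<open>T\<close>.\<close>
  define F where "F = insert (0, \<zero>) (\<Union>a\<in>A. (\<lambda>n. (n, hcomp a n)) ` {n. hcomp a n \<noteq> \<zero>})"
  have "finite F" unfolding F_def using A hcomp(2) by auto
  moreover have "r \<in> gr d \<and> r \<in> P" if "(d, r) \<in> F" for d r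
  proof -
    have "A \<subseteq> P" using A genideal_self by blast
    then show ?thesis
      using that gr_zero additive_subgroup.zero_closed[OF ideal.axioms(1)[OF I]] hcomp(1) A(1)
        homogeneous_ideal_hcomp[OF P] by (auto simp: F_def)
  qed
  moreover have "P \<subseteq> Q" if Q: "ideal Q R" and F: "\<And>d r. (d, r) \<in> F \<Longrightarrow> r \<in> Q" for Q
  proof -
    have "A \<subseteq> Q"
    proof
      fix a assume a: "a \<in> A"
      show "a \<in> Q"
      proof (rule ideal_mem_hcomp[OF Q])
        show "a \<in> carrier R" using a A by blast
        show "hcomp a n \<in> Q" for n
          using F[of n "hcomp a n"] a additive_subgroup.zero_closed[OF ideal.axioms(1)[OF Q]]
          by (cases "hcomp a n = \<zero>") (auto simp: F_def)
      qed
    qed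
    then show ?thesis using A(3) genideal_minimal[OF Q] by blast
  qed
  moreover have "F \<noteq> {}" by (auto simp: F_def)
  ultimately show ?thesis using that by blast
qed

end

section \<open>Supports and the local-global principle\<close>

locale linear_cg_category =
  cg_category T U + noetherian_graded_commutative_ring R gr
  for T :: "('o, 'm, 'z) tricat_scheme" and U :: "'u set"
    and R :: "('r, 'b) ring_scheme" (structure) and gr :: "int \<Rightarrow> 'r set" +
  fixes \<phi> :: "int \<Rightarrow> 'r \<Rightarrow> 'o \<Rightarrow> 'm"
  assumes lin: "linear_structure R gr T \<phi>" and R_small: "small U (carrier R)"
begin

section \<open>The action of ring elements on morphisms\<close>

lemma \<phi>_center: "r \<in> gr n \<Longrightarrow> \<phi> n r \<in> center T n"
  using lin unfolding linear_structure_def by blast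

lemma \<phi>_cen: "\<lbrakk>r \<in> gr n; even n\<rbrakk> \<Longrightarrow> cen n (\<phi> n r)"
  using \<phi>_center by (simp add: cen_def)

lemma \<phi>_ar: "\<lbrakk>r \<in> gr n; Y \<in> Ob T\<rbrakk> \<Longrightarrow> ar (\<phi> n r Y) Y (susp T n Y)"
  using \<phi>_center[of r n] by (auto simp: center_def nat_transf_def ar_def susp_Ob)

lemma \<phi>_add:
  assumes "r \<in> gr n" "s \<in> gr n" "Y \<in> Ob T"
  shows "\<phi> n (r \<oplus> s) Y = \<phi> n r Y \<otimes>\<^bsub>Hom T Y (susp T n Y)\<^esub> \<phi> n s Y"
proof -
  have "\<phi> n (r \<oplus> s) = center_add T n (\<phi> n r) (\<phi> n s)" using lin assms unfolding linear_structure_def by blast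
  then show ?thesis using assms by (simp add: center_add_def)
qed

lemma \<phi>_center_mult:
  "\<lbrakk>r \<in> gr m; s \<in> gr n\<rbrakk> \<Longrightarrow> \<phi> (m + n) (r \<otimes> s) = center_mult T n (\<phi> m r) (\<phi> n s)"
  using lin unfolding linear_structure_def by blast

lemma \<phi>_mult:
  "\<lbrakk>r \<in> gr m; s \<in> gr n; Y \<in> Ob T\<rbrakk> \<Longrightarrow> \<phi> (m + n) (r \<otimes> s) Y = \<phi> m r (susp T n Y) \<cdot> \<phi> n s Y"
  using \<phi>_center_mult center_mult_ap by simp

lemma \<phi>_one: "Y \<in> Ob T \<Longrightarrow> \<phi> 0 \<one> Y = Idt T Y"
proof -
  assume Y: "Y \<in> Ob T"
  have "\<phi> 0 \<one> = center_one T" using lin unfolding linear_structure_def by blast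
  then show ?thesis using Y by (simp add: center_one_def)
qed

lemma \<phi>_zero:
  assumes Y: "Y \<in> Ob T"
  shows "\<phi> n \<zero> Y = zr Y (susp T n Y)"
proof -
  interpret H: group "Hom T Y (susp T n Y)" using ar_group Y susp_Ob by blast
  have c: "\<phi> n \<zero> Y \<in> carrier (Hom T Y (susp T n Y))" using \<phi>_ar[OF gr_zero Y] ar_carrier by blast
  have "\<phi> n \<zero> Y \<otimes>\<^bsub>Hom T Y (susp T n Y)\<^esub> \<phi> n \<zero> Y = \<phi> n \<zero> Y"
    using \<phi>_add[OF gr_zero gr_zero Y, of n] by simp
  then show ?thesis using H.r_cancel_one c by simp
qed

lemma \<phi>_neg:
  assumes r: "r \<in> gr n" and Y: "Y \<in> Ob T"
  shows "\<phi> n (\<ominus> r) Y = inv\<^bsub>Hom T Y (susp T n Y)\<^esub> (\<phi> n r Y)"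
proof -
  interpret H: group "Hom T Y (susp T n Y)" using ar_group Y susp_Ob by blast
  have c: "\<phi> n r Y \<in> carrier (Hom T Y (susp T n Y))" "\<phi> n (\<ominus> r) Y \<in> carrier (Hom T Y (susp T n Y))"
    using \<phi>_ar[OF _ Y] ar_carrier r gr_neg by blast+
  have "\<phi> n (\<ominus> r) Y \<otimes>\<^bsub>Hom T Y (susp T n Y)\<^esub> \<phi> n r Y = zr Y (susp T n Y)"
    using \<phi>_add[OF gr_neg[OF r] r Y] l_neg[OF gr_carrier[OF r]] \<phi>_zero[OF Y] by simp
  then show ?thesis using H.inv_equality c by metis
qed

section \<open>Annihilators and supports\<close>

definition Ann where "Ann C Y x = hideal (\<lambda>n. {u \<in> gr n. \<phi> n u Y \<cdot> x = zr C (susp T n Y)})"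

lemma
  assumes x: "ar x C Y"
  shows Ann_ideal: "homogeneous_ideal R gr (Ann C Y x)"
    and Ann_iff: "\<And>u n. u \<in> gr n \<Longrightarrow> u \<in> Ann C Y x \<longleftrightarrow> \<phi> n u Y \<cdot> x = zr C (susp T n Y)"
proof -
  let ?N = "\<lambda>n. {u \<in> gr n. \<phi> n u Y \<cdot> x = zr C (susp T n Y)}"
  have CO: "C \<in> Ob T" and YO: "Y \<in> Ob T" using ar_Ob[OF x] by auto
  have 1: "?N n \<subseteq> gr n" for n by blast
  have 2: "\<zero> \<in> ?N n" for n using gr_zero \<phi>_zero[OF YO] zr_cmp[OF x susp_Ob[OF YO]] by simp
  have 3: "u \<oplus> v \<in> ?N n" if u: "u \<in> ?N n" and v: "v \<in> ?N n" for n u v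
  proof -
    interpret H: group "Hom T C (susp T n Y)" using ar_group CO YO susp_Ob by blast
    show ?thesis
      using u v gr_add \<phi>_add[OF _ _ YO] pl_cmp[OF x \<phi>_ar[OF _ YO] \<phi>_ar[OF _ YO]] by simp
  qed
  have 4: "t \<otimes> u \<in> ?N (m + n)" if t: "t \<in> gr m" and u: "u \<in> ?N n" for m n t u
  proof -
    have ug: "u \<in> gr n" using u by blast
    have "\<phi> (m + n) (t \<otimes> u) Y \<cdot> x = \<phi> m t (susp T n Y) \<cdot> (\<phi> n u Y \<cdot> x)"
      using \<phi>_mult[OF t ug YO] cmp_assoc[OF \<phi>_ar[OF t susp_Ob[OF YO]] \<phi>_ar[OF ug YO] x] by simp
    then show ?thesis
      using u gr_mult[OF t ug] cmp_zr[OF \<phi>_ar[OF t susp_Ob[OF YO, of n]] CO] susp_add[OF YO, of m n] by simp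
  qed
  have neg: "\<ominus> u \<in> ?N n" if u: "u \<in> ?N n" for n u
    using u gr_neg \<phi>_neg[OF _ YO] neg_cmp[OF x \<phi>_ar[OF _ YO]] neg_zr[OF CO susp_Ob[OF YO]] by simp
  \<comment> \<open>Graded commutativity turns right multiples into left multiples up to sign, so
    the annihilator is two-sided.\<close>
  have 5: "u \<otimes> t \<in> ?N (m + n)" if t: "t \<in> gr m" and u: "u \<in> ?N n" for m n t u
  proof -
    have "u \<otimes> t = t \<otimes> u \<or> u \<otimes> t = \<ominus> (t \<otimes> u)" using gr_commute[of u n t m] t u by auto
    then show ?thesis
    proof
      assume e: "u \<otimes> t = t \<otimes> u"
      show ?thesis unfolding e by (rule 4[OF t u])
    next
      assume e: "u \<otimes> t = \<ominus> (t \<otimes> u)"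
      show ?thesis unfolding e by (rule neg[OF 4[OF t u]])
    qed
  qed
  show "homogeneous_ideal R gr (Ann C Y x)" unfolding Ann_def by (rule hideal[OF 1 2 3 4 5])
  have "Ann C Y x \<inter> gr n = ?N n" for n unfolding Ann_def by (rule hideal_gr[OF 1 2 3 4 5])
  then show "u \<in> Ann C Y x \<longleftrightarrow> \<phi> n u Y \<cdot> x = zr C (susp T n Y)" if "u \<in> gr n" for u n using that by blast
qed

lemma Ann_ideal': "ar x C Y \<Longrightarrow> ideal (Ann C Y x) R"
  using Ann_ideal by (simp add: homogeneous_ideal_def)

lemma Ann_subset_iff:
  assumes x: "ar x C Y" and P: "ideal P R"
  shows "Ann C Y x \<subseteq> P \<longleftrightarrow> (\<forall>n. \<forall>u \<in> gr n. \<phi> n u Y \<cdot> x = zr C (susp T n Y) \<longrightarrow> u \<in> P)"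
proof
  show "\<forall>n. \<forall>u \<in> gr n. \<phi> n u Y \<cdot> x = zr C (susp T n Y) \<longrightarrow> u \<in> P" if "Ann C Y x \<subseteq> P"
    using that Ann_iff[OF x] by blast
  assume a: "\<forall>n. \<forall>u \<in> gr n. \<phi> n u Y \<cdot> x = zr C (susp T n Y) \<longrightarrow> u \<in> P"
  show "Ann C Y x \<subseteq> P"
  proof
    fix r assume r: "r \<in> Ann C Y x"
    have rc: "r \<in> carrier R" using r by (simp add: Ann_def hideal_def)
    show "r \<in> P"
    proof (rule ideal_mem_hcomp[OF P rc])
      fix n
      show "hcomp r n \<in> P"
        using a hcomp(1)[OF rc] homogeneous_ideal_hcomp[OF Ann_ideal[OF x] r] Ann_iff[OF x hcomp(1)[OF rc]] by blast
    qed
  qed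
qed

text \<open>The primes at which some \<open>hom_star T \<phi> C Y\<close> with \<open>C\<close>
  compact has a nonzero localization. Maps of degree zero suffice, because the compact object may be
  suspended.\<close>

definition supp where
  "supp Y = {P \<in> Spec R gr. \<exists>C x. compact_object U T C \<and> ar x C Y \<and> Ann C Y x \<subseteq> P}"

text \<open>The fraction \<open>x / 1\<close> vanishes exactly when some homogeneous element outside
  \<open>P\<close> kills \<open>x\<close>. Conversely, if every element is killed in this way, the
  product of two annihilating elements relates any two fractions, so there is only one
  class.\<close>

lemma localization_zero_iff:
  assumes CO: "C \<in> Ob T" and XO: "X \<in> Ob T" and P: "P \<in> Spec R gr"
  shows "localization_zero R gr P (hom_star T \<phi> C X) \<longleftrightarrow>
    (\<forall>n x. ar x C (susp T n X) \<longrightarrow> \<not> Ann C (susp T n X) x \<subseteq> P)"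
proof -
  let ?M = "hom_star T \<phi> C X"
  have one: "\<one> \<in> gr 0" "\<one> \<notin> P" using gr_one Spec_one[OF P] by auto
  have M: "gpart ?M n = Hom T C (susp T n X)" "gact ?M k r n f = \<phi> k r (susp T n X) \<cdot> f" for n k r f
    by (simp_all add: hom_star_def)
  have sO: "susp T n X \<in> Ob T" for n using susp_Ob[OF XO] .
  have notsub: "\<not> Ann C (susp T n X) x \<subseteq> P \<longleftrightarrow>
      (\<exists>k. \<exists>u\<in>gr k - P. \<phi> k u (susp T n X) \<cdot> x = zr C (susp T k (susp T n X)))"
    if "ar x C (susp T n X)" for n x
    using Ann_subset_iff[OF that Spec_ideal[OF P]] by blast
  have frac_one: "(0, \<one>, m) \<in> fractions gr P ?M n" if "ar m C (susp T n X)" for m n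
    using that one ar_carrier by (simp add: fractions_def M)
  show ?thesis
  proof
    assume z: "localization_zero R gr P ?M"
    show "\<forall>n x. ar x C (susp T n X) \<longrightarrow> \<not> Ann C (susp T n X) x \<subseteq> P"
    proof (intro allI impI)
      fix n x assume x: "ar x C (susp T n X)"
      let ?z = "zr C (susp T n X)"
      have za: "ar ?z C (susp T n X)" using ar_zr[OF CO sO] .
      have "fraction_rel gr P ?M n `` {(0, \<one>, x)} \<in> localization gr P ?M n"
        unfolding localization_def using frac_one[OF x] by (rule quotientI)
      then have e: "fraction_rel gr P ?M n `` {(0, \<one>, x)} = fraction_rel gr P ?M n `` {(0, \<one>, ?z)}"
        using z unfolding localization_zero_def by (simp add: M)
      have "((0, \<one>, x), (0, \<one>, x)) \<in> fraction_rel gr P ?M n"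
        unfolding fraction_rel_def using frac_one[OF x] one by auto
      then have "((0, \<one>, ?z), (0, \<one>, x)) \<in> fraction_rel gr P ?M n" using e by blast
      then obtain j u where u: "u \<in> gr j - P" and
        eq: "gact ?M j u (n + 0 + 0) (gact ?M 0 \<one> (n + 0) ?z) = gact ?M j u (n + 0 + 0) (gact ?M 0 \<one> (n + 0) x)"
        unfolding fraction_rel_def by blast
      have ua: "ar (\<phi> j u (susp T n X)) (susp T n X) (susp T j (susp T n X))" using \<phi>_ar[OF _ sO] u by blast
      have "\<phi> j u (susp T n X) \<cdot> x = zr C (susp T j (susp T n X))"
        using eq \<phi>_one[OF sO] id_cmp[OF za] id_cmp[OF x] cmp_zr[OF ua CO] by (simp add: M)
      then show "\<not> Ann C (susp T n X) x \<subseteq> P" using notsub[OF x] u by blast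
    qed
  next
    assume a: "\<forall>n x. ar x C (susp T n X) \<longrightarrow> \<not> Ann C (susp T n X) x \<subseteq> P"
    have rel: "(a, b) \<in> fraction_rel gr P ?M n" if "a \<in> fractions gr P ?M n" "b \<in> fractions gr P ?M n" for a b n
    proof -
      obtain k s m k' s' m' where ab: "a = (k, s, m)" "b = (k', s', m')" by (metis prod_cases3)
      have s: "s \<in> gr k" "s' \<in> gr k'" and m: "ar m C (susp T (n + k) X)" "ar m' C (susp T (n + k') X)"
        using that sO CO unfolding ab by (auto simp: fractions_def M ar_def)
      obtain i u where u: "u \<in> gr i - P" "\<phi> i u (susp T (n + k) X) \<cdot> m = zr C (susp T i (susp T (n + k) X))"
        using a m(1) notsub[OF m(1)] by blast
      obtain j v where v: "v \<in> gr j - P" "\<phi> j v (susp T (n + k') X) \<cdot> m' = zr C (susp T j (susp T (n + k') X))"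
        using a m(2) notsub[OF m(2)] by blast
      have ui: "u \<in> gr i" "v \<in> gr j" using u v by auto
      have w: "u \<otimes> v \<in> gr (i + j) - P" using gr_mult[OF ui] Spec_mult[OF P ui] u v by blast
      \<comment> \<open>The annihilating product must act after the denominator \<open>t\<close> has
        been applied; that it still kills uses closure of \<open>Ann\<close> under right
        multiplication.\<close>
      have kill: "\<phi> (i + j) (u \<otimes> v) (susp T (l + l') X) \<cdot> (\<phi> l' t (susp T l X) \<cdot> y) = zr C (susp T (i + j) (susp T (l + l') X))"
        if t: "t \<in> gr l'" and y: "ar y C (susp T l X)"
          and uv: "u \<in> Ann C (susp T l X) y \<or> v \<in> Ann C (susp T l X) y" for l l' t y
      proof -
        interpret A: ideal "Ann C (susp T l X) y" R using Ann_ideal'[OF y] .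
        have "u \<otimes> v \<in> Ann C (susp T l X) y" using uv A.I_l_closed A.I_r_closed gr_carrier ui by blast
        then have "(u \<otimes> v) \<otimes> t \<in> Ann C (susp T l X) y" using A.I_r_closed gr_carrier[OF t] by blast
        moreover have uvt: "(u \<otimes> v) \<otimes> t \<in> gr (i + j + l')" using gr_mult[OF gr_mult[OF ui] t] .
        ultimately have "\<phi> (i + j + l') ((u \<otimes> v) \<otimes> t) (susp T l X) \<cdot> y = zr C (susp T (i + j + l') (susp T l X))"
          using Ann_iff[OF y uvt] by blast
        then show ?thesis
          using \<phi>_mult[OF gr_mult[OF ui] t sO[of l]]
            cmp_assoc[OF \<phi>_ar[OF gr_mult[OF ui] susp_Ob[OF sO[of l]]] \<phi>_ar[OF t sO[of l]] y]
            susp_add[OF XO, of l' l] susp_add[OF sO[of l], of "i + j" l'] by (simp add: add.commute)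
      qed
      have "u \<in> Ann C (susp T (n + k) X) m" "v \<in> Ann C (susp T (n + k') X) m'"
        using u v Ann_iff[OF m(1) ui(1)] Ann_iff[OF m(2) ui(2)] by auto
      then have "gact ?M (i + j) (u \<otimes> v) (n + k + k') (gact ?M k' s' (n + k) m) =
          gact ?M (i + j) (u \<otimes> v) (n + k' + k) (gact ?M k s (n + k') m')"
        using kill[OF s(2) m(1)] kill[OF s(1) m(2)] by (simp add: M add.commute add.left_commute)
      then show ?thesis using that w unfolding fraction_rel_def ab by blast
    qed
    have cls: "fraction_rel gr P ?M n `` {a} = fractions gr P ?M n" if "a \<in> fractions gr P ?M n" for a n
      using rel[OF that] by (auto simp: fraction_rel_def)
    have "localization gr P ?M n = {fraction_rel gr P ?M n `` {(0, \<one>, \<one>\<^bsub>gpart ?M n\<^esub>)}}" for n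
    proof -
      have z: "(0, \<one>, \<one>\<^bsub>gpart ?M n\<^esub>) \<in> fractions gr P ?M n" using frac_one[OF ar_zr[OF CO sO]] by (simp add: M)
      have "fractions gr P ?M n // fraction_rel gr P ?M n = {fractions gr P ?M n}"
        unfolding quotient_def using cls z by auto
      then show ?thesis unfolding localization_def using cls[OF z] by simp
    qed
    then show "localization_zero R gr P ?M" unfolding localization_zero_def by blast
  qed
qed

lemma torsion_iff: "X \<in> torsion U R gr T \<phi> V \<longleftrightarrow> X \<in> Ob T \<and> supp X \<subseteq> V"
proof
  assume X: "X \<in> torsion U R gr T \<phi> V"
  then have XO: "X \<in> Ob T" by (simp add: torsion_def)
  have "P \<in> V" if P: "P \<in> supp X" for P
  proof (rule ccontr)
    assume "P \<notin> V"
    obtain C x where C: "compact_object U T C" "ar x C X" "Ann C X x \<subseteq> P" and PS: "P \<in> Spec R gr"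
      using P by (auto simp: supp_def)
    have "localization_zero R gr P (hom_star T \<phi> C X)" using X C(1) PS \<open>P \<notin> V\<close> by (simp add: torsion_def)
    then have "\<not> Ann C (susp T 0 X) x \<subseteq> P"
      using localization_zero_iff[OF compact_Ob[OF C(1)] XO PS] C(2) by (metis susp_0)
    then show False using C(3) by (simp add: susp_0)
  qed
  then show "X \<in> Ob T \<and> supp X \<subseteq> V" using XO by blast
next
  assume X: "X \<in> Ob T \<and> supp X \<subseteq> V"
  then have XO: "X \<in> Ob T" by blast
  have "localization_zero R gr P (hom_star T \<phi> C X)"
    if C: "compact_object U T C" and P: "P \<in> Spec R gr - V" for C P
  proof -
    have CO: "C \<in> Ob T" using compact_Ob[OF C] .
    have PS: "P \<in> Spec R gr" using P by blast
    have "\<not> Ann C (susp T n X) x \<subseteq> P" if x: "ar x C (susp T n X)" for n x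
    proof
      assume sub: "Ann C (susp T n X) x \<subseteq> P"
      \<comment> \<open>A map of degree \<open>n\<close> from \<open>C\<close> is a map of degree
        zero from the desuspension of \<open>C\<close>, to which \<open>supp\<close>
        applies.\<close>
      define C' where "C' = susp T (- n) C"
      have C': "compact_object U T C'" "C' \<in> Ob T" "susp T n C' = C"
        using compact_susp[OF C] susp_Ob[OF CO] susp_neg(2)[OF CO] by (auto simp: C'_def)
      define x' where "x' = suspM T (- n) x"
      have x': "ar x' C' X" "suspM T n x' = x"
        using suspM_ar[OF x, of "- n"] susp_neg(1)[OF XO] suspM_neg(2)[OF ar_Arr[OF x]]
        by (simp_all add: x'_def C'_def)
      have "P \<notin> supp X" using P X by blast
      then obtain k u where u: "u \<in> gr k" "u \<notin> P" "\<phi> k u X \<cdot> x' = zr C' (susp T k X)"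
        using Ann_subset_iff[OF x'(1) Spec_ideal[OF PS]] C'(1) x'(1) PS unfolding supp_def by blast
      \<comment> \<open>In odd degree the suspension would introduce signs; the square has even
        degree and is still outside the prime.\<close>
      have uu: "u \<otimes> u \<in> gr (k + k)" using gr_mult u by blast
      have "u \<otimes> u \<in> Ann C' X x'"
        using ideal.I_l_closed[OF Ann_ideal'[OF x'(1)]] Ann_iff[OF x'(1) u(1)] u gr_carrier by blast
      then have k: "\<phi> (k + k) (u \<otimes> u) X \<cdot> x' = zr C' (susp T (k + k) X)" using Ann_iff[OF x'(1) uu] by blast
      have c: "cen (k + k) (\<phi> (k + k) (u \<otimes> u))" using \<phi>_cen[OF uu] by simp
      have "\<phi> (k + k) (u \<otimes> u) (susp T n X) \<cdot> x = suspM T n (\<phi> (k + k) (u \<otimes> u) X \<cdot> x')"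
        using cen_susp[OF c XO, of n] suspM_cmp[OF cen_ar[OF c XO] x'(1), of n] x'(2) by simp
      also have "\<dots> = zr C (susp T n (susp T (k + k) X))" using k suspM_zr[OF C'(2) susp_Ob[OF XO]] C'(3) by simp
      also have "susp T n (susp T (k + k) X) = susp T (k + k) (susp T n X)"
        using susp_add[OF XO, of n "k + k"] susp_add[OF XO, of "k + k" n] by (metis add.commute)
      finally have "u \<otimes> u \<in> Ann C (susp T n X) x" using Ann_iff[OF x uu] by blast
      then show False using sub Spec_mult[OF PS u(1) u(1)] u(2) by blast
    qed
    then show ?thesis using localization_zero_iff[OF CO XO PS] by blast
  qed
  then show "X \<in> torsion U R gr T \<phi> V" using XO by (simp add: torsion_def)
qed

text \<open>The squares make the degrees even, so that no signs occur in the operators.\<close>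

definition powers where
  "powers d r = range (\<lambda>k :: nat. (int k * (d + d), \<phi> (int k * (d + d)) ((r \<otimes> r) [^] k)))"

lemma powers_central:
  assumes r: "r \<in> gr d"
  shows "mult_central (powers d r)"
proof (rule mult_centralI)
  have rr: "r \<otimes> r \<in> gr (d + d)" and rc: "r \<otimes> r \<in> carrier R" using gr_mult[OF r r] gr_carrier by auto
  note g = gr_pow[OF rr]
  show "powers d r \<noteq> {}" by (simp add: powers_def)
  show "small U (powers d r)" unfolding powers_def using small_image[OF small_nat[OF univ]] .
  show "cen e \<rho>" if "(e, \<rho>) \<in> powers d r" for e \<rho>
    using that \<phi>_cen[OF g] by (auto simp: powers_def)
  fix e \<rho> e' \<tau> assume "(e, \<rho>) \<in> powers d r" "(e', \<tau>) \<in> powers d r"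
  then obtain k l :: nat where ab: "e = int k * (d + d)" "\<rho> = \<phi> (int k * (d + d)) ((r \<otimes> r) [^] k)"
    "e' = int l * (d + d)" "\<tau> = \<phi> (int l * (d + d)) ((r \<otimes> r) [^] l)" by (auto simp: powers_def)
  have "int l * (d + d) + int k * (d + d) = int (l + k) * (d + d)" by (simp add: algebra_simps)
  moreover have "(r \<otimes> r) [^] l \<otimes> (r \<otimes> r) [^] k = (r \<otimes> r) [^] (l + k)" using nat_pow_mult[OF rc] .
  ultimately have "(int l * (d + d) + int k * (d + d),
      center_mult T (int k * (d + d)) (\<phi> (int l * (d + d)) ((r \<otimes> r) [^] l)) (\<phi> (int k * (d + d)) ((r \<otimes> r) [^] k)))
      = (int (l + k) * (d + d), \<phi> (int (l + k) * (d + d)) ((r \<otimes> r) [^] (l + k)))"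
    using \<phi>_center_mult[OF g g, of l k] by simp
  moreover have "(int (l + k) * (d + d), \<phi> (int (l + k) * (d + d)) ((r \<otimes> r) [^] (l + k))) \<in> powers d r"
    unfolding powers_def by (rule rangeI)
  ultimately show "(e' + e, center_mult T e \<tau> \<rho>) \<in> powers d r" unfolding ab by metis
qed

text \<open>If no power of \<open>r\<close> kills \<open>x\<close>, then
  \<open>Spec_avoiding_powers\<close> yields a prime that contains the annihilator of
  \<open>x\<close>, hence lies in the support, but does not contain \<open>r\<close>.\<close>

lemma tors_powers_iff:
  assumes r: "r \<in> gr d" and Y: "Y \<in> Ob T"
  shows "Y \<in> tors (powers d r) \<longleftrightarrow> (\<forall>P \<in> supp Y. r \<in> P)"
proof -
  have rr: "r \<otimes> r \<in> gr (d + d)" and rc: "r \<in> carrier R" using gr_mult[OF r r] r gr_carrier by auto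
  have iff: "Y \<in> tors (powers d r) \<longleftrightarrow>
    (\<forall>C x. compact_object U T C \<longrightarrow> ar x C Y \<longrightarrow> (\<exists>k :: nat. (r \<otimes> r) [^] k \<in> Ann C Y x))"
    unfolding tors_def powers_def using Y Ann_iff[OF _ gr_pow[OF rr]] by auto
  show ?thesis
  proof
    assume t: "Y \<in> tors (powers d r)"
    show "\<forall>P \<in> supp Y. r \<in> P"
    proof
      fix P assume "P \<in> supp Y"
      then obtain C x where P: "P \<in> Spec R gr" and C: "compact_object U T C" "ar x C Y" "Ann C Y x \<subseteq> P"
        by (auto simp: supp_def)
      obtain k :: nat where "(r \<otimes> r) [^] k \<in> P" using t iff C by blast
      then have "r \<otimes> r \<in> P" using Spec_pow[OF P rr] by blast
      then show "r \<in> P" using Spec_mult[OF P r r] by blast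
    qed
  next
    assume s: "\<forall>P \<in> supp Y. r \<in> P"
    have "\<exists>k :: nat. (r \<otimes> r) [^] k \<in> Ann C Y x" if C: "compact_object U T C" and x: "ar x C Y" for C x
    proof (rule ccontr)
      assume no: "\<nexists>k :: nat. (r \<otimes> r) [^] k \<in> Ann C Y x"
      have "r [^] k \<notin> Ann C Y x" for k :: nat
      proof
        assume "r [^] k \<in> Ann C Y x"
        then have "r [^] k \<otimes> r [^] k \<in> Ann C Y x"
          using ideal.I_l_closed[OF Ann_ideal'[OF x]] nat_pow_closed[OF rc] by blast
        moreover have "r [^] k \<otimes> r [^] k = (r \<otimes> r) [^] k" using pow_mult_distrib[OF refl rc rc] by simp
        ultimately show False using no by metis
      qed
      then obtain P where "P \<in> Spec R gr" "Ann C Y x \<subseteq> P" "r \<notin> P"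
        using Spec_avoiding_powers[OF Ann_ideal[OF x] r] by metis
      then show False using s C x by (auto simp: supp_def)
    qed
    then show "Y \<in> tors (powers d r)" using iff by blast
  qed
qed

text \<open>The restriction to even degree avoids signs; an element of odd degree outside a prime is
  represented by its square, which is outside as well.\<close>

definition outside where
  "outside P = {(d, \<phi> d r) | d r. even d \<and> r \<in> gr d \<and> r \<notin> P}"

lemma outside_central:
  assumes P: "P \<in> Spec R gr"
  shows "mult_central (outside P)"
proof (rule mult_centralI)
  have "(0, \<phi> 0 \<one>) \<in> outside P" unfolding outside_def using gr_one Spec_one[OF P] even_zero by blast
  then show "outside P \<noteq> {}" by blast
  define B where "B = {(d, r) | d r. even d \<and> r \<in> gr d \<and> r \<notin> P}"
  \<comment> \<open>An element outside \<open>P\<close> is nonzero, so it determines its degree; the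
    index set thus embeds into the small set \<open>carrier R\<close>.\<close>
  have "inj_on snd B"
  proof (rule inj_onI)
    fix a b assume a: "a \<in> B" and b: "b \<in> B" and eq: "snd a = snd b"
    obtain d e r where ab: "a = (d, r)" "b = (e, r)" using eq by (metis prod.collapse)
    have r: "r \<in> gr d" "r \<in> gr e" "r \<noteq> \<zero>" using a b Spec_zero[OF P] by (auto simp: B_def ab)
    have "d = e" using fun_cong[OF hcomp_gr[OF r(1)], of d] fun_cong[OF hcomp_gr[OF r(2)], of d] r(3)
      by (simp split: if_splits)
    then show "a = b" using ab by simp
  qed
  moreover have "snd ` B \<subseteq> carrier R" using gr_carrier by (auto simp: B_def)
  then have "small U (snd ` B)" using R_small unfolding small_def by (meson card_of_mono1 ordLeq_ordLess_trans)
  ultimately have "small U B" using small_inj_on by blast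
  from small_image[OF this, of "\<lambda>(d, r). (d, \<phi> d r)"]
  show "small U (outside P)" by (rule back_subst[of "small U"]) (auto simp: outside_def B_def image_iff)
  show "cen e \<rho>" if "(e, \<rho>) \<in> outside P" for e \<rho>
    using that \<phi>_cen by (auto simp: outside_def)
  fix d \<rho> e \<tau> assume "(d, \<rho>) \<in> outside P" "(e, \<tau>) \<in> outside P"
  then obtain r s where ab: "\<rho> = \<phi> d r" "\<tau> = \<phi> e s" and r: "even d" "r \<in> gr d" "r \<notin> P"
    and s: "even e" "s \<in> gr e" "s \<notin> P" by (auto simp: outside_def)
  have "even (e + d)" "s \<otimes> r \<in> gr (e + d)" "s \<otimes> r \<notin> P" using gr_mult[OF s(2) r(2)] Spec_mult[OF P s(2) r(2)] r s by auto
  then have "(e + d, \<phi> (e + d) (s \<otimes> r)) \<in> outside P" unfolding outside_def by blast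
  then show "(e + d, center_mult T d \<tau> \<rho>) \<in> outside P"
    unfolding ab using \<phi>_center_mult[OF s(2) r(2)] by simp
qed

lemma tors_outside:
  assumes P: "P \<in> Spec R gr"
  shows "tors (outside P) = torsion U R gr T \<phi> (not_below R gr P)"
proof (intro equalityI subsetI)
  fix Y assume t: "Y \<in> tors (outside P)"
  have "Q \<in> not_below R gr P" if Q: "Q \<in> supp Y" for Q
  proof -
    obtain C x where C: "compact_object U T C" "ar x C Y" "Ann C Y x \<subseteq> Q" and QS: "Q \<in> Spec R gr"
      using Q by (auto simp: supp_def)
    obtain d r where "r \<in> gr d" "r \<notin> P" "\<phi> d r Y \<cdot> x = zr C (susp T d Y)"
      by (rule torsD[OF t C(1,2)]) (auto simp: outside_def)
    then show ?thesis using Ann_iff[OF C(2)] C(3) QS by (auto simp: not_below_def)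
  qed
  then show "Y \<in> torsion U R gr T \<phi> (not_below R gr P)" using torsion_iff tors_Ob[OF t] by blast
next
  fix Y assume "Y \<in> torsion U R gr T \<phi> (not_below R gr P)"
  then have Y: "Y \<in> Ob T" "supp Y \<subseteq> not_below R gr P" using torsion_iff by auto
  show "Y \<in> tors (outside P)"
  proof (rule torsI[OF Y(1)])
    fix C x assume C: "compact_object U T C" and x: "ar x C Y"
    have "P \<notin> supp Y" using Y(2) by (auto simp: not_below_def)
    then obtain d r where r: "r \<in> gr d" "r \<notin> P" "\<phi> d r Y \<cdot> x = zr C (susp T d Y)"
      using Ann_subset_iff[OF x Spec_ideal[OF P]] P C x unfolding supp_def by blast
    have rr: "r \<otimes> r \<in> gr (d + d)" "r \<otimes> r \<notin> P" using gr_mult[OF r(1) r(1)] Spec_mult[OF P r(1) r(1)] r(2) by auto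
    have "r \<otimes> r \<in> Ann C Y x"
      using ideal.I_l_closed[OF Ann_ideal'[OF x]] Ann_iff[OF x r(1)] r gr_carrier by blast
    then have "\<phi> (d + d) (r \<otimes> r) Y \<cdot> x = zr C (susp T (d + d) Y)" using Ann_iff[OF x rr(1)] by blast
    moreover have "(d + d, \<phi> (d + d) (r \<otimes> r)) \<in> outside P"
      unfolding outside_def using rr by (intro CollectI exI[of _ "d + d"] exI[of _ "r \<otimes> r"]) simp
    ultimately show "\<exists>d \<rho>. (d, \<rho>) \<in> outside P \<and> \<rho> Y \<cdot> x = zr C (susp T d Y)" by blast
  qed
qed

lemma smashing_not_below: "P \<in> Spec R gr \<Longrightarrow> smashing (torsion U R gr T \<phi> (not_below R gr P))"
  using smashing_tors[OF outside_central] tors_outside by metis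

text \<open>Whether a prime contains \<open>P\<close> is tested on finitely many homogeneous
  generators of \<open>P\<close>, so this subcategory is a finite intersection of classes
  \<open>tors (powers d r)\<close>.\<close>

lemma smashing_closed_set:
  assumes P: "P \<in> Spec R gr"
  shows "smashing (torsion U R gr T \<phi> (closed_set R gr P))"
proof -
  have hP: "homogeneous_ideal R gr P" using P by (simp add: Spec_def)
  obtain F where F: "finite F" "F \<noteq> {}" "\<And>d r. (d, r) \<in> F \<Longrightarrow> r \<in> gr d \<and> r \<in> P"
    "\<And>Q. \<lbrakk>ideal Q R; \<And>d r. (d, r) \<in> F \<Longrightarrow> r \<in> Q\<rbrakk> \<Longrightarrow> P \<subseteq> Q"
    by (rule homogeneous_generators[OF hP]) blast
  have "smashing (\<Inter>(d, r)\<in>E. tors (powers d r))" if "finite E" "E \<noteq> {}" "E \<subseteq> F" for E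
    using that
  proof (induction E rule: finite_ne_induct)
    case (singleton a)
    then show ?case using smashing_tors[OF powers_central] F(3) by (auto split: prod.splits)
  next
    case (insert a E)
    obtain d r where a: "a = (d, r)" by fastforce
    have "smashing (tors (powers d r))" using smashing_tors[OF powers_central] F(3) insert.prems a by auto
    then show ?case using smashing_Int insert a by auto
  qed
  then have g: "smashing (\<Inter>(d, r)\<in>F. tors (powers d r))" using F(1,2) by blast
  have "(\<Inter>(d, r)\<in>F. tors (powers d r)) = torsion U R gr T \<phi> (closed_set R gr P)"
  proof (intro equalityI subsetI)
    fix Y assume Y: "Y \<in> (\<Inter>(d, r)\<in>F. tors (powers d r))"
    have YO: "Y \<in> Ob T" using Y F(2) tors_Ob by fastforce
    have "P \<subseteq> Q" if Q: "Q \<in> supp Y" for Q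
    proof (rule F(4))
      show "ideal Q R" using Q Spec_ideal by (auto simp: supp_def)
      show "r \<in> Q" if dr: "(d, r) \<in> F" for d r
      proof -
        have "Y \<in> tors (powers d r)" using Y dr by auto
        then show ?thesis using tors_powers_iff[of r d, OF _ YO] F(3)[OF dr] Q by blast
      qed
    qed
    then show "Y \<in> torsion U R gr T \<phi> (closed_set R gr P)"
      using YO by (auto simp: torsion_iff closed_set_def supp_def)
  next
    fix Y assume "Y \<in> torsion U R gr T \<phi> (closed_set R gr P)"
    then have Y: "Y \<in> Ob T" "supp Y \<subseteq> closed_set R gr P" using torsion_iff by auto
    have "Y \<in> tors (powers d r)" if dr: "(d, r) \<in> F" for d r
      using tors_powers_iff[of r d, OF _ Y(1)] F(3)[OF dr] Y(2) by (auto simp: closed_set_def)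
    then show "Y \<in> (\<Inter>(d, r)\<in>F. tors (powers d r))" by auto
  qed
  then show ?thesis using g by simp
qed

lemma loc_at:
  assumes "smashing (torsion U R gr T \<phi> V)" "X \<in> Ob T"
  shows "locT (torsion U R gr T \<phi> V) (GO (loc_at U R gr T \<phi> V) X) X (LO (loc_at U R gr T \<phi> V) X)"
  unfolding loc_at_def
  using is_localization_locT[OF someI_ex[OF is_localization_exists[OF assms(1)]] assms(2)] .

text \<open>The intersection of the primes in the support. It is the whole ring when the support is
  empty, which by \<open>supp_ideal_one_zero\<close> happens only for zero objects.\<close>

definition supp_ideal where "supp_ideal Y = hideal (\<lambda>n. {r \<in> gr n. \<forall>P \<in> supp Y. r \<in> P})"

lemma
  shows supp_ideal_ideal: "homogeneous_ideal R gr (supp_ideal Y)"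
    and supp_ideal_iff: "\<And>r n. r \<in> gr n \<Longrightarrow> r \<in> supp_ideal Y \<longleftrightarrow> (\<forall>P \<in> supp Y. r \<in> P)"
proof -
  let ?N = "\<lambda>n. {r \<in> gr n. \<forall>P \<in> supp Y. r \<in> P}"
  have S: "P \<in> Spec R gr" if "P \<in> supp Y" for P using that by (simp add: supp_def)
  have 1: "?N n \<subseteq> gr n" for n by blast
  have 2: "\<zero> \<in> ?N n" for n using gr_zero Spec_zero S by blast
  have 3: "u \<oplus> v \<in> ?N n" if "u \<in> ?N n" "v \<in> ?N n" for n u v
    using that gr_add[of u n v] additive_subgroup.a_closed[OF ideal.axioms(1)[OF Spec_ideal[OF S]]] by simp
  have 4: "t \<otimes> u \<in> ?N (m + n)" if "t \<in> gr m" "u \<in> ?N n" for m n t u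
    using that gr_mult[of t m u n] ideal.I_l_closed[OF Spec_ideal[OF S]] gr_carrier by simp
  have 5: "u \<otimes> t \<in> ?N (m + n)" if "t \<in> gr m" "u \<in> ?N n" for m n t u
    using that gr_mult[of u n t m] ideal.I_r_closed[OF Spec_ideal[OF S]] gr_carrier by (simp add: add.commute)
  show "homogeneous_ideal R gr (supp_ideal Y)" unfolding supp_ideal_def by (rule hideal[OF 1 2 3 4 5])
  have "supp_ideal Y \<inter> gr n = ?N n" for n unfolding supp_ideal_def by (rule hideal_gr[OF 1 2 3 4 5])
  then show "r \<in> supp_ideal Y \<longleftrightarrow> (\<forall>P \<in> supp Y. r \<in> P)" if "r \<in> gr n" for r n using that by blast
qed

lemma supp_ideal_ideal': "ideal (supp_ideal Y) R"
  using supp_ideal_ideal by (simp add: homogeneous_ideal_def)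

lemma supp_ideal_carrier: "supp_ideal Y \<subseteq> carrier R"
  by (auto simp: supp_ideal_def hideal_def)

lemma supp_ideal_subset:
  assumes P: "P \<in> supp Y" shows "supp_ideal Y \<subseteq> P"
proof
  fix r assume r: "r \<in> supp_ideal Y"
  have rc: "r \<in> carrier R" using r supp_ideal_carrier by blast
  show "r \<in> P"
    by (rule ideal_mem_hcomp[OF Spec_ideal rc])
      (use P supp_ideal_iff[OF hcomp(1)[OF rc]] homogeneous_ideal_hcomp[OF supp_ideal_ideal r] in \<open>auto simp: supp_def\<close>)
qed

lemma supp_ideal_tors: "\<lbrakk>r \<in> gr d; Y \<in> Ob T\<rbrakk> \<Longrightarrow> r \<in> supp_ideal Y \<longleftrightarrow> Y \<in> tors (powers d r)"
  by (simp add: supp_ideal_iff tors_powers_iff)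

text \<open>A homogeneous \<open>r\<close> of degree \<open>d\<close> lies in the ideal of
  \<open>Y\<close> exactly when \<open>Y\<close> lies in \<open>tors (powers d r)\<close>; this
  class is localizing, so it then contains \<open>Loc U T {Y}\<close>.\<close>

lemma supp_ideal_mono:
  assumes Y: "Y \<in> Ob T" and Z: "Z \<in> Loc U T {Y}"
  shows "supp_ideal Y \<subseteq> supp_ideal Z"
proof
  fix r assume r: "r \<in> supp_ideal Y"
  have rc: "r \<in> carrier R" using r supp_ideal_carrier by blast
  have ZO: "Z \<in> Ob T" using loc_Ob[OF Loc_localizing Z] Y by blast
  show "r \<in> supp_ideal Z"
  proof (rule ideal_mem_hcomp[OF supp_ideal_ideal' rc])
    fix n
    have h: "hcomp r n \<in> gr n" "hcomp r n \<in> supp_ideal Y" using hcomp(1)[OF rc] homogeneous_ideal_hcomp[OF supp_ideal_ideal r] .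
    then have "Loc U T {Y} \<subseteq> tors (powers n (hcomp r n))"
      using supp_ideal_tors[OF h(1) Y] Loc_least[OF tors_localizing[OF powers_central[OF h(1)]]] by blast
    then show "hcomp r n \<in> supp_ideal Z" using supp_ideal_tors[OF h(1) ZO] Z by blast
  qed
qed

lemma supp_ideal_one_zero:
  assumes Y: "Y \<in> Ob T" and 1: "\<one> \<in> supp_ideal Y"
  shows "is_zero T Y"
proof (rule zero_if_compact[OF Y])
  fix C x assume C: "compact_object U T C" and x: "ar x C Y"
  have t: "Y \<in> tors (powers 0 \<one>)" using supp_ideal_tors[OF gr_one Y] 1 by blast
  obtain d \<rho> where "(d, \<rho>) \<in> powers 0 \<one>" "\<rho> Y \<cdot> x = zr C (susp T d Y)" using torsD[OF t C x] .
  then show "x = zr C Y" using \<phi>_one[OF Y] id_cmp[OF x] by (auto simp: powers_def susp_0)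
qed

end

section \<open>The local-global principle\<close>

context linear_cg_category
begin

lemma Gamma_prime_Loc:
  assumes P: "P \<in> Spec R gr" and X: "X \<in> Ob T"
  shows "Gamma_prime U R gr T \<phi> P X \<in> Loc U T {X}"
proof -
  let ?Z = "loc_at U R gr T \<phi> (not_below R gr P)"
  have 1: "LO ?Z X \<in> Loc U T {X}" using locT_Loc[OF smashing_not_below[OF P] loc_at[OF smashing_not_below[OF P] X]] by blast
  have O: "LO ?Z X \<in> Ob T" using locT_Ob[OF loc_at[OF smashing_not_below[OF P] X]] by blast
  have "Gamma_prime U R gr T \<phi> P X \<in> Loc U T {LO ?Z X}"
    unfolding Gamma_prime_def
    using locT_Loc[OF smashing_closed_set[OF P] loc_at[OF smashing_closed_set[OF P] O]] by blast
  then show ?thesis using Loc_subset[of "{X}" "{LO ?Z X}"] 1 X by blast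
qed

text \<open>\<open>K\<close> is isomorphic to \<open>\<Gamma>\<^sub>P K\<close>, and \<open>\<Gamma>\<^sub>P\<close> maps \<open>Loc X\<close> to \<open>Loc (\<Gamma>\<^sub>P X)\<close>.\<close>

lemma local_torsion_in_Loc:
  assumes P: "P \<in> Spec R gr" and X: "X \<in> Ob T" and K: "K \<in> Loc U T {X}"
    and Ko: "K \<in> rorth (torsion U R gr T \<phi> (not_below R gr P))" and Kt: "K \<in> torsion U R gr T \<phi> (closed_set R gr P)"
    and L: "localizing U T L" and G: "Gamma_prime U R gr T \<phi> P X \<in> L"
  shows "K \<in> L"
proof -
  define S where "S = torsion U R gr T \<phi> (not_below R gr P)"
  define V where "V = torsion U R gr T \<phi> (closed_set R gr P)"
  have gS: "smashing S" and gV: "smashing V" using smashing_not_below smashing_closed_set P by (auto simp: S_def V_def)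
  have lS: "localizing U T S" "localizing U T (rorth S)" and lV: "localizing U T V" "localizing U T (rorth V)"
    using gS gV by (auto simp: smashing_def)
  \<comment> \<open>\<open>L1\<close> is the preimage of \<open>L\<close> under the torsion functor
    of \<open>V\<close>, and \<open>L2\<close> is the preimage of \<open>L1\<close> under
    localization away from \<open>S\<close>. So \<open>L2\<close> consists of the objects that
    \<open>Gamma_prime\<close> sends into \<open>L\<close>.\<close>
  define L1 where "L1 = {Y. \<exists>G K. locT V G Y K \<and> G \<in> L}"
  define L2 where "L2 = {Y. \<exists>G K. locT S G Y K \<and> K \<in> L1}"
  have l1: "localizing U T L1" unfolding L1_def using locT_preimages(1)[OF gV L] .
  have l2: "localizing U T L2" unfolding L2_def using locT_preimages(2)[OF gS l1] .
  have t: "locT S (GO (loc_at U R gr T \<phi> (not_below R gr P)) X) X (LO (loc_at U R gr T \<phi> (not_below R gr P)) X)"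
    using loc_at[OF gS[unfolded S_def] X] by (simp add: S_def)
  have "LO (loc_at U R gr T \<phi> (not_below R gr P)) X \<in> L1"
    using loc_at[OF gV[unfolded V_def], of "LO (loc_at U R gr T \<phi> (not_below R gr P)) X"] locT_Ob[OF t] G
    unfolding L1_def Gamma_prime_def V_def by blast
  then have "X \<in> L2" using t unfolding L2_def by blast
  then have K2: "K \<in> L2" using Loc_least[OF l2] K by blast
  have KO: "K \<in> Ob T" using rorth_Ob[OF Ko] .
  have i: "isos T K K \<noteq> {}" using isos_Idt[OF KO] by blast
  obtain Z where Z: "is_zero T Z" using has_zero by blast
  have "locT S Z K K"
    unfolding locT_def using tri_zero_Idt[OF KO Z] loc_zero[OF lS(1) Z] Ko by (auto simp: S_def)
  moreover obtain G1 K1 where "locT S G1 K K1" "K1 \<in> L1" using K2 unfolding L2_def by blast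
  ultimately have "K \<in> L1" using locT_iso[OF lS(1) _ _ i] loc_iso[OF l1] KO by blast
  then obtain G2 K2 where "locT V G2 K K2" "G2 \<in> L" unfolding L1_def by blast
  moreover have "locT V K K Z"
    unfolding locT_def using tri_Idt[OF KO Z] loc_zero[OF lV(2) Z] Kt by (auto simp: V_def)
  ultimately show "K \<in> L" using locT_iso[OF lV(1) _ _ i] loc_iso[OF L] KO by blast
qed

text \<open>
  An object of \<open>Loc X\<close> outside \<open>L\<close> with maximal support ideal \<open>p\<close> would have \<open>p\<close> prime, and both ends
  of its localization triangle at \<open>p\<close> would lie in \<open>L\<close>.
\<close>

lemma Loc_subset_if_Gamma_primes:
  assumes X: "X \<in> Ob T" and L: "localizing U T L"
    and G: "\<And>P. P \<in> Spec R gr \<Longrightarrow> Gamma_prime U R gr T \<phi> P X \<in> L"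
  shows "Loc U T {X} \<subseteq> L"
proof (rule ccontr)
  have LX: "localizing U T (Loc U T {X})" using Loc_localizing X by blast
  define \<A> where "\<A> = supp_ideal ` (Loc U T {X} - L)"
  assume "\<not> Loc U T {X} \<subseteq> L"
  then have ne: "\<A> \<noteq> {}" by (auto simp: \<A>_def)
  have "ideal I R" if "I \<in> \<A>" for I using that supp_ideal_ideal' by (auto simp: \<A>_def)
  then obtain p where p: "p \<in> \<A>" "\<And>I. \<lbrakk>I \<in> \<A>; p \<subseteq> I\<rbrakk> \<Longrightarrow> I = p" using maximal_ideal_exists[OF ne] by metis
  then obtain Y where Y: "Y \<in> Loc U T {X}" "Y \<notin> L" "p = supp_ideal Y" by (auto simp: \<A>_def)
  have YO: "Y \<in> Ob T" using loc_Ob[OF LX Y(1)] .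
  have LY: "localizing U T (Loc U T {Y})" using Loc_localizing YO by blast
  have YX: "Loc U T {Y} \<subseteq> Loc U T {X}" using Loc_least[OF LX] Y(1) by blast
  have YY: "Y \<in> Loc U T {Y}" using Loc_incl by blast
  \<comment> \<open>Support ideals can only grow inside \<open>Loc U T {Y}\<close>, so one new
    element already contradicts the maximality of \<open>p\<close>, unless the object lies in
    \<open>L\<close>.\<close>
  have max: "Z \<in> L" if Z: "Z \<in> Loc U T {Y}" and r: "r \<in> supp_ideal Z" "r \<notin> p" for Z r
  proof (rule ccontr)
    assume "Z \<notin> L"
    then have "supp_ideal Z \<in> \<A>" using Z YX by (auto simp: \<A>_def)
    moreover have "p \<subseteq> supp_ideal Z" using supp_ideal_mono[OF YO Z] Y(3) by simp
    ultimately show False using p(2) r by blast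
  qed
  have hp: "homogeneous_ideal R gr p" using supp_ideal_ideal Y(3) by simp
  have "\<one> \<notin> p" using supp_ideal_one_zero[OF YO] loc_zero[OF L] Y(2,3) by blast
  then have pR: "p \<noteq> carrier R" by blast
  have prime: "a \<in> p \<or> b \<in> p" if a: "a \<in> gr m" and b: "b \<in> gr n" and ab: "a \<otimes> b \<in> p" for a b m n
  proof (rule ccontr)
    assume "\<not> (a \<in> p \<or> b \<in> p)"
    then have nab: "a \<notin> p" "b \<notin> p" by auto
    \<comment> \<open>Squares have even degree, so \<open>c\<close> and \<open>d\<close> commute and
      powers of their product split.\<close>
    define c where "c = a \<otimes> a"
    define d where "d = b \<otimes> b"
    have c: "c \<in> gr (m + m)" and d: "d \<in> gr (n + n)" using gr_mult[OF a a] gr_mult[OF b b] by (simp_all only: c_def d_def)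
    have S: "P \<in> Spec R gr" if "P \<in> supp Y" for P using that by (simp add: supp_def)
    have cd: "c \<notin> p" "d \<notin> p"
      using nab supp_ideal_iff[OF a, of Y] supp_ideal_iff[OF b, of Y] supp_ideal_iff[OF c, of Y] supp_ideal_iff[OF d, of Y] Spec_mult[OF S a a] Spec_mult[OF S b b]
      unfolding Y(3) c_def d_def by blast+
    have cdg: "c \<otimes> d \<in> gr ((m + m) + (n + n))" using gr_mult[OF c d] .
    have cdp: "c \<otimes> d \<in> p"
      using ab supp_ideal_iff[OF gr_mult[OF a b], of Y] supp_ideal_iff[OF cdg, of Y] Spec_mult[OF S a b] Spec_mult[OF S a a]
        Spec_mult[OF S b b] Spec_mult[OF S c d] unfolding Y(3) c_def d_def by blast
    note Ac = powers_central[OF c]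
    \<comment> \<open>Inverting \<open>c\<close> puts \<open>c\<close> into the support ideal of
      \<open>A\<close>. On \<open>K\<close> each map from a compact object is killed by a power of
      \<open>c \<otimes> d\<close>, up to squares, while \<open>c\<close> can be cancelled; so
      \<open>d\<close> lies in the support ideal of \<open>K\<close>. Both ends then belong to
      \<open>L\<close>.\<close>
    obtain f g h A K where t: "tri f g h A Y K" "A \<in> tors (powers (m + m) c)" "K \<in> rorth (tors (powers (m + m) c))"
      "K \<in> Loc U T {Y}" using tors_triangle[OF Ac YO] by metis
    have AO: "A \<in> Ob T" and KO: "K \<in> Ob T" using tri_Ob[OF t(1)] by auto
    have AY: "A \<in> Loc U T {Y}" using loc_tri(2)[OF LY t(1) YY t(4)] .
    have "c \<in> supp_ideal A" using supp_ideal_tors[OF c AO] t(2) by blast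
    then have AL: "A \<in> L" using max[OF AY] cd(1) by blast
    have Ki: "K \<in> inv_set (powers (m + m) c)" using orth_inv_set[OF Ac t(3)] .
    have "c \<otimes> d \<in> supp_ideal K" using supp_ideal_mono[OF YO t(4)] cdp Y(3) by blast
    then have tcd: "K \<in> tors (powers ((m + m) + (n + n)) (c \<otimes> d))" using supp_ideal_tors[OF cdg KO] by blast
    have "K \<in> tors (powers (n + n) d)"
    proof (rule torsI[OF KO])
      fix C x assume C: "compact_object U T C" and x: "ar x C K"
      have cc: "c \<in> carrier R" and dc: "d \<in> carrier R" using c d gr_carrier by auto
      have ccg: "c \<otimes> c \<in> gr ((m + m) + (m + m))" and ddg: "d \<otimes> d \<in> gr ((n + n) + (n + n))"
        using gr_mult[OF c c] gr_mult[OF d d] .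
      have ccc: "c \<otimes> c \<in> carrier R" and ddc: "d \<otimes> d \<in> carrier R" using cc dc by auto
      have sw: "d \<otimes> c = c \<otimes> d" using even_commute[OF d c] by simp
      have e: "(c \<otimes> d) \<otimes> (c \<otimes> d) = (c \<otimes> c) \<otimes> (d \<otimes> d)"
        using sw cc dc by (metis m_assoc m_closed)
      obtain k :: nat where k: "((c \<otimes> d) \<otimes> (c \<otimes> d)) [^] k \<in> Ann C K x"
      proof -
        have g: "(c \<otimes> d) \<otimes> (c \<otimes> d) \<in> gr (((m + m) + (n + n)) + ((m + m) + (n + n)))" using gr_mult[OF cdg cdg] .
        obtain l \<rho> where "(l, \<rho>) \<in> powers ((m + m) + (n + n)) (c \<otimes> d)" "\<rho> K \<cdot> x = zr C (susp T l K)"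
          using torsD[OF tcd C x] .
        then show ?thesis using that Ann_iff[OF x gr_pow[OF g]] unfolding powers_def by blast
      qed
      have cd2: "(c \<otimes> c) \<otimes> (d \<otimes> d) = (d \<otimes> d) \<otimes> (c \<otimes> c)" using even_commute[OF ccg ddg] by simp
      define i where "i = int k * ((m + m) + (m + m))"
      define j where "j = int k * ((n + n) + (n + n))"
      define u where "u = (c \<otimes> c) [^] k"
      define v where "v = (d \<otimes> d) [^] k"
      have u: "u \<in> gr i" and v: "v \<in> gr j" using gr_pow[OF ccg] gr_pow[OF ddg] by (auto simp: u_def v_def i_def j_def)
      have "u \<otimes> v \<in> Ann C K x" using k pow_mult_distrib[OF cd2 ccc ddc] by (simp add: u_def v_def e)
      then have uv: "\<phi> (i + j) (u \<otimes> v) K \<cdot> x = zr C (susp T (i + j) K)" using Ann_iff[OF x gr_mult[OF u v]] by blast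
      have vx: "ar (\<phi> j v K \<cdot> x) C (susp T j K)" using ar_cmp[OF \<phi>_ar[OF v KO] x] .
      have "\<phi> i u (susp T j K) \<cdot> (\<phi> j v K \<cdot> x) = zr C (susp T i (susp T j K))"
        using uv \<phi>_mult[OF u v KO] cmp_assoc[OF \<phi>_ar[OF u susp_Ob[OF KO]] \<phi>_ar[OF v KO] x] susp_add[OF KO, of i j]
        by simp
      moreover have "(i, \<phi> i u) \<in> powers (m + m) c" unfolding powers_def i_def u_def by (rule rangeI)
      ultimately have "\<phi> j v K \<cdot> x = zr C (susp T j K)" using inv_mono[OF Ac _ inv_susp[OF Ac Ki] vx] by blast
      moreover have "(j, \<phi> j v) \<in> powers (n + n) d" unfolding powers_def j_def v_def by (rule rangeI)
      ultimately show "\<exists>l \<rho>. (l, \<rho>) \<in> powers (n + n) d \<and> \<rho> K \<cdot> x = zr C (susp T l K)" by blast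
    qed
    then have "d \<in> supp_ideal K" using supp_ideal_tors[OF d KO] by blast
    then have "K \<in> L" using max[OF t(4)] cd(2) by blast
    then show False using loc_tri(3)[OF L t(1) AL] Y(2) by blast
  qed
  have P: "p \<in> Spec R gr" unfolding Spec_def using hp pR prime by blast
  note Ap = outside_central[OF P]
  obtain f g h A K where t: "tri f g h A Y K" "K \<in> rorth (tors (outside p))" "K \<in> Loc U T {Y}"
      "A \<in> Loc U T (pieces (outside p) Y)"
    using tors_triangle[OF Ap YO] by metis
  have KO: "K \<in> Ob T" using tri_Ob[OF t(1)] by auto
  \<comment> \<open>A piece is killed by the square of a single element outside \<open>p\<close>,
    which therefore lies in its support ideal. Torsion alone would only give such an element for
    each map separately.\<close>
  have "pieces (outside p) Y \<subseteq> L"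
  proof
    fix F assume F: "F \<in> pieces (outside p) Y"
    then have FY: "F \<in> Loc U T {Y}" by (simp add: pieces_def)
    have FO: "F \<in> Ob T" using loc_Ob[OF LY FY] .
    obtain d r where r: "r \<in> gr d" "r \<notin> p" "\<phi> d r (susp T d F) \<cdot> \<phi> d r F = zr F (susp T d (susp T d F))"
      using F by (auto simp: pieces_def outside_def)
    have rr: "r \<otimes> r \<in> gr (d + d)" using gr_mult[OF r(1) r(1)] .
    have "r \<in> Q" if Q: "Q \<in> supp F" for Q
    proof -
      obtain C x where C: "ar x C F" "Ann C F x \<subseteq> Q" and QS: "Q \<in> Spec R gr" using Q by (auto simp: supp_def)
      have "\<phi> (d + d) (r \<otimes> r) F \<cdot> x = zr C (susp T (d + d) F)"
        unfolding \<phi>_mult[OF r(1) r(1) FO] r(3) susp_add[OF FO] by (rule zr_cmp[OF C(1) susp_Ob[OF susp_Ob[OF FO]]])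
      then have "r \<otimes> r \<in> Q" using Ann_iff[OF C(1) rr] C(2) by blast
      then show ?thesis using Spec_mult[OF QS r(1) r(1)] by blast
    qed
    then have "r \<in> supp_ideal F" using supp_ideal_iff[OF r(1)] by blast
    then show "F \<in> L" using max[OF FY] r(2) by blast
  qed
  then have AL: "A \<in> L" using Loc_least[OF L] t(4) by blast
  have "supp K \<subseteq> closed_set R gr p"
  proof
    fix Q assume Q: "Q \<in> supp K"
    have "p \<subseteq> supp_ideal K" using supp_ideal_mono[OF YO t(3)] Y(3) by simp
    then show "Q \<in> closed_set R gr p" using supp_ideal_subset[OF Q] Q by (auto simp: closed_set_def supp_def)
  qed
  then have "K \<in> torsion U R gr T \<phi> (closed_set R gr p)" using torsion_iff KO by blast
  \<comment> \<open>\<open>K\<close> is local at \<open>p\<close> and supported on the primes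
    containing \<open>p\<close>, so it is its own \<open>Gamma_prime\<close> up to
    isomorphism.\<close>
  then have "K \<in> L"
    using local_torsion_in_Loc[OF P X _ _ _ L G[OF P]] t(2,3) YX tors_outside[OF P] by auto
  then show False using loc_tri(3)[OF L t(1) AL] Y(2) by blast
qed

theorem local_global: "local_global_principle U R gr T \<phi>"
  unfolding local_global_principle_def
proof (intro ballI equalityI)
  fix X assume X: "X \<in> Ob T"
  let ?C = "{Gamma_prime U R gr T \<phi> P X | P. P \<in> Spec R gr}"
  have sub: "?C \<subseteq> Loc U T {X}" using Gamma_prime_Loc[OF _ X] by blast
  have LX: "localizing U T (Loc U T {X})" using Loc_localizing X by blast
  show "Loc U T ?C \<subseteq> Loc U T {X}" using Loc_least[OF LX sub] .
  have C: "?C \<subseteq> Ob T" using sub loc_Ob[OF LX] by blast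
  show "Loc U T {X} \<subseteq> Loc U T ?C"
  proof (rule Loc_subset_if_Gamma_primes[OF X Loc_localizing[OF C]])
    show "Gamma_prime U R gr T \<phi> P X \<in> Loc U T ?C" if "P \<in> Spec R gr" for P
      using that Loc_incl[of ?C] by blast
  qed
qed

end

theorem corollary3p5:
  fixes U :: "'u set"
    and R :: "('r, 'b) ring_scheme"
    and gr :: "int \<Rightarrow> 'r set"
    and T :: "('o, 'm, 'z) tricat_scheme"
    and \<phi> :: "int \<Rightarrow> 'r \<Rightarrow> 'o \<Rightarrow> 'm"
  assumes "universe U"
    and "graded_commutative_ring R gr"
    and "noetherian_ring R"
    and "small U (carrier R)"
    and "triangulated_category T"
    and "locally_small U T"
    and "has_coproducts U T"
    and "compactly_generated U T"
    and "linear_structure R gr T \<phi>"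
    and "dimension (Spec R gr) < \<infinity>"
  shows "local_global_principle U R gr T \<phi>"
proof -
  interpret linear_cg_category T U R gr \<phi>
    using assms
    by (intro linear_cg_category.intro cg_category.intro cg_category_axioms.intro
        noetherian_graded_commutative_ring.intro linear_cg_category_axioms.intro)
  show ?thesis by (rule local_global)
qed

end
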